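(* Let $q_1,q_2\in Q$. If $\Lambda(q_1)=\Lambda_{q_1}=\Lambda_{q_2}=\Lambda(q_2)$, then $q_1=q_2$.
   Context: Let $d\in\{2,3\}$, $k>0$, and $0<R_0<R$. Write $x=(\underline{x},x_d)$ with $\underline{x}=(x_1,\dots,x_{d-1})$, and $\mathbb{R}^d_+=\{x_d>0\}$. Put $\Omega^R=\mathbb{R}^{d-1}\times(0,R)$, $\Gamma^R=\mathbb{R}^{d-1}\times\{R\}$, $\Gamma^0=\mathbb{R}^{d-1}\times\{0\}$, $\Omega_0^R=(-\pi,\pi)^{d-1}\times(0,R)$, $\Omega_0^{R_0}=(-\pi,\pi)^{d-1}\times(0,R_0)$. The function $n_p^2\in L^\infty(\mathbb{R}^d_+)$ is complex-valued, $2\pi$-periodic in each of $x_1,\dots,x_{d-1}$, $n_p^2=1$ for $x_d>R_0$, $\operatorname{Im}n_p^2\ge0$, and $\{\operatorname{Im}n_p^2>0\}$ contains a non-empty open set. $\tilde H^1(\Omega^R)$ is the space of $H^1(\Omega^R)$-functions with vanishing trace on $\Gamma^0$. With $\hat\phi(\xi)=(2\pi)^{-(d-1)/2}\int_{\mathbb{R}^{d-1}}\phi(\underline{x})e^{-i\underline{x}\cdot\xi}d\underline{x}$, $T:H^{1/2}(\Gamma^R)\to H^{-1/2}(\Gamma^R)$ is $T(\phi)(\underline{x})=(2\pi)^{-(d-1)/2}\int_{\mathbb{R}^{d-1}}i\sqrt{k^2-|\xi|^2}e^{i\underline{x}\cdot\xi}\hat\phi(\xi)d\xi$, where $\sqrt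 t=i\sqrt{|t|}$ for $t<0$. For $q\in L^2(\Omega_0^{R_0})$ (complex-valued, extended by zero) define on $\tilde H^1(\Omega^R)$ the bounded sesquilinear form $$a_q(u,v)=\int_{\Omega^R}\nabla u\cdot\nabla\overline v-k^2(n_p^2+q)u\overline v\,dx-\int_{\Gamma^R}T(u|_{\Gamma^R})\overline v\,dS,$$ and let $B_q$ be the bounded operator on $\tilde H^1(\Omega^R)$ representing $a_q$ via Riesz. For $q_0\in L^\infty(\Omega_0^{R_0})$ with $\operatorname{Im}q_0\ge0$, $B_{q_0}$ is invertible; fix $\delta(q_0)>0$ so small that for all $q\in L^2(\Omega_0^{R_0})$ with $\|q-q_0\|_{L^2(\Omega_0^{R_0})}<\delta(q_0)$ one has $\|B_q-B_{q_0}\|<\|B_{q_0}^{-1}\|^{-1}$, so that $B_q$ is invertible by the Neumann series (possible since $H^1(\Omega_0^R)\subset L^4(\Omega_0^R)$ continuously). Set $$Q=\bigcup_{q_0\in L^\infty(\Omega_0^{R_0}),\ \operatorname{Im}q_0\ge0}B_{\delta(q_0)}(q_0)\subseteq L^2(\Omega_0^{R_0}),$$ with $B_\delta(q_0)$ the open $L^2(\Omega_0^{R_0})$-ball. Thus for $q\in Q$ and $f\in L^2(\Omega_0^{R_0})$ (extended by zero) there is a unique $u\in\tilde H^1(\Omega^R)$ with $a_q(u,v)=\int_{\Omega^R}f\overline v\,dx$ for all $v\in\tilde H^1(\Omega^R)$. For $q\in Q$, $\Lambda_q:L^2(\Omega_0^{R_0})\to L^2(\Omega_0^R)$ is the bounded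 linear operator mapping $f$ to the restriction $u|_{\Omega_0^R}$ of this solution, and $\Lambda:Q\to\mathcal{L}(L^2(\Omega_0^{R_0}),L^2(\Omega_0^R))$, $q\mapsto\Lambda_q$ ($\mathcal{L}$ = bounded linear operators with operator norm). *)

theory Defs
  imports "HOL-Analysis.Analysis"
begin

text \<open>
  Elements of Lebesgue and Sobolev spaces are represented by functions, and equality in these
  spaces is equality almost everywhere. Choices by \<open>SOME\<close> below pick representatives of objects
  that are unique up to a null set.
\<close>

section \<open>Lebesgue spaces\<close>

definition L2 :: "'a::euclidean_space set \<Rightarrow> ('a \<Rightarrow> complex) set" where
  "L2 S = {f. f \<in> borel_measurable (lebesgue_on S) \<and>
              integrable (lebesgue_on S) (\<lambda>x. (cmod (f x))\<^sup>2)}"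

definition L2_norm :: "'a::euclidean_space set \<Rightarrow> ('a \<Rightarrow> complex) \<Rightarrow> real" where
  "L2_norm S f = sqrt (LINT x|lebesgue_on S. (cmod (f x))\<^sup>2)"

definition Linf :: "'a::euclidean_space set \<Rightarrow> ('a \<Rightarrow> complex) set" where
  "Linf S = {f. f \<in> borel_measurable (lebesgue_on S) \<and>
                (\<exists>C. AE x in lebesgue_on S. cmod (f x) \<le> C)}"

definition zero_ext :: "'a set \<Rightarrow> ('a \<Rightarrow> complex) \<Rightarrow> 'a \<Rightarrow> complex" where
  "zero_ext S f = (\<lambda>x. if x \<in> S then f x else 0)"

section \<open>Test functions, weak derivatives and the Sobolev space of order one\<close>

primrec Ck :: "nat \<Rightarrow> ('a::euclidean_space \<Rightarrow> complex) \<Rightarrow> bool" where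
  "Ck 0 f = continuous_on UNIV f"
| "Ck (Suc m) f = ((\<forall>x. f differentiable (at x)) \<and>
                   (\<forall>b\<in>Basis. Ck m (\<lambda>x. frechet_derivative f (at x) b)))"

definition test_functions :: "'a::euclidean_space set \<Rightarrow> ('a \<Rightarrow> complex) set" where
  "test_functions S = {\<phi>. (\<forall>m. Ck m \<phi>) \<and>
     compact (closure {x. \<phi> x \<noteq> 0}) \<and> closure {x. \<phi> x \<noteq> 0} \<subseteq> S}"

definition is_weak_partial ::
  "'a::euclidean_space set \<Rightarrow> ('a \<Rightarrow> complex) \<Rightarrow> 'a \<Rightarrow> ('a \<Rightarrow> complex) \<Rightarrow> bool" where
  "is_weak_partial S u b g \<longleftrightarrow> g \<in> L2 S \<and>
     (\<forall>\<phi>\<in>test_functions S.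
        (LINT x|lebesgue_on S. u x * frechet_derivative \<phi> (at x) b)
        = - (LINT x|lebesgue_on S. g x * \<phi> x))"

definition weak_partial ::
  "'a::euclidean_space set \<Rightarrow> ('a \<Rightarrow> complex) \<Rightarrow> 'a \<Rightarrow> 'a \<Rightarrow> complex" where
  "weak_partial S u b = (SOME g. is_weak_partial S u b g)"

definition H1 :: "'a::euclidean_space set \<Rightarrow> ('a \<Rightarrow> complex) set" where
  "H1 S = {u \<in> L2 S. \<forall>b\<in>Basis. \<exists>g. is_weak_partial S u b g}"

definition H1_inner ::
  "'a::euclidean_space set \<Rightarrow> ('a \<Rightarrow> complex) \<Rightarrow> ('a \<Rightarrow> complex) \<Rightarrow> complex" where
  "H1_inner S u v = (LINT x|lebesgue_on S.
     u x * cnj (v x) + (\<Sum>b\<in>Basis. weak_partial S u b x * cnj (weak_partial S v b x)))"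

definition H1_norm :: "'a::euclidean_space set \<Rightarrow> ('a \<Rightarrow> complex) \<Rightarrow> real" where
  "H1_norm S u = sqrt (Re (H1_inner S u u))"

section \<open>Geometry\<close>

text \<open>
  A point \<open>x = (x', x\<^sub>d)\<close> of \<open>d\<close>-dimensional space, where \<open>d = CARD('n) + 1\<close>. The norm, the basis
  and Lebesgue measure of this product type are the Euclidean ones.
\<close>
type_synonym 'n pt = "(real^'n) \<times> real"

definition half_space :: "('n::finite) pt set" where
  "half_space = {x. 0 < snd x}"

definition slab :: "real \<Rightarrow> ('n::finite) pt set" where
  "slab R = UNIV \<times> {0<..<R}"

definition cell :: "real \<Rightarrow> ('n::finite) pt set" where
  "cell R = {y. \<forall>i. - pi < y $ i \<and> y $ i < pi} \<times> {0<..<R}"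

section \<open>Traces\<close>

text \<open>
  The trace on the hyperplane at height \<open>h\<close>, identified with \<open>real^'n\<close>: the continuous extension
  of the pointwise restriction from (restrictions to the slab of) compactly supported smooth
  functions on the whole space, which are dense in \<open>H1 (slab R)\<close>.
\<close>
definition has_trace ::
  "real \<Rightarrow> real \<Rightarrow> (('n::finite) pt \<Rightarrow> complex) \<Rightarrow> (real^'n \<Rightarrow> complex) \<Rightarrow> bool" where
  "has_trace R h u g \<longleftrightarrow> g \<in> L2 UNIV \<and>
     (\<exists>\<phi>. (\<forall>j::nat. \<phi> j \<in> test_functions UNIV) \<and>
          (\<lambda>j. H1_norm (slab R) (\<lambda>x. u x - \<phi> j x)) \<longlonglongrightarrow> 0 \<and>
          (\<lambda>j. L2_norm UNIV (\<lambda>y. g y - \<phi> j (y, h))) \<longlonglongrightarrow> 0)"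

definition trace_at ::
  "real \<Rightarrow> real \<Rightarrow> (('n::finite) pt \<Rightarrow> complex) \<Rightarrow> real^'n \<Rightarrow> complex" where
  "trace_at R h u = (SOME g. has_trace R h u g)"

definition H1_tilde :: "real \<Rightarrow> (('n::finite) pt \<Rightarrow> complex) set" where
  "H1_tilde R = {u \<in> H1 (slab R). has_trace R 0 u (\<lambda>_. 0)}"

section \<open>Fourier transform and the operator T\<close>

definition fourier_L1 :: "('a::euclidean_space \<Rightarrow> complex) \<Rightarrow> 'a \<Rightarrow> complex" where
  "fourier_L1 \<phi> \<xi> = of_real ((2 * pi) powr (- real DIM('a) / 2)) *
     (LINT y|lebesgue. \<phi> y * exp (- \<i> * of_real (y \<bullet> \<xi>)))"

text \<open>The Fourier transform on L2: the L2-limit of the transforms of truncations.\<close>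
definition has_fourier ::
  "('a::euclidean_space \<Rightarrow> complex) \<Rightarrow> ('a \<Rightarrow> complex) \<Rightarrow> bool" where
  "has_fourier \<phi> g \<longleftrightarrow> g \<in> L2 UNIV \<and>
     (\<lambda>j::nat. L2_norm UNIV
        (\<lambda>\<xi>. g \<xi> - fourier_L1 (zero_ext (ball 0 (real j)) \<phi>) \<xi>)) \<longlonglongrightarrow> 0"

definition fourier :: "('a::euclidean_space \<Rightarrow> complex) \<Rightarrow> 'a \<Rightarrow> complex" where
  "fourier \<phi> = (SOME g. has_fourier \<phi> g)"

text \<open>
  The inverse Fourier transform of \<open>F\<close> as an element of \<open>H\<^sup>-\<^sup>1\<^sup>/\<^sup>2\<close>, the antidual of \<open>H\<^sup>1\<^sup>/\<^sup>2\<close>: an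
  antilinear functional \<open>\<psi> \<mapsto> \<integral> (inverse transform of F) \<sqdot> cnj \<psi>\<close>. Inserting the inversion formula
  and exchanging the integrals moves the transform to \<open>\<psi>\<close>; this is how the boundary integral
  of \<open>T\<close> against \<open>cnj \<psi>\<close> is to be read, since \<open>T \<phi>\<close> need not be a function.
\<close>
definition inv_fourier_dual ::
  "('a::euclidean_space \<Rightarrow> complex) \<Rightarrow> ('a \<Rightarrow> complex) \<Rightarrow> complex" where
  "inv_fourier_dual F \<psi> = (LINT \<xi>|lebesgue. F \<xi> * cnj (fourier \<psi> \<xi>))"

text \<open>\<open>csqrt\<close> takes the value \<open>\<i> * sqrt \<bar>t\<bar>\<close> at a negative real \<open>t\<close>.\<close>
definition T_op ::
  "real \<Rightarrow> ('a::euclidean_space \<Rightarrow> complex) \<Rightarrow> ('a \<Rightarrow> complex) \<Rightarrow> complex" where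
  "T_op k \<phi> = inv_fourier_dual
     (\<lambda>\<xi>. \<i> * csqrt (of_real (k\<^sup>2 - (norm \<xi>)\<^sup>2)) * fourier \<phi> \<xi>)"

section \<open>The sesquilinear form, its operator and the set of admissible perturbations\<close>

definition a_form ::
  "real \<Rightarrow> real \<Rightarrow> real \<Rightarrow> (('n::finite) pt \<Rightarrow> complex) \<Rightarrow> ('n pt \<Rightarrow> complex) \<Rightarrow>
   ('n pt \<Rightarrow> complex) \<Rightarrow> ('n pt \<Rightarrow> complex) \<Rightarrow> complex" where
  "a_form k R0 R np2 q u v =
     (LINT x|lebesgue_on (slab R).
        (\<Sum>b\<in>Basis. weak_partial (slab R) u b x * cnj (weak_partial (slab R) v b x))
        - of_real (k\<^sup>2) * (np2 x + zero_ext (cell R0) q x) * u x * cnj (v x))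
     - T_op k (trace_at R R u) (trace_at R R v)"

text \<open>
  The operator representing the form with respect to the full H1 inner product. \<open>B_inv\<close> is its
  inverse on classes modulo null sets.
\<close>
definition B_op ::
  "real \<Rightarrow> real \<Rightarrow> real \<Rightarrow> (('n::finite) pt \<Rightarrow> complex) \<Rightarrow> ('n pt \<Rightarrow> complex) \<Rightarrow>
   ('n pt \<Rightarrow> complex) \<Rightarrow> 'n pt \<Rightarrow> complex" where
  "B_op k R0 R np2 q u = (SOME w. w \<in> H1_tilde R \<and>
     (\<forall>v\<in>H1_tilde R. H1_inner (slab R) w v = a_form k R0 R np2 q u v))"

definition B_inv ::
  "real \<Rightarrow> real \<Rightarrow> real \<Rightarrow> (('n::finite) pt \<Rightarrow> complex) \<Rightarrow> ('n pt \<Rightarrow> complex) \<Rightarrow>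
   ('n pt \<Rightarrow> complex) \<Rightarrow> 'n pt \<Rightarrow> complex" where
  "B_inv k R0 R np2 q w = (SOME u. u \<in> H1_tilde R \<and>
     (AE x in lebesgue_on (slab R). B_op k R0 R np2 q u x = w x))"

definition op_norm ::
  "real \<Rightarrow> ((('n::finite) pt \<Rightarrow> complex) \<Rightarrow> 'n pt \<Rightarrow> complex) \<Rightarrow> real" where
  "op_norm R A = (SUP u\<in>{u \<in> H1_tilde R. H1_norm (slab R) u \<le> 1}. H1_norm (slab R) (A u))"

definition bounded_absorbing :: "real \<Rightarrow> (('n::finite) pt \<Rightarrow> complex) set" where
  "bounded_absorbing R0 =
     {q0 \<in> Linf (cell R0). AE x in lebesgue_on (cell R0). 0 \<le> Im (q0 x)}"

text \<open>
  \<open>\<delta>\<close> acts on representatives and need not respect equality almost everywhere: the balls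
  around the representatives of one class form a single ball whose radius is admissible again.
\<close>
definition admissible_radius ::
  "real \<Rightarrow> real \<Rightarrow> real \<Rightarrow> (('n::finite) pt \<Rightarrow> complex) \<Rightarrow>
   (('n pt \<Rightarrow> complex) \<Rightarrow> real) \<Rightarrow> bool" where
  "admissible_radius k R0 R np2 \<delta> \<longleftrightarrow>
     (\<forall>q0\<in>bounded_absorbing R0. 0 < \<delta> q0 \<and>
        (\<forall>q\<in>L2 (cell R0). L2_norm (cell R0) (\<lambda>x. q x - q0 x) < \<delta> q0 \<longrightarrow>
           op_norm R (\<lambda>u x. B_op k R0 R np2 q u x - B_op k R0 R np2 q0 u x)
           < inverse (op_norm R (B_inv k R0 R np2 q0))))"

definition Q_set ::
  "real \<Rightarrow> ((('n::finite) pt \<Rightarrow> complex) \<Rightarrow> real) \<Rightarrow> ('n pt \<Rightarrow> complex) set" where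
  "Q_set R0 \<delta> = (\<Union>q0\<in>bounded_absorbing R0.
     {q \<in> L2 (cell R0). L2_norm (cell R0) (\<lambda>x. q x - q0 x) < \<delta> q0})"

section \<open>The measurement operator\<close>

definition is_solution ::
  "real \<Rightarrow> real \<Rightarrow> real \<Rightarrow> (('n::finite) pt \<Rightarrow> complex) \<Rightarrow> ('n pt \<Rightarrow> complex) \<Rightarrow>
   ('n pt \<Rightarrow> complex) \<Rightarrow> ('n pt \<Rightarrow> complex) \<Rightarrow> bool" where
  "is_solution k R0 R np2 q f u \<longleftrightarrow> u \<in> H1_tilde R \<and>
     (\<forall>v\<in>H1_tilde R. a_form k R0 R np2 q u v =
        (LINT x|lebesgue_on (slab R). zero_ext (cell R0) f x * cnj (v x)))"

text \<open>The value is an element of \<open>L2 (cell R)\<close>; only its values on \<open>cell R\<close> are meaningful.\<close>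
definition \<Lambda>_op ::
  "real \<Rightarrow> real \<Rightarrow> real \<Rightarrow> (('n::finite) pt \<Rightarrow> complex) \<Rightarrow> ('n pt \<Rightarrow> complex) \<Rightarrow>
   ('n pt \<Rightarrow> complex) \<Rightarrow> 'n pt \<Rightarrow> complex" where
  "\<Lambda>_op k R0 R np2 q f = zero_ext (cell R) (SOME u. is_solution k R0 R np2 q f u)"

end

theory Submission
  imports Defs "HOL-Real_Asymp.Real_Asymp"
begin

text \<open>
  For a test function \<open>u\<close> on the cell put \<open>f = - \<Delta>u - k\<^sup>2 (n\<^sub>p\<^sup>2 + q\<^sub>1) u\<close>. Then \<open>u\<close> solves the problem with potential
  \<open>q\<^sub>1\<close> and source \<open>f\<close>, because it vanishes near both faces of the slab, where the boundary operator acts. Suppose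
  the problem with potential \<open>q\<^sub>2\<close> and source \<open>f\<close> is solvable as well. By equality of the data the two chosen solutions
  agree on the cell; call their common value \<open>p\<close>. Subtracting the two equations gives \<open>(q\<^sub>1 - q\<^sub>2) p = 0\<close>, so \<open>p\<close>
  vanishes almost everywhere on the set \<open>E\<close> where the potentials differ.

  The analytic core is that a solution can vanish on a set of positive measure only if its source vanishes there: if
  \<open>- \<Delta>p = V p + f\<close> with \<open>V\<close> and \<open>f\<close> square integrable, then \<open>f = 0\<close> almost everywhere on \<open>{p = 0}\<close>
  (\<open>source_zero_on_zero_set\<close>). This needs two facts. First, \<open>p\<close> is locally bounded (\<open>schroedinger_bounded\<close>);
  this is where dimension at most three enters, through the local square integrability of the fundamental solution of the
  Laplacian. Hence \<open>\<Delta>p\<close> is locally square integrable and \<open>p\<close> has second derivatives in \<open>L\<^sup>2\<close>. Second, the weak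
  derivative of a function vanishes almost everywhere on its zero set; applied to \<open>p\<close> and then to its first derivatives,
  this gives \<open>\<Delta>p = 0\<close> almost everywhere on \<open>{p = 0}\<close> (\<open>laplacian_zero_on_zero_set\<close>), and there
  \<open>f = - \<Delta>p - V p = 0\<close>.

  Consequently \<open>- \<Delta>u - k\<^sup>2 (n\<^sub>p\<^sup>2 + q\<^sub>1) u = 0\<close> almost everywhere on \<open>E\<close> for every test function \<open>u\<close> on the cell. A
  test function that equals 1 on a compact set \<open>K\<close> and its product with the square of a coordinate satisfy
  this together only on a null set, since the Laplacian of the square contributes the constant 2. So \<open>E \<inter> K\<close> is null.

  The operator \<open>\<Lambda>\<^sub>q\<close> is a choice of solutions, so solvability for \<open>q\<^sub>2\<close> has to be dealt with separately. If neither \<open>f\<close> nor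
  \<open>2 f\<close> admits a solution for \<open>q\<^sub>2\<close>, the chosen values for \<open>f\<close> and \<open>2 f\<close> coincide; by equality of the data one function
  then solves the equation for \<open>q\<^sub>1\<close> with both sources on the cell, and \<open>f = 0\<close> follows directly.
\<close>

section \<open>Smooth functions\<close>

definition pd :: "'a::euclidean_space \<Rightarrow> ('a \<Rightarrow> complex) \<Rightarrow> 'a \<Rightarrow> complex" where
  "pd b f x = frechet_derivative f (at x) b"

definition smooth :: "('a::euclidean_space \<Rightarrow> complex) \<Rightarrow> bool" where
  "smooth f \<longleftrightarrow> (\<forall>m. Ck m f)"

lemma Ck_Suc_pd:
  "Ck (Suc m) f \<longleftrightarrow> (\<forall>x. f differentiable (at x)) \<and> (\<forall>b\<in>Basis. Ck m (pd b f))"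
  by (simp add: pd_def[abs_def])

lemma Ck_continuous: "Ck m f \<Longrightarrow> continuous_on UNIV f"
proof (cases m)
  case (Suc n)
  assume "Ck m f"
  then have "\<And>x. f differentiable (at x)" using Suc by simp
  then show ?thesis
    by (simp add: continuous_on_eq_continuous_within differentiable_imp_continuous_within)
qed simp

lemma Ck_lower: "Ck (Suc m) f \<Longrightarrow> Ck m f"
proof (induction m arbitrary: f)
  case 0 then show ?case using Ck_continuous by (metis Ck.simps(1))
next
  case (Suc m) then show ?case unfolding Ck_Suc_pd[of "Suc m"] Ck_Suc_pd[of m] by blast
qed

lemma pd_eqI: "(f has_derivative f') (at x) \<Longrightarrow> pd b f x = f' b"
  unfolding pd_def by (metis frechet_derivative_at)

lemma pd_const [simp]: "pd b (\<lambda>x. c) = (\<lambda>x. 0)"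
  by (rule ext, rule pd_eqI[where f'="\<lambda>_. 0"]) simp

lemma differentiable_pd:
  assumes "f differentiable (at x)"
  shows "(f has_derivative (\<lambda>v. \<Sum>b\<in>Basis. (v \<bullet> b) *\<^sub>R pd b f x)) (at x)"
proof -
  have d: "(f has_derivative frechet_derivative f (at x)) (at x)"
    using assms frechet_derivative_works by blast
  then interpret bounded_linear "frechet_derivative f (at x)" by (rule has_derivative_bounded_linear)
  have "frechet_derivative f (at x) v = (\<Sum>b\<in>Basis. (v \<bullet> b) *\<^sub>R pd b f x)" for v
  proof -
    have "frechet_derivative f (at x) v = frechet_derivative f (at x) (\<Sum>b\<in>Basis. (v \<bullet> b) *\<^sub>R b)"
      by (simp add: euclidean_representation)
    also have "\<dots> = (\<Sum>b\<in>Basis. (v \<bullet> b) *\<^sub>R pd b f x)"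
      by (simp add: sum scaleR pd_def)
    finally show ?thesis .
  qed
  then have "frechet_derivative f (at x) = (\<lambda>v. \<Sum>b\<in>Basis. (v \<bullet> b) *\<^sub>R pd b f x)" by auto
  with d show ?thesis by simp
qed

lemma Ck_const [simp]: "Ck m (\<lambda>x. c)"
  by (induction m arbitrary: c) (auto simp: Ck_Suc_pd simp del: Ck.simps(2))

lemma pd_add:
  assumes "f differentiable (at x)" "g differentiable (at x)"
  shows "pd b (\<lambda>x. f x + g x) x = pd b f x + pd b g x"
  using pd_eqI[OF has_derivative_add[OF differentiable_pd[OF assms(1)] differentiable_pd[OF assms(2)]], of b]
    pd_eqI[OF differentiable_pd[OF assms(1)], of b] pd_eqI[OF differentiable_pd[OF assms(2)], of b] by simp

lemma pd_mult:
  assumes "f differentiable (at x)" "g differentiable (at x)"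
  shows "pd b (\<lambda>x. f x * g x) x = pd b f x * g x + f x * pd b g x"
  using pd_eqI[OF has_derivative_mult[OF differentiable_pd[OF assms(1)] differentiable_pd[OF assms(2)]], of b]
    pd_eqI[OF differentiable_pd[OF assms(1)], of b] pd_eqI[OF differentiable_pd[OF assms(2)], of b] by simp

lemma pd_bounded_linear:
  assumes "bounded_linear L" "f differentiable (at x)"
  shows "pd b (\<lambda>x. L (f x)) x = L (pd b f x)"
  using pd_eqI[OF bounded_linear.has_derivative[OF assms(1) differentiable_pd[OF assms(2)]], of b]
    pd_eqI[OF differentiable_pd[OF assms(2)], of b] by simp

lemma pd_shift:
  assumes "f differentiable (at (s *\<^sub>R x + a))"
  shows "pd b (\<lambda>x. f (s *\<^sub>R x + a)) x = s *\<^sub>R pd b f (s *\<^sub>R x + a)"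
proof -
  have "((\<lambda>x. f (s *\<^sub>R x + a)) has_derivative (\<lambda>v. \<Sum>b\<in>Basis. ((s *\<^sub>R v) \<bullet> b) *\<^sub>R pd b f (s *\<^sub>R x + a))) (at x)"
    by (rule has_derivative_compose[where f="\<lambda>x. s *\<^sub>R x + a", OF _ differentiable_pd[OF assms]])
      (auto intro!: derivative_eq_intros)
  from pd_eqI[OF this, of b] pd_eqI[OF differentiable_pd[OF assms], of b]
  show ?thesis by (simp add: scaleR_sum_right)
qed

lemma Ck_add: "Ck m f \<Longrightarrow> Ck m g \<Longrightarrow> Ck m (\<lambda>x. f x + g x)"
proof (induction m arbitrary: f g)
  case 0 then show ?case by (auto intro: continuous_intros)
next
  case (Suc m)
  then have d: "\<And>x. f differentiable (at x)" "\<And>x. g differentiable (at x)" by auto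
  have "pd b (\<lambda>x. f x + g x) = (\<lambda>x. pd b f x + pd b g x)" for b using pd_add d by blast
  then show ?case using Suc d unfolding Ck_Suc_pd by auto
qed

lemma Ck_mult: "Ck m f \<Longrightarrow> Ck m g \<Longrightarrow> Ck m (\<lambda>x. f x * g x)"
proof (induction m arbitrary: f g)
  case 0 then show ?case by (auto intro: continuous_intros)
next
  case (Suc m)
  then have d: "\<And>x. f differentiable (at x)" "\<And>x. g differentiable (at x)" by auto
  have "pd b (\<lambda>x. f x * g x) = (\<lambda>x. pd b f x * g x + f x * pd b g x)" for b using pd_mult d by blast
  moreover have "Ck m f" "Ck m g" using Suc.prems Ck_lower by auto
  ultimately show ?case using Suc d unfolding Ck_Suc_pd by (auto intro!: Ck_add)
qed

lemma Ck_bounded_linear: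
  assumes L: "bounded_linear L" shows "Ck m f \<Longrightarrow> Ck m (\<lambda>x. L (f x))"
proof (induction m arbitrary: f)
  case 0 then show ?case
    by (auto intro!: continuous_on_compose2[OF linear_continuous_on[OF L]])
next
  case (Suc m)
  then have d: "\<And>x. f differentiable (at x)" by auto
  have "pd b (\<lambda>x. L (f x)) = (\<lambda>x. L (pd b f x))" for b using pd_bounded_linear[OF L] d by blast
  moreover have "(\<lambda>x. L (f x)) differentiable (at x)" for x
    using bounded_linear.has_derivative[OF L differentiable_pd[OF d]] differentiable_def by blast
  ultimately show ?case using Suc unfolding Ck_Suc_pd by auto
qed

lemma Ck_shift: "Ck m f \<Longrightarrow> Ck m (\<lambda>x. f (s *\<^sub>R x + a))"
proof (induction m arbitrary: f)
  case 0 then show ?case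
    by (auto intro!: continuous_on_compose2[where f="\<lambda>x. s *\<^sub>R x + a" and t=UNIV] continuous_intros)
next
  case (Suc m)
  then have d: "\<And>x. f differentiable (at x)" by auto
  have "pd b (\<lambda>x. f (s *\<^sub>R x + a)) = (\<lambda>x. of_real s * pd b f (s *\<^sub>R x + a))" for b
    using pd_shift d by (fastforce simp: scaleR_conv_of_real)
  moreover have "(\<lambda>x. f (s *\<^sub>R x + a)) differentiable (at x)" for x
  proof -
    have "((\<lambda>x. s *\<^sub>R x + a) has_derivative (\<lambda>v. s *\<^sub>R v)) (at x)" by (auto intro!: derivative_eq_intros)
    from has_derivative_compose[OF this differentiable_pd[OF d]] show ?thesis
      using differentiable_def by blast
  qed
  moreover have "Ck m (\<lambda>x. of_real s * pd b f (s *\<^sub>R x + a))" if "b \<in> Basis" for b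
    using Suc.IH[of "pd b f"] Suc.prems that unfolding Ck_Suc_pd by (intro Ck_mult Ck_const) blast
  ultimately show ?case unfolding Ck_Suc_pd by auto
qed

lemma Ck_of_inner [simp]: "Ck m (\<lambda>x. of_real (x \<bullet> c))"
proof (cases m)
  case (Suc n)
  have h: "((\<lambda>x. complex_of_real (x \<bullet> c)) has_derivative (\<lambda>v. of_real (v \<bullet> c))) (at x)" for x
    by (auto intro!: derivative_eq_intros)
  then have "pd b (\<lambda>x. complex_of_real (x \<bullet> c)) = (\<lambda>x. of_real (b \<bullet> c))" for b using pd_eqI by blast
  then show ?thesis using Suc h unfolding Ck_Suc_pd by (auto simp: Suc Ck_Suc_pd differentiable_def simp del: Ck.simps(2))
qed (auto intro!: continuous_intros)

lemma smoothD:
  assumes "smooth f"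
  shows "f differentiable (at x)" "continuous_on UNIV f" "b \<in> Basis \<Longrightarrow> smooth (pd b f)"
proof -
  have s: "Ck (Suc m) f" for m using assms unfolding smooth_def by blast
  show "f differentiable (at x)" using s[of 0] unfolding Ck_Suc_pd by blast
  show "continuous_on UNIV f" using s Ck_continuous by blast
  show "b \<in> Basis \<Longrightarrow> smooth (pd b f)" using s unfolding Ck_Suc_pd smooth_def by blast
qed

lemma smooth_has_derivative:
  "smooth f \<Longrightarrow> (f has_derivative (\<lambda>v. \<Sum>b\<in>Basis. (v \<bullet> b) *\<^sub>R pd b f x)) (at x)"
  using differentiable_pd smoothD(1) by blast

text \<open>
  Smoothness is the greatest class of differentiable functions that is closed under partial derivatives.
\<close>

lemma smooth_coinduct:
  assumes "X f"
    and "\<And>f. X f \<Longrightarrow> (\<forall>x. f differentiable (at x)) \<and> (\<forall>b\<in>Basis. X (pd b f))"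
  shows "smooth f"
proof -
  have "X f \<Longrightarrow> Ck m f" for m f
  proof (induction m arbitrary: f)
    case 0
    then have "\<And>x. f differentiable (at x)" using assms(2) by blast
    then show ?case
      by (simp add: continuous_on_eq_continuous_within differentiable_imp_continuous_within)
  next
    case (Suc m) then show ?case using assms(2) unfolding Ck_Suc_pd by blast
  qed
  with assms(1) show ?thesis unfolding smooth_def by blast
qed

named_theorems smooth_intros

lemma smooth_closure [smooth_intros]:
  shows "smooth (\<lambda>x. c)" "smooth (\<lambda>x. of_real (x \<bullet> a))"
    and "smooth f \<Longrightarrow> smooth g \<Longrightarrow> smooth (\<lambda>x. f x + g x)"
    and "smooth f \<Longrightarrow> smooth g \<Longrightarrow> smooth (\<lambda>x. f x * g x)"
    and "smooth f \<Longrightarrow> smooth (\<lambda>x. cnj (f x))"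
    and "smooth f \<Longrightarrow> smooth (\<lambda>x. of_real (Re (f x)))"
    and "smooth f \<Longrightarrow> smooth (\<lambda>x. of_real (Im (f x)))"
    and "b \<in> Basis \<Longrightarrow> smooth f \<Longrightarrow> smooth (pd b f)"
proof -
  show "smooth (\<lambda>x. c)" "smooth (\<lambda>x. of_real (x \<bullet> a))" by (simp_all add: smooth_def del: Ck.simps)
  show "smooth f \<Longrightarrow> smooth g \<Longrightarrow> smooth (\<lambda>x. f x + g x)"
    "smooth f \<Longrightarrow> smooth g \<Longrightarrow> smooth (\<lambda>x. f x * g x)"
    unfolding smooth_def by (blast intro: Ck_add Ck_mult)+
  show "smooth f \<Longrightarrow> smooth (\<lambda>x. cnj (f x))"
    unfolding smooth_def by (blast intro: Ck_bounded_linear[OF bounded_linear_cnj])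
  show "smooth f \<Longrightarrow> smooth (\<lambda>x. of_real (Re (f x)))"
    unfolding smooth_def by (blast intro:
      Ck_bounded_linear[OF bounded_linear_compose[OF bounded_linear_of_real bounded_linear_Re]])
  show "smooth f \<Longrightarrow> smooth (\<lambda>x. of_real (Im (f x)))"
    unfolding smooth_def by (blast intro:
      Ck_bounded_linear[OF bounded_linear_compose[OF bounded_linear_of_real bounded_linear_Im]])
  show "b \<in> Basis \<Longrightarrow> smooth f \<Longrightarrow> smooth (pd b f)"
    by (rule smoothD(3))
qed

lemma smooth_shift:
  shows "smooth f \<Longrightarrow> smooth (\<lambda>x. f (x + v))"
    and "smooth f \<Longrightarrow> smooth (\<lambda>x. f (x - v))"
    and "smooth f \<Longrightarrow> smooth (\<lambda>x. f (v - x))"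
proof -
  show "smooth f \<Longrightarrow> smooth (\<lambda>x. f (x + v))"
    using Ck_shift[of _ f 1 v] unfolding smooth_def scaleR_one by blast
  show "smooth f \<Longrightarrow> smooth (\<lambda>x. f (x - v))"
    using Ck_shift[of _ f 1 "-v"] unfolding smooth_def scaleR_one add_uminus_conv_diff by blast
  show "smooth f \<Longrightarrow> smooth (\<lambda>x. f (v - x))"
    using Ck_shift[of _ f "-1" v] unfolding smooth_def scaleR_minus_left scaleR_one uminus_add_conv_diff by blast
qed

lemma smooth_minus [smooth_intros]: "smooth f \<Longrightarrow> smooth (\<lambda>x. - f x)"
  using smooth_closure(4)[of "\<lambda>x. -1" f] smooth_closure(1)[of "-1"] by simp

lemma smooth_diff [smooth_intros]: "smooth f \<Longrightarrow> smooth g \<Longrightarrow> smooth (\<lambda>x. f x - g x)"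
  using smooth_closure(3)[of f "\<lambda>x. - g x"] smooth_minus[of g] by simp

lemma smooth_sum [smooth_intros]: "(\<And>i. i \<in> I \<Longrightarrow> smooth (f i)) \<Longrightarrow> smooth (\<lambda>x. \<Sum>i\<in>I. f i x)"
  by (induction I rule: infinite_finite_induct) (auto intro: smooth_closure)

lemma pd_rules:
  assumes "smooth f" "smooth g"
  shows "pd b (\<lambda>x. f x + g x) = (\<lambda>x. pd b f x + pd b g x)"
    and "pd b (\<lambda>x. f x - g x) = (\<lambda>x. pd b f x - pd b g x)"
    and "pd b (\<lambda>x. f x * g x) = (\<lambda>x. pd b f x * g x + f x * pd b g x)"
    and "pd b (\<lambda>x. cnj (f x)) = (\<lambda>x. cnj (pd b f x))"
    and "pd b (\<lambda>x. - f x) = (\<lambda>x. - pd b f x)"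
    and "pd b (\<lambda>x. of_real (Re (f x))) = (\<lambda>x. of_real (Re (pd b f x)))"
    and "pd b (\<lambda>x. of_real (Im (f x))) = (\<lambda>x. of_real (Im (pd b f x)))"
    and "pd b (\<lambda>x. c * f x) = (\<lambda>x. c * pd b f x)"
    and "pd b (\<lambda>x. f (x + v)) = (\<lambda>x. pd b f (x + v))"
    and "pd b (\<lambda>x. f (x - v)) = (\<lambda>x. pd b f (x - v))"
    and "pd b (\<lambda>x. f (v - x)) = (\<lambda>x. - pd b f (v - x))"
proof -
  have d: "\<And>x. f differentiable (at x)" "\<And>x. g differentiable (at x)" using assms smoothD by auto
  show "pd b (\<lambda>x. f x + g x) = (\<lambda>x. pd b f x + pd b g x)" using pd_add d by blast
  show "pd b (\<lambda>x. f x * g x) = (\<lambda>x. pd b f x * g x + f x * pd b g x)" using pd_mult d by blast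
  show "pd b (\<lambda>x. cnj (f x)) = (\<lambda>x. cnj (pd b f x))"
    using pd_bounded_linear[OF bounded_linear_cnj] d by blast
  show mf: "pd b (\<lambda>x. - f x) = (\<lambda>x. - pd b f x)"
    using pd_bounded_linear[OF bounded_linear_minus[OF bounded_linear_ident]] d by blast
  have mg: "pd b (\<lambda>x. - g x) = (\<lambda>x. - pd b g x)"
    using pd_bounded_linear[OF bounded_linear_minus[OF bounded_linear_ident]] d by blast
  show "pd b (\<lambda>x. f x - g x) = (\<lambda>x. pd b f x - pd b g x)"
    using pd_add[OF d(1) differentiable_minus[OF d(2)], of b] mg by (auto simp: fun_eq_iff)
  show "pd b (\<lambda>x. of_real (Re (f x))) = (\<lambda>x. of_real (Re (pd b f x)))"
    using pd_bounded_linear[OF bounded_linear_compose[OF bounded_linear_of_real bounded_linear_Re]] d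
    by (auto simp: o_def fun_eq_iff)
  show "pd b (\<lambda>x. of_real (Im (f x))) = (\<lambda>x. of_real (Im (pd b f x)))"
    using pd_bounded_linear[OF bounded_linear_compose[OF bounded_linear_of_real bounded_linear_Im]] d
    by (auto simp: o_def fun_eq_iff)
  show "pd b (\<lambda>x. c * f x) = (\<lambda>x. c * pd b f x)"
    using pd_bounded_linear[OF bounded_linear_mult_right] d by blast
  show "pd b (\<lambda>x. f (x + v)) = (\<lambda>x. pd b f (x + v))"
    using pd_shift[of f 1 _ v] d by (auto simp: fun_eq_iff)
  show "pd b (\<lambda>x. f (x - v)) = (\<lambda>x. pd b f (x - v))"
    using pd_shift[of f 1 _ "-v"] d by (auto simp: fun_eq_iff)
  show "pd b (\<lambda>x. f (v - x)) = (\<lambda>x. - pd b f (v - x))"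
    using pd_shift[of f "-1" _ v] d by (auto simp: fun_eq_iff)
qed

lemma pd_inner: "pd b (\<lambda>x. complex_of_real (x \<bullet> c)) = (\<lambda>x. of_real (b \<bullet> c))"
  by (rule ext, rule pd_eqI[where f'="\<lambda>v. of_real (v \<bullet> c)"]) (auto intro!: derivative_eq_intros)

lemma norm_sq_sum: "complex_of_real ((norm (x::'a::euclidean_space))\<^sup>2) = (\<Sum>b\<in>Basis. of_real (x \<bullet> b) * of_real (x \<bullet> b))"
  unfolding power2_norm_eq_inner euclidean_inner[of x x] by simp

lemma smooth_norm_sq [smooth_intros]: "smooth (\<lambda>x. of_real ((norm x)\<^sup>2))"
  unfolding norm_sq_sum by (intro smooth_intros)

lemma smooth_exp [smooth_intros]:
  assumes "smooth p" shows "smooth (\<lambda>x. exp (p x))"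
    and "pd b (\<lambda>x. exp (p x)) = (\<lambda>x. pd b p x * exp (p x))"
proof -
  have h: "((\<lambda>x. exp (p x)) has_derivative (\<lambda>v. (\<Sum>b\<in>Basis. (v \<bullet> b) *\<^sub>R pd b p x) * exp (p x))) (at x)" for x
    using has_derivative_compose[OF smooth_has_derivative[OF assms, of x] DERIV_exp[unfolded has_field_derivative_def]]
    by (simp add: mult.commute)
  show pd: "pd b (\<lambda>x. exp (p x)) = (\<lambda>x. pd b p x * exp (p x))" for b
    using pd_eqI[OF h, of b] pd_eqI[OF smooth_has_derivative[OF assms], of b] by (auto simp: fun_eq_iff)
  have "Ck m (\<lambda>x. exp (p x))" for m
  proof (induction m)
    case 0 then show ?case using smoothD(2)[OF assms] by (auto intro: continuous_intros)
  next
    case (Suc m)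
    have "\<And>b. b \<in> Basis \<Longrightarrow> Ck m (pd b p)" using smoothD(3)[OF assms] unfolding smooth_def by blast
    moreover have "(\<lambda>x. exp (p x)) differentiable (at x)" for x using h differentiable_def by blast
    ultimately show ?case unfolding Ck_Suc_pd pd using Suc Ck_mult by blast
  qed
  then show "smooth (\<lambda>x. exp (p x))" unfolding smooth_def by blast
qed

section \<open>Test functions\<close>

lemma test_functions_iff:
  "\<phi> \<in> test_functions S \<longleftrightarrow> smooth \<phi> \<and> compact (closure {x. \<phi> x \<noteq> 0}) \<and> closure {x. \<phi> x \<noteq> 0} \<subseteq> S"
  unfolding test_functions_def smooth_def by blast

lemma test_functionsI:
  assumes "smooth \<phi>" "compact K" "K \<subseteq> S" "\<And>x. \<phi> x \<noteq> 0 \<Longrightarrow> x \<in> K"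
  shows "\<phi> \<in> test_functions S"
proof -
  have "closure {x. \<phi> x \<noteq> 0} \<subseteq> K"
    using assms by (intro closure_minimal compact_imp_closed) auto
  then show ?thesis unfolding test_functions_iff
    using assms compact_Int_closed[OF assms(2) closed_closure[of "{x. \<phi> x \<noteq> 0}"]]
    by (metis (no_types, lifting) inf.absorb_iff2 order_trans)
qed

lemma test_support:
  assumes "\<phi> \<in> test_functions S"
  obtains K where "compact K" "K \<subseteq> S" "\<And>x. \<phi> x \<noteq> 0 \<Longrightarrow> x \<in> K" "\<And>x b. pd b \<phi> x \<noteq> 0 \<Longrightarrow> x \<in> K"
proof
  let ?K = "closure {x. \<phi> x \<noteq> 0}"
  show "compact ?K" "?K \<subseteq> S" using assms by (auto simp: test_functions_iff)
  show "\<phi> x \<noteq> 0 \<Longrightarrow> x \<in> ?K" for x by (rule subsetD[OF closure_subset]) simp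
  show "pd b \<phi> x \<noteq> 0 \<Longrightarrow> x \<in> ?K" for x b
  proof (rule ccontr)
    assume ne: "pd b \<phi> x \<noteq> 0" and x: "x \<notin> ?K"
    have "(\<phi> has_derivative (\<lambda>v. 0)) (at x)"
    proof (rule has_derivative_transform_within_open)
      show "((\<lambda>x. 0) has_derivative (\<lambda>v. 0)) (at x)" by (rule has_derivative_const)
      show "open (- ?K)" by (rule open_Compl) (rule closed_closure)
      show "x \<in> - ?K" using x by simp
      show "\<And>y. y \<in> - ?K \<Longrightarrow> 0 = \<phi> y"
      proof -
        fix y assume "y \<in> - ?K"
        then have "y \<notin> {x. \<phi> x \<noteq> 0}" using closure_subset[of "{x. \<phi> x \<noteq> 0}"] by blast
        then show "0 = \<phi> y" by simp
      qed
    qed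
    from pd_eqI[OF this, of b] ne show False by simp
  qed
qed

lemma test_smooth: "\<phi> \<in> test_functions S \<Longrightarrow> smooth \<phi>"
  by (simp add: test_functions_iff)

lemma test_mono: "\<phi> \<in> test_functions S \<Longrightarrow> S \<subseteq> T \<Longrightarrow> \<phi> \<in> test_functions T"
  by (auto simp: test_functions_iff)

lemma test_zero [simp]: "(\<lambda>x. 0) \<in> test_functions S"
  by (rule test_functionsI[where K="{}"]) (auto intro: smooth_intros)

lemma test_outside: "\<phi> \<in> test_functions S \<Longrightarrow> x \<notin> S \<Longrightarrow> \<phi> x = 0 \<and> pd b \<phi> x = 0"
  by (erule test_support) blast

lemma test_pd: assumes "\<phi> \<in> test_functions S" "b \<in> Basis" shows "pd b \<phi> \<in> test_functions S"
proof -
  obtain K where K: "compact K" "K \<subseteq> S" "\<And>x b. pd b \<phi> x \<noteq> 0 \<Longrightarrow> x \<in> K"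
    using test_support[OF assms(1)] by metis
  show ?thesis
    by (rule test_functionsI[OF _ K(1,2)]) (use K assms in \<open>auto intro: smooth_intros test_smooth\<close>)
qed

lemma test_mult:
  assumes "\<phi> \<in> test_functions S" "smooth f"
  shows "(\<lambda>x. \<phi> x * f x) \<in> test_functions S" "(\<lambda>x. f x * \<phi> x) \<in> test_functions S"
proof -
  obtain K where K: "compact K" "K \<subseteq> S" "\<And>x. \<phi> x \<noteq> 0 \<Longrightarrow> x \<in> K"
    using test_support[OF assms(1)] by metis
  show "(\<lambda>x. \<phi> x * f x) \<in> test_functions S" "(\<lambda>x. f x * \<phi> x) \<in> test_functions S"
    by (rule test_functionsI[OF _ K(1,2)]; use K assms in \<open>auto intro: smooth_intros test_smooth\<close>)+
qed

lemma test_add: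
  assumes "\<phi> \<in> test_functions S" "\<psi> \<in> test_functions S"
  shows "(\<lambda>x. \<phi> x + \<psi> x) \<in> test_functions S"
proof -
  obtain K where K: "compact K" "K \<subseteq> S" "\<And>x. \<phi> x \<noteq> 0 \<Longrightarrow> x \<in> K"
    using test_support[OF assms(1)] by metis
  obtain L where L: "compact L" "L \<subseteq> S" "\<And>x. \<psi> x \<noteq> 0 \<Longrightarrow> x \<in> L"
    using test_support[OF assms(2)] by metis
  show ?thesis
  proof (rule test_functionsI[where K="K \<union> L"])
    show "smooth (\<lambda>x. \<phi> x + \<psi> x)" using assms by (intro smooth_intros test_smooth)
    show "\<phi> x + \<psi> x \<noteq> 0 \<Longrightarrow> x \<in> K \<union> L" for x using K(3)[of x] L(3)[of x] by (cases "\<phi> x = 0") auto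
  qed (use K L in auto)
qed

lemma test_cmult: "\<phi> \<in> test_functions S \<Longrightarrow> (\<lambda>x. c * \<phi> x) \<in> test_functions S"
  by (rule test_mult) (auto intro: smooth_intros)

lemma test_diff:
  "\<phi> \<in> test_functions S \<Longrightarrow> \<psi> \<in> test_functions S \<Longrightarrow> (\<lambda>x. \<phi> x - \<psi> x) \<in> test_functions S"
  using test_add[of \<phi> S "\<lambda>x. (-1) * \<psi> x"] test_cmult[of \<psi> S "-1"] by simp

lemma test_cnj: assumes "\<phi> \<in> test_functions S" shows "(\<lambda>x. cnj (\<phi> x)) \<in> test_functions S"
proof -
  obtain K where K: "compact K" "K \<subseteq> S" "\<And>x. \<phi> x \<noteq> 0 \<Longrightarrow> x \<in> K"
    using test_support[OF assms(1)] by metis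
  show ?thesis
    by (rule test_functionsI[OF _ K(1,2)]) (use K assms in \<open>auto intro: smooth_intros test_smooth\<close>)
qed

lemma test_sum:
  assumes "\<And>i. i \<in> I \<Longrightarrow> f i \<in> test_functions S"
  shows "(\<lambda>x. \<Sum>i\<in>I. f i x) \<in> test_functions S"
  using assms by (induction I rule: infinite_finite_induct) (auto intro: test_add)

lemma test_reflect: assumes "\<phi> \<in> test_functions S" shows "(\<lambda>y. \<phi> (x - y)) \<in> test_functions ((\<lambda>y. x - y) ` S)"
proof -
  obtain K where K: "compact K" "K \<subseteq> S" "\<And>x. \<phi> x \<noteq> 0 \<Longrightarrow> x \<in> K"
    using test_support[OF assms(1)] by metis
  show ?thesis
  proof (rule test_functionsI[where K="(\<lambda>y. x - y) ` K"])
    show "smooth (\<lambda>y. \<phi> (x - y))" using assms by (intro smooth_shift test_smooth)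
    show "compact ((\<lambda>y. x - y) ` K)" using K(1) by (intro compact_continuous_image continuous_intros)
    show "\<phi> (x - y) \<noteq> 0 \<Longrightarrow> y \<in> (\<lambda>y. x - y) ` K" for y
      using K(3)[of "x - y"] by (auto intro!: image_eqI[of _ _ "x - y"])
  qed (use K in auto)
qed

lemma compact_support_bounded:
  fixes f :: "'a::euclidean_space \<Rightarrow> complex"
  assumes "continuous_on UNIV f" "compact K" "\<And>x. f x \<noteq> 0 \<Longrightarrow> x \<in> K"
  obtains C where "0 < C" "\<And>x. cmod (f x) \<le> C"
proof -
  have "bounded (f ` K)" using assms by (intro compact_imp_bounded compact_continuous_image) (auto intro: continuous_on_subset)
  then obtain C where "\<And>x. x \<in> K \<Longrightarrow> cmod (f x) \<le> C" unfolding bounded_iff by auto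
  then have "cmod (f x) \<le> max C 1" for x by (cases "f x = 0") (use assms(3) in \<open>auto simp: le_max_iff_disj\<close>)
  then show ?thesis using that[of "max C 1"] by auto
qed

lemma compact_support_integrable:
  fixes f :: "'a::euclidean_space \<Rightarrow> complex"
  assumes "continuous_on UNIV f" "compact K" "\<And>x. f x \<noteq> 0 \<Longrightarrow> x \<in> K"
  shows "integrable lborel f" "integrable lebesgue f"
proof -
  have "integrable lborel (\<lambda>x. indicator K x *\<^sub>R f x)"
    using assms by (intro borel_integrable_compact) (auto intro: continuous_on_subset)
  moreover have "(\<lambda>x. indicator K x *\<^sub>R f x) = f" using assms(3) by (force simp: indicator_def)
  ultimately show "integrable lborel f" by simp
  then show "integrable lebesgue f" by (simp add: integrable_completion)
qed

lemma test_continuous: "\<phi> \<in> test_functions S \<Longrightarrow> continuous_on A \<phi>"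
  using smoothD(2)[OF test_smooth] continuous_on_subset by blast

lemma test_bounded:
  assumes "\<phi> \<in> test_functions S" obtains C where "0 < C" "\<And>x. cmod (\<phi> x) \<le> C"
  by (rule test_support[OF assms]) (metis compact_support_bounded test_continuous[OF assms])

lemma test_integrable:
  assumes "\<phi> \<in> test_functions S"
  shows "integrable lborel \<phi>" "integrable lebesgue \<phi>"
  by (rule test_support[OF assms], metis compact_support_integrable test_continuous[OF assms])+

lemma test_borel:
  assumes "\<phi> \<in> test_functions S"
  shows "\<phi> \<in> borel_measurable borel"
  using test_continuous[OF assms] by (rule borel_measurable_continuous_onI)

subsection \<open>Uniform differentiability\<close>

lemma smooth_lipschitz:
  fixes f :: "'a::euclidean_space \<Rightarrow> complex" and M :: real
  assumes f: "smooth f" and M: "\<And>x b. b \<in> Basis \<Longrightarrow> cmod (pd b f x) \<le> M"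
  shows "cmod (f x - f y) \<le> (DIM('a) * M) * norm (x - y)"
proof (rule differentiable_bound[where S=UNIV])
  show "(f has_derivative (\<lambda>v. \<Sum>b\<in>Basis. (v \<bullet> b) *\<^sub>R pd b f x)) (at x)" for x
    using smooth_has_derivative f by blast
  show "onorm (\<lambda>v. \<Sum>b\<in>Basis. (v \<bullet> b) *\<^sub>R pd b f x) \<le> DIM('a) * M" for x
  proof (rule onorm_le)
    fix v
    have "cmod (\<Sum>b\<in>Basis. (v \<bullet> b) *\<^sub>R pd b f x) \<le> (\<Sum>b\<in>(Basis::'a set). norm v * M)"
      by (intro sum_norm_le) (auto intro!: mult_mono M Basis_le_norm)
    then show "cmod (\<Sum>b\<in>Basis. (v \<bullet> b) *\<^sub>R pd b f x) \<le> DIM('a) * M * norm v" by (simp add: mult_ac)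
  qed
qed auto

lemma smooth_second_order:
  fixes f :: "'a::euclidean_space \<Rightarrow> complex" and M :: real
  assumes f: "smooth f" and M: "\<And>x b c. b \<in> Basis \<Longrightarrow> c \<in> Basis \<Longrightarrow> cmod (pd c (pd b f) x) \<le> M"
  shows "cmod (f (x + v) - f x - (\<Sum>b\<in>Basis. (v \<bullet> b) *\<^sub>R pd b f x)) \<le> (DIM('a) * (DIM('a) * M)) * norm v * norm v"
proof -
  define g where "g = (\<lambda>y. f y - (\<Sum>b\<in>Basis. (y \<bullet> b) *\<^sub>R pd b f x))"
  have "cmod (g (x + v) - g x) \<le> (DIM('a) * (DIM('a) * M) * norm v) * norm ((x + v) - x)"
  proof (rule differentiable_bound[where S="cball x (norm v)"])
    fix y assume y: "y \<in> cball x (norm v)"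
    show "(g has_derivative (\<lambda>w. \<Sum>b\<in>Basis. (w \<bullet> b) *\<^sub>R (pd b f y - pd b f x))) (at y within cball x (norm v))"
      unfolding g_def
      by (rule has_derivative_at_withinI)
        (auto intro!: derivative_eq_intros smooth_has_derivative f simp: fun_eq_iff sum_subtractf algebra_simps)
    show "onorm (\<lambda>w. \<Sum>b\<in>Basis. (w \<bullet> b) *\<^sub>R (pd b f y - pd b f x)) \<le> DIM('a) * (DIM('a) * M) * norm v"
    proof (rule onorm_le)
      fix w
      have M0: "0 \<le> M" using M[of "SOME b. b \<in> Basis" "SOME b. b \<in> Basis" 0] norm_ge_zero order_trans some_in_eq nonempty_Basis by metis
      have "cmod (pd b f y - pd b f x) \<le> DIM('a) * M * norm v" if "b \<in> Basis" for b
      proof -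
        have "cmod (pd b f y - pd b f x) \<le> DIM('a) * M * norm (y - x)"
          using that by (intro smooth_lipschitz M smoothD(3) f)
        also have "\<dots> \<le> DIM('a) * M * norm v" using y M0 by (intro mult_left_mono) (auto simp: dist_norm norm_minus_commute)
        finally show ?thesis .
      qed
      then have "cmod (\<Sum>b\<in>Basis. (w \<bullet> b) *\<^sub>R (pd b f y - pd b f x)) \<le> (\<Sum>b\<in>(Basis::'a set). norm w * (DIM('a) * M * norm v))"
        by (intro sum_norm_le) (auto intro!: mult_mono Basis_le_norm)
      then show "cmod (\<Sum>b\<in>Basis. (w \<bullet> b) *\<^sub>R (pd b f y - pd b f x)) \<le> DIM('a) * (DIM('a) * M) * norm v * norm w"
        by (simp add: mult_ac)
    qed
  qed (auto simp: dist_norm)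
  moreover have "g (x + v) - g x = f (x + v) - f x - (\<Sum>b\<in>Basis. (v \<bullet> b) *\<^sub>R pd b f x)"
    by (simp add: g_def inner_add_left scaleR_add_left sum.distrib)
  ultimately show ?thesis by simp
qed

text \<open>
  A second order Taylor estimate that is uniform in the base point: this is what allows differentiation under the
  integral sign in a convolution without a dominating function.
\<close>

lemma test_second_order:
  assumes "\<phi> \<in> test_functions S"
  obtains C where "0 < C" "\<And>x v. cmod (\<phi> (x + v) - \<phi> x - (\<Sum>b\<in>Basis. (v \<bullet> b) *\<^sub>R pd b \<phi> x)) \<le> C * norm v * norm v"
proof -
  have "\<exists>C. \<forall>x. cmod (pd c (pd b \<phi>) x) \<le> C" if "b \<in> Basis" "c \<in> Basis" for b c
    using test_bounded[OF test_pd[OF test_pd[OF assms]]] that by metis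
  then obtain C where C: "\<And>b c x. b \<in> Basis \<Longrightarrow> c \<in> Basis \<Longrightarrow> cmod (pd c (pd b \<phi>) x) \<le> C b c" by metis
  define M where "M = (\<Sum>(b,c)\<in>Basis\<times>Basis. \<bar>C b c\<bar>)"
  have "C b c \<le> M" if "b \<in> Basis" "c \<in> Basis" for b c
  proof -
    have "\<bar>C b c\<bar> \<le> M" unfolding M_def
      using member_le_sum[of "(b,c)" "Basis \<times> Basis" "\<lambda>(b,c). \<bar>C b c\<bar>"] that by auto
    then show ?thesis by linarith
  qed
  then have M: "cmod (pd c (pd b \<phi>) x) \<le> M" if "b \<in> Basis" "c \<in> Basis" for b c x using C that order_trans by blast
  have "M \<ge> 0" unfolding M_def by (auto intro: sum_nonneg)
  define K where "K = real DIM('a) * (real DIM('a) * M)"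
  have "K \<ge> 0" unfolding K_def using \<open>M \<ge> 0\<close> by simp
  have "cmod (\<phi> (x + v) - \<phi> x - (\<Sum>b\<in>Basis. (v \<bullet> b) *\<^sub>R pd b \<phi> x)) \<le> (K + 1) * norm v * norm v" for x v
    using smooth_second_order[OF test_smooth[OF assms] M, of x v] \<open>K \<ge> 0\<close>
    unfolding K_def[symmetric] by (smt (verit, ccfv_SIG) mult_right_mono norm_ge_zero)
  then show ?thesis using that[of "K + 1"] \<open>K \<ge> 0\<close> by auto
qed

subsection \<open>Convolution with a test function\<close>

definition conv :: "('a::euclidean_space \<Rightarrow> complex) \<Rightarrow> ('a \<Rightarrow> complex) \<Rightarrow> 'a \<Rightarrow> complex" where
  "conv f \<phi> x = (LINT y|lebesgue. f y * \<phi> (x - y))"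

lemma conv_integrable:
  assumes f: "integrable lebesgue f" and \<phi>: "\<phi> \<in> test_functions S"
  shows "integrable lebesgue (\<lambda>y. f y * \<phi> (x - y))"
proof -
  obtain C where C: "\<And>x. cmod (\<phi> x) \<le> C" using test_bounded[OF \<phi>] by metis
  have m: "(\<lambda>y. \<phi> (x - y)) \<in> borel_measurable lebesgue"
  proof (rule measurable_completion)
    have [measurable]: "\<phi> \<in> borel_measurable borel" using \<phi> by (rule test_borel)
    show "(\<lambda>y. \<phi> (x - y)) \<in> borel_measurable lborel" by measurable
  qed
  show ?thesis
  proof (rule Bochner_Integration.integrable_bound[of _ "\<lambda>y. C * cmod (f y)"])
    show "(\<lambda>y. f y * \<phi> (x - y)) \<in> borel_measurable lebesgue" using f m by measurable
    show "AE y in lebesgue. norm (f y * \<phi> (x - y)) \<le> norm (C * cmod (f y))"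
    proof (rule AE_I2)
      fix y show "norm (f y * \<phi> (x - y)) \<le> norm (C * cmod (f y))"
        using mult_right_mono[OF order_trans[OF C[of "x - y"] abs_ge_self], of "cmod (f y)"] by (simp add: norm_mult abs_mult mult.commute)
    qed
  qed (use f in auto)
qed

text \<open>
  The Taylor remainder of the test function is bounded uniformly by a multiple of \<open>(norm v)\<^sup>2\<close>, and the kernel \<open>f\<close> is integrable.
\<close>

lemma conv_has_derivative:
  fixes f :: "'a::euclidean_space \<Rightarrow> complex"
  assumes f: "integrable lebesgue f" and \<phi>: "\<phi> \<in> test_functions S"
  shows "(conv f \<phi> has_derivative (\<lambda>v. \<Sum>b\<in>Basis. (v \<bullet> b) *\<^sub>R conv f (pd b \<phi>) x)) (at x)"
proof -
  obtain C where C: "0 < C" "\<And>x v. cmod (\<phi> (x + v) - \<phi> x - (\<Sum>b\<in>Basis. (v \<bullet> b) *\<^sub>R pd b \<phi> x)) \<le> C * norm v * norm v"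
    using test_second_order[OF \<phi>] by metis
  let ?N = "LINT y|lebesgue. cmod (f y)"
  have N: "?N \<ge> 0" by simp
  have key: "cmod (conv f \<phi> (x + v) - conv f \<phi> x - (\<Sum>b\<in>Basis. (v \<bullet> b) *\<^sub>R conv f (pd b \<phi>) x)) \<le> (C * ?N) * norm v * norm v" for v
  proof -
    have i: "integrable lebesgue (\<lambda>y. f y * \<phi> (z - y))" for z by (rule conv_integrable[OF f \<phi>])
    have ib: "integrable lebesgue (\<lambda>y. f y * pd b \<phi> (x - y))" if "b \<in> Basis" for b
      by (rule conv_integrable[OF f test_pd[OF \<phi> that]])
    have ic: "integrable lebesgue (\<lambda>y. \<Sum>b\<in>Basis. (v \<bullet> b) *\<^sub>R (f y * pd b \<phi> (x - y)))"
      using ib by (intro Bochner_Integration.integrable_sum integrable_scaleR_right) auto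
    have "conv f \<phi> (x + v) - conv f \<phi> x - (\<Sum>b\<in>Basis. (v \<bullet> b) *\<^sub>R conv f (pd b \<phi>) x)
      = (LINT y|lebesgue. f y * \<phi> (x + v - y) - f y * \<phi> (x - y) - (\<Sum>b\<in>Basis. (v \<bullet> b) *\<^sub>R (f y * pd b \<phi> (x - y))))"
      unfolding conv_def using i ib ic by (simp add: Bochner_Integration.integral_sum)
    also have "\<dots> = (LINT y|lebesgue. f y * (\<phi> ((x - y) + v) - \<phi> (x - y) - (\<Sum>b\<in>Basis. (v \<bullet> b) *\<^sub>R pd b \<phi> (x - y))))"
      by (intro Bochner_Integration.integral_cong) (auto simp: algebra_simps sum_distrib_left)
    also have "cmod \<dots> \<le> (LINT y|lebesgue. cmod (f y) * (C * norm v * norm v))"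
    proof (rule Bochner_Integration.integral_norm_bound_integral)
      show "integrable lebesgue (\<lambda>y. f y * (\<phi> ((x - y) + v) - \<phi> (x - y) - (\<Sum>b\<in>Basis. (v \<bullet> b) *\<^sub>R pd b \<phi> (x - y))))"
      proof (rule Bochner_Integration.integrable_cong[THEN iffD1, OF refl])
        show "integrable lebesgue (\<lambda>y. f y * \<phi> (x + v - y) - f y * \<phi> (x - y) - (\<Sum>b\<in>Basis. (v \<bullet> b) *\<^sub>R (f y * pd b \<phi> (x - y))))"
          using i ic by auto
      qed (auto simp: algebra_simps sum_distrib_left)
      show "cmod (f y * (\<phi> ((x - y) + v) - \<phi> (x - y) - (\<Sum>b\<in>Basis. (v \<bullet> b) *\<^sub>R pd b \<phi> (x - y)))) \<le> cmod (f y) * (C * norm v * norm v)" for y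
        unfolding norm_mult using C(2) by (intro mult_left_mono) auto
    qed (use f in auto)
    also have "\<dots> = (C * ?N) * norm v * norm v" by simp
    finally show ?thesis .
  qed
  show ?thesis unfolding has_derivative_at2
  proof
    show "bounded_linear (\<lambda>v. \<Sum>b\<in>Basis. (v \<bullet> b) *\<^sub>R conv f (pd b \<phi>) x)"
      by (intro bounded_linear_sum bounded_linear_scaleR_const bounded_linear_inner_left)
    show "(\<lambda>y. (1 / norm (y - x)) *\<^sub>R (conv f \<phi> y - (conv f \<phi> x + (\<Sum>b\<in>Basis. ((y - x) \<bullet> b) *\<^sub>R conv f (pd b \<phi>) x)))) \<midarrow>x\<rightarrow> 0"
    proof (rule Lim_null_comparison[where g="\<lambda>y. (C * ?N) * norm (y - x)"])
      show "\<forall>\<^sub>F y in at x. norm ((1 / norm (y - x)) *\<^sub>R (conv f \<phi> y - (conv f \<phi> x + (\<Sum>b\<in>Basis. ((y - x) \<bullet> b) *\<^sub>R conv f (pd b \<phi>) x)))) \<le> (C * ?N) * norm (y - x)"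
        unfolding eventually_at_filter
      proof (intro always_eventually allI impI)
        fix y assume "y \<noteq> x"
        then show "norm ((1 / norm (y - x)) *\<^sub>R (conv f \<phi> y - (conv f \<phi> x + (\<Sum>b\<in>Basis. ((y - x) \<bullet> b) *\<^sub>R conv f (pd b \<phi>) x)))) \<le> (C * ?N) * norm (y - x)"
          using key[of "y - x"] by (simp add: divide_simps diff_diff_eq)
      qed
      have "((\<lambda>y. (C * ?N) * norm (y - x)) \<longlongrightarrow> (C * ?N) * norm (x - x)) (at x)"
        by (intro tendsto_intros)
      then show "((\<lambda>y. (C * ?N) * norm (y - x)) \<longlongrightarrow> 0) (at x)" by simp
    qed
  qed
qed

lemma pd_conv:
  assumes f: "integrable lebesgue f" and \<phi>: "\<phi> \<in> test_functions S" and b: "b \<in> Basis"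
  shows "pd b (conv f \<phi>) = conv f (pd b \<phi>)"
  using pd_eqI[OF conv_has_derivative[OF f \<phi>], of b] b
  by (auto simp: fun_eq_iff inner_Basis if_distrib[of "\<lambda>x. x *\<^sub>R _"] cong: if_cong)

lemma smooth_conv:
  assumes f: "integrable lebesgue f" and \<phi>: "\<phi> \<in> test_functions S"
  shows "smooth (conv f \<phi>)"
proof (rule smooth_coinduct[where X="\<lambda>g. \<exists>\<phi>\<in>test_functions S. g = conv f \<phi>"])
  show "\<exists>\<psi>\<in>test_functions S. conv f \<phi> = conv f \<psi>" using \<phi> by blast
  fix g assume "\<exists>\<phi>\<in>test_functions S. g = conv f \<phi>"
  then obtain \<psi> where \<psi>: "\<psi> \<in> test_functions S" "g = conv f \<psi>" by blast
  show "(\<forall>x. g differentiable at x) \<and> (\<forall>b\<in>Basis. \<exists>\<phi>\<in>test_functions S. pd b g = conv f \<phi>)"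
  proof (intro conjI allI ballI)
    show "g differentiable at x" for x
      unfolding \<psi>(2) by (rule differentiableI[OF conv_has_derivative[OF f \<psi>(1)]])
    show "\<exists>\<phi>\<in>test_functions S. pd b g = conv f \<phi>" if "b \<in> Basis" for b
      using pd_conv[OF f \<psi>(1) that] test_pd[OF \<psi>(1) that] unfolding \<psi>(2) by (rule bexI)
  qed
qed

section \<open>Bump functions, mollifiers and cut-off functions\<close>

text \<open>
  The functions \<open>exp (- 1 / t) / t ^ j\<close>, extended by zero to \<open>t \<le> 0\<close>. The family is closed under differentiation up
  to linear combinations, so all its members are smooth.
\<close>

definition flat :: "nat \<Rightarrow> real \<Rightarrow> real" where
  "flat j t = (if 0 < t then exp (- 1 / t) / t ^ j else 0)"

text \<open>
  The quadratic bound makes the derivative at the origin vanish; it comes from \<open>exp s \<ge> (s / n) ^ n\<close> with \<open>s = 1 / t\<close>.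
\<close>

lemma flat_bound: "\<bar>flat j t\<bar> \<le> real (j + 2) ^ (j + 2) * t\<^sup>2"
proof (cases "0 < t")
  case True
  define n where "n = real (j + 2)"
  have n: "0 < n" by (simp add: n_def)
  have "(1 / (t * n)) ^ (j + 2) \<le> (1 + (1 / t) / n) ^ (j + 2)"
    using True n by (intro power_mono) (simp_all add: field_simps)
  also have "\<dots> \<le> exp (1 / t)"
    unfolding n_def using True by (intro exp_ge_one_plus_x_over_n_power_n) (auto intro: order_trans[of _ 0])
  finally have "1 / (t * n) ^ (j + 2) \<le> exp (1 / t)" by (simp only: power_one_over)
  then have "1 / exp (1 / t) \<le> (t * n) ^ (j + 2)"
    using True n by (simp only: divide_le_eq le_divide_eq exp_gt_zero zero_less_power mult_pos_pos if_True mult.commute)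
  also have "\<dots> = (n ^ (j + 2) * t\<^sup>2) * t ^ j"
    by (simp only: power_mult_distrib power_add mult_ac)
  finally have "exp (- 1 / t) / t ^ j \<le> n ^ (j + 2) * t\<^sup>2"
    using True by (simp only: divide_le_eq zero_less_power if_True exp_minus inverse_eq_divide minus_divide_left[symmetric])
  then show ?thesis using True by (simp only: flat_def if_True n_def abs_of_nonneg zero_le_divide_iff exp_ge_zero zero_le_power less_imp_le) simp
qed (simp add: flat_def)

lemma flat_deriv: "(flat j has_real_derivative (flat (j + 2) t - j * flat (j + 1) t)) (at t)"
proof -
  consider "0 < t" | "t < 0" | "t = 0" by linarith
  then show ?thesis
  proof cases
    case 1
    have "((\<lambda>t. exp (- 1 / t) / t ^ j) has_real_derivative (flat (j + 2) t - j * flat (j + 1) t)) (at t)"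
    proof -
      have e: "((\<lambda>t. exp (- 1 / t)) has_real_derivative exp (- 1 / t) / t\<^sup>2) (at t)"
        using 1 by (auto intro!: derivative_eq_intros simp: power2_eq_square)
      have p: "((\<lambda>t. t ^ j) has_real_derivative real j * t ^ (j - 1)) (at t)"
        by (auto intro!: derivative_eq_intros)
      have "real j * t ^ (j - 1) * t = real j * t ^ j" by (cases j) auto
      then have "real j * t ^ (j - 1) = real j * t ^ j / t" using 1 by (simp add: field_simps)
      moreover have "exp (- 1 / t) / t\<^sup>2 * t ^ j = exp (- 1 / t) * t ^ j / t\<^sup>2" by simp
      ultimately have "(exp (- 1 / t) / t\<^sup>2 * t ^ j - exp (- 1 / t) * (real j * t ^ (j - 1))) / (t ^ j * t ^ j)
         = flat (j + 2) t - j * flat (j + 1) t"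
        using 1 by (simp add: flat_def diff_divide_distrib power2_eq_square)
      with DERIV_divide[OF e p] 1 show ?thesis by simp
    qed
    then show ?thesis
      by (rule has_field_derivative_transform_within_open[where S="{0<..}"]) (use 1 in \<open>auto simp: flat_def\<close>)
  next
    case 2
    have "((\<lambda>t. 0) has_real_derivative (flat (j + 2) t - j * flat (j + 1) t)) (at t)"
      using 2 by (simp add: flat_def)
    then show ?thesis
      by (rule has_field_derivative_transform_within_open[where S="{..<0}"]) (use 2 in \<open>auto simp: flat_def\<close>)
  next
    case 3
    have "((\<lambda>h. (flat j h) / h) \<longlongrightarrow> 0) (at 0)"
    proof (rule Lim_null_comparison[where g="\<lambda>h. real (j + 2) ^ (j + 2) * \<bar>h\<bar>"])
      show "\<forall>\<^sub>F h in at 0. norm (flat j h / h) \<le> real (j + 2) ^ (j + 2) * \<bar>h\<bar>"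
        unfolding eventually_at_filter
      proof (intro always_eventually allI impI)
        fix h :: real assume "h \<noteq> 0"
        have "\<bar>flat j h\<bar> \<le> (real (j + 2) ^ (j + 2) * \<bar>h\<bar>) * \<bar>h\<bar>"
          using flat_bound[of j h] by (simp add: power2_eq_square mult.assoc)
        then show "norm (flat j h / h) \<le> real (j + 2) ^ (j + 2) * \<bar>h\<bar>"
          using \<open>h \<noteq> 0\<close> by (simp add: divide_le_eq)
      qed
      show "((\<lambda>h. real (j + 2) ^ (j + 2) * \<bar>h\<bar>) \<longlongrightarrow> 0) (at (0::real))"
        by (rule tendsto_eq_intros tendsto_rabs_zero tendsto_ident_at refl)+ simp
    qed
    then show ?thesis using 3 by (simp add: DERIV_def flat_def)
  qed
qed

lemma smooth_flat:
  fixes p :: "'a::euclidean_space \<Rightarrow> complex"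
  assumes p: "smooth p" and re: "\<And>x. p x = of_real (P x)"
  shows "smooth (\<lambda>x. of_real (flat j (P x)))"
proof -
  have P: "P = (\<lambda>x. Re (p x))" using re by simp
  have h: "((\<lambda>x. complex_of_real (flat j (P x))) has_derivative
      (\<lambda>v. of_real ((flat (j + 2) (P x) - j * flat (j + 1) (P x)) * (\<Sum>b\<in>Basis. (v \<bullet> b) * Re (pd b p x))))) (at x)" for x j
  proof -
    have "(P has_derivative (\<lambda>v. Re (\<Sum>b\<in>Basis. (v \<bullet> b) *\<^sub>R pd b p x))) (at x)"
      unfolding P by (intro derivative_intros smooth_has_derivative p)
    then have "((\<lambda>x. flat j (P x)) has_derivative
      (\<lambda>v. (flat (j + 2) (P x) - j * flat (j + 1) (P x)) * Re (\<Sum>b\<in>Basis. (v \<bullet> b) *\<^sub>R pd b p x))) (at x)"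
      by (rule has_derivative_compose[OF _ flat_deriv[unfolded has_field_derivative_def]])
    from has_derivative_of_real[OF this] show ?thesis by simp
  qed
  have real: "of_real (Re (pd b p x)) = pd b p x" for b x
  proof -
    have "pd b (\<lambda>x. of_real (Re (p x))) = (\<lambda>x. of_real (Re (pd b p x)))" using pd_rules(6)[OF p p] .
    moreover have "(\<lambda>x. of_real (Re (p x))) = p" using re by auto
    ultimately show ?thesis by metis
  qed
  have pd: "pd b (\<lambda>x. complex_of_real (flat j (P x))) =
      (\<lambda>x. (of_real (flat (j + 2) (P x)) + (- of_nat j) * of_real (flat (j + 1) (P x))) * pd b p x)" if b: "b \<in> Basis" for b j
  proof
    fix x
    have "(\<Sum>c\<in>Basis. (b \<bullet> c) * Re (pd c p x)) = Re (pd b p x)"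
      using b by (simp add: inner_Basis if_distrib[of "\<lambda>x. x * _"] cong: if_cong)
    then show "pd b (\<lambda>x. complex_of_real (flat j (P x))) x =
      (of_real (flat (j + 2) (P x)) + (- of_nat j) * of_real (flat (j + 1) (P x))) * pd b p x"
      using pd_eqI[OF h[of j x], of b] by (simp only: of_real_mult real of_real_diff of_real_of_nat_eq) simp
  qed
  have "Ck m (\<lambda>x. complex_of_real (flat j (P x)))" for m j
  proof (induction m arbitrary: j)
    case 0
    have "isCont (\<lambda>x. complex_of_real (flat j (P x))) x" for x
      using has_derivative_continuous[OF h[of j x]] .
    then show ?case unfolding Ck.simps(1) by (intro continuous_at_imp_continuous_on ballI)
  next
    case (Suc m)
    have "Ck m (pd b p)" if "b \<in> Basis" for b using smoothD(3)[OF p that] unfolding smooth_def by blast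
    then have "Ck m (pd b (\<lambda>x. complex_of_real (flat j (P x))))" if "b \<in> Basis" for b
      unfolding pd[OF that] using Suc that by (intro Ck_mult Ck_add Ck_const) auto
    moreover have "(\<lambda>x. complex_of_real (flat j (P x))) differentiable (at x)" for x
      using h[of j x] by (rule differentiableI)
    ultimately show ?case unfolding Ck_Suc_pd by blast
  qed
  then show ?thesis unfolding smooth_def by blast
qed

definition bump :: "real \<Rightarrow> 'a::euclidean_space \<Rightarrow> real" where
  "bump e x = flat 0 (e\<^sup>2 - (norm x)\<^sup>2)"

definition moll :: "real \<Rightarrow> 'a::euclidean_space \<Rightarrow> real" where
  "moll e x = bump e x / (LINT x|lborel. bump e (x::'a))"

lemma bump_nonneg: "0 \<le> bump e x" by (simp add: bump_def flat_def)

lemma bump_pos_iff: "0 < e \<Longrightarrow> 0 < bump e x \<longleftrightarrow> norm x < e"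
  unfolding bump_def flat_def using power_strict_mono[of "norm x" e 2] power2_less_imp_less[of "norm x" e]
  by auto

lemma bump_nz: "0 < e \<Longrightarrow> bump e x \<noteq> 0 \<Longrightarrow> norm x < e"
  using bump_pos_iff[of e x] bump_nonneg[of e x] by linarith

lemma bump_test: "0 < e \<Longrightarrow> (\<lambda>x. complex_of_real (bump e x)) \<in> test_functions UNIV"
proof (rule test_functionsI[where K="cball 0 e"])
  show "smooth (\<lambda>x. complex_of_real (bump e x))" unfolding bump_def
    by (rule smooth_flat[where p="\<lambda>x. of_real (e\<^sup>2) - of_real ((norm x)\<^sup>2)"]) (auto intro!: smooth_intros simp del: of_real_power)
  show "0 < e \<Longrightarrow> complex_of_real (bump e x) \<noteq> 0 \<Longrightarrow> x \<in> cball 0 e" for x :: 'a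
    using bump_nz[of e x] by simp
qed auto

lemma bump_integral_pos:
  assumes "0 < e" shows "0 < (LINT x|lborel. bump e (x::'a::euclidean_space))"
proof -
  have i: "integrable lborel (bump e :: 'a \<Rightarrow> real)"
    using integrable_Re[OF test_integrable(1)[OF bump_test[OF assms]]] by simp
  have "(LINT x|lborel. bump e (x::'a)) \<noteq> 0"
  proof
    assume "(LINT x|lborel. bump e (x::'a)) = 0"
    then have "AE x in lborel. bump e (x::'a) = 0"
      using integral_nonneg_eq_0_iff_AE[OF i] bump_nonneg by auto
    then have "AE x in lborel. (x::'a) \<notin> ball 0 e"
      by (rule eventually_mono) (use bump_pos_iff[OF assms] in force)
    then have "emeasure lborel (ball (0::'a) e) = 0"
      by (subst (asm) AE_iff_measurable[where N="ball 0 e"]) auto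
    then show False using emeasure_lborel_ball_finite content_ball_pos[OF assms, of "0::'a"] by (simp add: measure_def)
  qed
  moreover have "0 \<le> (LINT x|lborel. bump e (x::'a))" using bump_nonneg by (intro Bochner_Integration.integral_nonneg) auto
  ultimately show ?thesis by linarith
qed

lemma moll_nonneg: "0 < e \<Longrightarrow> 0 \<le> moll e x"
  unfolding moll_def using bump_nonneg bump_integral_pos by (metis divide_nonneg_pos)

lemma moll_nz: "0 < e \<Longrightarrow> moll e x \<noteq> 0 \<Longrightarrow> norm x < e"
  unfolding moll_def using bump_nz by auto

lemma moll_test: assumes "0 < e" shows "(\<lambda>x. complex_of_real (moll e x)) \<in> test_functions UNIV"
  using test_cmult[OF bump_test[OF assms], of "1 / of_real (LINT x|lborel. bump e (x::'a))"]
  unfolding moll_def by simp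

lemma moll_integral:
  assumes "0 < e" shows "integrable lborel (moll e :: 'a \<Rightarrow> real)" "(LINT x|lborel. moll e (x::'a::euclidean_space)) = 1"
proof -
  show "integrable lborel (moll e :: 'a \<Rightarrow> real)"
    using integrable_Re[OF test_integrable(1)[OF moll_test[OF assms]]] by simp
  show "(LINT x|lborel. moll e (x::'a)) = 1"
    unfolding moll_def using bump_integral_pos[OF assms, where 'a='a] by simp
qed

lemma moll_borel [measurable]: "0 < e \<Longrightarrow> moll e \<in> borel_measurable borel"
  using borel_measurable_continuous_onI[OF continuous_on_Re[OF test_continuous[OF moll_test]]] by simp

subsection \<open>Translations and reflections of Lebesgue measure\<close>

lemma lborel_reflect: "distr lborel borel (\<lambda>y. x - y) = (lborel :: 'a::euclidean_space measure)"
  using lborel_affine[of "-1" x] by (simp add: density_1)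

lemma lborel_shift: "distr lborel borel (\<lambda>y. y + x) = (lborel :: 'a::euclidean_space measure)"
  using lborel_affine[of "1" x] by (simp add: density_1 add.commute)

lemma integral_reflect:
  fixes f :: "'a::euclidean_space \<Rightarrow> 'b::{banach,second_countable_topology}"
  assumes [measurable]: "f \<in> borel_measurable borel"
  shows "(LINT y|lborel. f (x - y)) = (LINT y|lborel. f y)"
  by (subst (2) lborel_reflect[of x, symmetric], subst integral_distr) auto

lemma nn_integral_reflect:
  fixes f :: "'a::euclidean_space \<Rightarrow> ennreal"
  assumes [measurable]: "f \<in> borel_measurable borel"
  shows "(\<integral>\<^sup>+y. f (x - y) \<partial>lborel) = (\<integral>\<^sup>+y. f y \<partial>lborel)"
  by (subst (2) lborel_reflect[of x, symmetric], subst nn_integral_distr) auto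

lemma nn_integral_shift:
  fixes f :: "'a::euclidean_space \<Rightarrow> ennreal"
  assumes [measurable]: "f \<in> borel_measurable borel"
  shows "(\<integral>\<^sup>+y. f (y + x) \<partial>lborel) = (\<integral>\<^sup>+y. f y \<partial>lborel)"
  by (subst (2) lborel_shift[of x, symmetric], subst nn_integral_distr) auto

subsection \<open>Cut-off functions\<close>

lemma integrable_indicator_compact:
  assumes A: "compact A" shows "integrable lebesgue (indicator A :: 'a::euclidean_space \<Rightarrow> complex)"
proof -
  have "integrable lborel (indicator A :: 'a \<Rightarrow> real)"
    using emeasure_bounded_finite[OF compact_imp_bounded[OF A]] borel_compact[OF A]
    by (intro integrable_real_indicator) auto
  then have "integrable lborel (\<lambda>x. complex_of_real (indicator A x))" by (rule integrable_of_real)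
  moreover have "(\<lambda>x. complex_of_real (indicator A x)) = indicator A" by (auto simp: indicator_def)
  ultimately show ?thesis by (simp add: integrable_completion borel_measurable_integrable)
qed

text \<open>
  Mollify the indicator of a neighbourhood of \<open>K\<close> of width \<open>e\<close> at scale \<open>e\<close>.
\<close>

lemma smooth_cutoff:
  fixes K U :: "'a::euclidean_space set"
  assumes K: "compact K" and U: "open U" "K \<subseteq> U"
  obtains r :: "'a \<Rightarrow> real" where "(\<lambda>x. complex_of_real (r x)) \<in> test_functions U"
    "\<And>x. 0 \<le> r x" "\<And>x. r x \<le> 1" "\<And>x. x \<in> K \<Longrightarrow> r x = 1"
proof (cases "K = {}")
  case True
  then show ?thesis using that[of "\<lambda>x. 0"] by simp
next
  case False
  obtain e0 where e0: "0 < e0" "{x. infdist x K \<le> e0} \<subseteq> U"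
    using compact_in_open_separated[OF False K U] by metis
  define e where "e = e0 / 3"
  have e: "0 < e" using e0 by (simp add: e_def)
  define A where "A = {x. infdist x K \<le> e}"
  define L where "L = {x. infdist x K \<le> 2 * e}"
  have A: "compact A" and L: "compact L" "L \<subseteq> U"
  proof -
    show "compact A" "compact L" unfolding A_def L_def using e by (intro compact_infdist_le[OF False K]; simp)+
    have "2 * e \<le> e0" using e0 by (simp add: e_def)
    then show "L \<subseteq> U" unfolding L_def using e0(2) by auto
  qed
  have Am: "A \<in> sets lborel" using A by (simp add: borel_closed compact_imp_closed)
  have Ai: "integrable lebesgue (indicator A :: 'a \<Rightarrow> complex)"
    using A by (rule integrable_indicator_compact)
  define r where "r x = (LINT y|lborel. indicator A y * moll e (x - y))" for x
  have ri: "integrable lborel (\<lambda>y. indicator A y * moll e (x - y))" "integrable lborel (\<lambda>y. moll e (x - y))"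
      "(LINT y|lborel. moll e (x - y)) = 1" for x :: 'a
  proof -
    have [measurable]: "moll e \<in> borel_measurable borel" using e by simp
    have "integrable (distr lborel borel (\<lambda>y. x - y)) (moll e)" unfolding lborel_reflect using moll_integral e by auto
    then show i: "integrable lborel (\<lambda>y. moll e (x - y))" by (subst (asm) integrable_distr_eq) auto
    show "(LINT y|lborel. moll e (x - y)) = 1" using integral_reflect[of "moll e" x] moll_integral[OF e] by simp
    show "integrable lborel (\<lambda>y. indicator A y * moll e (x - y))"
      using integrable_mult_indicator[OF Am i] by simp
  qed
  have conv: "conv (indicator A) (\<lambda>x. complex_of_real (moll e x)) x = of_real (r x)" for x
  proof -
    have "conv (indicator A) (\<lambda>x. complex_of_real (moll e x)) x = (LINT y|lborel. complex_of_real (indicator A y * moll e (x - y)))"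
      unfolding conv_def using Am e
      by (subst integral_completion) (auto simp: indicator_def intro!: Bochner_Integration.integral_cong)
    then show ?thesis by (simp only: integral_complex_of_real r_def)
  qed
  have r0: "0 \<le> r x" for x unfolding r_def
    by (intro Bochner_Integration.integral_nonneg mult_nonneg_nonneg moll_nonneg[OF e] indicator_pos_le)
  show ?thesis
  proof (rule that[of r])
    show "r x \<le> 1" for x
      unfolding ri(3)[of x, symmetric] r_def using moll_nonneg[OF e]
      by (intro integral_mono ri) (auto simp: indicator_def)
    show "r x = 1" if "x \<in> K" for x
      unfolding ri(3)[of x, symmetric] r_def
    proof (intro Bochner_Integration.integral_cong refl)
      fix y
      show "indicator A y * moll e (x - y) = moll e (x - y)"
      proof (cases "moll e (x - y) = 0")
        case False
        then have "dist y x \<le> e" using moll_nz[OF e] by (force simp: dist_norm norm_minus_commute)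
        then have "y \<in> A" unfolding A_def using infdist_le2[OF that] by auto
        then show ?thesis by simp
      qed simp
    qed
    show "(\<lambda>x. complex_of_real (r x)) \<in> test_functions U"
    proof (rule test_functionsI[OF _ L])
      show "smooth (\<lambda>x. complex_of_real (r x))"
        using smooth_conv[OF Ai moll_test[OF e]] unfolding conv .
      fix x assume "complex_of_real (r x) \<noteq> 0"
      then have "\<exists>y. indicator A y * moll e (x - y) \<noteq> 0"
      proof (rule contrapos_np)
        assume "\<nexists>y. indicator A y * moll e (x - y) \<noteq> 0"
        then have "(\<lambda>y. indicator A y * moll e (x - y)) = (\<lambda>y. 0)" by blast
        then show "complex_of_real (r x) = 0" unfolding r_def by simp
      qed
      then obtain y where y: "y \<in> A" "norm (x - y) < e" using moll_nz[OF e] by (auto simp: indicator_def split: if_splits)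
      then have "infdist x K \<le> infdist y K + dist x y" using infdist_triangle by blast
      then show "x \<in> L" using y by (simp add: A_def L_def dist_norm)
    qed
  qed (rule r0)
qed

subsection \<open>Integration by parts\<close>

text \<open>
  Near the origin the convolution of \<open>\<phi>\<close> with the indicator of a large ball is the constant \<open>LINT x|lborel. \<phi> x\<close>; its derivative
  there is the integral of the derivative of \<open>\<phi>\<close>.
\<close>

lemma integral_pd:
  assumes \<phi>: "\<phi> \<in> test_functions S" and b: "b \<in> Basis"
  shows "(LINT x|lborel. pd b \<phi> x) = 0"
proof -
  obtain K where K: "compact K" "\<And>x. \<phi> x \<noteq> 0 \<Longrightarrow> x \<in> K" "\<And>x b. pd b \<phi> x \<noteq> 0 \<Longrightarrow> x \<in> K"
    using test_support[OF \<phi>] by metis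
  obtain r where r: "0 < r" "\<And>x. x \<in> K \<Longrightarrow> norm x \<le> r" using compact_imp_bounded[OF K(1)] bounded_pos by metis
  define f where "f = (indicator (cball 0 (r + 1)) :: 'a \<Rightarrow> complex)"
  have f: "integrable lebesgue f" unfolding f_def
    by (rule integrable_indicator_compact) simp
  have c: "conv f \<psi> x = (LINT y|lborel. \<psi> y)" if \<psi>: "\<psi> \<in> test_functions S" "\<And>x. \<psi> x \<noteq> 0 \<Longrightarrow> x \<in> K" and x: "norm x \<le> 1" for \<psi> x
  proof -
    have *: "f y * \<psi> (x - y) = \<psi> (x - y)" for y
    proof (cases "\<psi> (x - y) = 0")
      case False
      then have "norm (x - y) \<le> r" using \<psi> r by auto
      then have "norm y \<le> r + 1" using x norm_triangle_ineq2[of y x] by (simp add: norm_minus_commute)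
      then show ?thesis by (simp add: f_def)
    qed simp
    then have "conv f \<psi> x = (LINT y|lebesgue. \<psi> (x - y))" by (simp only: conv_def *)
    also have "\<dots> = (LINT y|lborel. \<psi> (x - y))"
    proof (rule integral_completion)
      have [measurable]: "\<psi> \<in> borel_measurable borel" using \<psi>(1) by (rule test_borel)
      show "(\<lambda>y. \<psi> (x - y)) \<in> borel_measurable lborel" by measurable
    qed
    finally show ?thesis using integral_reflect[OF test_borel[OF \<psi>(1)]] by simp
  qed
  have "(conv f \<phi> has_derivative (\<lambda>v. 0)) (at 0)"
  proof (rule has_derivative_transform_within_open[where f="\<lambda>x. LINT y|lborel. \<phi> y" and s="ball 0 1"])
    show "x \<in> ball 0 1 \<Longrightarrow> (LINT y|lborel. \<phi> y) = conv f \<phi> x" for x using c[OF \<phi> K(2), of x] by simp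
  qed auto
  then have "pd b (conv f \<phi>) 0 = 0" by (rule pd_eqI)
  moreover have "pd b (conv f \<phi>) 0 = (LINT y|lborel. pd b \<phi> y)"
    unfolding pd_conv[OF f \<phi> b]
  proof (rule c)
    show "\<And>x. pd b \<phi> x \<noteq> 0 \<Longrightarrow> x \<in> K" by (rule K(3))
  qed (use test_pd[OF \<phi> b] in auto)
  ultimately show ?thesis by simp
qed

lemma integration_by_parts:
  assumes \<phi>: "\<phi> \<in> test_functions S" and f: "smooth f" and b: "b \<in> Basis"
  shows "(LINT x|lborel. pd b f x * \<phi> x) = - (LINT x|lborel. f x * pd b \<phi> x)"
proof -
  have "(LINT x|lborel. pd b (\<lambda>x. f x * \<phi> x) x) = 0"
    using integral_pd[OF test_mult(2)[OF \<phi> f] b] .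
  moreover have "integrable lborel (\<lambda>x. pd b f x * \<phi> x)" "integrable lborel (\<lambda>x. f x * pd b \<phi> x)"
    using test_integrable(1)[OF test_mult(2)[OF \<phi> smoothD(3)[OF f b]]]
      test_integrable(1)[OF test_mult(2)[OF test_pd[OF \<phi> b] f]] by auto
  ultimately have "(LINT x|lborel. pd b f x * \<phi> x) + (LINT x|lborel. f x * pd b \<phi> x) = 0"
    unfolding pd_rules(3)[OF f test_smooth[OF \<phi>]] by simp
  then show ?thesis by (rule eq_neg_iff_add_eq_0[THEN iffD2])
qed

subsection \<open>Symmetry of second derivatives\<close>

text \<open>
  Both mixed derivatives are limits of the same symmetric second difference quotient.
\<close>

lemma pd_commute:
  fixes f :: "'a::euclidean_space \<Rightarrow> complex"
  assumes f: "f \<in> test_functions S" and a: "a \<in> Basis" and b: "b \<in> Basis"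
  shows "pd a (pd b f) x = pd b (pd a f) x"
proof -
  let ?d = "real DIM('a)"
  have "\<exists>C. \<forall>x. cmod (pd e (pd d (pd c f)) x) \<le> C" if "c \<in> Basis" "d \<in> Basis" "e \<in> Basis" for c d e
    using test_bounded[OF test_pd[OF test_pd[OF test_pd[OF f]]]] that by metis
  then obtain C where C: "\<And>c d e x. c \<in> Basis \<Longrightarrow> d \<in> Basis \<Longrightarrow> e \<in> Basis \<Longrightarrow> cmod (pd e (pd d (pd c f)) x) \<le> C c d e" by metis
  define M where "M = (\<Sum>(c,d,e)\<in>Basis\<times>Basis\<times>Basis. \<bar>C c d e\<bar>)"
  have M: "cmod (pd e (pd d (pd c f)) x) \<le> M" if "c \<in> Basis" "d \<in> Basis" "e \<in> Basis" for c d e x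
  proof -
    have "\<bar>C c d e\<bar> \<le> M" unfolding M_def
      using member_le_sum[of "(c,d,e)" "Basis \<times> Basis \<times> Basis" "\<lambda>(c,d,e). \<bar>C c d e\<bar>"] that by auto
    then show ?thesis using C[OF that, of x] by linarith
  qed
  have sf: "smooth f" using f test_smooth by blast
  define D where "D h = f (x + h *\<^sub>R a + h *\<^sub>R b) - f (x + h *\<^sub>R a) - f (x + h *\<^sub>R b) + f x" for h :: real
  define K where "K = ?d * (?d * M) + ?d * (?d * (?d * M))"
  have main: "cmod (D h - h\<^sup>2 *\<^sub>R pd q (pd p f) x) \<le> K * h ^ 3"
    if h: "h > 0" and p: "p \<in> Basis" and q: "q \<in> Basis"
      and D: "D h = f (x + h *\<^sub>R p + h *\<^sub>R q) - f (x + h *\<^sub>R p) - f (x + h *\<^sub>R q) + f x" for h p q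
  proof -
    define G where "G = (\<lambda>y. f (y + h *\<^sub>R q) - f y)"
    have sG: "smooth G" unfolding G_def by (intro smooth_diff smooth_shift sf)
    have pdG: "pd c G = (\<lambda>y. pd c f (y + h *\<^sub>R q) - pd c f y)" for c
      unfolding G_def using sf by (simp add: pd_rules smooth_shift)
    have "pd d (pd c G) = (\<lambda>y. pd d (pd c f) (y + h *\<^sub>R q) - pd d (pd c f) y)" if "c \<in> Basis" for c d
      unfolding pdG using smoothD(3)[OF sf that] by (simp add: pd_rules smooth_shift)
    then have "cmod (pd d (pd c G) y) \<le> ?d * M * h" if "c \<in> Basis" "d \<in> Basis" for c d y
      using smooth_lipschitz[of "pd d (pd c f)" M "y + h *\<^sub>R q" y] that M sf h q by (simp add: smoothD(3))
    then have "cmod (G (x + h *\<^sub>R p) - G x - (\<Sum>c\<in>Basis. ((h *\<^sub>R p) \<bullet> c) *\<^sub>R pd c G x)) \<le> (?d * (?d * (?d * M * h))) * norm (h *\<^sub>R p) * norm (h *\<^sub>R p)"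
      by (intro smooth_second_order sG)
    moreover have "(\<Sum>c\<in>Basis. ((h *\<^sub>R p) \<bullet> c) *\<^sub>R pd c G x) = h *\<^sub>R pd p G x"
      using p by (simp add: inner_Basis if_distrib[of "\<lambda>x. x *\<^sub>R _"] if_distrib[of "\<lambda>x. _ * x"] cong: if_cong)
    ultimately have 1: "cmod (G (x + h *\<^sub>R p) - G x - h *\<^sub>R pd p G x) \<le> (?d * (?d * (?d * M))) * h ^ 3"
      using p h by (simp add: power3_eq_cube mult_ac)
    have "cmod (pd p f (x + h *\<^sub>R q) - pd p f x - (\<Sum>c\<in>Basis. ((h *\<^sub>R q) \<bullet> c) *\<^sub>R pd c (pd p f) x)) \<le> (?d * (?d * M)) * norm (h *\<^sub>R q) * norm (h *\<^sub>R q)"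
      using M p by (intro smooth_second_order smoothD(3) sf)
    moreover have "(\<Sum>c\<in>Basis. ((h *\<^sub>R q) \<bullet> c) *\<^sub>R pd c (pd p f) x) = h *\<^sub>R pd q (pd p f) x"
      using q by (simp add: inner_Basis if_distrib[of "\<lambda>x. x *\<^sub>R _"] if_distrib[of "\<lambda>x. _ * x"] cong: if_cong)
    ultimately have "cmod (pd p G x - h *\<^sub>R pd q (pd p f) x) \<le> (?d * (?d * M)) * h\<^sup>2"
      using q h by (simp add: power2_eq_square mult_ac pdG)
    then have "h * cmod (pd p G x - h *\<^sub>R pd q (pd p f) x) \<le> h * ((?d * (?d * M)) * h\<^sup>2)" using h by (intro mult_left_mono) auto
    then have 2: "cmod (h *\<^sub>R pd p G x - h\<^sup>2 *\<^sub>R pd q (pd p f) x) \<le> (?d * (?d * M)) * h ^ 3"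
    proof -
      have "h *\<^sub>R pd p G x - h\<^sup>2 *\<^sub>R pd q (pd p f) x = h *\<^sub>R (pd p G x - h *\<^sub>R pd q (pd p f) x)"
        by (simp add: scaleR_diff_right power2_eq_square)
      then show ?thesis using \<open>h * cmod _ \<le> _\<close> h by (simp add: power2_eq_square power3_eq_cube mult_ac)
    qed
    have "D h = G (x + h *\<^sub>R p) - G x" unfolding D G_def by (simp add: add_ac)
    then have e: "D h - h\<^sup>2 *\<^sub>R pd q (pd p f) x = (G (x + h *\<^sub>R p) - G x - h *\<^sub>R pd p G x) + (h *\<^sub>R pd p G x - h\<^sup>2 *\<^sub>R pd q (pd p f) x)" by simp
    show ?thesis unfolding e using norm_triangle_mono[OF 1 2] by (simp only: K_def distrib_right add.commute)
  qed
  have "norm (pd a (pd b f) x - pd b (pd a f) x) \<le> 2 * K * h" if "h > 0" for h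
  proof -
    have "cmod (D h - h\<^sup>2 *\<^sub>R pd b (pd a f) x) \<le> K * h ^ 3" by (rule main[OF that a b]) (simp add: D_def)
    moreover have "cmod (D h - h\<^sup>2 *\<^sub>R pd a (pd b f) x) \<le> K * h ^ 3" by (rule main[OF that b a]) (simp add: D_def add_ac)
    moreover have "h\<^sup>2 *\<^sub>R (pd a (pd b f) x - pd b (pd a f) x) = (D h - h\<^sup>2 *\<^sub>R pd b (pd a f) x) - (D h - h\<^sup>2 *\<^sub>R pd a (pd b f) x)"
      by (simp add: scaleR_diff_right)
    ultimately have "cmod (h\<^sup>2 *\<^sub>R (pd a (pd b f) x - pd b (pd a f) x)) \<le> 2 * (K * h ^ 3)"
      using norm_triangle_ineq4 by (smt (verit))
    then have "h\<^sup>2 * cmod (pd a (pd b f) x - pd b (pd a f) x) \<le> h\<^sup>2 * (2 * K * h)"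
      by (simp add: power2_eq_square power3_eq_cube mult_ac)
    then show ?thesis using that by simp
  qed
  then have le: "norm (pd a (pd b f) x - pd b (pd a f) x) \<le> 2 * K * h" if "h > 0" for h using that by blast
  have K0: "0 \<le> K" using le[of 1] norm_ge_zero[of "pd a (pd b f) x - pd b (pd a f) x"] by linarith
  have "norm (pd a (pd b f) x - pd b (pd a f) x) \<le> e" if "e > 0" for e
  proof -
    have "2 * K * (e / (2 * K + 1)) \<le> e" using that K0 by (simp add: divide_le_eq field_simps)
    moreover have "0 < e / (2 * K + 1)" using that K0 by (intro divide_pos_pos) auto
    ultimately show ?thesis using le order_trans by blast
  qed
  then have "norm (pd a (pd b f) x - pd b (pd a f) x) \<le> 0" by (rule field_le_epsilon[where y=0, simplified])
  then show ?thesis by simp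
qed

section \<open>Spaces of functions with a semi-inner product\<close>

locale semi_inner =
  fixes V :: "('a \<Rightarrow> complex) set" and ip :: "('a \<Rightarrow> complex) \<Rightarrow> ('a \<Rightarrow> complex) \<Rightarrow> complex"
  assumes zero: "(\<lambda>x. 0) \<in> V"
    and lin: "u \<in> V \<Longrightarrow> v \<in> V \<Longrightarrow> (\<lambda>x. u x + c * v x) \<in> V"
    and ip_lin: "u \<in> V \<Longrightarrow> v \<in> V \<Longrightarrow> w \<in> V \<Longrightarrow> ip (\<lambda>x. u x + c * v x) w = ip u w + c * ip v w"
    and ip_cnj: "u \<in> V \<Longrightarrow> v \<in> V \<Longrightarrow> ip v u = cnj (ip u v)"
    and ip_nonneg: "u \<in> V \<Longrightarrow> 0 \<le> Re (ip u u)"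
begin

definition nrm :: "('a \<Rightarrow> complex) \<Rightarrow> real" where "nrm u = sqrt (Re (ip u u))"

lemma add: "u \<in> V \<Longrightarrow> v \<in> V \<Longrightarrow> (\<lambda>x. u x + v x) \<in> V" using lin[of u v 1] by simp
lemma diff: "u \<in> V \<Longrightarrow> v \<in> V \<Longrightarrow> (\<lambda>x. u x - v x) \<in> V" using lin[of u v "-1"] by simp
lemma cmult: "v \<in> V \<Longrightarrow> (\<lambda>x. c * v x) \<in> V" using lin[OF zero, of v c] by simp

lemma ip_lin2:
  assumes "u \<in> V" "v \<in> V" "w \<in> V"
  shows "ip w (\<lambda>x. u x + c * v x) = ip w u + cnj c * ip w v"
  using ip_cnj[OF lin[OF assms(1,2), of c] assms(3)] ip_lin[OF assms, of c] ip_cnj[OF assms(1,3)] ip_cnj[OF assms(2,3)]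
  by simp

lemma ip_real: "u \<in> V \<Longrightarrow> ip u u = of_real ((nrm u)\<^sup>2)"
  using ip_cnj[of u u] ip_nonneg[of u] by (simp add: nrm_def complex_eq_iff)

lemma nrm_nonneg: "u \<in> V \<Longrightarrow> 0 \<le> nrm u" using ip_nonneg by (simp add: nrm_def)

lemma nrm_expand:
  assumes "u \<in> V" "v \<in> V"
  shows "(nrm (\<lambda>x. u x + c * v x))\<^sup>2 = (nrm u)\<^sup>2 + 2 * Re (cnj c * ip u v) + (cmod c)\<^sup>2 * (nrm v)\<^sup>2"
proof -
  have uv: "(\<lambda>x. u x + c * v x) \<in> V" using lin assms by blast
  have "of_real ((nrm (\<lambda>x. u x + c * v x))\<^sup>2) = ip u u + cnj c * ip u v + (c * ip v u + c * (cnj c * ip v v))"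
    unfolding ip_real[OF uv, symmetric] ip_lin[OF assms uv] ip_lin2[OF assms assms(1)] ip_lin2[OF assms assms(2)]
    by (simp add: algebra_simps)
  also have "\<dots> = of_real ((nrm u)\<^sup>2) + (cnj c * ip u v + cnj (cnj c * ip u v)) + (c * cnj c) * of_real ((nrm v)\<^sup>2)"
    unfolding ip_real[OF assms(1)] ip_real[OF assms(2)] ip_cnj[OF assms] by (simp add: algebra_simps)
  also have "\<dots> = of_real ((nrm u)\<^sup>2 + 2 * Re (cnj c * ip u v) + (cmod c)\<^sup>2 * (nrm v)\<^sup>2)"
    unfolding complex_add_cnj complex_norm_square[symmetric] by simp
  finally show ?thesis using of_real_eq_iff by blast
qed

lemma cauchy_schwarz:
  assumes "u \<in> V" "v \<in> V" shows "cmod (ip u v) \<le> nrm u * nrm v"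
proof -
  define z where "z = ip u v"
  have key: "0 \<le> (nrm u)\<^sup>2 - 2 * t * (cmod z)\<^sup>2 + t\<^sup>2 * (cmod z)\<^sup>2 * (nrm v)\<^sup>2" for t :: real
  proof -
    have "0 \<le> (nrm (\<lambda>x. u x + (- of_real t * z) * v x))\<^sup>2" by simp
    also have "\<dots> = (nrm u)\<^sup>2 + 2 * Re (- of_real t * (cnj z * z)) + (t\<^sup>2 * (cmod z)\<^sup>2) * (nrm v)\<^sup>2"
      unfolding nrm_expand[OF assms] z_def by (simp add: norm_mult power_mult_distrib algebra_simps)
    also have "cnj z * z = of_real ((cmod z)\<^sup>2)" by (metis complex_norm_square mult.commute)
    finally show ?thesis by simp
  qed
  have "(cmod z)\<^sup>2 \<le> (nrm u * nrm v)\<^sup>2"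
  proof (cases "nrm v = 0")
    case True
    have "(cmod z)\<^sup>2 \<le> 0"
    proof (rule ccontr)
      assume "\<not> (cmod z)\<^sup>2 \<le> 0"
      then have p: "0 < (cmod z)\<^sup>2" by linarith
      have "0 \<le> (nrm u)\<^sup>2 - 2 * (((nrm u)\<^sup>2 + 1) / (cmod z)\<^sup>2) * (cmod z)\<^sup>2"
        using key[of "((nrm u)\<^sup>2 + 1) / (cmod z)\<^sup>2"] True by simp
      also have "\<dots> = - (nrm u)\<^sup>2 - 2" using p by simp
      finally show False using zero_le_power2[of "nrm u"] by linarith
    qed
    then show ?thesis by (rule order_trans) simp
  next
    case False
    then have p: "0 < (nrm v)\<^sup>2" by simp
    have "0 \<le> (nrm u)\<^sup>2 - (cmod z)\<^sup>2 / (nrm v)\<^sup>2"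
    proof -
      have "(1 / B)\<^sup>2 * c * B = c / B" "2 * (1 / B) * c = 2 * (c / B)" if "B > 0" for B c :: real
        using that by (auto simp: power2_eq_square)
      then show ?thesis using key[of "1 / (nrm v)\<^sup>2"] p by simp
    qed
    then show ?thesis using p by (simp add: power_mult_distrib divide_le_eq)
  qed
  then show ?thesis unfolding z_def
    using nrm_nonneg assms by (meson abs_le_square_iff mult_nonneg_nonneg power2_le_imp_le)
qed

lemma nrm_triangle:
  assumes "u \<in> V" "v \<in> V" shows "nrm (\<lambda>x. u x + v x) \<le> nrm u + nrm v"
proof (rule power2_le_imp_le)
  have "(nrm (\<lambda>x. u x + v x))\<^sup>2 = (nrm u)\<^sup>2 + 2 * Re (ip u v) + (nrm v)\<^sup>2"
    using nrm_expand[OF assms, of 1] by simp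
  also have "\<dots> \<le> (nrm u)\<^sup>2 + 2 * (nrm u * nrm v) + (nrm v)\<^sup>2"
    using cauchy_schwarz[OF assms] complex_Re_le_cmod[of "ip u v"] by linarith
  finally show "(nrm (\<lambda>x. u x + v x))\<^sup>2 \<le> (nrm u + nrm v)\<^sup>2" by (simp add: power2_sum)
qed (use nrm_nonneg assms in auto)

lemma nrm_cmult: assumes "u \<in> V" shows "nrm (\<lambda>x. c * u x) = cmod c * nrm u"
proof (rule power2_eq_imp_eq)
  have "ip (\<lambda>x. 0) u = 0" using ip_lin[OF zero zero assms, of 1] by simp
  moreover have "nrm (\<lambda>x. 0) = 0" using ip_lin[OF zero zero zero, of 1] by (simp add: nrm_def)
  ultimately show "(nrm (\<lambda>x. c * u x))\<^sup>2 = (cmod c * nrm u)\<^sup>2"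
    using nrm_expand[OF zero assms, of c] by (simp add: power_mult_distrib)
qed (use nrm_nonneg assms cmult in auto)

lemma nrm_diff_commute: "u \<in> V \<Longrightarrow> v \<in> V \<Longrightarrow> nrm (\<lambda>x. u x - v x) = nrm (\<lambda>x. v x - u x)"
  using nrm_cmult[OF diff, of u v "-1"] by simp

lemma nrm_triangle_diff:
  assumes "u \<in> V" "v \<in> V" "w \<in> V"
  shows "nrm (\<lambda>x. u x - w x) \<le> nrm (\<lambda>x. u x - v x) + nrm (\<lambda>x. v x - w x)"
  using nrm_triangle[OF diff[OF assms(1,2)] diff[OF assms(2,3)]] by simp

end

section \<open>Square integrable functions\<close>

definition sqint :: "'a measure \<Rightarrow> ('a \<Rightarrow> complex) set" where
  "sqint M = {f. f \<in> borel_measurable M \<and> integrable M (\<lambda>x. (cmod (f x))\<^sup>2)}"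

definition l2 :: "'a measure \<Rightarrow> ('a \<Rightarrow> complex) \<Rightarrow> real" where
  "l2 M f = sqrt (LINT x|M. (cmod (f x))\<^sup>2)"

definition l2ip :: "'a measure \<Rightarrow> ('a \<Rightarrow> complex) \<Rightarrow> ('a \<Rightarrow> complex) \<Rightarrow> complex" where
  "l2ip M f g = (LINT x|M. f x * cnj (g x))"

lemma L2_sqint: "L2 S = sqint (lebesgue_on S)" by (auto simp: L2_def sqint_def)
lemma L2_norm_l2: "L2_norm S = l2 (lebesgue_on S)" by (auto simp: L2_norm_def l2_def)

lemma sqint_meas [measurable_dest]: "f \<in> sqint M \<Longrightarrow> f \<in> borel_measurable M" by (simp add: sqint_def)
lemma sqint_int: "f \<in> sqint M \<Longrightarrow> integrable M (\<lambda>x. (cmod (f x))\<^sup>2)" by (simp add: sqint_def)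

lemma borel_measurable_cnj [measurable (raw)]:
  "f \<in> borel_measurable M \<Longrightarrow> (\<lambda>x. cnj (f x)) \<in> borel_measurable M"
  by (rule measurable_compose[OF _ borel_measurable_continuous_onI[OF continuous_on_cnj[OF continuous_on_id]]])

lemma sqint_mult_abs:
  assumes "f \<in> sqint M" "g \<in> sqint M" shows "integrable M (\<lambda>x. cmod (f x) * cmod (g x))"
proof (rule Bochner_Integration.integrable_bound)
  show "integrable M (\<lambda>x. (cmod (f x))\<^sup>2 + (cmod (g x))\<^sup>2)"
    by (intro Bochner_Integration.integrable_add sqint_int assms)
  show "(\<lambda>x. cmod (f x) * cmod (g x)) \<in> borel_measurable M" using assms by measurable
  show "AE x in M. norm (cmod (f x) * cmod (g x)) \<le> norm ((cmod (f x))\<^sup>2 + (cmod (g x))\<^sup>2)"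
  proof (rule AE_I2)
    fix x
    have "2 * (cmod (f x) * cmod (g x)) \<le> (cmod (f x))\<^sup>2 + (cmod (g x))\<^sup>2"
      using sum_squares_bound[of "cmod (f x)" "cmod (g x)"] by simp
    moreover have "0 \<le> cmod (f x) * cmod (g x)" by simp
    ultimately have "cmod (f x) * cmod (g x) \<le> (cmod (f x))\<^sup>2 + (cmod (g x))\<^sup>2" by linarith
    then show "norm (cmod (f x) * cmod (g x)) \<le> norm ((cmod (f x))\<^sup>2 + (cmod (g x))\<^sup>2)" by (simp add: abs_mult)
  qed
qed

lemma sqint_mult:
  assumes "f \<in> sqint M" "g \<in> sqint M" shows "integrable M (\<lambda>x. f x * g x)" "integrable M (\<lambda>x. f x * cnj (g x))"
proof -
  show "integrable M (\<lambda>x. f x * g x)" "integrable M (\<lambda>x. f x * cnj (g x))"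
    by (rule Bochner_Integration.integrable_bound[OF sqint_mult_abs[OF assms]];
        use assms in \<open>measurable\<close>; simp add: norm_mult)+
qed

lemma sqint_lin:
  assumes "f \<in> sqint M" "g \<in> sqint M" shows "(\<lambda>x. f x + c * g x) \<in> sqint M"
proof -
  have "integrable M (\<lambda>x. (cmod (f x + c * g x))\<^sup>2)"
  proof (rule Bochner_Integration.integrable_bound)
    show "integrable M (\<lambda>x. 2 * (cmod (f x))\<^sup>2 + 2 * (cmod c)\<^sup>2 * (cmod (g x))\<^sup>2)"
      by (intro Bochner_Integration.integrable_add integrable_mult_right sqint_int assms)
    show "(\<lambda>x. (cmod (f x + c * g x))\<^sup>2) \<in> borel_measurable M" using assms by measurable
    show "AE x in M. norm ((cmod (f x + c * g x))\<^sup>2) \<le> norm (2 * (cmod (f x))\<^sup>2 + 2 * (cmod c)\<^sup>2 * (cmod (g x))\<^sup>2)"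
    proof (rule AE_I2)
      fix x
      have "(cmod (f x + c * g x))\<^sup>2 \<le> (cmod (f x) + cmod (c * g x))\<^sup>2" by (intro power_mono norm_triangle_ineq) auto
      also have "\<dots> \<le> 2 * (cmod (f x))\<^sup>2 + 2 * (cmod (c * g x))\<^sup>2"
        using sum_squares_bound[of "cmod (f x)" "cmod (c * g x)"] by (simp add: power2_sum)
      finally show "norm ((cmod (f x + c * g x))\<^sup>2) \<le> norm (2 * (cmod (f x))\<^sup>2 + 2 * (cmod c)\<^sup>2 * (cmod (g x))\<^sup>2)"
        by (simp add: norm_mult power_mult_distrib)
    qed
  qed
  then show ?thesis using assms unfolding sqint_def by auto
qed

lemma sqint_zero [simp]: "(\<lambda>x. 0) \<in> sqint M" by (simp add: sqint_def)

interpretation L2m: semi_inner "sqint M" "l2ip M"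
  rewrites "semi_inner.nrm (l2ip M) = l2 M"
proof -
  show s: "semi_inner (sqint M) (l2ip M)"
  proof
    fix u v w :: "'a \<Rightarrow> complex" and c assume u: "u \<in> sqint M" and v: "v \<in> sqint M"
    show "(\<lambda>x. u x + c * v x) \<in> sqint M" using u v by (rule sqint_lin)
    have "cnj (l2ip M u v) = (LINT x|M. cnj (u x * cnj (v x)))" unfolding l2ip_def by (rule Bochner_Integration.integral_cnj[symmetric])
    also have "\<dots> = l2ip M v u" unfolding l2ip_def
      by (rule Bochner_Integration.integral_cong) (simp_all add: mult.commute)
    finally show "l2ip M v u = cnj (l2ip M u v)" by (rule sym)
    show "0 \<le> Re (l2ip M u u)" unfolding l2ip_def
      using sqint_mult(2)[OF u u] by (subst integral_Re[symmetric]) (auto intro!: Bochner_Integration.integral_nonneg)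
    assume w: "w \<in> sqint M"
    show "l2ip M (\<lambda>x. u x + c * v x) w = l2ip M u w + c * l2ip M v w"
      unfolding l2ip_def using sqint_mult(2)[OF u w] sqint_mult(2)[OF v w] by (simp add: algebra_simps)
  qed simp
  have "Re (l2ip M f f) = (LINT x|M. (cmod (f x))\<^sup>2)" for f
    unfolding l2ip_def complex_norm_square[symmetric] integral_complex_of_real by simp
  then show "semi_inner.nrm (l2ip M) = l2 M"
    unfolding semi_inner.nrm_def[OF s] l2_def by (auto simp: fun_eq_iff)
qed

lemma l2_sq: "(l2 M f)\<^sup>2 = (LINT x|M. (cmod (f x))\<^sup>2)" unfolding l2_def by (simp add: Bochner_Integration.integral_nonneg)
lemma l2_nonneg [simp]: "0 \<le> l2 M f" unfolding l2_def by (simp add: Bochner_Integration.integral_nonneg)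

lemma sqint_cnj: "f \<in> sqint M \<Longrightarrow> (\<lambda>x. cnj (f x)) \<in> sqint M" unfolding sqint_def by auto
lemma l2_cnj: "l2 M (\<lambda>x. cnj (f x)) = l2 M f" unfolding l2_def by simp

lemma l2_cs:
  assumes "f \<in> sqint M" "g \<in> sqint M"
  shows "cmod (LINT x|M. f x * g x) \<le> l2 M f * l2 M g"
  using L2m.cauchy_schwarz[OF assms(1) sqint_cnj[OF assms(2)]] by (simp add: l2ip_def l2_cnj)

lemma sqint_bound:
  assumes "f \<in> sqint M" "g \<in> borel_measurable M" "AE x in M. cmod (g x) \<le> C * cmod (f x)"
  shows "g \<in> sqint M" "0 \<le> C \<Longrightarrow> l2 M g \<le> C * l2 M f"
proof -
  have le: "AE x in M. (cmod (g x))\<^sup>2 \<le> C\<^sup>2 * (cmod (f x))\<^sup>2"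
    using assms(3) by eventually_elim (metis norm_ge_zero power_mono power_mult_distrib)
  have i: "integrable M (\<lambda>x. C\<^sup>2 * (cmod (f x))\<^sup>2)" using sqint_int[OF assms(1)] by auto
  have ig: "integrable M (\<lambda>x. (cmod (g x))\<^sup>2)"
    by (rule Bochner_Integration.integrable_bound[OF i]) (use assms le in auto)
  then show "g \<in> sqint M" unfolding sqint_def using assms(2) by auto
  show "l2 M g \<le> C * l2 M f" if "0 \<le> C"
  proof (rule power2_le_imp_le)
    show "(l2 M g)\<^sup>2 \<le> (C * l2 M f)\<^sup>2" unfolding power_mult_distrib l2_sq
      using integral_mono_AE[OF ig i le] by simp
  qed (use that in auto)
qed

lemma l2_cs_abs:
  assumes "f \<in> sqint M" "g \<in> sqint M"
  shows "(LINT x|M. cmod (f x) * cmod (g x)) \<le> l2 M f * l2 M g"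
proof -
  have a: "(\<lambda>x. complex_of_real (cmod (h x))) \<in> sqint M" if "h \<in> sqint M" for h
    by (rule sqint_bound(1)[OF that, where C=1]) (use that in auto)
  have "(LINT x|M. complex_of_real (cmod (f x)) * complex_of_real (cmod (g x))) = of_real (LINT x|M. cmod (f x) * cmod (g x))"
    unfolding of_real_mult[symmetric] integral_complex_of_real ..
  then have "\<bar>LINT x|M. cmod (f x) * cmod (g x)\<bar> \<le> l2 M f * l2 M g"
    using l2_cs[OF a[OF assms(1)] a[OF assms(2)]] by (simp add: l2_def)
  then show ?thesis by linarith
qed

lemma sqint_cong_AE:
  assumes "AE x in M. f x = g x" "f \<in> sqint M" "g \<in> borel_measurable M"
  shows "g \<in> sqint M"
  by (rule sqint_bound(1)[OF assms(2,3), where C=1]) (use assms in auto)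

lemma l2_zero_iff:
  assumes "f \<in> sqint M" shows "l2 M f = 0 \<longleftrightarrow> (AE x in M. f x = 0)"
  unfolding l2_def using integral_nonneg_eq_0_iff_AE[OF sqint_int[OF assms]] by simp

lemma nn_l2: "f \<in> sqint M \<Longrightarrow> (\<integral>\<^sup>+x. ennreal ((cmod (f x))\<^sup>2) \<partial>M) = ennreal ((l2 M f)\<^sup>2)"
  unfolding l2_sq by (rule nn_integral_eq_integral[OF sqint_int]) auto

lemma sqint_nn:
  assumes "f \<in> borel_measurable M" "(\<integral>\<^sup>+x. ennreal ((cmod (f x))\<^sup>2) \<partial>M) \<le> ennreal C"
  shows "f \<in> sqint M" "0 \<le> C \<Longrightarrow> (l2 M f)\<^sup>2 \<le> C"
proof -
  show f: "f \<in> sqint M" unfolding sqint_def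
    using assms(1) le_less_trans[OF assms(2) ennreal_less_top] by (auto simp: integrable_iff_bounded)
  show "(l2 M f)\<^sup>2 \<le> C" if "0 \<le> C" using assms(2) that unfolding nn_l2[OF f] by simp
qed

lemma l2_fatou:
  assumes F: "\<And>n. F n \<in> sqint M" and f: "f \<in> borel_measurable M"
    and lim: "AE x in M. (\<lambda>n. F n x) \<longlonglongrightarrow> f x"
    and bd: "\<forall>\<^sub>F n in sequentially. l2 M (F n) \<le> C"
  shows "f \<in> sqint M" "l2 M f \<le> C"
proof -
  obtain n where "l2 M (F n) \<le> C" using eventually_happens'[OF sequentially_bot bd] by blast
  then have C: "0 \<le> C" using l2_nonneg[of M "F n"] by linarith
  have [measurable]: "F n \<in> borel_measurable M" for n using F sqint_meas by blast
  have "(\<integral>\<^sup>+x. ennreal ((cmod (f x))\<^sup>2) \<partial>M) = (\<integral>\<^sup>+x. liminf (\<lambda>n. ennreal ((cmod (F n x))\<^sup>2)) \<partial>M)"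
  proof (intro nn_integral_cong_AE)
    show "AE x in M. ennreal ((cmod (f x))\<^sup>2) = liminf (\<lambda>n. ennreal ((cmod (F n x))\<^sup>2))"
      using lim
    proof eventually_elim
      case (elim x)
      then have "(\<lambda>n. ennreal ((cmod (F n x))\<^sup>2)) \<longlonglongrightarrow> ennreal ((cmod (f x))\<^sup>2)"
        by (intro tendsto_ennrealI tendsto_power tendsto_norm)
      then show ?case by (rule lim_imp_Liminf[OF trivial_limit_sequentially, symmetric])
    qed
  qed
  also have "\<dots> \<le> liminf (\<lambda>n. \<integral>\<^sup>+x. ennreal ((cmod (F n x))\<^sup>2) \<partial>M)"
    by (intro nn_integral_liminf) measurable
  also have "\<dots> \<le> ennreal (C\<^sup>2)"
  proof (rule Liminf_le)
    show "\<forall>\<^sub>F n in sequentially. (\<integral>\<^sup>+x. ennreal ((cmod (F n x))\<^sup>2) \<partial>M) \<le> ennreal (C\<^sup>2)"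
      using bd unfolding nn_l2[OF F] by eventually_elim (auto intro!: ennreal_leI power_mono)
  qed simp
  finally have le: "(\<integral>\<^sup>+x. ennreal ((cmod (f x))\<^sup>2) \<partial>M) \<le> ennreal (C\<^sup>2)" .
  show "f \<in> sqint M" by (rule sqint_nn(1)[OF f le])
  show "l2 M f \<le> C" by (rule power2_le_imp_le[OF sqint_nn(2)[OF f le zero_le_power2] C])
qed

lemma l2_subseq_AE:
  assumes F: "\<And>n. F n \<in> sqint M" and f: "f \<in> sqint M" and lim: "(\<lambda>n. l2 M (\<lambda>x. F n x - f x)) \<longlonglongrightarrow> 0"
  obtains r where "strict_mono r" "AE x in M. (\<lambda>n. F (r n) x) \<longlonglongrightarrow> f x"
proof -
  have d: "(\<lambda>x. F n x - f x) \<in> sqint M" for n using L2m.diff[OF F f] .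
  have "(\<lambda>n. (l2 M (\<lambda>x. F n x - f x))\<^sup>2) \<longlonglongrightarrow> 0" using tendsto_power[OF lim, of 2] by simp
  then have "(\<lambda>n. LINT x|M. norm ((cmod (F n x - f x))\<^sup>2)) \<longlonglongrightarrow> 0" unfolding l2_sq by simp
  from tendsto_L1_AE_subseq[OF sqint_int[OF d] this]
  obtain r where r: "strict_mono r" "AE x in M. (\<lambda>n. (cmod (F (r n) x - f x))\<^sup>2) \<longlonglongrightarrow> 0" by blast
  have "AE x in M. (\<lambda>n. F (r n) x) \<longlonglongrightarrow> f x" using r(2)
  proof eventually_elim
    case (elim x)
    then have "(\<lambda>n. sqrt ((cmod (F (r n) x - f x))\<^sup>2)) \<longlonglongrightarrow> sqrt 0" by (rule tendsto_real_sqrt)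
    then show ?case by (simp add: tendsto_norm_zero_iff LIM_zero_iff)
  qed
  with r(1) that show ?thesis by blast
qed

text \<open>
  Along a rapidly converging subsequence the increments are summable almost everywhere, which produces the limit; Fatou controls the distance to it.
\<close>

lemma l2_complete:
  assumes F: "\<And>n. F n \<in> sqint M"
    and cauchy: "\<And>e. e > 0 \<Longrightarrow> \<exists>N. \<forall>m\<ge>N. \<forall>n\<ge>N. l2 M (\<lambda>x. F m x - F n x) < e"
  shows "\<exists>f\<in>sqint M. (\<lambda>n. l2 M (\<lambda>x. F n x - f x)) \<longlonglongrightarrow> 0"
proof -
  obtain N where N: "\<And>k m n. N k \<le> m \<Longrightarrow> N k \<le> n \<Longrightarrow> l2 M (\<lambda>x. F m x - F n x) < (1/4) ^ k"
    using cauchy[of "(1/4) ^ k" for k] by (metis zero_less_divide_1_iff zero_less_numeral zero_less_power)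
  define r where "r k = (\<Sum>i\<le>k. N i) + k" for k
  have r_ge: "N k \<le> r k" "k \<le> r k" "r k \<le> r (Suc k)" for k
    unfolding r_def using member_le_sum[of k "{..k}" N] by auto
  have Nr: "N k \<le> r (Suc k)" for k using r_ge order_trans by blast
  define d where "d k x = F (r (Suc k)) x - F (r k) x" for k x
  have d: "d k \<in> sqint M" for k unfolding d_def using L2m.diff[OF F F] .
  have d_meas [measurable]: "d k \<in> borel_measurable M" for k using d sqint_meas by blast
  have F_meas [measurable]: "F k \<in> borel_measurable M" for k using F sqint_meas by blast
  have dl: "l2 M (d k) \<le> (1/4) ^ k" for k unfolding d_def using N[OF Nr r_ge(1)] less_imp_le by blast
  have "(\<integral>\<^sup>+x. (\<Sum>k. ennreal (2 ^ k * (cmod (d k x))\<^sup>2)) \<partial>M) = (\<Sum>k. \<integral>\<^sup>+x. ennreal (2 ^ k * (cmod (d k x))\<^sup>2) \<partial>M)"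
    by (intro nn_integral_suminf) measurable
  also have "\<dots> \<le> (\<Sum>k. ennreal ((1/2) ^ k))"
  proof (intro suminf_le)
    fix k
    have "(\<integral>\<^sup>+x. ennreal (2 ^ k * (cmod (d k x))\<^sup>2) \<partial>M) = ennreal (2 ^ k) * ennreal ((l2 M (d k))\<^sup>2)"
      using d by (subst nn_l2[OF d, symmetric], subst nn_integral_cmult[symmetric]) (auto simp: ennreal_mult')
    also have "\<dots> = ennreal (2 ^ k * (l2 M (d k))\<^sup>2)" by (simp add: ennreal_mult')
    also have "\<dots> \<le> ennreal ((1/2) ^ k)"
    proof (rule ennreal_leI)
      have "(l2 M (d k))\<^sup>2 \<le> ((1/4) ^ k)\<^sup>2" using dl by (intro power_mono) auto
      also have "((1/4::real) ^ k)\<^sup>2 \<le> (1/4) ^ k" unfolding power2_eq_square by (intro mult_left_le) (auto simp: power_le_one)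
      finally have "2 ^ k * (l2 M (d k))\<^sup>2 \<le> 2 ^ k * (1/4) ^ k" by simp
      then show "2 ^ k * (l2 M (d k))\<^sup>2 \<le> (1/2) ^ k" by (simp add: power_mult_distrib[symmetric])
    qed
    finally show "(\<integral>\<^sup>+x. ennreal (2 ^ k * (cmod (d k x))\<^sup>2) \<partial>M) \<le> ennreal ((1/2) ^ k)" .
  qed auto
  also have "\<dots> < \<infinity>"
    by (subst suminf_ennreal2) (auto simp: summable_geometric)
  finally have "(\<integral>\<^sup>+x. (\<Sum>k. ennreal (2 ^ k * (cmod (d k x))\<^sup>2)) \<partial>M) \<noteq> \<infinity>" by simp
  then have fin: "AE x in M. (\<Sum>k. ennreal (2 ^ k * (cmod (d k x))\<^sup>2)) \<noteq> \<infinity>"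
    by (intro nn_integral_PInf_AE) measurable
  have conv: "AE x in M. convergent (\<lambda>k. F (r k) x)"
    using fin
  proof eventually_elim
    case (elim x)
    have sm: "summable (\<lambda>k. 2 ^ k * (cmod (d k x))\<^sup>2)"
      by (rule summable_suminf_not_top) (use elim in auto)
    then have "(\<lambda>k. 2 ^ k * (cmod (d k x))\<^sup>2) \<longlonglongrightarrow> 0" by (rule summable_LIMSEQ_zero)
    then have "Bseq (\<lambda>k. 2 ^ k * (cmod (d k x))\<^sup>2)" by (intro convergent_imp_Bseq convergentI)
    then obtain K where K: "0 < K" "\<And>k. 2 ^ k * (cmod (d k x))\<^sup>2 \<le> K" unfolding Bseq_def by (auto simp: abs_mult)
    have "cmod (d k x) \<le> sqrt K * (1 / sqrt 2) ^ k" for k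
    proof (rule power2_le_imp_le)
      have "(cmod (d k x))\<^sup>2 \<le> K / 2 ^ k" using K(2)[of k] by (simp add: field_simps)
      also have "\<dots> = (sqrt K * (1 / sqrt 2) ^ k)\<^sup>2"
        using K(1) by (simp add: power_mult_distrib power_divide power_mult[symmetric] mult.commute[of k 2]) (simp add: power_mult)
      finally show "(cmod (d k x))\<^sup>2 \<le> (sqrt K * (1 / sqrt 2) ^ k)\<^sup>2" .
    qed (use K in auto)
    then have "summable (\<lambda>k. d k x)"
      by (intro summable_comparison_test'[where N=0, OF summable_mult[OF summable_geometric]]) auto
    then have "convergent (\<lambda>n. \<Sum>k<n. d k x)" by (simp add: summable_iff_convergent)
    moreover have "(\<Sum>k<n. d k x) = F (r n) x - F (r 0) x" for n
      unfolding d_def by (rule sum_lessThan_telescope)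
    ultimately have "convergent (\<lambda>n. F (r n) x - F (r 0) x)" by simp
    then show ?case using convergent_add[OF _ convergent_const[of "F (r 0) x"]] by fastforce
  qed
  define f where "f x = lim (\<lambda>k. F (r k) x)" for x
  have f_meas: "f \<in> borel_measurable M" unfolding f_def by measurable
  have lim: "AE x in M. (\<lambda>k. F (r k) x) \<longlonglongrightarrow> f x"
    using conv by eventually_elim (simp add: f_def convergent_LIMSEQ_iff)
  have r_mono: "\<And>k n. k \<le> n \<Longrightarrow> r k \<le> r n" using r_ge(3) lift_Suc_mono_le by blast
  have key: "(\<lambda>x. F n x - f x) \<in> sqint M \<and> l2 M (\<lambda>x. F n x - f x) \<le> (1/4) ^ k" if "N k \<le> n" for n k
  proof -
    have l: "AE x in M. (\<lambda>j. F n x - F (r j) x) \<longlonglongrightarrow> F n x - f x"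
      using lim by eventually_elim (intro tendsto_intros)
    have m: "(\<lambda>x. F n x - f x) \<in> borel_measurable M" using f_meas by measurable
    have b: "\<forall>\<^sub>F j in sequentially. l2 M (\<lambda>x. F n x - F (r j) x) \<le> (1/4) ^ k"
      unfolding eventually_sequentially using N[OF that] r_ge(1) r_mono order_trans less_imp_le by meson
    show ?thesis using l2_fatou[OF L2m.diff[OF F F] m l b] by blast
  qed
  have f: "f \<in> sqint M"
    using L2m.diff[OF F[of "N 0"] conjunct1[OF key[OF order_refl, of 0]]] by simp
  have "(\<lambda>n. l2 M (\<lambda>x. F n x - f x)) \<longlonglongrightarrow> 0"
  proof (rule LIMSEQ_I)
    fix e :: real assume "e > 0"
    then obtain k where k: "(1/4::real) ^ k < e" using real_arch_pow_inv[of e "1/4"] by auto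
    show "\<exists>no. \<forall>n\<ge>no. norm (l2 M (\<lambda>x. F n x - f x) - 0) < e"
    proof (intro exI[of _ "N k"] allI impI)
      fix n assume "N k \<le> n"
      from key[OF this] k show "norm (l2 M (\<lambda>x. F n x - f x) - 0) < e" by (simp add: order.strict_trans1)
    qed
  qed
  with f show ?thesis by blast
qed

section \<open>Restriction of Lebesgue measure\<close>

lemma lebesgue_on_integral:
  fixes f :: "'a::euclidean_space \<Rightarrow> complex"
  assumes "S \<in> sets lebesgue"
  shows "(LINT x|lebesgue_on S. f x) = (LINT x|lebesgue. zero_ext S f x)"
  using assms by (subst integral_restrict_space) (auto simp: zero_ext_def indicator_def intro!: Bochner_Integration.integral_cong)

lemma lebesgue_on_measurable:
  fixes f :: "'a::euclidean_space \<Rightarrow> complex"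
  assumes "S \<in> sets lebesgue"
  shows "f \<in> borel_measurable (lebesgue_on S) \<longleftrightarrow> zero_ext S f \<in> borel_measurable lebesgue"
proof -
  have "(\<lambda>x. indicator S x *\<^sub>R f x) = zero_ext S f" by (auto simp: zero_ext_def indicator_def)
  then show ?thesis using assms borel_measurable_restrict_space_iff[of S lebesgue f] by (auto simp: sets_completionI)
qed

lemma AE_lebesgue_on:
  assumes "S \<in> sets lebesgue"
  shows "(AE x in lebesgue_on S. P x) \<longleftrightarrow> (AE x in lebesgue. x \<in> S \<longrightarrow> P x)"
  using assms by (subst AE_restrict_space_iff) auto

lemma sqint_lebesgue_on:
  fixes f :: "'a::euclidean_space \<Rightarrow> complex"
  assumes S: "S \<in> sets lebesgue"
  shows "f \<in> sqint (lebesgue_on S) \<longleftrightarrow> zero_ext S f \<in> sqint lebesgue"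
    and "l2 (lebesgue_on S) f = l2 lebesgue (zero_ext S f)"
proof -
  have e: "(\<lambda>x. indicator S x * (cmod (f x))\<^sup>2) = (\<lambda>x. (cmod (zero_ext S f x))\<^sup>2)"
    by (auto simp: zero_ext_def indicator_def)
  have "integrable (lebesgue_on S) (\<lambda>x. (cmod (f x))\<^sup>2) \<longleftrightarrow> integrable lebesgue (\<lambda>x. (cmod (zero_ext S f x))\<^sup>2)"
    using S by (subst integrable_restrict_space) (auto simp: e)
  then show "f \<in> sqint (lebesgue_on S) \<longleftrightarrow> zero_ext S f \<in> sqint lebesgue"
    unfolding sqint_def using lebesgue_on_measurable[OF S, of f] by simp
  show "l2 (lebesgue_on S) f = l2 lebesgue (zero_ext S f)"
    unfolding l2_def using S by (subst integral_restrict_space) (auto simp: e)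
qed

lemma sqint_integrable:
  fixes f :: "'a::euclidean_space \<Rightarrow> complex"
  assumes f: "f \<in> sqint lebesgue" and A: "bounded A" "\<And>x. x \<notin> A \<Longrightarrow> f x = 0"
  shows "integrable lebesgue f"
proof -
  obtain r where r: "\<And>x. x \<in> A \<Longrightarrow> norm x \<le> r" using A(1) unfolding bounded_iff by blast
  show ?thesis
  proof (rule Bochner_Integration.integrable_bound)
    show "integrable lebesgue (\<lambda>x. (cmod (f x))\<^sup>2 + Re (indicator (cball 0 r) x))"
      by (intro Bochner_Integration.integrable_add sqint_int f integrable_Re integrable_indicator_compact) simp
    show "AE x in lebesgue. norm (f x) \<le> norm ((cmod (f x))\<^sup>2 + Re (indicator (cball 0 r) x))"
    proof (rule AE_I2)
      fix x
      have "cmod (f x) \<le> (cmod (f x))\<^sup>2 + 1"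
      proof -
        have "2 * cmod (f x) \<le> (cmod (f x))\<^sup>2 + 1" using sum_squares_bound[of "cmod (f x)" 1] by simp
        then show ?thesis by (rule order_trans[rotated]) simp
      qed
      then show "norm (f x) \<le> norm ((cmod (f x))\<^sup>2 + Re (indicator (cball 0 r) x))"
        using A(2)[of x] r[of x] by (cases "x \<in> A") (auto simp: indicator_def)
    qed
  qed (use f in measurable)
qed

lemma lebesgue_borel_rep:
  fixes f :: "'a::euclidean_space \<Rightarrow> complex"
  assumes f: "f \<in> borel_measurable lebesgue"
  obtains f0 where "f0 \<in> borel_measurable borel" "AE x in lebesgue. f x = f0 x"
proof -
  obtain g where g: "g \<in> borel_measurable lborel" "AE x in lborel. Re (f x) = g x"
    using completion_ex_borel_measurable_real[of "\<lambda>x. Re (f x)" lborel] f by auto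
  obtain h where h: "h \<in> borel_measurable lborel" "AE x in lborel. Im (f x) = h x"
    using completion_ex_borel_measurable_real[of "\<lambda>x. Im (f x)" lborel] f by auto
  show ?thesis
  proof (rule that[of "\<lambda>x. Complex (g x) (h x)"])
    have "(\<lambda>x. complex_of_real (g x) + \<i> * of_real (h x)) \<in> borel_measurable lborel" using g h by measurable
    then show "(\<lambda>x. Complex (g x) (h x)) \<in> borel_measurable borel" by (simp add: Complex_eq)
    have "AE x in lborel. f x = Complex (g x) (h x)" using g(2) h(2) by eventually_elim (simp add: complex_eq_iff)
    then show "AE x in lebesgue. f x = Complex (g x) (h x)" by (simp add: AE_completion_iff)
  qed
qed

section \<open>Mollification of square integrable functions\<close>

abbreviation cmoll :: "real \<Rightarrow> 'a::euclidean_space \<Rightarrow> complex" where "cmoll e \<equiv> \<lambda>x. complex_of_real (moll e x)"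

text \<open>
  Mollification averages translates, so by Jensen it does not increase the norm.
\<close>

lemma conv_young:
  fixes f :: "'a::euclidean_space \<Rightarrow> complex"
  assumes f: "integrable lebesgue f" "f \<in> sqint lebesgue" and e: "0 < e"
  shows "conv f (cmoll e) \<in> sqint lebesgue" "l2 lebesgue (conv f (cmoll e)) \<le> l2 lebesgue f"
proof -
  let ?m = "moll e :: 'a \<Rightarrow> real"
  obtain f0 where f0[measurable]: "f0 \<in> borel_measurable borel" and ff0: "AE x in lebesgue. f x = f0 x"
    using lebesgue_borel_rep[OF sqint_meas[OF f(2)]] by metis
  have m[measurable]: "?m \<in> borel_measurable borel" using e by simp
  have m0: "0 \<le> ?m x" for x by (rule moll_nonneg[OF e])
  have mint: "(\<integral>\<^sup>+y. ennreal (?m y) \<partial>lborel) = 1"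
    using moll_integral[OF e, where 'a='a] m0 by (subst nn_integral_eq_integral) auto
  have f0i: "integrable lborel f0"
  proof -
    have "integrable lebesgue f0" using f(1) ff0 by (subst integrable_cong_AE[symmetric]) (auto intro: measurable_completion)
    then show ?thesis by (simp add: integrable_completion)
  qed
  have conv: "conv f (cmoll e) x = (LINT y|lborel. f0 y * of_real (?m (x - y)))" for x
  proof -
    have "conv f (cmoll e) x = (LINT y|lebesgue. f0 y * of_real (?m (x - y)))"
      unfolding conv_def
    proof (rule integral_cong_AE)
      show "(\<lambda>y. f y * complex_of_real (?m (x - y))) \<in> borel_measurable lebesgue"
        using conv_integrable[OF f(1) moll_test[OF e]] by (rule borel_measurable_integrable)
      have "(\<lambda>y. f0 y * complex_of_real (?m (x - y))) \<in> borel_measurable lborel" by measurable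
      then show "(\<lambda>y. f0 y * complex_of_real (?m (x - y))) \<in> borel_measurable lebesgue" by (rule measurable_completion)
      show "AE y in lebesgue. f y * complex_of_real (?m (x - y)) = f0 y * complex_of_real (?m (x - y))"
        using ff0 by eventually_elim simp
    qed
    also have "\<dots> = (LINT y|lborel. f0 y * of_real (?m (x - y)))"
      by (rule integral_completion) measurable
    finally show ?thesis .
  qed
  have pt: "ennreal ((cmod (conv f (cmoll e) x))\<^sup>2) \<le> (\<integral>\<^sup>+y. ennreal ((cmod (f0 y))\<^sup>2) * ennreal (?m (x - y)) \<partial>lborel)" for x
  proof -
    have "ennreal (cmod (conv f (cmoll e) x)) \<le> (\<integral>\<^sup>+y. norm (f0 y * of_real (?m (x - y))) \<partial>lborel)"
    proof -
      have "integrable lebesgue (\<lambda>y. f y * cmoll e (x - y))" by (rule conv_integrable[OF f(1) moll_test[OF e]])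
      show ?thesis unfolding conv by (cases "integrable lborel (\<lambda>y. f0 y * complex_of_real (?m (x - y)))")
         (auto intro: integral_norm_bound_ennreal simp: not_integrable_integral_eq)
    qed
    also have "\<dots> = (\<integral>\<^sup>+y. ennreal (cmod (f0 y) * sqrt (?m (x - y))) * ennreal (sqrt (?m (x - y))) \<partial>lborel)"
      using m0 by (intro nn_integral_cong) (simp add: norm_mult ennreal_mult[symmetric] mult.assoc)
    finally have "(ennreal (cmod (conv f (cmoll e) x)))\<^sup>2 \<le> (\<integral>\<^sup>+y. ennreal (cmod (f0 y) * sqrt (?m (x - y))) * ennreal (sqrt (?m (x - y))) \<partial>lborel)\<^sup>2"
      by (intro power_mono) auto
    also have "\<dots> \<le> (\<integral>\<^sup>+y. (ennreal (cmod (f0 y) * sqrt (?m (x - y))))\<^sup>2 \<partial>lborel) * (\<integral>\<^sup>+y. (ennreal (sqrt (?m (x - y))))\<^sup>2 \<partial>lborel)"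
      by (rule Cauchy_Schwarz_nn_integral) measurable
    also have "(\<integral>\<^sup>+y. (ennreal (sqrt (?m (x - y))))\<^sup>2 \<partial>lborel) = 1"
      using nn_integral_reflect[of "\<lambda>y. ennreal (?m y)" x] mint m0 by (simp add: ennreal_power)
    also have "(\<integral>\<^sup>+y. (ennreal (cmod (f0 y) * sqrt (?m (x - y))))\<^sup>2 \<partial>lborel) = (\<integral>\<^sup>+y. ennreal ((cmod (f0 y))\<^sup>2) * ennreal (?m (x - y)) \<partial>lborel)"
      using m0 by (intro nn_integral_cong) (simp add: ennreal_power power_mult_distrib ennreal_mult)
    finally show ?thesis by (simp add: ennreal_power)
  qed
  have meas: "conv f (cmoll e) \<in> borel_measurable borel"
    by (rule borel_measurable_continuous_onI[OF smoothD(2)[OF smooth_conv[OF f(1) moll_test[OF e]]]])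
  have "(\<integral>\<^sup>+x. ennreal ((cmod (conv f (cmoll e) x))\<^sup>2) \<partial>lebesgue) = (\<integral>\<^sup>+x. ennreal ((cmod (conv f (cmoll e) x))\<^sup>2) \<partial>lborel)"
    using meas by (intro nn_integral_completion) measurable
  also have "\<dots> \<le> (\<integral>\<^sup>+x. (\<integral>\<^sup>+y. ennreal ((cmod (f0 y))\<^sup>2) * ennreal (?m (x - y)) \<partial>lborel) \<partial>lborel)"
    by (intro nn_integral_mono pt)
  also have "\<dots> = (\<integral>\<^sup>+y. (\<integral>\<^sup>+x. ennreal ((cmod (f0 y))\<^sup>2) * ennreal (?m (x - y)) \<partial>lborel) \<partial>lborel)"
    by (rule lborel_pair.Fubini'[symmetric]) measurable
  also have "\<dots> = (\<integral>\<^sup>+y. ennreal ((cmod (f0 y))\<^sup>2) \<partial>lborel)"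
  proof (intro nn_integral_cong)
    fix y
    have "(\<integral>\<^sup>+x. ennreal (?m (x - y)) \<partial>lborel) = 1"
      using nn_integral_shift[of "\<lambda>y. ennreal (?m y)" "- y"] mint by simp
    then show "(\<integral>\<^sup>+x. ennreal ((cmod (f0 y))\<^sup>2) * ennreal (?m (x - y)) \<partial>lborel) = ennreal ((cmod (f0 y))\<^sup>2)"
      by (subst nn_integral_cmult) auto
  qed
  also have "\<dots> = (\<integral>\<^sup>+y. ennreal ((cmod (f0 y))\<^sup>2) \<partial>lebesgue)" by (rule nn_integral_completion[symmetric]) measurable
  also have "\<dots> = (\<integral>\<^sup>+y. ennreal ((cmod (f y))\<^sup>2) \<partial>lebesgue)"
    using ff0 by (intro nn_integral_cong_AE) (auto elim!: eventually_mono)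
  also have "\<dots> = ennreal ((l2 lebesgue f)\<^sup>2)" by (rule nn_l2[OF f(2)])
  finally have le: "(\<integral>\<^sup>+x. ennreal ((cmod (conv f (cmoll e) x))\<^sup>2) \<partial>lebesgue) \<le> ennreal ((l2 lebesgue f)\<^sup>2)" .
  have m1: "conv f (cmoll e) \<in> borel_measurable lebesgue" using meas by (auto intro: measurable_completion)
  show "conv f (cmoll e) \<in> sqint lebesgue" by (rule sqint_nn(1)[OF m1 le])
  show "l2 lebesgue (conv f (cmoll e)) \<le> l2 lebesgue f"
    by (rule power2_le_imp_le[OF sqint_nn(2)[OF m1 le zero_le_power2] l2_nonneg])
qed

lemma compact_support_sqint:
  fixes f :: "'a::euclidean_space \<Rightarrow> complex"
  assumes c: "continuous_on UNIV f" and s: "\<And>x. f x \<noteq> 0 \<Longrightarrow> norm x \<le> r"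
  shows "f \<in> sqint lebesgue" "integrable lebesgue f"
proof -
  have m: "f \<in> borel_measurable lebesgue" using borel_measurable_continuous_onI[OF c] by (auto intro: measurable_completion)
  have "integrable lebesgue (\<lambda>x. complex_of_real ((cmod (f x))\<^sup>2))"
    by (rule compact_support_integrable(2)[where K="cball 0 r"]) (use c s in \<open>auto intro!: continuous_intros\<close>)
  then have "integrable lebesgue (\<lambda>x. Re (complex_of_real ((cmod (f x))\<^sup>2)))" by (rule integrable_Re)
  then show "f \<in> sqint lebesgue" using m by (simp add: sqint_def)
  show "integrable lebesgue f"
    by (rule compact_support_integrable(2)[where K="cball 0 r"]) (use c s in auto)
qed

lemma conv_uniform:
  fixes g :: "'a::euclidean_space \<Rightarrow> complex"
  assumes g: "integrable lebesgue g" and e: "0 < e"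
    and d: "\<And>y. norm (x - y) < e \<Longrightarrow> cmod (g y - g x) \<le> d" "0 \<le> d"
  shows "cmod (conv g (cmoll e) x - g x) \<le> d"
proof -
  let ?m = "moll e :: 'a \<Rightarrow> real"
  have mb[measurable]: "?m \<in> borel_measurable borel" using e by simp
  have "integrable (distr lborel borel (\<lambda>y. x - y)) ?m" unfolding lborel_reflect using moll_integral e by auto
  then have "integrable lborel (\<lambda>y. ?m (x - y))" by (subst (asm) integrable_distr_eq) auto
  then have mi: "integrable lebesgue (\<lambda>y. ?m (x - y))" by (subst integrable_completion) auto
  have m1: "(LINT y|lebesgue. ?m (x - y)) = 1"
    using integral_reflect[of ?m x] moll_integral[OF e, where 'a='a] by (subst integral_completion) auto
  have "(LINT y|lebesgue. g x * of_real (?m (x - y))) = g x"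
    by (simp only: Bochner_Integration.integral_mult_right_zero integral_complex_of_real m1) simp
  then have "conv g (cmoll e) x - g x = (LINT y|lebesgue. g y * of_real (?m (x - y))) - (LINT y|lebesgue. g x * of_real (?m (x - y)))"
    unfolding conv_def by simp
  also have "\<dots> = (LINT y|lebesgue. (g y - g x) * of_real (?m (x - y)))"
    using conv_integrable[OF g moll_test[OF e], of x] mi
    by (subst Bochner_Integration.integral_diff[symmetric]) (auto simp: algebra_simps)
  also have "cmod \<dots> \<le> (LINT y|lebesgue. d * ?m (x - y))"
  proof (rule Bochner_Integration.integral_norm_bound_integral)
    have "integrable lebesgue (\<lambda>y. g y * of_real (?m (x - y)) - g x * of_real (?m (x - y)))"
      using conv_integrable[OF g moll_test[OF e], of x] mi by auto
    then show "integrable lebesgue (\<lambda>y. (g y - g x) * complex_of_real (?m (x - y)))" by (simp add: algebra_simps)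
    fix y
    show "cmod ((g y - g x) * complex_of_real (?m (x - y))) \<le> d * ?m (x - y)"
    proof (cases "?m (x - y) = 0")
      case False
      then have "cmod (g y - g x) \<le> d" using d(1) moll_nz[OF e] by blast
      then show ?thesis using moll_nonneg[OF e, of "x - y"] by (simp add: norm_mult mult_right_mono)
    qed simp
  qed (use mi in auto)
  also have "\<dots> = d" using m1 by simp
  finally show ?thesis .
qed

lemma l2_bound_support:
  fixes f :: "'a::euclidean_space \<Rightarrow> complex"
  assumes f: "f \<in> sqint lebesgue" and b: "\<And>x. cmod (f x) \<le> d" and s: "\<And>x. f x \<noteq> 0 \<Longrightarrow> norm x \<le> r"
  shows "l2 lebesgue f \<le> d * l2 lebesgue (indicator (cball (0::'a) r))"
proof (rule sqint_bound(2))
  show "(indicator (cball (0::'a) r) :: 'a \<Rightarrow> complex) \<in> sqint lebesgue"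
  proof -
    have "(\<lambda>x::'a. (cmod (indicator (cball 0 r) x))\<^sup>2) = (\<lambda>x::'a. Re (indicator (cball 0 r) x))" by (auto simp: indicator_def)
    moreover have "integrable lebesgue (\<lambda>x::'a. Re (indicator (cball 0 r) x))"
      by (rule integrable_Re[OF integrable_indicator_compact]) simp
    ultimately show ?thesis unfolding sqint_def
      using borel_measurable_integrable[OF integrable_indicator_compact[of "cball (0::'a) r"]] by (simp only: mem_Collect_eq) simp
  qed
  show "f \<in> borel_measurable lebesgue" using f by (rule sqint_meas)
  show "AE x in lebesgue. cmod (f x) \<le> d * cmod (indicator (cball 0 r) x)"
  proof (rule AE_I2)
    fix x show "cmod (f x) \<le> d * cmod (indicator (cball 0 r) x)"
      using b[of x] s[of x] by (cases "f x = 0") (auto simp: indicator_def order_trans[OF norm_ge_zero])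
  qed
  show "0 \<le> d" using b[of 0] norm_ge_zero order_trans by blast
qed

abbreviation meps :: "nat \<Rightarrow> real" where "meps n \<equiv> 1 / real (Suc n)"

lemma conv_tendsto_continuous:
  fixes g :: "'a::euclidean_space \<Rightarrow> complex"
  assumes c: "continuous_on UNIV g" and s: "\<And>x. g x \<noteq> 0 \<Longrightarrow> norm x \<le> r"
  shows "(\<lambda>n. l2 lebesgue (\<lambda>x. conv g (cmoll (meps n)) x - g x)) \<longlonglongrightarrow> 0"
proof -
  note gi = compact_support_sqint[OF c s]
  define A where "A = l2 lebesgue (indicator (cball (0::'a) (r + 1)) :: 'a \<Rightarrow> complex)"
  have uc: "uniformly_continuous_on (cball 0 (r + 2)) g"
    by (rule compact_uniformly_continuous) (use c continuous_on_subset in auto)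
  show ?thesis
  proof (rule LIMSEQ_I)
    fix e :: real assume e: "0 < e"
    define d where "d = e / 2 / (A + 1)"
    have A0: "0 \<le> A" by (simp add: A_def)
    have d: "0 < d" using e A0 by (simp add: d_def)
    obtain h where h: "0 < h" "\<And>x y. x \<in> cball 0 (r+2) \<Longrightarrow> y \<in> cball 0 (r+2) \<Longrightarrow> dist y x < h \<Longrightarrow> dist (g y) (g x) < d"
      using uc d unfolding uniformly_continuous_on_def by metis
    obtain N where N: "1 / real (Suc N) < h" using h(1) nat_approx_posE by blast
    show "\<exists>no. \<forall>n\<ge>no. norm (l2 lebesgue (\<lambda>x. conv g (cmoll (meps n)) x - g x) - 0) < e"
    proof (intro exI allI impI)
      fix n assume n: "N \<le> n"
      have en: "meps n < h" "0 < meps n" "meps n \<le> 1"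
        using N n by (auto intro: order.strict_trans1[OF _ N] simp: frac_le)
      have small: "cmod (g y - g x) \<le> d" if "norm (x - y) < meps n" for x y
      proof (cases "norm x \<le> r + 1")
        case True
        have "norm y \<le> norm x + norm (x - y)" using norm_triangle_ineq2[of y x] by (simp add: norm_minus_commute)
        then have "norm y \<le> r + 2" using True that en by linarith
        then show ?thesis using h(2)[of x y] True that en by (auto simp: dist_norm norm_minus_commute)
      next
        case False
        have "norm x \<le> norm y + norm (x - y)" using norm_triangle_ineq2[of x y] by simp
        then have "\<not> norm y \<le> r" "\<not> norm x \<le> r" using False that en by linarith+
        then have "g x = 0" "g y = 0" using s by blast+
        then show ?thesis using d by simp
      qed
      have cs: "(\<lambda>x. conv g (cmoll (meps n)) x - g x) \<in> sqint lebesgue"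
        by (rule L2m.diff[OF conv_young(1)[OF gi(2,1) en(2)] gi(1)])
      have "l2 lebesgue (\<lambda>x. conv g (cmoll (meps n)) x - g x) \<le> d * A"
        unfolding A_def
      proof (rule l2_bound_support[OF cs])
        show "cmod (conv g (cmoll (meps n)) x - g x) \<le> d" for x
          by (rule conv_uniform[OF gi(2) en(2)]) (use small d in auto)
        fix x assume ne: "conv g (cmoll (meps n)) x - g x \<noteq> 0"
        show "norm x \<le> r + 1"
        proof (rule ccontr)
          assume x: "\<not> norm x \<le> r + 1"
          have z: "g y = 0" if "norm (x - y) < meps n" for y
          proof -
            have "norm x \<le> norm y + norm (x - y)" using norm_triangle_ineq2[of x y] by simp
            then show ?thesis using s[of y] x that en by auto
          qed
          have "g x = 0" using z[of x] en by simp
          have "cmod (conv g (cmoll (meps n)) x - g x) \<le> 0"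
            by (rule conv_uniform[OF gi(2) en(2)]) (use z \<open>g x = 0\<close> in auto)
          then show False using ne by simp
        qed
      qed
      also have "\<dots> < e"
      proof -
        have "d * A \<le> d * (A + 1)" using d by simp
        moreover have "A + 1 \<noteq> 0" using A0 by simp
        moreover from this have "d * (A + 1) = e / 2" by (rule nonzero_eq_divide_eq[THEN iffD1, OF _ d_def])
        ultimately show ?thesis using e by linarith
      qed
      finally show "norm (l2 lebesgue (\<lambda>x. conv g (cmoll (meps n)) x - g x) - 0) < e" by simp
    qed
  qed
qed

subsection \<open>Density of continuous functions with compact support\<close>

definition clip :: "real \<Rightarrow> complex \<Rightarrow> complex" where
  "clip c z = of_real (c / max c (cmod z)) * z"

lemma clip_props:
  assumes "0 < c"
  shows "cmod (clip c z) \<le> c" "cmod (clip c z) \<le> cmod z" "cmod z \<le> c \<Longrightarrow> clip c z = z"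
    "continuous_on UNIV (clip c)"
proof -
  show "cmod (clip c z) \<le> c" "cmod (clip c z) \<le> cmod z" "cmod z \<le> c \<Longrightarrow> clip c z = z"
    using assms by (auto simp: clip_def norm_mult norm_divide max_def divide_le_eq mult_le_cancel_right1 mult_right_mono)
  have "max c (cmod z) \<noteq> 0" for z
  proof -
    have "c \<le> max c (cmod z)" by simp
    then show ?thesis using assms by linarith
  qed
  then have "\<forall>z\<in>UNIV. max c (cmod z) \<noteq> 0" by blast
  then show "continuous_on UNIV (clip c)" unfolding clip_def by (intro continuous_intros)
qed

definition ramp :: "real \<Rightarrow> 'a::euclidean_space \<Rightarrow> real" where
  "ramp c x = max 0 (min 1 (c + 1 - norm x))"

lemma l2_dominated:
  assumes F: "\<And>n. F n \<in> borel_measurable M" and g: "g \<in> sqint M" and f: "f \<in> borel_measurable M"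
    and lim: "AE x in M. (\<lambda>n. F n x) \<longlonglongrightarrow> f x"
    and bd: "\<And>n. AE x in M. cmod (F n x) \<le> cmod (g x)"
  shows "(\<lambda>n. l2 M (\<lambda>x. F n x - f x)) \<longlonglongrightarrow> 0" "f \<in> sqint M" "F n \<in> sqint M"
proof -
  have Fs: "F n \<in> sqint M" for n by (rule sqint_bound(1)[OF g F, where C=1]) (use bd in auto)
  have bdf: "AE x in M. cmod (f x) \<le> cmod (g x)"
  proof -
    have "AE x in M. \<forall>n. cmod (F n x) \<le> cmod (g x)" using bd by (simp add: AE_all_countable)
    then show ?thesis using lim
    proof eventually_elim
      case (elim x)
      show ?case by (rule LIMSEQ_le_const2[OF tendsto_norm[OF elim(2)]]) (use elim(1) in auto)
    qed
  qed
  show fs: "f \<in> sqint M" by (rule sqint_bound(1)[OF g f, where C=1]) (use bdf in auto)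
  show "F n \<in> sqint M" by (rule Fs)
  have "(\<lambda>n. LINT x|M. (cmod (F n x - f x))\<^sup>2) \<longlonglongrightarrow> (LINT x|M. 0)"
  proof (rule integral_dominated_convergence[where w="\<lambda>x. 4 * (cmod (g x))\<^sup>2"])
    show "(\<lambda>x. (cmod (F n x - f x))\<^sup>2) \<in> borel_measurable M" for n using F f by measurable
    show "integrable M (\<lambda>x. 4 * (cmod (g x))\<^sup>2)" using sqint_int[OF g] by simp
    show "AE x in M. (\<lambda>n. (cmod (F n x - f x))\<^sup>2) \<longlonglongrightarrow> 0"
      using lim
    proof eventually_elim
      case (elim x)
      have "(\<lambda>n. (cmod (F n x - f x))\<^sup>2) \<longlonglongrightarrow> (cmod (f x - f x))\<^sup>2" by (intro tendsto_intros elim)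
      then show ?case by simp
    qed
    show "AE x in M. norm ((cmod (F n x - f x))\<^sup>2) \<le> 4 * (cmod (g x))\<^sup>2" for n
      using bd[of n] bdf
    proof eventually_elim
      case (elim x)
      have "cmod (F n x - f x) \<le> 2 * cmod (g x)" using norm_triangle_ineq4[of "F n x" "f x"] elim by linarith
      then have "(cmod (F n x - f x))\<^sup>2 \<le> (2 * cmod (g x))\<^sup>2" by (intro power_mono) auto
      then show ?case by (simp add: power_mult_distrib)
    qed
  qed simp
  then have "(\<lambda>n. sqrt (LINT x|M. (cmod (F n x - f x))\<^sup>2)) \<longlonglongrightarrow> sqrt 0" by (intro tendsto_real_sqrt) simp
  then show "(\<lambda>n. l2 M (\<lambda>x. F n x - f x)) \<longlonglongrightarrow> 0" by (simp add: l2_def)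
qed

text \<open>
  Measurable functions are almost everywhere limits of continuous ones; clipping the values and cutting off in space makes the convergence dominated.
\<close>

lemma l2_dense_continuous:
  fixes f :: "'a::euclidean_space \<Rightarrow> complex"
  assumes f: "f \<in> sqint lebesgue" and e: "0 < e"
  obtains g r where "continuous_on UNIV g" "\<And>x. g x \<noteq> 0 \<Longrightarrow> norm x \<le> r" "l2 lebesgue (\<lambda>x. g x - f x) < e"
proof -
  have "f measurable_on UNIV" using sqint_meas[OF f] lebesgue_measurable_imp_measurable_on[of f UNIV] by simp
  then obtain N G where N: "negligible N" "\<And>n. continuous_on UNIV (G n)" "\<And>x. x \<notin> N \<Longrightarrow> (\<lambda>n. G n x) \<longlonglongrightarrow> f x"
    unfolding measurable_on_def by auto
  have AEN: "AE x in lebesgue. (\<lambda>n. G n x) \<longlonglongrightarrow> f x"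
    using N(1,3) by (intro AE_I'[of N]) (auto simp: negligible_iff_null_sets)
  define H where "H c h x = of_real (ramp c x) * clip c (h x)" for c h and x :: 'a
  have Hc: "continuous_on UNIV (H c h)" if "continuous_on UNIV h" "0 < c" for c h
    unfolding H_def ramp_def using that
    by (intro continuous_intros continuous_on_compose2[OF clip_props(4)[OF that(2)] that(1)]) auto
  have ramp_c: "continuous_on UNIV (\<lambda>x::'a. complex_of_real (ramp c x))" for c
    unfolding ramp_def by (intro continuous_intros)
  have [measurable]: "f \<in> borel_measurable lebesgue" using f by (rule sqint_meas)
  have rampm [measurable]: "(\<lambda>x::'a. complex_of_real (ramp c x)) \<in> borel_measurable lebesgue" for c
    by (rule measurable_completion) (simp add: borel_measurable_continuous_onI[OF ramp_c])
  have Hm: "H c f \<in> borel_measurable lebesgue" if "0 < c" for c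
    unfolding H_def using measurable_compose[OF sqint_meas[OF f] borel_measurable_continuous_onI[OF clip_props(4)[OF that]]]
    by measurable
  have ramp01: "0 \<le> ramp c x" "ramp c x \<le> 1" for c and x :: 'a by (auto simp: ramp_def)
  have "(\<lambda>n. l2 lebesgue (\<lambda>x. H (real (Suc n)) f x - f x)) \<longlonglongrightarrow> 0"
  proof (rule l2_dominated(1)[OF Hm f sqint_meas[OF f]])
    show "AE x in lebesgue. (\<lambda>n. H (real (Suc n)) f x) \<longlonglongrightarrow> f x"
    proof (rule AE_I2, rule tendsto_eventually)
      fix x
      obtain k where k: "norm x + cmod (f x) \<le> real k" using real_arch_simple by blast
      have "H (real (Suc n)) f x = f x" if "k \<le> n" for n
      proof -
        have "norm x \<le> real (Suc n)" "cmod (f x) \<le> real (Suc n)" using k that norm_ge_zero[of x] norm_ge_zero[of "f x"] by linarith+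
        then show ?thesis by (simp add: H_def clip_props(3) ramp_def del: of_nat_Suc)
      qed
      then show "\<forall>\<^sub>F n in sequentially. H (real (Suc n)) f x = f x" unfolding eventually_sequentially by blast
    qed
    show "AE x in lebesgue. cmod (H (real (Suc n)) f x) \<le> cmod (f x)" for n
    proof (rule AE_I2)
      fix x
      have "cmod (H (real (Suc n)) f x) \<le> 1 * cmod (f x)"
        unfolding H_def norm_mult using ramp01 by (intro mult_mono clip_props(2)) auto
      then show "cmod (H (real (Suc n)) f x) \<le> cmod (f x)" by simp
    qed
  qed simp
  from LIMSEQ_D[OF this, of "e/2"] e obtain n where n: "l2 lebesgue (\<lambda>x. H (real (Suc n)) f x - f x) < e / 2" by auto
  define c where "c = real (Suc n)"
  have c: "0 < c" by (simp add: c_def)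
  have Hz: "H c h x \<noteq> 0 \<Longrightarrow> norm x \<le> c + 1" for h and x :: 'a by (auto simp: H_def ramp_def max_def min_def split: if_splits)
  have Gs: "H c (G k) \<in> sqint lebesgue" for k by (rule compact_support_sqint(1)[OF Hc[OF N(2) c] Hz])
  have Hf: "H c f \<in> sqint lebesgue"
  proof (rule sqint_bound(1)[OF f Hm[OF c], where C=1])
    show "AE x in lebesgue. cmod (H c f x) \<le> 1 * cmod (f x)"
      unfolding H_def norm_mult using ramp01 c by (intro AE_I2 mult_mono clip_props(2)) auto
  qed
  have rs: "(\<lambda>x::'a. complex_of_real (c * ramp c x)) \<in> sqint lebesgue"
  proof (rule compact_support_sqint(1)[where r="c + 1"])
    show "continuous_on UNIV (\<lambda>x::'a. complex_of_real (c * ramp c x))" unfolding ramp_def by (intro continuous_intros)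
    show "complex_of_real (c * ramp c x) \<noteq> 0 \<Longrightarrow> norm x \<le> c + 1" for x :: 'a
      by (auto simp: ramp_def max_def min_def split: if_splits)
  qed
  have "(\<lambda>k. l2 lebesgue (\<lambda>x. H c (G k) x - H c f x)) \<longlonglongrightarrow> 0"
  proof (rule l2_dominated(1)[OF sqint_meas[OF Gs] rs sqint_meas[OF Hf]])
    show "AE x in lebesgue. (\<lambda>k. H c (G k) x) \<longlonglongrightarrow> H c f x"
      using AEN
    proof eventually_elim
      case (elim x)
      have "isCont (clip c) (f x)" using clip_props(4)[OF c] by (simp add: continuous_on_eq_continuous_at)
      then show ?case unfolding H_def by (intro tendsto_intros isCont_tendsto_compose[OF _ elim])
    qed
    show "AE x in lebesgue. cmod (H c (G k) x) \<le> cmod (complex_of_real (c * ramp c x))" for k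
    proof (rule AE_I2)
      fix x
      have "cmod (H c (G k) x) \<le> ramp c x * c"
        unfolding H_def norm_mult using ramp01[of c x] clip_props(1)[OF c] by (auto intro!: mult_mono)
      also have "\<dots> = cmod (complex_of_real (c * ramp c x))" using ramp01[of c x] c by (simp add: norm_mult abs_mult mult.commute)
      finally show "cmod (H c (G k) x) \<le> cmod (complex_of_real (c * ramp c x))" .
    qed
  qed
  from LIMSEQ_D[OF this, of "e/2"] e obtain k where k: "l2 lebesgue (\<lambda>x. H c (G k) x - H c f x) < e / 2" by auto
  have "l2 lebesgue (\<lambda>x. H c (G k) x - f x) < e"
    using L2m.nrm_triangle_diff[OF Gs[of k] Hf f] k n unfolding c_def[symmetric] by linarith
  show ?thesis
  proof (rule that[of "H c (G k)" "c + 1"])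
    show "continuous_on UNIV (H c (G k))" by (rule Hc[OF N(2) c])
    show "H c (G k) x \<noteq> 0 \<Longrightarrow> norm x \<le> c + 1" for x by (rule Hz)
    show "l2 lebesgue (\<lambda>x. H c (G k) x - f x) < e" by fact
  qed
qed

text \<open>
  Uniform convergence for continuous functions with compact support, extended by density and \<open>conv_young\<close>.
\<close>

theorem conv_tendsto:
  fixes f :: "'a::euclidean_space \<Rightarrow> complex"
  assumes f: "integrable lebesgue f" "f \<in> sqint lebesgue"
  shows "(\<lambda>n. l2 lebesgue (\<lambda>x. conv f (cmoll (meps n)) x - f x)) \<longlonglongrightarrow> 0"
proof (rule LIMSEQ_I)
  fix e :: real assume e: "0 < e"
  obtain g r where g: "continuous_on UNIV g" "\<And>x. g x \<noteq> 0 \<Longrightarrow> norm x \<le> r" "l2 lebesgue (\<lambda>x. g x - f x) < e/3"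
    using l2_dense_continuous[OF f(2), of "e/3"] e by auto
  note gi = compact_support_sqint[OF g(1,2)]
  obtain N where N: "\<And>n. N \<le> n \<Longrightarrow> l2 lebesgue (\<lambda>x. conv g (cmoll (meps n)) x - g x) < e/3"
    using LIMSEQ_D[OF conv_tendsto_continuous[OF g(1,2)], of "e/3"] e by auto
  show "\<exists>no. \<forall>n\<ge>no. norm (l2 lebesgue (\<lambda>x. conv f (cmoll (meps n)) x - f x) - 0) < e"
  proof (intro exI allI impI)
    fix n assume n: "N \<le> n"
    have p: "0 < meps n" by simp
    let ?m = "cmoll (meps n) :: 'a \<Rightarrow> complex"
    have cd: "conv (\<lambda>x. f x - g x) ?m = (\<lambda>x. conv f ?m x - conv g ?m x)"
      unfolding conv_def using conv_integrable[OF f(1) moll_test[OF p]] conv_integrable[OF gi(2) moll_test[OF p]]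
      by (auto simp: left_diff_distrib fun_eq_iff)
    have cf: "conv f ?m \<in> sqint lebesgue" and cg: "conv g ?m \<in> sqint lebesgue"
      using conv_young(1) f gi p by blast+
    have "l2 lebesgue (\<lambda>x. conv f ?m x - conv g ?m x) \<le> l2 lebesgue (\<lambda>x. f x - g x)"
      unfolding cd[symmetric] using f gi by (intro conv_young(2) L2m.diff p) auto
    also have "\<dots> = l2 lebesgue (\<lambda>x. g x - f x)" by (rule L2m.nrm_diff_commute[OF f(2) gi(1)])
    finally have 1: "l2 lebesgue (\<lambda>x. conv f ?m x - conv g ?m x) < e/3" using g(3) by linarith
    have "l2 lebesgue (\<lambda>x. conv f ?m x - f x) \<le> l2 lebesgue (\<lambda>x. conv f ?m x - conv g ?m x) + l2 lebesgue (\<lambda>x. conv g ?m x - f x)"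
      by (rule L2m.nrm_triangle_diff[OF cf cg f(2)])
    also have "l2 lebesgue (\<lambda>x. conv g ?m x - f x) \<le> l2 lebesgue (\<lambda>x. conv g ?m x - g x) + l2 lebesgue (\<lambda>x. g x - f x)"
      by (rule L2m.nrm_triangle_diff[OF cg gi(1) f(2)])
    finally have "l2 lebesgue (\<lambda>x. conv f ?m x - f x) < e" using 1 N[OF n] g(3) by linarith
    then show "norm (l2 lebesgue (\<lambda>x. conv f ?m x - f x) - 0) < e" by simp
  qed
qed

section \<open>The fundamental lemma of the calculus of variations\<close>

lemma conv_eq_lebesgue_on:
  fixes f :: "'a::euclidean_space \<Rightarrow> complex"
  assumes S: "S \<in> sets lebesgue" and T: "cball x e \<subseteq> T" "T \<subseteq> S" and e: "0 < e"
  shows "conv (zero_ext T f) (cmoll e) x = (LINT y|lebesgue_on S. f y * cmoll e (x - y))"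
  unfolding lebesgue_on_integral[OF S] conv_def
proof (rule Bochner_Integration.integral_cong[OF refl])
  fix y
  show "zero_ext T f y * cmoll e (x - y) = zero_ext S (\<lambda>y. f y * cmoll e (x - y)) y"
  proof (cases "y \<in> cball x e")
    case True then show ?thesis using T by (auto simp: zero_ext_def)
  next
    case False
    then have "moll e (x - y) = 0" using moll_nz[OF e, of "x - y"] by (auto simp: dist_norm)
    then show ?thesis by (simp add: zero_ext_def)
  qed
qed

lemma moll_test_at:
  assumes "0 < e" "cball x e \<subseteq> S" shows "(\<lambda>y. cmoll e (x - y)) \<in> test_functions S"
proof (rule test_functionsI[where K="cball x e"])
  show "smooth (\<lambda>y. cmoll e (x - y))" by (rule smooth_shift(3)[OF test_smooth[OF moll_test[OF assms(1)]]])
  show "cmoll e (x - y) \<noteq> 0 \<Longrightarrow> y \<in> cball x e" for y using moll_nz[OF assms(1), of "x - y"] by (auto simp: dist_norm)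
qed (use assms in auto)

text \<open>
  Test with translated mollifiers: the mollifications of \<open>g\<close> vanish at interior points, and a subsequence converges to \<open>g\<close> almost everywhere.
\<close>

theorem fundamental_lemma:
  fixes g :: "'a::euclidean_space \<Rightarrow> complex"
  assumes S: "open S" and g: "g \<in> L2 S"
    and z: "\<And>\<phi>. \<phi> \<in> test_functions S \<Longrightarrow> (LINT x|lebesgue_on S. g x * \<phi> x) = 0"
  shows "AE x in lebesgue_on S. g x = 0"
proof -
  have Sm: "S \<in> sets lebesgue" using S by auto
  have "AE x in lebesgue. x \<in> S \<inter> ball 0 (real R) \<longrightarrow> g x = 0" for R :: nat
  proof -
    define T where "T = S \<inter> ball 0 (real R)"
    have T: "open T" "bounded T" "T \<subseteq> S" "T \<in> sets lebesgue" using S by (auto simp: T_def intro: bounded_subset)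
    define h where "h = zero_ext T g"
    have gs: "zero_ext S g \<in> sqint lebesgue" using g sqint_lebesgue_on(1)[OF Sm] by (simp add: L2_sqint)
    have hs: "h \<in> sqint lebesgue"
    proof (rule sqint_bound(1)[OF gs, where C=1])
      have "h = (\<lambda>x. indicator T x * zero_ext S g x)" using T(3) by (auto simp: h_def zero_ext_def indicator_def fun_eq_iff)
      then show "h \<in> borel_measurable lebesgue" using sqint_meas[OF gs] T(4) by simp
      show "AE x in lebesgue. cmod (h x) \<le> 1 * cmod (zero_ext S g x)" using T(3) by (auto simp: h_def zero_ext_def)
    qed
    have hi: "integrable lebesgue h" by (rule sqint_integrable[OF hs T(2)]) (simp add: h_def zero_ext_def)
    have cs: "conv h (cmoll (meps n)) \<in> sqint lebesgue" for n by (rule conv_young(1)[OF hi hs]) simp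
    obtain r where r: "strict_mono r" "AE x in lebesgue. (\<lambda>n. conv h (cmoll (meps (r n))) x) \<longlonglongrightarrow> h x"
      by (rule l2_subseq_AE[OF cs hs conv_tendsto[OF hi hs]])
    show ?thesis using r(2)
    proof eventually_elim
      case (elim x)
      show ?case
      proof
        assume "x \<in> S \<inter> ball 0 (real R)"
        then have x: "x \<in> T" by (simp add: T_def)
        obtain d where d: "0 < d" "cball x d \<subseteq> T" using T(1) x open_contains_cball by blast
        obtain N where N: "1 / real (Suc N) < d" using d(1) nat_approx_posE by blast
        have "conv h (cmoll (meps (r n))) x = 0" if "N \<le> n" for n
        proof -
          have "n \<le> r n" using seq_suble[OF r(1)] .
          then have le: "meps (r n) \<le> d" using N that by (intro order_trans[OF _ less_imp_le[OF N]]) (simp add: frac_le)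
          then have c: "cball x (meps (r n)) \<subseteq> T" using d(2) by auto
          have "conv h (cmoll (meps (r n))) x = (LINT y|lebesgue_on S. g y * cmoll (meps (r n)) (x - y))"
            unfolding h_def by (rule conv_eq_lebesgue_on[OF Sm c T(3)]) simp
          also have "\<dots> = 0" using c T(3) by (intro z moll_test_at) auto
          finally show ?thesis .
        qed
        then have "(\<lambda>n. conv h (cmoll (meps (r n))) x) \<longlonglongrightarrow> 0"
          by (intro tendsto_eventually) (auto simp: eventually_sequentially)
        then have "h x = 0" using elim LIMSEQ_unique by blast
        then show "g x = 0" using x by (simp add: h_def zero_ext_def)
      qed
    qed
  qed
  then have "AE x in lebesgue. \<forall>R::nat. x \<in> S \<inter> ball 0 (real R) \<longrightarrow> g x = 0" unfolding AE_all_countable by blast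
  then have "AE x in lebesgue. x \<in> S \<longrightarrow> g x = 0"
  proof eventually_elim
    case (elim x)
    obtain R :: nat where "norm x < real R" using reals_Archimedean2 by blast
    then show ?case using elim by auto
  qed
  then show ?thesis by (simp add: AE_lebesgue_on[OF Sm])
qed

section \<open>The Laplacian and mollification\<close>

definition lap :: "('a::euclidean_space \<Rightarrow> complex) \<Rightarrow> 'a \<Rightarrow> complex" where
  "lap f x = (\<Sum>i\<in>Basis. pd i (pd i f) x)"

lemmas pd_unary = pd_rules(4,5,6,7,8,9,10,11)[where g="\<lambda>x. 0", OF _ smooth_closure(1)]

lemma test_lap: "f \<in> test_functions S \<Longrightarrow> lap f \<in> test_functions S"
  unfolding lap_def[abs_def] by (intro test_sum test_pd)

lemma lap_diff: "smooth f \<Longrightarrow> smooth g \<Longrightarrow> lap (\<lambda>x. f x - g x) = (\<lambda>x. lap f x - lap g x)"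
  unfolding lap_def[abs_def] by (simp add: pd_rules(2) smoothD(3) sum_subtractf cong: sum.cong)

lemma lap_reflect: "smooth \<phi> \<Longrightarrow> lap (\<lambda>y. \<phi> (x - y)) y = lap \<phi> (x - y)"
  unfolding lap_def
  by (intro sum.cong refl) (simp add: pd_unary(8) pd_unary(2)[OF smooth_shift(3)] smoothD(3))

lemma lap_conv:
  assumes f: "integrable lebesgue f" and \<phi>: "\<phi> \<in> test_functions S"
  shows "lap (conv f \<phi>) x = conv f (lap \<phi>) x"
proof -
  have p: "pd i (pd i (conv f \<phi>)) x = conv f (pd i (pd i \<phi>)) x" if "i \<in> Basis" for i
    unfolding pd_conv[OF f \<phi> that] pd_conv[OF f test_pd[OF \<phi> that] that] ..
  have "conv f (lap \<phi>) x = (LINT y|lebesgue. (\<Sum>i\<in>Basis. f y * pd i (pd i \<phi>) (x - y)))"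
    unfolding conv_def lap_def by (simp add: sum_distrib_left)
  also have "\<dots> = (\<Sum>i\<in>Basis. conv f (pd i (pd i \<phi>)) x)"
    unfolding conv_def by (intro Bochner_Integration.integral_sum conv_integrable[OF f test_pd[OF test_pd[OF \<phi>]]])
  finally show ?thesis unfolding lap_def using p by simp
qed

text \<open>
  The equation \<open>\<Delta>w = H\<close> on the whole space in the sense of distributions.
\<close>

definition wlap :: "('a::euclidean_space \<Rightarrow> complex) \<Rightarrow> ('a \<Rightarrow> complex) \<Rightarrow> bool" where
  "wlap w H \<longleftrightarrow> (\<forall>\<psi>\<in>test_functions UNIV.
     (LINT x|lebesgue. w x * lap \<psi> x) = (LINT x|lebesgue. H x * \<psi> x))"

lemma lap_conv_moll:
  assumes w: "wlap w H" and i: "integrable lebesgue w" and e: "0 < e"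
  shows "lap (conv w (cmoll e)) x = conv H (cmoll e) x"
proof -
  note m = moll_test[OF e]
  have "lap (conv w (cmoll e)) x = (LINT y|lebesgue. w y * lap (\<lambda>y. cmoll e (x - y)) y)"
    unfolding lap_conv[OF i m] lap_reflect[OF test_smooth[OF m]] conv_def ..
  also have "\<dots> = conv H (cmoll e) x"
    using w moll_test_at[OF e subset_UNIV, of x] unfolding wlap_def conv_def by blast
  finally show ?thesis .
qed

lemma conv_moll_test:
  assumes i: "integrable lebesgue w" and e: "0 < e" and s: "\<And>x. w x \<noteq> 0 \<Longrightarrow> norm x \<le> r"
  shows "conv w (cmoll e) \<in> test_functions UNIV"
proof (rule test_functionsI[where K="cball 0 (r + e)"])
  show "smooth (conv w (cmoll e))" by (rule smooth_conv[OF i moll_test[OF e]])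
  fix x assume nz: "conv w (cmoll e) x \<noteq> 0"
  show "x \<in> cball 0 (r + e)"
  proof (rule ccontr)
    assume "x \<notin> cball 0 (r + e)"
    then have x: "r + e < norm x" by simp
    have "w y * cmoll e (x - y) = 0" for y
    proof (cases "norm y \<le> r")
      case True
      then have "e \<le> norm (x - y)" using x norm_triangle_ineq2[of x y] by linarith
      then show ?thesis using moll_nz[OF e, of "x - y"] by auto
    qed (use s[of y] in auto)
    then have "conv w (cmoll e) x = 0" unfolding conv_def by (simp only: Bochner_Integration.integral_zero)
    then show False using nz by simp
  qed
qed auto

section \<open>Second derivatives are controlled by the Laplacian\<close>

lemma test_sqint: assumes "\<phi> \<in> test_functions S" shows "\<phi> \<in> sqint lebesgue"
proof -
  obtain K where K: "compact K" "\<And>x. \<phi> x \<noteq> 0 \<Longrightarrow> x \<in> K" using test_support[OF assms] by metis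
  obtain r where "\<forall>x\<in>K. norm x \<le> r" using compact_imp_bounded[OF K(1)] by (auto simp: bounded_iff)
  then show ?thesis using K(2) by (intro compact_support_sqint(1)[where r=r] test_continuous[OF assms]) blast
qed

lemma test_parts:
  assumes f: "f \<in> test_functions S" and g: "g \<in> test_functions T" and b: "b \<in> Basis"
  shows "(LINT x|lebesgue. pd b f x * g x) = - (LINT x|lebesgue. f x * pd b g x)"
proof -
  note [measurable] = test_borel[OF f] test_borel[OF g] test_borel[OF test_pd[OF f b]] test_borel[OF test_pd[OF g b]]
  show ?thesis using integration_by_parts[OF g test_smooth[OF f] b] by (simp add: integral_completion)
qed

lemma pd_cnj: "smooth f \<Longrightarrow> pd b (\<lambda>x. cnj (f x)) = (\<lambda>x. cnj (pd b f x))" by (rule pd_unary(1))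

text \<open>
  Integrating by parts twice turns \<open>\<integral> \<bar>\<Delta>f\<bar>\<^sup>2\<close> into the sum of the squared norms of all second derivatives.
\<close>

lemma l2_pd2_le_lap:
  assumes f: "f \<in> test_functions S" and i: "i \<in> Basis"
  shows "l2 lebesgue (pd i (pd i f)) \<le> l2 lebesgue (lap f)"
proof -
  note t = test_pd[OF test_pd[OF f]]
  have sm: "smooth f" using test_smooth[OF f] .
  have e: "(LINT x|lebesgue. pd a (pd a f) x * cnj (pd b (pd b f) x)) = of_real ((l2 lebesgue (pd a (pd b f)))\<^sup>2)"
    if a: "a \<in> Basis" and b: "b \<in> Basis" for a b
  proof -
    have c1: "pd a (pd b (pd b f)) = pd b (pd a (pd b f))" using pd_commute[OF test_pd[OF f b] a b] by auto
    have c2: "pd b (pd a f) = pd a (pd b f)" using pd_commute[OF f b a] by auto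
    have "(LINT x|lebesgue. pd a (pd a f) x * cnj (pd b (pd b f) x))
      = - (LINT x|lebesgue. pd a f x * cnj (pd b (pd a (pd b f)) x))"
      using test_parts[OF test_pd[OF f a] test_cnj[OF t[OF b b]] a] pd_cnj[OF test_smooth[OF t[OF b b]]] c1 by simp
    also have "\<dots> = (LINT x|lebesgue. pd b (pd a f) x * cnj (pd a (pd b f) x))"
      using test_parts[OF test_pd[OF f a] test_cnj[OF t[OF b a]] b] pd_cnj[OF test_smooth[OF t[OF b a]]] by simp
    also have "\<dots> = (LINT x|lebesgue. of_real ((cmod (pd a (pd b f) x))\<^sup>2))"
      unfolding c2 by (simp only: complex_norm_square)
    also have "\<dots> = of_real ((l2 lebesgue (pd a (pd b f)))\<^sup>2)" unfolding l2_sq by (rule integral_complex_of_real)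
    finally show ?thesis .
  qed
  have "(\<Sum>a\<in>Basis. \<Sum>b\<in>Basis. complex_of_real ((l2 lebesgue (pd a (pd b f)))\<^sup>2))
      = (LINT x|lebesgue. (\<Sum>a\<in>Basis. \<Sum>b\<in>Basis. pd a (pd a f) x * cnj (pd b (pd b f) x)))"
    using sqint_mult(2)[OF test_sqint[OF t] test_sqint[OF t]]
    by (subst Bochner_Integration.integral_sum; (intro sum.cong refl Bochner_Integration.integrable_sum)?) (auto simp: Bochner_Integration.integral_sum e)
  also have "\<dots> = (LINT x|lebesgue. lap f x * cnj (lap f x))" unfolding lap_def by (simp add: sum_product)
  also have "\<dots> = (LINT x|lebesgue. of_real ((cmod (lap f x))\<^sup>2))" by (simp only: complex_norm_square)
  also have "\<dots> = of_real ((l2 lebesgue (lap f))\<^sup>2)" unfolding l2_sq by (rule integral_complex_of_real)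
  finally have s: "(\<Sum>a\<in>Basis. \<Sum>b\<in>Basis. (l2 lebesgue (pd a (pd b f)))\<^sup>2) = (l2 lebesgue (lap f))\<^sup>2"
    by (simp only: of_real_sum[symmetric] of_real_eq_iff)
  have "(l2 lebesgue (pd i (pd i f)))\<^sup>2 \<le> (\<Sum>b\<in>Basis. (l2 lebesgue (pd i (pd b f)))\<^sup>2)"
    by (rule member_le_sum[OF i]) auto
  also have "\<dots> \<le> (\<Sum>a\<in>Basis. \<Sum>b\<in>Basis. (l2 lebesgue (pd a (pd b f)))\<^sup>2)"
    by (rule member_le_sum[OF i, where f="\<lambda>a. (\<Sum>b\<in>Basis. (l2 lebesgue (pd a (pd b f)))\<^sup>2)"]) (auto intro: sum_nonneg)
  finally show ?thesis unfolding s by (rule power2_le_imp_le) simp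
qed

lemma l2_pd_le_lap:
  assumes f: "f \<in> test_functions S" and i: "i \<in> Basis"
  shows "l2 lebesgue (pd i f) \<le> l2 lebesgue f + l2 lebesgue (lap f)"
proof -
  let ?d = "pd i f" and ?d2 = "pd i (pd i f)"
  have "of_real ((l2 lebesgue ?d)\<^sup>2) = (LINT x|lebesgue. ?d x * cnj (?d x))"
    unfolding l2_sq integral_complex_of_real[symmetric] by (simp only: complex_norm_square)
  also have "\<dots> = - (LINT x|lebesgue. f x * cnj (?d2 x))"
    using test_parts[OF f test_cnj[OF test_pd[OF f i]] i] pd_cnj[OF test_smooth[OF test_pd[OF f i]]] by simp
  finally have "(l2 lebesgue ?d)\<^sup>2 = cmod (LINT x|lebesgue. f x * cnj (?d2 x))"
    by (metis abs_of_nonneg norm_minus_cancel norm_of_real zero_le_power2)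
  also have "\<dots> \<le> l2 lebesgue f * l2 lebesgue (\<lambda>x. cnj (?d2 x))"
    by (rule l2_cs[OF test_sqint[OF f] sqint_cnj[OF test_sqint[OF test_pd[OF test_pd[OF f i] i]]]])
  also have "\<dots> \<le> l2 lebesgue f * l2 lebesgue (lap f)"
    unfolding l2_cnj by (intro mult_left_mono l2_pd2_le_lap[OF f i]) simp
  also have "\<dots> \<le> (l2 lebesgue f + l2 lebesgue (lap f))\<^sup>2" by (simp add: power2_sum)
  finally show ?thesis by (rule power2_le_imp_le) simp
qed

section \<open>Derivatives vanish on level sets\<close>

text \<open>The derivative of \<open>z * exp (- t * (cmod z)\<^sup>2)\<close> at \<open>z\<close> in the direction \<open>g\<close>.\<close>
definition damp :: "real \<Rightarrow> complex \<Rightarrow> complex \<Rightarrow> complex" where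
  "damp t z g = of_real (exp (- t * (cmod z)\<^sup>2)) * (g - of_real (t * (2 * Re (g * cnj z))) * z)"

lemma exp_bounds: assumes "0 \<le> (s::real)" shows "exp (- s) \<le> 1" "s * exp (- s) \<le> 1" "s * exp (- s\<^sup>2) \<le> 1"
proof -
  show "exp (- s) \<le> 1" using assms by simp
  have e: "u \<le> exp u" for u :: real using exp_ge_add_one_self[of u] by linarith
  show "s * exp (- s) \<le> 1" using e[of s] by (simp add: exp_minus field_simps)
  have "s \<le> 1 + s\<^sup>2" using sum_squares_bound[of s 1] assms by (simp add: power2_eq_square)
  then have "s \<le> exp (s\<^sup>2)" using exp_ge_add_one_self[of "s\<^sup>2"] by linarith
  then show "s * exp (- s\<^sup>2) \<le> 1" by (simp add: exp_minus field_simps)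
qed

text \<open>
  The bound does not depend on \<open>t\<close>, so the limit \<open>t \<rightarrow> \<infinity>\<close> can be taken under the integral.
\<close>

lemma damp_bound: assumes t: "0 \<le> t" shows "cmod (damp t z g) \<le> 3 * cmod g"
proof -
  let ?s = "t * (cmod z)\<^sup>2"
  have s: "0 \<le> ?s" using t by simp
  have "\<bar>Re (g * cnj z)\<bar> \<le> cmod g * cmod z" using abs_Re_le_cmod[of "g * cnj z"] by (simp add: norm_mult)
  then have "t * (2 * \<bar>Re (g * cnj z)\<bar>) * cmod z \<le> t * (2 * (cmod g * cmod z)) * cmod z" using t by (intro mult_right_mono mult_left_mono) auto
  then have "cmod (of_real (t * (2 * Re (g * cnj z))) * z) \<le> 2 * ?s * cmod g"
    unfolding norm_mult norm_of_real abs_mult using t by (simp add: power2_eq_square mult_ac del: times_complex.simps)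
  then have "cmod (g - of_real (t * (2 * Re (g * cnj z))) * z) \<le> cmod g + 2 * ?s * cmod g"
    using norm_triangle_ineq4[of g "of_real (t * (2 * Re (g * cnj z))) * z"] by linarith
  then have "cmod (damp t z g) \<le> exp (- ?s) * (cmod g + 2 * ?s * cmod g)"
    unfolding damp_def norm_mult by (intro mult_mono) auto
  also have "\<dots> = (exp (- ?s) + 2 * (?s * exp (- ?s))) * cmod g" by (simp add: algebra_simps)
  also have "\<dots> \<le> 3 * cmod g" using exp_bounds(1)[OF s] exp_bounds(2)[OF s] by (intro mult_right_mono norm_ge_zero) linarith
  finally show ?thesis .
qed

lemma damp_diff: "damp t z g - damp t z h = damp t z (g - h)"
  by (simp add: damp_def algebra_simps)

text \<open>
  As \<open>t\<close> grows, the derivative of the damped function concentrates on the zero set of the function.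
\<close>

lemma damp_tendsto: "(\<lambda>n. damp (real n) z g) \<longlonglongrightarrow> (if z = 0 then g else 0)"
proof (cases "z = 0")
  case False
  define a where "a = (cmod z)\<^sup>2"
  have a: "0 < a" using False by (simp add: a_def)
  have "(\<lambda>n. exp (- real n * a)) \<longlonglongrightarrow> 0" "(\<lambda>n. real n * exp (- real n * a)) \<longlonglongrightarrow> 0"
    using a by real_asymp+
  then have "(\<lambda>n. of_real (exp (- real n * a)) * g - of_real (real n * exp (- real n * a)) * (of_real (2 * Re (g * cnj z)) * z)) \<longlonglongrightarrow> of_real 0 * g - of_real 0 * (of_real (2 * Re (g * cnj z)) * z)"
    by (intro tendsto_diff tendsto_mult_right tendsto_of_real)
  then show ?thesis using False unfolding damp_def a_def by (simp add: algebra_simps)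
qed (simp add: damp_def)

lemma continuous_damp: "continuous_on UNIV (\<lambda>z. damp t z g)"
  unfolding damp_def by (intro continuous_intros)

lemma damp_measurable [measurable]:
  assumes [measurable]: "f \<in> borel_measurable M" "g \<in> borel_measurable M"
  shows "(\<lambda>x. damp t (f x) (g x)) \<in> borel_measurable M"
  unfolding damp_def by measurable

text \<open>
  The damped function \<open>w * exp (- t * (cmod w)\<^sup>2)\<close> is bounded by \<open>1 / sqrt t\<close>, so after integration by parts the pairing is small for large \<open>t\<close>.
\<close>

lemma damp_parts:
  assumes w: "w \<in> test_functions S" and p: "\<phi> \<in> test_functions T" and i: "i \<in> Basis" and t: "0 < t"
  shows "cmod (LINT x|lebesgue. damp t (w x) (pd i w x) * \<phi> x) \<le> (LINT x|lebesgue. cmod (pd i \<phi> x)) / sqrt t"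
proof -
  define q where "q x = complex_of_real (- t) * (w x * cnj (w x))" for x
  define b where "b x = exp (q x)" for x
  have sw: "smooth w" using test_smooth[OF w] .
  have sq: "smooth q" unfolding q_def[abs_def] using sw by (intro smooth_intros)
  have sb: "smooth b" unfolding b_def[abs_def] by (rule smooth_exp[OF sq])
  have q: "q x = of_real (- t * (cmod (w x))\<^sup>2)" for x unfolding q_def by (simp only: of_real_mult complex_norm_square)
  have b: "b x = of_real (exp (- t * (cmod (w x))\<^sup>2))" for x unfolding b_def q by (simp only: exp_of_real)
  have pq: "pd i q = (\<lambda>x. of_real (- t) * (pd i w x * cnj (w x) + w x * cnj (pd i w x)))"
    unfolding q_def[abs_def] pd_unary(5)[OF smooth_closure(4)[OF sw smooth_closure(5)[OF sw]]]
      pd_rules(3)[OF sw smooth_closure(5)[OF sw]] pd_cnj[OF sw] ..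
  have re: "g * cnj z + z * cnj g = of_real (2 * Re (g * cnj z))" for g z
    by (simp add: complex_eq_iff)
  have wb: "(\<lambda>x. w x * b x) \<in> test_functions S" by (rule test_mult(1)[OF w sb])
  have d: "pd i (\<lambda>x. w x * b x) x = damp t (w x) (pd i w x)" for x
  proof -
    have "pd i b x = pd i q x * b x" unfolding b_def[abs_def] smooth_exp(2)[OF sq] ..
    then have "pd i (\<lambda>x. w x * b x) x = pd i w x * b x + w x * (pd i q x * b x)" unfolding pd_rules(3)[OF sw sb] by simp
    also have "\<dots> = damp t (w x) (pd i w x)" unfolding pq re b damp_def by (simp add: algebra_simps del: times_complex.simps)
    finally show ?thesis .
  qed
  have "(LINT x|lebesgue. damp t (w x) (pd i w x) * \<phi> x) = - (LINT x|lebesgue. w x * b x * pd i \<phi> x)"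
    using test_parts[OF wb p i] unfolding d .
  then have "cmod (LINT x|lebesgue. damp t (w x) (pd i w x) * \<phi> x) = cmod (LINT x|lebesgue. w x * b x * pd i \<phi> x)" by simp
  also have "\<dots> \<le> (LINT x|lebesgue. cmod (pd i \<phi> x) / sqrt t)"
  proof (rule Bochner_Integration.integral_norm_bound_integral)
    show "integrable lebesgue (\<lambda>x. w x * b x * pd i \<phi> x)"
      by (rule test_integrable(2)[OF test_mult(1)[OF wb smoothD(3)[OF test_smooth[OF p] i]]])
    show "integrable lebesgue (\<lambda>x. cmod (pd i \<phi> x) / sqrt t)" using test_integrable(2)[OF test_pd[OF p i]] by simp
    fix x
    have "cmod (w x * b x) * sqrt t = (sqrt t * cmod (w x)) * exp (- (sqrt t * cmod (w x))\<^sup>2)"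
      unfolding b norm_mult using t by (simp add: power_mult_distrib)
    also have "\<dots> \<le> 1" by (rule exp_bounds(3)) (use t in simp)
    finally have "cmod (w x * b x) \<le> 1 / sqrt t" using t by (simp add: field_simps)
    then have "cmod (w x * b x) * cmod (pd i \<phi> x) \<le> 1 / sqrt t * cmod (pd i \<phi> x)" by (rule mult_right_mono) simp
    then show "cmod (w x * b x * pd i \<phi> x) \<le> cmod (pd i \<phi> x) / sqrt t" by (simp add: norm_mult)
  qed
  finally show ?thesis by simp
qed

text \<open>
  The pairing of a test function with the derivative of \<open>w * exp (- t * (cmod w)\<^sup>2)\<close> tends to zero by \<open>damp_parts\<close>, and to
  the pairing with \<open>a\<close> restricted to \<open>{w = 0}\<close> by \<open>damp_tendsto\<close>. Here \<open>a\<close> is the weak derivative of \<open>w\<close>, given as the limit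
  of derivatives of approximating test functions.
\<close>

lemma derivative_zero_on_zero_set:
  fixes w a :: "'a::euclidean_space \<Rightarrow> complex"
  assumes F: "\<And>n. F n \<in> test_functions UNIV" and i: "i \<in> Basis"
    and w: "w \<in> sqint lebesgue" "(\<lambda>n. l2 lebesgue (\<lambda>x. F n x - w x)) \<longlonglongrightarrow> 0"
    and a: "a \<in> sqint lebesgue" "(\<lambda>n. l2 lebesgue (\<lambda>x. pd i (F n) x - a x)) \<longlonglongrightarrow> 0"
  shows "AE x in lebesgue. w x = 0 \<longrightarrow> a x = 0"
proof -
  note Fi = test_pd[OF F i]
  note [measurable] = sqint_meas[OF w(1)] sqint_meas[OF a(1)] sqint_meas[OF test_sqint[OF F]] sqint_meas[OF test_sqint[OF Fi]]
  obtain r where r: "strict_mono r" "AE x in lebesgue. (\<lambda>n. F (r n) x) \<longlonglongrightarrow> w x"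
    using l2_subseq_AE[OF test_sqint[OF F] w] by metis
  have ar: "(\<lambda>n. l2 lebesgue (\<lambda>x. pd i (F (r n)) x - a x)) \<longlonglongrightarrow> 0"
    using LIMSEQ_subseq_LIMSEQ[OF a(2) r(1)] by (simp add: comp_def)
  define z where "z x = (if w x = 0 then a x else 0)" for x
  have zm[measurable]: "z \<in> borel_measurable lebesgue" unfolding z_def[abs_def] by measurable
  have zs: "z \<in> sqint lebesgue" by (rule sqint_bound(1)[OF a(1) zm, where C=1]) (auto simp: z_def)
  have "(LINT x|lebesgue. z x * \<phi> x) = 0" if p: "\<phi> \<in> test_functions UNIV" for \<phi> :: "'a \<Rightarrow> complex"
  proof -
    note ps = test_sqint[OF p]
    note [measurable] = sqint_meas[OF ps]
    define C where "C = (LINT x|lebesgue. cmod (pd i \<phi> x))"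
    have ia: "integrable lebesgue (\<lambda>x. 3 * (cmod (a x) * cmod (\<phi> x)))" using sqint_mult_abs[OF a(1) ps] by simp
    have B: "cmod (LINT x|lebesgue. damp t (w x) (a x) * \<phi> x) \<le> C / sqrt t" if t: "0 < t" for t
    proof -
      have t0: "0 \<le> t" using t by simp
      have bd: "cmod (damp t u v * y) \<le> 3 * (cmod v * cmod y)" for u v y
        using mult_right_mono[OF damp_bound[OF t0, of u v] norm_ge_zero[of y]] by (simp add: norm_mult)
      have int: "integrable lebesgue (\<lambda>x. damp t (u x) (v x) * \<phi> x)"
        if [measurable]: "u \<in> borel_measurable lebesgue" and v: "v \<in> sqint lebesgue" for u v
      proof (rule Bochner_Integration.integrable_bound[where f="\<lambda>x. 3 * (cmod (v x) * cmod (\<phi> x))"])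
        note [measurable] = sqint_meas[OF v]
        show "(\<lambda>x. damp t (u x) (v x) * \<phi> x) \<in> borel_measurable lebesgue" by measurable
        show "integrable lebesgue (\<lambda>x. 3 * (cmod (v x) * cmod (\<phi> x)))" using sqint_mult_abs[OF v ps] by simp
      qed (use bd in auto)
      have l1: "(\<lambda>n. LINT x|lebesgue. damp t (F (r n) x) (a x) * \<phi> x) \<longlonglongrightarrow> (LINT x|lebesgue. damp t (w x) (a x) * \<phi> x)"
      proof (rule integral_dominated_convergence[OF _ _ ia])
        show "AE x in lebesgue. (\<lambda>n. damp t (F (r n) x) (a x) * \<phi> x) \<longlonglongrightarrow> damp t (w x) (a x) * \<phi> x"
          using r(2)
        proof eventually_elim
          case (elim x)
          have "(\<lambda>n. damp t (F (r n) x) (a x)) \<longlonglongrightarrow> damp t (w x) (a x)"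
            by (rule continuous_on_tendsto_compose[OF continuous_damp elim]) auto
          then show ?case by (intro tendsto_mult_right)
        qed
      qed (use bd in auto)
      have l2': "(\<lambda>n. (LINT x|lebesgue. damp t (F (r n) x) (pd i (F (r n)) x) * \<phi> x) - (LINT x|lebesgue. damp t (F (r n) x) (a x) * \<phi> x)) \<longlonglongrightarrow> 0"
      proof (rule Lim_null_comparison[where g="\<lambda>n. 3 * (l2 lebesgue (\<lambda>x. pd i (F (r n)) x - a x) * l2 lebesgue \<phi>)"])
        show "(\<lambda>n. 3 * (l2 lebesgue (\<lambda>x. pd i (F (r n)) x - a x) * l2 lebesgue \<phi>)) \<longlonglongrightarrow> 0"
          by (intro tendsto_mult_right_zero tendsto_mult_left_zero ar)
        have "cmod ((LINT x|lebesgue. damp t (F n x) (pd i (F n) x) * \<phi> x) - (LINT x|lebesgue. damp t (F n x) (a x) * \<phi> x))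
          \<le> 3 * (l2 lebesgue (\<lambda>x. pd i (F n) x - a x) * l2 lebesgue \<phi>)" for n
        proof -
          have ds: "(\<lambda>x. pd i (F n) x - a x) \<in> sqint lebesgue" by (rule L2m.diff[OF test_sqint[OF Fi] a(1)])
          have "(LINT x|lebesgue. damp t (F n x) (pd i (F n) x) * \<phi> x) - (LINT x|lebesgue. damp t (F n x) (a x) * \<phi> x)
             = (LINT x|lebesgue. damp t (F n x) (pd i (F n) x) * \<phi> x - damp t (F n x) (a x) * \<phi> x)"
            by (rule Bochner_Integration.integral_diff[symmetric]; intro int test_sqint[OF Fi] a(1) sqint_meas[OF test_sqint[OF F]])
          also have "\<dots> = (LINT x|lebesgue. damp t (F n x) (pd i (F n) x - a x) * \<phi> x)"
            by (simp only: left_diff_distrib[symmetric] damp_diff)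
          also have "cmod \<dots> \<le> (LINT x|lebesgue. 3 * (cmod (pd i (F n) x - a x) * cmod (\<phi> x)))"
            by (rule Bochner_Integration.integral_norm_bound_integral[OF int[OF sqint_meas[OF test_sqint[OF F]] ds]])
              (use sqint_mult_abs[OF ds ps] bd in auto)
          also have "\<dots> \<le> 3 * (l2 lebesgue (\<lambda>x. pd i (F n) x - a x) * l2 lebesgue \<phi>)"
            using l2_cs_abs[OF ds ps] by simp
          finally show ?thesis .
        qed
        then show "\<forall>\<^sub>F n in sequentially. norm ((LINT x|lebesgue. damp t (F (r n) x) (pd i (F (r n)) x) * \<phi> x) - (LINT x|lebesgue. damp t (F (r n) x) (a x) * \<phi> x))
          \<le> 3 * (l2 lebesgue (\<lambda>x. pd i (F (r n)) x - a x) * l2 lebesgue \<phi>)" by (intro always_eventually allI)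
      qed
      have "(\<lambda>n. LINT x|lebesgue. damp t (F (r n) x) (pd i (F (r n)) x) * \<phi> x) \<longlonglongrightarrow> (LINT x|lebesgue. damp t (w x) (a x) * \<phi> x)"
        using tendsto_add[OF l2' l1] by simp
      then show ?thesis
        by (rule LIMSEQ_le_const2[OF tendsto_norm]) (use damp_parts[OF F p i t] in \<open>auto simp: C_def\<close>)
    qed
    have "(\<lambda>n. LINT x|lebesgue. damp (real n) (w x) (a x) * \<phi> x) \<longlonglongrightarrow> (LINT x|lebesgue. z x * \<phi> x)"
    proof (rule integral_dominated_convergence[OF _ _ ia])
      show "AE x in lebesgue. (\<lambda>n. damp (real n) (w x) (a x) * \<phi> x) \<longlonglongrightarrow> z x * \<phi> x"
        unfolding z_def by (intro AE_I2 tendsto_mult_right damp_tendsto)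
      show "AE x in lebesgue. norm (damp (real n) (w x) (a x) * \<phi> x) \<le> 3 * (cmod (a x) * cmod (\<phi> x))" for n
        using mult_right_mono[OF damp_bound norm_ge_zero, of "real n"] by (intro AE_I2) (simp add: norm_mult mult.assoc)
    qed auto
    moreover have "(\<lambda>n. LINT x|lebesgue. damp (real n) (w x) (a x) * \<phi> x) \<longlonglongrightarrow> 0"
    proof (rule Lim_null_comparison[where g="\<lambda>n. C / sqrt (real n)"])
      show "\<forall>\<^sub>F n in sequentially. norm (LINT x|lebesgue. damp (real n) (w x) (a x) * \<phi> x) \<le> C / sqrt (real n)"
        using eventually_gt_at_top[of 0] by eventually_elim (rule B, simp)
      show "(\<lambda>n. C / sqrt (real n)) \<longlonglongrightarrow> 0" by real_asymp
    qed
    ultimately show ?thesis by (rule LIMSEQ_unique)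
  qed
  then have "AE x in lebesgue_on UNIV. z x = 0"
    using zs by (intro fundamental_lemma) (auto simp: L2_sqint lebesgue_on_UNIV_eq)
  then have "AE x in lebesgue. x \<in> UNIV \<longrightarrow> z x = 0" by (subst (asm) AE_lebesgue_on) auto
  then show ?thesis by eventually_elim (simp add: z_def split: if_splits)
qed

text \<open>
  Since \<open>H\<close> is square integrable, the first and second derivatives of the mollifications of \<open>w\<close> are Cauchy sequences. Their
  limits vanish on \<open>{w = 0}\<close> by two applications of \<open>derivative_zero_on_zero_set\<close>, and \<open>H\<close> is the sum of the pure second ones.
\<close>

theorem laplacian_zero_on_zero_set:
  fixes w H :: "'a::euclidean_space \<Rightarrow> complex"
  assumes w: "w \<in> sqint lebesgue" "\<And>x. w x \<noteq> 0 \<Longrightarrow> norm x \<le> r"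
    and H: "H \<in> sqint lebesgue" "\<And>x. H x \<noteq> 0 \<Longrightarrow> norm x \<le> r" and wl: "wlap w H"
  shows "AE x in lebesgue. w x = 0 \<longrightarrow> H x = 0"
proof -
  have iw: "integrable lebesgue w" by (rule sqint_integrable[OF w(1), of "cball 0 r"]) (use w(2) in auto)
  have iH: "integrable lebesgue H" by (rule sqint_integrable[OF H(1), of "cball 0 r"]) (use H(2) in auto)
  define F where "F n = conv w (cmoll (meps n))" for n
  have ep: "0 < meps n" for n by simp
  have F: "F n \<in> test_functions UNIV" for n unfolding F_def by (rule conv_moll_test[OF iw ep w(2)])
  have lF: "lap (F n) = conv H (cmoll (meps n))" for n unfolding F_def using lap_conv_moll[OF wl iw ep] by auto
  have Fw: "(\<lambda>n. l2 lebesgue (\<lambda>x. F n x - w x)) \<longlonglongrightarrow> 0" unfolding F_def by (rule conv_tendsto[OF iw w(1)])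
  have FH: "(\<lambda>n. l2 lebesgue (\<lambda>x. lap (F n) x - H x)) \<longlonglongrightarrow> 0" unfolding lF by (rule conv_tendsto[OF iH H(1)])
  define E where "E n = l2 lebesgue (\<lambda>x. F n x - w x) + l2 lebesgue (\<lambda>x. lap (F n) x - H x)" for n
  have E0: "E \<longlonglongrightarrow> 0" unfolding E_def using tendsto_add[OF Fw FH] by simp
  have Ed: "l2 lebesgue (\<lambda>x. F m x - F n x) + l2 lebesgue (lap (\<lambda>x. F m x - F n x)) \<le> E m + E n" for m n
    using L2m.nrm_triangle_diff[OF test_sqint[OF F] w(1) test_sqint[OF F], of m n] L2m.nrm_diff_commute[OF test_sqint[OF F] w(1), of n]
      L2m.nrm_triangle_diff[OF test_sqint[OF test_lap[OF F]] H(1) test_sqint[OF test_lap[OF F]], of m n] L2m.nrm_diff_commute[OF test_sqint[OF test_lap[OF F]] H(1), of n]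
    unfolding lap_diff[OF test_smooth[OF F] test_smooth[OF F]] E_def by linarith
  have lim: "\<exists>f\<in>sqint lebesgue. (\<lambda>n. l2 lebesgue (\<lambda>x. D n x - f x)) \<longlonglongrightarrow> 0"
    if D: "\<And>n. D n \<in> sqint lebesgue" and b: "\<And>m n. l2 lebesgue (\<lambda>x. D m x - D n x) \<le> E m + E n" for D :: "nat \<Rightarrow> 'a \<Rightarrow> complex"
  proof (rule l2_complete[OF D])
    fix e :: real assume e: "0 < e"
    obtain N where N: "\<forall>n\<ge>N. norm (E n - 0) < e / 2" using LIMSEQ_D[OF E0, of "e/2"] e by auto
    have "l2 lebesgue (\<lambda>x. D m x - D n x) < e" if "N \<le> m" "N \<le> n" for m n
    proof -
      have "\<bar>E m\<bar> < e / 2" "\<bar>E n\<bar> < e / 2" using N that by auto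
      then show ?thesis using b[of m n] by linarith
    qed
    then show "\<exists>N. \<forall>m\<ge>N. \<forall>n\<ge>N. l2 lebesgue (\<lambda>x. D m x - D n x) < e" by blast
  qed
  have z: "\<exists>b\<in>sqint lebesgue. (\<lambda>n. l2 lebesgue (\<lambda>x. pd i (pd i (F n)) x - b x)) \<longlonglongrightarrow> 0 \<and> (AE x in lebesgue. w x = 0 \<longrightarrow> b x = 0)"
    if i: "i \<in> Basis" for i
  proof -
    note F1 = test_pd[OF F i] and F2 = test_pd[OF test_pd[OF F i] i]
    have sm: "smooth (F n)" for n using test_smooth[OF F] .
    have pdd: "pd i (\<lambda>x. F m x - F n x) = (\<lambda>x. pd i (F m) x - pd i (F n) x)" for m n by (rule pd_rules(2)[OF sm sm])
    have pdd2: "pd i (pd i (\<lambda>x. F m x - F n x)) = (\<lambda>x. pd i (pd i (F m)) x - pd i (pd i (F n)) x)" for m n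
      unfolding pdd by (rule pd_rules(2)[OF smoothD(3)[OF sm i] smoothD(3)[OF sm i]])
    obtain a where a: "a \<in> sqint lebesgue" "(\<lambda>n. l2 lebesgue (\<lambda>x. pd i (F n) x - a x)) \<longlonglongrightarrow> 0"
      using lim[of "\<lambda>n. pd i (F n)", OF test_sqint[OF F1]] order_trans[OF l2_pd_le_lap[OF test_diff[OF F F] i] Ed] unfolding pdd by blast
    have b2: "l2 lebesgue (\<lambda>x. pd i (pd i (F m)) x - pd i (pd i (F n)) x) \<le> E m + E n" for m n
      using l2_pd2_le_lap[OF test_diff[OF F F] i, of m n] Ed[of m n] l2_nonneg[of lebesgue "\<lambda>x. F m x - F n x"] unfolding pdd2 by linarith
    obtain b where b: "b \<in> sqint lebesgue" "(\<lambda>n. l2 lebesgue (\<lambda>x. pd i (pd i (F n)) x - b x)) \<longlonglongrightarrow> 0"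
      using lim[of "\<lambda>n. pd i (pd i (F n))", OF test_sqint[OF F2] b2] by blast
    have "AE x in lebesgue. w x = 0 \<longrightarrow> a x = 0" by (rule derivative_zero_on_zero_set[OF F i w(1) Fw a])
    moreover have "AE x in lebesgue. a x = 0 \<longrightarrow> b x = 0" by (rule derivative_zero_on_zero_set[OF F1 i a b])
    ultimately have "AE x in lebesgue. w x = 0 \<longrightarrow> b x = 0" by eventually_elim blast
    then show ?thesis using b by blast
  qed
  obtain b where b: "\<And>i. i \<in> Basis \<Longrightarrow> b i \<in> sqint lebesgue" "\<And>i. i \<in> Basis \<Longrightarrow> (\<lambda>n. l2 lebesgue (\<lambda>x. pd i (pd i (F n)) x - b i x)) \<longlonglongrightarrow> 0"
    "\<And>i. i \<in> Basis \<Longrightarrow> AE x in lebesgue. w x = 0 \<longrightarrow> b i x = 0"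
  proof -
    from z have "\<forall>i\<in>Basis. \<exists>b. b \<in> sqint lebesgue \<and> (\<lambda>n. l2 lebesgue (\<lambda>x. pd i (pd i (F n)) x - b x)) \<longlonglongrightarrow> 0 \<and> (AE x in lebesgue. w x = 0 \<longrightarrow> b x = 0)"
      by blast
    from bchoice[OF this] show ?thesis using that by blast
  qed
  have sum: "(\<lambda>x. \<Sum>i\<in>I. f i x) \<in> sqint lebesgue" "l2 lebesgue (\<lambda>x. \<Sum>i\<in>I. f i x) \<le> (\<Sum>i\<in>I. l2 lebesgue (f i))"
    if "finite I" "\<And>i. i \<in> I \<Longrightarrow> f i \<in> sqint lebesgue" for I and f :: "'a \<Rightarrow> 'a \<Rightarrow> complex"
  proof -
    have "(\<lambda>x. \<Sum>i\<in>I. f i x) \<in> sqint lebesgue \<and> l2 lebesgue (\<lambda>x. \<Sum>i\<in>I. f i x) \<le> (\<Sum>i\<in>I. l2 lebesgue (f i))"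
      using that
    proof (induction I rule: finite_induct)
      case (insert j I)
      then have s: "f j \<in> sqint lebesgue" "(\<lambda>x. \<Sum>i\<in>I. f i x) \<in> sqint lebesgue" by auto
      have "l2 lebesgue (\<lambda>x. f j x + (\<Sum>i\<in>I. f i x)) \<le> l2 lebesgue (f j) + (\<Sum>i\<in>I. l2 lebesgue (f i))"
        using L2m.nrm_triangle[OF s] insert.IH insert.prems by force
      then show ?case using L2m.add[OF s] insert.hyps by simp
    qed (simp add: l2_def)
    then show "(\<lambda>x. \<Sum>i\<in>I. f i x) \<in> sqint lebesgue" "l2 lebesgue (\<lambda>x. \<Sum>i\<in>I. f i x) \<le> (\<Sum>i\<in>I. l2 lebesgue (f i))" by auto
  qed
  define B where "B x = (\<Sum>i\<in>Basis. b i x)" for x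
  have Bs: "B \<in> sqint lebesgue" unfolding B_def[abs_def] by (rule sum(1)) (use b in auto)
  have "(\<lambda>n. l2 lebesgue (\<lambda>x. lap (F n) x - B x)) \<longlonglongrightarrow> 0"
  proof (rule Lim_null_comparison[where g="\<lambda>n. \<Sum>i\<in>Basis. l2 lebesgue (\<lambda>x. pd i (pd i (F n)) x - b i x)"])
    show "(\<lambda>n. \<Sum>i\<in>Basis. l2 lebesgue (\<lambda>x. pd i (pd i (F n)) x - b i x)) \<longlonglongrightarrow> 0" by (rule tendsto_null_sum) (rule b)
    have "l2 lebesgue (\<lambda>x. lap (F n) x - B x) \<le> (\<Sum>i\<in>Basis. l2 lebesgue (\<lambda>x. pd i (pd i (F n)) x - b i x))" for n
      unfolding lap_def B_def sum_subtractf[symmetric]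
      by (rule sum(2)[OF finite_Basis L2m.diff[OF test_sqint[OF test_pd[OF test_pd[OF F]]] b(1)]])
    then show "\<forall>\<^sub>F n in sequentially. norm (l2 lebesgue (\<lambda>x. lap (F n) x - B x)) \<le> (\<Sum>i\<in>Basis. l2 lebesgue (\<lambda>x. pd i (pd i (F n)) x - b i x))"
      by (intro always_eventually allI) simp
  qed
  then have "(\<lambda>n. l2 lebesgue (\<lambda>x. lap (F n) x - H x) + l2 lebesgue (\<lambda>x. lap (F n) x - B x)) \<longlonglongrightarrow> 0" using tendsto_add[OF FH] by simp
  moreover have "l2 lebesgue (\<lambda>x. H x - B x) \<le> l2 lebesgue (\<lambda>x. lap (F n) x - H x) + l2 lebesgue (\<lambda>x. lap (F n) x - B x)" for n
    using L2m.nrm_triangle_diff[OF H(1) test_sqint[OF test_lap[OF F]] Bs, of n] L2m.nrm_diff_commute[OF H(1) test_sqint[OF test_lap[OF F]], of n] by simp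
  ultimately have "l2 lebesgue (\<lambda>x. H x - B x) \<le> 0" by (intro LIMSEQ_le_const) auto
  then have "AE x in lebesgue. H x - B x = 0" using l2_zero_iff[OF L2m.diff[OF H(1) Bs]] l2_nonneg[of lebesgue "\<lambda>x. H x - B x"] by simp
  moreover have "AE x in lebesgue. \<forall>i\<in>Basis. w x = 0 \<longrightarrow> b i x = 0" using b(3) by (intro AE_finite_allI) auto
  ultimately show ?thesis by eventually_elim (simp add: B_def)
qed

section \<open>A potential representation\<close>

text \<open>
  The profile with \<open>\<nabla> (bump 1) y = - rim y *\<^sub>R y\<close>. This relation turns the radial derivative of a function, averaged
  against \<open>rim\<close>, into its Laplacian averaged against \<open>bump 1\<close>.
\<close>

definition rim :: "'a::euclidean_space \<Rightarrow> real" where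
  "rim y = 2 * flat 2 (1 - (norm y)\<^sup>2)"

lemma rim_nonneg: "0 \<le> rim y" by (simp add: rim_def flat_def)

lemma rim_pos_iff: "0 < rim y \<longleftrightarrow> norm y < 1"
proof -
  have "0 < 1 - (norm y)\<^sup>2 \<longleftrightarrow> norm y < 1"
    using power_strict_mono[of "norm y" 1 2] power2_less_imp_less[of "norm y" 1] by auto
  then show ?thesis unfolding rim_def flat_def by auto
qed

lemma rim_test: "(\<lambda>y. complex_of_real (rim y)) \<in> test_functions UNIV"
proof (rule test_functionsI[where K="cball 0 1"])
  have "smooth (\<lambda>y::'a. complex_of_real (flat 2 (1 - (norm y)\<^sup>2)))"
    by (rule smooth_flat[where p="\<lambda>x. 1 - of_real ((norm x)\<^sup>2)"]) (auto intro!: smooth_intros simp del: of_real_power)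
  then have "smooth (\<lambda>y::'a. 2 * complex_of_real (flat 2 (1 - (norm y)\<^sup>2)))" by (intro smooth_intros)
  then show "smooth (\<lambda>y::'a. complex_of_real (rim y))" unfolding rim_def by simp
  show "complex_of_real (rim y) \<noteq> 0 \<Longrightarrow> y \<in> cball 0 1" for y :: 'a
    using rim_pos_iff[of y] rim_nonneg[of y] by (cases "norm y < 1") auto
qed auto

lemma rim_integral_pos: "0 < (LINT x|lborel. rim (x::'a::euclidean_space))"
proof -
  have i: "integrable lborel (rim :: 'a \<Rightarrow> real)"
    using integrable_Re[OF test_integrable(1)[OF rim_test]] by simp
  have "(LINT x|lborel. rim (x::'a)) \<noteq> 0"
  proof
    assume "(LINT x|lborel. rim (x::'a)) = 0"
    then have "AE x in lborel. rim (x::'a) = 0"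
      using integral_nonneg_eq_0_iff_AE[OF i] rim_nonneg by auto
    then have "AE x in lborel. (x::'a) \<notin> ball 0 1"
      by (rule eventually_mono) (use rim_pos_iff in force)
    then have "emeasure lborel (ball (0::'a) 1) = 0"
      by (subst (asm) AE_iff_measurable[where N="ball 0 1"]) auto
    then show False using emeasure_lborel_ball_finite content_ball_pos[of 1 "0::'a"] by (simp add: measure_def)
  qed
  moreover have "0 \<le> (LINT x|lborel. rim (x::'a))" using rim_nonneg by (intro Bochner_Integration.integral_nonneg) auto
  ultimately show ?thesis by linarith
qed

abbreviation cbump :: "'a::euclidean_space \<Rightarrow> complex" where "cbump \<equiv> \<lambda>y. complex_of_real (bump 1 y)"

lemma pd_bump: "pd b cbump y = - of_real ((y \<bullet> b) * rim y)"
proof -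
  have "((\<lambda>y. 1\<^sup>2 - (norm y)\<^sup>2) has_derivative (\<lambda>v. - 2 * (y \<bullet> v))) (at y)"
    unfolding power2_norm_eq_inner by (auto intro!: derivative_eq_intros simp: inner_commute)
  then have "((\<lambda>y. flat 0 (1\<^sup>2 - (norm y)\<^sup>2)) has_derivative (\<lambda>v. (flat (0 + 2) (1\<^sup>2 - (norm y)\<^sup>2) - real 0 * flat (0 + 1) (1\<^sup>2 - (norm y)\<^sup>2)) * (- 2 * (y \<bullet> v)))) (at y)"
    by (rule has_derivative_compose[OF _ flat_deriv[unfolded has_field_derivative_def]])
  then have "(cbump has_derivative (\<lambda>v. of_real (flat 2 (1 - (norm y)\<^sup>2) * (- 2 * (y \<bullet> v))))) (at y)"
    unfolding bump_def by (intro has_derivative_of_real) (simp add: numeral_2_eq_2)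
  from pd_eqI[OF this, of b] show ?thesis by (simp add: rim_def)
qed

lemma bump_borel [measurable]: "bump 1 \<in> borel_measurable borel"
  using borel_measurable_continuous_onI[OF continuous_on_Re[OF test_continuous[OF bump_test[of 1]]]] by simp

text \<open>
  Convolution of \<open>H\<close> with a compactly supported kernel that has the singularity of the fundamental solution of the
  Laplacian at the origin, written as a superposition of the rescaled bumps of radius \<open>\<tau>\<^sup>2\<close>. The parametrisation by \<open>\<tau>\<^sup>2\<close> makes the
  weight \<open>2 * \<tau> ^ 3\<close>, whose square absorbs the scaling factor \<open>\<tau> ^ (- 2 d)\<close> exactly when \<open>d \<le> 3\<close>.
\<close>

definition pot :: "('a::euclidean_space \<Rightarrow> ennreal) \<Rightarrow> 'a \<Rightarrow> ennreal" where
  "pot H x = (\<integral>\<^sup>+\<tau>. \<integral>\<^sup>+y. indicator {0..1} \<tau> * (ennreal (2 * \<tau> ^ 3) * (ennreal (bump 1 y) * H (x - \<tau>\<^sup>2 *\<^sub>R y))) \<partial>lborel \<partial>lborel)"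

lemma enn_norm_integral:
  fixes f :: "'a \<Rightarrow> complex"
  shows "ennreal (cmod (LINT x|M. f x)) \<le> (\<integral>\<^sup>+x. ennreal (cmod (f x)) \<partial>M)"
  by (cases "integrable M f") (auto intro: integral_norm_bound_ennreal simp: not_integrable_integral_eq)

text \<open>
  Differentiate the averages \<open>\<integral> rim y * w (x - \<tau>\<^sup>2 y) dy\<close> in \<open>\<tau>\<close>, integrate from 0 to 1, and integrate by parts in \<open>y\<close>. It
  replaces the representation of \<open>w\<close> by the fundamental solution.
\<close>

lemma potential_identity:
  fixes w :: "'a::euclidean_space \<Rightarrow> complex"
  assumes w: "w \<in> test_functions UNIV"
  shows "(LINT y|lborel. of_real (rim y) * w (x - y)) - of_real (LINT y|lborel. rim (y::'a)) * w x
    = (LINT \<tau>|lborel. indicator {0..1} \<tau> *\<^sub>R (of_real (2 * \<tau> ^ 3) * (LINT y|lborel. cbump y * lap w (x - \<tau>\<^sup>2 *\<^sub>R y))))"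
proof -
  have sw: "smooth w" using test_smooth[OF w] .
  note bt = bump_test[of 1, where 'a='a, simplified]
  define f where "f \<tau> y = of_real (2 * \<tau>) * (\<Sum>b\<in>Basis. pd b cbump y * pd b w (x - \<tau>\<^sup>2 *\<^sub>R y))" for \<tau> :: real and y :: 'a
  define S where "S = ({0..1::real} \<times> cball (0::'a) 1)"
  have cS: "compact S" unfolding S_def by (intro compact_Times) auto
  have cont: "continuous_on UNIV (\<lambda>p. f (fst p) (snd p))"
    unfolding f_def
    by (intro continuous_intros continuous_on_compose2[OF smoothD(2)[OF smoothD(3)[OF sw]]]
        continuous_on_compose2[OF test_continuous[OF test_pd[OF bt], of _ UNIV]]) auto
  have int: "integrable (lborel \<Otimes>\<^sub>M lborel) (\<lambda>p. indicator S p *\<^sub>R f (fst p) (snd p))"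
    unfolding lborel_prod by (rule borel_integrable_compact[OF cS continuous_on_subset[OF cont]]) simp
  have fz: "f \<tau> y = 0" if "1 \<le> norm y" for \<tau> y
  proof -
    have "rim y = 0" using rim_pos_iff[of y] rim_nonneg[of y] that by linarith
    then show ?thesis unfolding f_def pd_bump by simp
  qed
  have indS: "indicator S (\<tau>, y) *\<^sub>R f \<tau> y = indicator {0..1} \<tau> *\<^sub>R f \<tau> y" for \<tau> y
    using fz[of y \<tau>] by (cases "norm y \<le> 1") (auto simp: S_def indicator_def)
  have int': "integrable (lborel \<Otimes>\<^sub>M lborel) (\<lambda>(\<tau>, y). indicator {0..1} \<tau> *\<^sub>R f \<tau> y)"
    using int by (rule Bochner_Integration.integrable_cong[THEN iffD1, rotated 2]) (auto simp: indS)
  have "(LINT y|lborel. (LINT \<tau>|lborel. indicator {0..1} \<tau> *\<^sub>R f \<tau> y)) = (LINT \<tau>|lborel. (LINT y|lborel. indicator {0..1} \<tau> *\<^sub>R f \<tau> y))"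
    by (rule lborel_pair.Fubini_integral[OF int'])
  moreover have "(LINT \<tau>|lborel. indicator {0..1} \<tau> *\<^sub>R f \<tau> y) = of_real (rim y) * w (x - y) - of_real (rim y) * w x" for y
  proof -
    have d: "((\<lambda>\<tau>. of_real (rim y) * w (x - \<tau>\<^sup>2 *\<^sub>R y)) has_vector_derivative f \<tau> y) (at \<tau> within {0..1})" for \<tau>
    proof -
      have "((\<lambda>\<tau>. x - \<tau>\<^sup>2 *\<^sub>R y) has_derivative (\<lambda>h. - (2 * \<tau> * h) *\<^sub>R y)) (at \<tau> within {0..1})"
        by (auto intro!: derivative_eq_intros simp: algebra_simps)
      from has_derivative_compose[OF this smooth_has_derivative[OF sw, of "x - \<tau>\<^sup>2 *\<^sub>R y"]]
      have "((\<lambda>\<tau>. w (x - \<tau>\<^sup>2 *\<^sub>R y)) has_derivative (\<lambda>h. \<Sum>b\<in>Basis. ((- (2 * \<tau> * h) *\<^sub>R y) \<bullet> b) *\<^sub>R pd b w (x - \<tau>\<^sup>2 *\<^sub>R y))) (at \<tau> within {0..1})" .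
      then have "((\<lambda>\<tau>. of_real (rim y) * w (x - \<tau>\<^sup>2 *\<^sub>R y)) has_derivative (\<lambda>h. of_real (rim y) * (\<Sum>b\<in>Basis. ((- (2 * \<tau> * h) *\<^sub>R y) \<bullet> b) *\<^sub>R pd b w (x - \<tau>\<^sup>2 *\<^sub>R y)))) (at \<tau> within {0..1})"
        by (rule has_derivative_mult_right)
      moreover have "(\<lambda>h. of_real (rim y) * (\<Sum>b\<in>Basis. ((- (2 * \<tau> * h) *\<^sub>R y) \<bullet> b) *\<^sub>R pd b w (x - \<tau>\<^sup>2 *\<^sub>R y))) = (\<lambda>h. h *\<^sub>R f \<tau> y)"
        unfolding f_def pd_bump by (simp add: fun_eq_iff sum_distrib_left scaleR_conv_of_real mult_ac)
      ultimately show ?thesis unfolding has_vector_derivative_def by simp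
    qed
    have "continuous_on {0..1} (\<lambda>\<tau>. f \<tau> y)"
      using continuous_on_compose2[OF cont, of "{0..1}" "\<lambda>\<tau>. (\<tau>, y)"] by (simp add: continuous_intros)
    from integral_FTC_Icc[OF _ d this] show ?thesis by simp
  qed
  moreover have "(LINT y|lborel. indicator {0..1} \<tau> *\<^sub>R f \<tau> y) = indicator {0..1} \<tau> *\<^sub>R (of_real (2 * \<tau> ^ 3) * (LINT y|lborel. cbump y * lap w (x - \<tau>\<^sup>2 *\<^sub>R y)))" for \<tau>
  proof -
    have sh: "x - \<tau>\<^sup>2 *\<^sub>R y = (- \<tau>\<^sup>2) *\<^sub>R y + x" for y by simp
    have sms: "smooth (\<lambda>y. g (x - \<tau>\<^sup>2 *\<^sub>R y))" if "smooth g" for g :: "'a \<Rightarrow> complex"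
      using that Ck_shift unfolding smooth_def sh by blast
    have p: "(LINT y|lborel. pd b cbump y * pd b w (x - \<tau>\<^sup>2 *\<^sub>R y)) = of_real (\<tau>\<^sup>2) * (LINT y|lborel. cbump y * pd b (pd b w) (x - \<tau>\<^sup>2 *\<^sub>R y))"
      if b: "b \<in> Basis" for b
    proof -
      have d: "pd b (\<lambda>y. pd b w (x - \<tau>\<^sup>2 *\<^sub>R y)) y = - of_real (\<tau>\<^sup>2) * pd b (pd b w) (x - \<tau>\<^sup>2 *\<^sub>R y)" for y
        unfolding sh pd_shift[OF smoothD(1)[OF smoothD(3)[OF sw b]]] by (simp add: scaleR_conv_of_real)
      have "(LINT y|lborel. pd b cbump y * pd b w (x - \<tau>\<^sup>2 *\<^sub>R y)) = (LINT y|lborel. pd b w (x - \<tau>\<^sup>2 *\<^sub>R y) * pd b cbump y)" by (simp only: mult.commute)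
      also have "\<dots> = - (LINT y|lborel. pd b (\<lambda>y. pd b w (x - \<tau>\<^sup>2 *\<^sub>R y)) y * cbump y)"
        using integration_by_parts[OF bt sms[OF smoothD(3)[OF sw b]] b] by simp
      also have "\<dots> = - (LINT y|lborel. - of_real (\<tau>\<^sup>2) * (cbump y * pd b (pd b w) (x - \<tau>\<^sup>2 *\<^sub>R y)))"
        unfolding d by (simp only: mult_ac)
      also have "\<dots> = of_real (\<tau>\<^sup>2) * (LINT y|lborel. cbump y * pd b (pd b w) (x - \<tau>\<^sup>2 *\<^sub>R y))" by (subst integral_mult_right_zero) simp
      finally show ?thesis .
    qed
    have i1: "integrable lborel (\<lambda>y. pd b cbump y * pd b w (x - \<tau>\<^sup>2 *\<^sub>R y))" if "b \<in> Basis" for b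
      by (rule test_integrable(1)[OF test_mult(1)[OF test_pd[OF bt that] sms[OF smoothD(3)[OF sw that]]]])
    have i2: "integrable lborel (\<lambda>y. cbump y * pd b (pd b w) (x - \<tau>\<^sup>2 *\<^sub>R y))" if "b \<in> Basis" for b
      by (rule test_integrable(1)[OF test_mult(1)[OF bt sms[OF smoothD(3)[OF smoothD(3)[OF sw that] that]]]])
    have "(LINT y|lborel. f \<tau> y) = of_real (2 * \<tau>) * (\<Sum>b\<in>Basis. (LINT y|lborel. pd b cbump y * pd b w (x - \<tau>\<^sup>2 *\<^sub>R y)))"
      unfolding f_def using i1 by (simp add: Bochner_Integration.integral_sum)
    also have "\<dots> = of_real (2 * \<tau>) * (of_real (\<tau>\<^sup>2) * (\<Sum>b\<in>Basis. (LINT y|lborel. cbump y * pd b (pd b w) (x - \<tau>\<^sup>2 *\<^sub>R y))))"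
      unfolding sum_distrib_left by (intro sum.cong refl arg_cong2[where f="(*)"] p)
    also have "(\<Sum>b\<in>Basis. (LINT y|lborel. cbump y * pd b (pd b w) (x - \<tau>\<^sup>2 *\<^sub>R y))) = (LINT y|lborel. cbump y * lap w (x - \<tau>\<^sup>2 *\<^sub>R y))"
      unfolding lap_def sum_distrib_left using i2 by (simp add: Bochner_Integration.integral_sum)
    finally have "(LINT y|lborel. f \<tau> y) = of_real (2 * \<tau> ^ 3) * (LINT y|lborel. cbump y * lap w (x - \<tau>\<^sup>2 *\<^sub>R y))"
      by (simp add: power2_eq_square power3_eq_cube mult_ac)
    then show ?thesis by simp
  qed
  ultimately have "(LINT y|lborel. of_real (rim y) * w (x - y) - of_real (rim y) * w x)
    = (LINT \<tau>|lborel. indicator {0..1} \<tau> *\<^sub>R (of_real (2 * \<tau> ^ 3) * (LINT y|lborel. cbump y * lap w (x - \<tau>\<^sup>2 *\<^sub>R y))))" by (simp only:)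
  moreover have "(LINT y|lborel. of_real (rim y) * w (x - y) - of_real (rim y) * w x)
    = (LINT y|lborel. of_real (rim y) * w (x - y)) - of_real (LINT y|lborel. rim (y::'a)) * w x"
    using test_integrable(1)[OF test_mult(1)[OF rim_test smooth_shift(3)[OF sw]]] test_integrable(1)[OF rim_test]
    by (subst Bochner_Integration.integral_diff) (auto simp: integral_complex_of_real)
  ultimately show ?thesis by simp
qed

lemma potential_bound:
  fixes w :: "'a::euclidean_space \<Rightarrow> complex"
  assumes w: "w \<in> test_functions UNIV"
  shows "ennreal ((LINT y|lborel. rim (y::'a)) * cmod (w x)) \<le> ennreal (l2 lebesgue (\<lambda>y::'a. of_real (rim y)) * l2 lebesgue w) + pot (\<lambda>x. ennreal (cmod (lap w x))) x"
proof -
  let ?c = "LINT y|lborel. rim (y::'a)"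
  define A where "A = (LINT y|lborel. of_real (rim y) * w (x - y))"
  define B where "B = (LINT \<tau>|lborel. indicator {0..1} \<tau> *\<^sub>R (of_real (2 * \<tau> ^ 3) * (LINT y|lborel. cbump y * lap w (x - \<tau>\<^sup>2 *\<^sub>R y))))"
  have id: "of_real ?c * w x = A - B" using potential_identity[OF w, of x] unfolding A_def B_def by (simp add: algebra_simps)
  have wr: "(\<lambda>y. w (x - y)) \<in> test_functions ((\<lambda>y. x - y) ` UNIV)" by (rule test_reflect[OF w])
  note [measurable] = test_borel[OF w] test_borel[OF wr] test_borel[OF rim_test] test_borel[OF test_lap[OF w]]
  have lr: "l2 lebesgue (\<lambda>y. w (x - y)) = l2 lebesgue w"
    unfolding l2_def by (simp add: integral_completion integral_reflect[of "\<lambda>y. (cmod (w y))\<^sup>2"])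
  have "cmod A = cmod (LINT y|lebesgue. of_real (rim y) * w (x - y))" unfolding A_def by (simp add: integral_completion)
  also have "\<dots> \<le> l2 lebesgue (\<lambda>y::'a. of_real (rim y)) * l2 lebesgue w"
    using l2_cs[OF test_sqint[OF rim_test] test_sqint[OF wr]] lr by simp
  finally have A: "cmod A \<le> l2 lebesgue (\<lambda>y::'a. of_real (rim y)) * l2 lebesgue w" .
  have "ennreal (cmod B) \<le> (\<integral>\<^sup>+\<tau>. ennreal (cmod (indicator {0..1} \<tau> *\<^sub>R (of_real (2 * \<tau> ^ 3) * (LINT y|lborel. cbump y * lap w (x - \<tau>\<^sup>2 *\<^sub>R y))))) \<partial>lborel)"
    unfolding B_def by (rule enn_norm_integral)
  also have "\<dots> \<le> pot (\<lambda>x. ennreal (cmod (lap w x))) x"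
    unfolding pot_def
  proof (rule nn_integral_mono)
    fix \<tau> :: real
    have "ennreal (cmod (LINT y|lborel. cbump y * lap w (x - \<tau>\<^sup>2 *\<^sub>R y))) \<le> (\<integral>\<^sup>+y. ennreal (bump 1 y) * ennreal (cmod (lap w (x - \<tau>\<^sup>2 *\<^sub>R y))) \<partial>lborel)"
      by (rule order_trans[OF enn_norm_integral]) (simp add: norm_mult bump_nonneg ennreal_mult)
    then show "ennreal (cmod (indicator {0..1} \<tau> *\<^sub>R (of_real (2 * \<tau> ^ 3) * (LINT y|lborel. cbump y * lap w (x - \<tau>\<^sup>2 *\<^sub>R y)))))
      \<le> (\<integral>\<^sup>+y. indicator {0..1} \<tau> * (ennreal (2 * \<tau> ^ 3) * (ennreal (bump 1 y) * ennreal (cmod (lap w (x - \<tau>\<^sup>2 *\<^sub>R y))))) \<partial>lborel)"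
      by (cases "\<tau> \<in> {0..1}") (auto simp: norm_mult norm_power ennreal_mult nn_integral_cmult abs_mult intro: mult_left_mono)
  qed
  finally have B: "ennreal (cmod B) \<le> pot (\<lambda>x. ennreal (cmod (lap w x))) x" .
  have "?c * cmod (w x) = cmod (of_real ?c * w x)" using rim_integral_pos[where 'a='a] by (simp add: norm_mult)
  also have "\<dots> \<le> cmod A + cmod B" unfolding id by (rule norm_triangle_ineq4)
  finally have "ennreal (?c * cmod (w x)) \<le> ennreal (cmod A + cmod B)" by (rule ennreal_leI)
  also have "\<dots> \<le> ennreal (l2 lebesgue (\<lambda>y::'a. of_real (rim y)) * l2 lebesgue w) + pot (\<lambda>x. ennreal (cmod (lap w x))) x"
    by (subst ennreal_plus) (auto intro!: add_mono B ennreal_leI A)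
  finally show ?thesis .
qed

section \<open>Mapping properties of the potential\<close>

lemma nn_scale:
  fixes H :: "'a::euclidean_space \<Rightarrow> ennreal"
  assumes [measurable]: "H \<in> borel_measurable borel" and s: "0 < s"
  shows "ennreal (s ^ DIM('a)) * (\<integral>\<^sup>+y. H (x - s *\<^sub>R y) \<partial>lborel) = (\<integral>\<^sup>+y. H y \<partial>lborel)"
proof -
  have "(\<integral>\<^sup>+y. H y \<partial>lborel) = (\<integral>\<^sup>+y. H y \<partial>(density (distr lborel borel (\<lambda>y. x + (- s) *\<^sub>R y)) (\<lambda>_. \<bar>- s\<bar> ^ DIM('a))))"
    using lborel_affine[of "- s" x] s by simp
  also have "\<dots> = (\<integral>\<^sup>+y. ennreal (s ^ DIM('a)) * H (x + (- s) *\<^sub>R y) \<partial>lborel)"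
    using s by (subst nn_integral_density; simp add: nn_integral_distr ennreal_power)
  also have "\<dots> = ennreal (s ^ DIM('a)) * (\<integral>\<^sup>+y. H (x - s *\<^sub>R y) \<partial>lborel)" by (subst nn_integral_cmult) auto
  finally show ?thesis by simp
qed

definition bump_sq :: "'a::euclidean_space itself \<Rightarrow> ennreal" where
  "bump_sq _ = (\<integral>\<^sup>+y. (ennreal (bump 1 (y::'a)))\<^sup>2 \<partial>lborel)"

text \<open>
  Cauchy--Schwarz in two ways: the first bound puts the square on \<open>H\<close> and is uniform in \<open>x\<close>, the second only needs \<open>H\<close>
  integrable and is integrated over \<open>x\<close> afterwards.
\<close>

lemma slice_bounds:
  fixes H :: "'a::euclidean_space \<Rightarrow> ennreal"
  assumes [measurable]: "H \<in> borel_measurable borel" and d: "DIM('a) \<le> 3" and t: "0 \<le> \<tau>" "\<tau> \<le> 1"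
  defines "A \<equiv> \<lambda>x. ennreal (2 * \<tau> ^ 3) * (\<integral>\<^sup>+y. ennreal (bump 1 y) * H (x - \<tau>\<^sup>2 *\<^sub>R y) \<partial>lborel)"
  shows "(A x)\<^sup>2 \<le> 4 * bump_sq TYPE('a) * (\<integral>\<^sup>+y. (H y)\<^sup>2 \<partial>lborel)"
    and "(A x)\<^sup>2 \<le> 4 * (\<integral>\<^sup>+y. H y \<partial>lborel) * (\<integral>\<^sup>+y. H (x - \<tau>\<^sup>2 *\<^sub>R y) * (ennreal (bump 1 y))\<^sup>2 \<partial>lborel)"
proof -
  have sc: "ennreal (\<tau> ^ 6) * (\<integral>\<^sup>+y. f (x - \<tau>\<^sup>2 *\<^sub>R y) \<partial>lborel) \<le> (\<integral>\<^sup>+y. f y \<partial>lborel)" if f: "f \<in> borel_measurable borel" for f :: "'a \<Rightarrow> ennreal"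
  proof (cases "\<tau> = 0")
    case False
    have "\<tau> ^ 6 \<le> (\<tau>\<^sup>2) ^ DIM('a)" unfolding power_mult[symmetric] using d t by (intro power_decreasing) auto
    then have "ennreal (\<tau> ^ 6) * (\<integral>\<^sup>+y. f (x - \<tau>\<^sup>2 *\<^sub>R y) \<partial>lborel) \<le> ennreal ((\<tau>\<^sup>2) ^ DIM('a)) * (\<integral>\<^sup>+y. f (x - \<tau>\<^sup>2 *\<^sub>R y) \<partial>lborel)"
      by (intro mult_right_mono ennreal_leI) auto
    then show ?thesis using nn_scale[OF f, of "\<tau>\<^sup>2" x] t False by simp
  qed simp
  have A2: "(A x)\<^sup>2 = 4 * (ennreal (\<tau> ^ 6) * (\<integral>\<^sup>+y. ennreal (bump 1 y) * H (x - \<tau>\<^sup>2 *\<^sub>R y) \<partial>lborel)\<^sup>2)"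
  proof -
    have "(ennreal (2 * \<tau> ^ 3))\<^sup>2 = 4 * ennreal (\<tau> ^ 6)" using t by (simp add: ennreal_power power_mult_distrib ennreal_mult flip: power_mult)
    then show ?thesis unfolding A_def power_mult_distrib by (simp add: mult.assoc)
  qed
  have "(\<integral>\<^sup>+y. ennreal (bump 1 y) * H (x - \<tau>\<^sup>2 *\<^sub>R y) \<partial>lborel)\<^sup>2 \<le> bump_sq TYPE('a) * (\<integral>\<^sup>+y. (H (x - \<tau>\<^sup>2 *\<^sub>R y))\<^sup>2 \<partial>lborel)"
    unfolding bump_sq_def by (rule Cauchy_Schwarz_nn_integral) measurable
  then have "ennreal (\<tau> ^ 6) * (\<integral>\<^sup>+y. ennreal (bump 1 y) * H (x - \<tau>\<^sup>2 *\<^sub>R y) \<partial>lborel)\<^sup>2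
    \<le> ennreal (\<tau> ^ 6) * (bump_sq TYPE('a) * (\<integral>\<^sup>+y. (H (x - \<tau>\<^sup>2 *\<^sub>R y))\<^sup>2 \<partial>lborel))" by (rule mult_left_mono) simp
  also have "\<dots> = bump_sq TYPE('a) * (ennreal (\<tau> ^ 6) * (\<integral>\<^sup>+y. (H (x - \<tau>\<^sup>2 *\<^sub>R y))\<^sup>2 \<partial>lborel))" by (simp only: mult_ac)
  also have "\<dots> \<le> bump_sq TYPE('a) * (\<integral>\<^sup>+y. (H y)\<^sup>2 \<partial>lborel)" by (intro mult_left_mono sc[of "\<lambda>y. (H y)\<^sup>2"]) auto
  finally show "(A x)\<^sup>2 \<le> 4 * bump_sq TYPE('a) * (\<integral>\<^sup>+y. (H y)\<^sup>2 \<partial>lborel)" unfolding A2 mult.assoc by (rule mult_left_mono) simp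
  have cs: "(\<integral>\<^sup>+y. b y * h y \<partial>lborel)\<^sup>2 \<le> (\<integral>\<^sup>+y. h y \<partial>lborel) * (\<integral>\<^sup>+y. h y * (b y)\<^sup>2 \<partial>lborel)"
    if [measurable]: "b \<in> borel_measurable borel" "h \<in> borel_measurable borel" for b h :: "'a \<Rightarrow> ennreal"
  proof -
    have "(\<integral>\<^sup>+y. b y * 1 \<partial>density lborel h)\<^sup>2 \<le> (\<integral>\<^sup>+y. (b y)\<^sup>2 \<partial>density lborel h) * (\<integral>\<^sup>+y. 1\<^sup>2 \<partial>density lborel h)"
      by (rule Cauchy_Schwarz_nn_integral) simp_all
    moreover have e1: "(\<integral>\<^sup>+y. b y * 1 \<partial>density lborel h) = (\<integral>\<^sup>+y. h y * (b y * 1) \<partial>lborel)" by (rule nn_integral_density) simp_all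
    moreover have e2: "(\<integral>\<^sup>+y. (b y)\<^sup>2 \<partial>density lborel h) = (\<integral>\<^sup>+y. h y * (b y)\<^sup>2 \<partial>lborel)" by (rule nn_integral_density) simp_all
    moreover have e3: "(\<integral>\<^sup>+y. 1\<^sup>2 \<partial>density lborel h) = (\<integral>\<^sup>+y. h y * 1\<^sup>2 \<partial>lborel)" by (rule nn_integral_density) simp_all
    ultimately have "(\<integral>\<^sup>+y. h y * b y \<partial>lborel)\<^sup>2 \<le> (\<integral>\<^sup>+y. h y * (b y)\<^sup>2 \<partial>lborel) * (\<integral>\<^sup>+y. h y \<partial>lborel)"
      by (simp only: mult_1_right power_one)
    then show ?thesis by (simp only: mult.commute)
  qed
  have "(\<integral>\<^sup>+y. ennreal (bump 1 y) * H (x - \<tau>\<^sup>2 *\<^sub>R y) \<partial>lborel)\<^sup>2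
    \<le> (\<integral>\<^sup>+y. H (x - \<tau>\<^sup>2 *\<^sub>R y) \<partial>lborel) * (\<integral>\<^sup>+y. H (x - \<tau>\<^sup>2 *\<^sub>R y) * (ennreal (bump 1 y))\<^sup>2 \<partial>lborel)"
    by (rule cs) measurable
  then have "ennreal (\<tau> ^ 6) * (\<integral>\<^sup>+y. ennreal (bump 1 y) * H (x - \<tau>\<^sup>2 *\<^sub>R y) \<partial>lborel)\<^sup>2
    \<le> ennreal (\<tau> ^ 6) * ((\<integral>\<^sup>+y. H (x - \<tau>\<^sup>2 *\<^sub>R y) \<partial>lborel) * (\<integral>\<^sup>+y. H (x - \<tau>\<^sup>2 *\<^sub>R y) * (ennreal (bump 1 y))\<^sup>2 \<partial>lborel))"
    by (rule mult_left_mono) simp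
  also have "\<dots> \<le> (\<integral>\<^sup>+y. H y \<partial>lborel) * (\<integral>\<^sup>+y. H (x - \<tau>\<^sup>2 *\<^sub>R y) * (ennreal (bump 1 y))\<^sup>2 \<partial>lborel)"
    unfolding mult.assoc[symmetric] by (intro mult_right_mono sc) auto
  finally show "(A x)\<^sup>2 \<le> 4 * (\<integral>\<^sup>+y. H y \<partial>lborel) * (\<integral>\<^sup>+y. H (x - \<tau>\<^sup>2 *\<^sub>R y) * (ennreal (bump 1 y))\<^sup>2 \<partial>lborel)"
    unfolding A2 mult.assoc by (rule mult_left_mono) simp
qed

lemma pot_measurable [measurable]:
  fixes H :: "'a::euclidean_space \<Rightarrow> ennreal"
  assumes [measurable]: "H \<in> borel_measurable borel"
  shows "pot H \<in> borel_measurable borel"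
  unfolding pot_def[abs_def] by measurable

lemma pot_alt:
  fixes H :: "'a::euclidean_space \<Rightarrow> ennreal"
  assumes [measurable]: "H \<in> borel_measurable borel"
  shows "pot H x = (\<integral>\<^sup>+\<tau>. indicator {0..1} \<tau> * (ennreal (2 * \<tau> ^ 3) * (\<integral>\<^sup>+y. ennreal (bump 1 y) * H (x - \<tau>\<^sup>2 *\<^sub>R y) \<partial>lborel)) \<partial>lborel)"
  unfolding pot_def by (simp add: nn_integral_cmult)

lemma indicator_ennreal:
  fixes g h :: ennreal
  shows "indicator A t * (indicator A t * g) = indicator A t * g" "(indicator A t * g)\<^sup>2 = indicator A t * g\<^sup>2"
    "(t \<in> A \<Longrightarrow> g \<le> h) \<Longrightarrow> indicator A t * g \<le> indicator A t * h" "(indicator A t :: ennreal)\<^sup>2 = indicator A t"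
  by (cases "t \<in> A"; simp)+

lemma pot_square:
  fixes H :: "'a::euclidean_space \<Rightarrow> ennreal"
  assumes [measurable]: "H \<in> borel_measurable borel"
  shows "(pot H x)\<^sup>2 \<le> (\<integral>\<^sup>+\<tau>. indicator {0..1} \<tau> * (ennreal (2 * \<tau> ^ 3) * (\<integral>\<^sup>+y. ennreal (bump 1 y) * H (x - \<tau>\<^sup>2 *\<^sub>R y) \<partial>lborel))\<^sup>2 \<partial>lborel)"
proof -
  define g where "g \<tau> = ennreal (2 * \<tau> ^ 3) * (\<integral>\<^sup>+y. ennreal (bump 1 y) * H (x - \<tau>\<^sup>2 *\<^sub>R y) \<partial>lborel)" for \<tau>
  have [measurable]: "g \<in> borel_measurable borel" unfolding g_def[abs_def] by measurable
  have p: "pot H x = (\<integral>\<^sup>+\<tau>. indicator {0..1} \<tau> * (indicator {0..1} \<tau> * g \<tau>) \<partial>lborel)"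
    unfolding pot_alt[OF assms] g_def indicator_ennreal(1) ..
  have "(pot H x)\<^sup>2 \<le> (\<integral>\<^sup>+\<tau>. (indicator {0..1::real} \<tau>)\<^sup>2 \<partial>lborel) * (\<integral>\<^sup>+\<tau>. (indicator {0..1} \<tau> * g \<tau>)\<^sup>2 \<partial>lborel)"
    unfolding p by (rule Cauchy_Schwarz_nn_integral) measurable
  also have "(\<integral>\<^sup>+\<tau>. (indicator {0..1::real} \<tau> :: ennreal)\<^sup>2 \<partial>lborel) = 1"
    unfolding indicator_ennreal(4) by simp
  finally show ?thesis unfolding mult_1 indicator_ennreal(2) g_def .
qed

text \<open>
  The kernel is square integrable, so the potential maps \<open>L\<^sup>2\<close> to \<open>L\<^sup>\<infinity>\<close>.
\<close>

lemma pot_sup: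
  fixes H :: "'a::euclidean_space \<Rightarrow> ennreal"
  assumes H: "H \<in> borel_measurable borel" and d: "DIM('a) \<le> 3"
  shows "(pot H x)\<^sup>2 \<le> 4 * bump_sq TYPE('a) * (\<integral>\<^sup>+y. (H y)\<^sup>2 \<partial>lborel)"
proof -
  have "(pot H x)\<^sup>2 \<le> (\<integral>\<^sup>+\<tau>. indicator {0..1::real} \<tau> * (4 * bump_sq TYPE('a) * (\<integral>\<^sup>+y. (H y)\<^sup>2 \<partial>lborel)) \<partial>lborel)"
    by (rule order_trans[OF pot_square[OF H]], rule nn_integral_mono)
      (intro indicator_ennreal(3) slice_bounds(1)[OF H d], auto)
  also have "\<dots> = 4 * bump_sq TYPE('a) * (\<integral>\<^sup>+y. (H y)\<^sup>2 \<partial>lborel)" by (subst nn_integral_multc) auto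
  finally show ?thesis .
qed

text \<open>
  Dually, the potential maps \<open>L\<^sup>1\<close> to \<open>L\<^sup>2\<close>, with the same constant.
\<close>

lemma pot_L2:
  fixes H :: "'a::euclidean_space \<Rightarrow> ennreal"
  assumes H[measurable]: "H \<in> borel_measurable borel" and d: "DIM('a) \<le> 3"
  shows "(\<integral>\<^sup>+x. (pot H x)\<^sup>2 \<partial>lborel) \<le> 4 * bump_sq TYPE('a) * (\<integral>\<^sup>+y. H y \<partial>lborel)\<^sup>2"
proof -
  let ?I = "\<integral>\<^sup>+y. H y \<partial>lborel"
  have "(\<integral>\<^sup>+x. (pot H x)\<^sup>2 \<partial>lborel) \<le> (\<integral>\<^sup>+x. (\<integral>\<^sup>+\<tau>. indicator {0..1::real} \<tau> * (4 * ?I * (\<integral>\<^sup>+y. H (x - \<tau>\<^sup>2 *\<^sub>R y) * (ennreal (bump 1 y))\<^sup>2 \<partial>lborel)) \<partial>lborel) \<partial>lborel)"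
    by (rule nn_integral_mono, rule order_trans[OF pot_square[OF H]], rule nn_integral_mono)
      (intro indicator_ennreal(3) slice_bounds(2)[OF H d], auto)
  also have "\<dots> = (\<integral>\<^sup>+\<tau>. (\<integral>\<^sup>+x. indicator {0..1::real} \<tau> * (4 * ?I * (\<integral>\<^sup>+y. H (x - \<tau>\<^sup>2 *\<^sub>R y) * (ennreal (bump 1 y))\<^sup>2 \<partial>lborel)) \<partial>lborel) \<partial>lborel)"
    by (rule lborel_pair.Fubini') measurable
  also have "\<dots> = (\<integral>\<^sup>+\<tau>. indicator {0..1::real} \<tau> * (4 * ?I * (\<integral>\<^sup>+x. (\<integral>\<^sup>+y. H (x - \<tau>\<^sup>2 *\<^sub>R y) * (ennreal (bump 1 y))\<^sup>2 \<partial>lborel) \<partial>lborel)) \<partial>lborel)"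
    by (simp add: nn_integral_cmult)
  also have "\<dots> = (\<integral>\<^sup>+\<tau>. indicator {0..1::real} \<tau> * (4 * ?I * (?I * bump_sq TYPE('a))) \<partial>lborel)"
  proof -
    have "(\<integral>\<^sup>+x. (\<integral>\<^sup>+y. H (x - \<tau>\<^sup>2 *\<^sub>R y) * (ennreal (bump 1 y))\<^sup>2 \<partial>lborel) \<partial>lborel) = ?I * bump_sq TYPE('a)" for \<tau> :: real
    proof -
      have "(\<integral>\<^sup>+x. (\<integral>\<^sup>+y. H (x - \<tau>\<^sup>2 *\<^sub>R y) * (ennreal (bump 1 y))\<^sup>2 \<partial>lborel) \<partial>lborel)
        = (\<integral>\<^sup>+y. (\<integral>\<^sup>+x. H (x - \<tau>\<^sup>2 *\<^sub>R y) * (ennreal (bump 1 y))\<^sup>2 \<partial>lborel) \<partial>lborel)"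
        by (rule lborel_pair.Fubini') measurable
      also have "\<dots> = (\<integral>\<^sup>+y. ?I * (ennreal (bump 1 (y::'a)))\<^sup>2 \<partial>lborel)"
      proof (rule nn_integral_cong)
        fix y :: 'a
        show "(\<integral>\<^sup>+x. H (x - \<tau>\<^sup>2 *\<^sub>R y) * (ennreal (bump 1 y))\<^sup>2 \<partial>lborel) = ?I * (ennreal (bump 1 y))\<^sup>2"
          using nn_integral_shift[OF H, of "- (\<tau>\<^sup>2 *\<^sub>R y)"] by (simp add: nn_integral_multc)
      qed
      also have "\<dots> = ?I * bump_sq TYPE('a)" unfolding bump_sq_def by (rule nn_integral_cmult) measurable
      finally show ?thesis .
    qed
    then show ?thesis by simp
  qed
  also have "\<dots> = 4 * bump_sq TYPE('a) * ?I\<^sup>2" by (subst nn_integral_multc) (auto simp: power2_eq_square mult_ac)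
  finally show ?thesis .
qed

lemma pot_mono: "(\<And>x. H x \<le> K x) \<Longrightarrow> pot H x \<le> pot K x"
  unfolding pot_def by (intro nn_integral_mono mult_left_mono) auto

lemma pot_add:
  assumes [measurable]: "H \<in> borel_measurable borel" "K \<in> borel_measurable borel"
  shows "pot (\<lambda>x. H x + K x) x = pot H x + pot K x"
  unfolding pot_def distrib_left by (subst nn_integral_add[symmetric]; (measurable)?) (intro nn_integral_cong, subst nn_integral_add, auto)

text \<open>
  The potential is a convolution, hence commutes with convolutions. This lets the mollification parameter tend to zero outside the potential of a merely integrable function.
\<close>

lemma pot_smear:
  fixes H m :: "'a::euclidean_space \<Rightarrow> ennreal"
  assumes [measurable]: "H \<in> borel_measurable borel" "m \<in> borel_measurable borel"
  shows "pot (\<lambda>x. \<integral>\<^sup>+z. m z * H (x - z) \<partial>lborel) x = (\<integral>\<^sup>+z. m z * pot H (x - z) \<partial>lborel)"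
proof -
  let ?J = "\<lambda>\<tau> y z. indicator {0..1::real} \<tau> * (ennreal (2 * \<tau> ^ 3) * (ennreal (bump 1 y) * (m z * H (x - \<tau>\<^sup>2 *\<^sub>R y - z))))"
  have "pot (\<lambda>x. \<integral>\<^sup>+z. m z * H (x - z) \<partial>lborel) x = (\<integral>\<^sup>+\<tau>. \<integral>\<^sup>+y. \<integral>\<^sup>+z. ?J \<tau> y z \<partial>lborel \<partial>lborel \<partial>lborel)"
    unfolding pot_def by (simp add: nn_integral_cmult)
  also have "\<dots> = (\<integral>\<^sup>+\<tau>. \<integral>\<^sup>+z. \<integral>\<^sup>+y. ?J \<tau> y z \<partial>lborel \<partial>lborel \<partial>lborel)"
    by (rule nn_integral_cong, rule lborel_pair.Fubini') measurable
  also have "\<dots> = (\<integral>\<^sup>+z. \<integral>\<^sup>+\<tau>. \<integral>\<^sup>+y. ?J \<tau> y z \<partial>lborel \<partial>lborel \<partial>lborel)"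
    by (rule lborel_pair.Fubini') measurable
  also have "\<dots> = (\<integral>\<^sup>+z. m z * pot H (x - z) \<partial>lborel)"
    unfolding pot_def
    by (simp add: nn_integral_cmult[symmetric]) (simp add: mult_ac diff_diff_eq add.commute)
  finally show ?thesis .
qed

lemma pot_support:
  assumes H: "\<And>x. H x \<noteq> 0 \<Longrightarrow> norm x \<le> r" and x: "pot H x \<noteq> 0" shows "norm x \<le> r + 1"
proof (rule ccontr)
  assume n: "\<not> ?thesis"
  have "indicator {0..1} \<tau> * (ennreal (2 * \<tau> ^ 3) * (ennreal (bump 1 y) * H (x - \<tau>\<^sup>2 *\<^sub>R y))) = 0" for \<tau> y
  proof (cases "\<tau> \<in> {0..1} \<and> norm y < 1")
    case True
    then have "norm (\<tau>\<^sup>2 *\<^sub>R y) \<le> 1 * 1" unfolding norm_scaleR by (intro mult_mono) (auto simp: power_le_one)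
    then have "r < norm (x - \<tau>\<^sup>2 *\<^sub>R y)" using n norm_triangle_ineq2[of x "\<tau>\<^sup>2 *\<^sub>R y"] by linarith
    then show ?thesis using H[of "x - \<tau>\<^sup>2 *\<^sub>R y"] by auto
  next
    case False
    then have "\<tau> \<notin> {0..1} \<or> bump 1 y = 0" using bump_nz[of 1 y] by auto
    then show ?thesis by (elim disjE) simp_all
  qed
  then have "pot H x = 0" unfolding pot_def by (simp only: nn_integral_const mult_zero_left)
  then show False using x by simp
qed

lemma bump_sq_real:
  obtains \<kappa> :: real where "0 < \<kappa>" "4 * bump_sq TYPE('a::euclidean_space) \<le> ennreal (\<kappa>\<^sup>2)"
proof -
  define b where "b = (l2 lebesgue (\<lambda>y::'a. complex_of_real (bump 1 y)))\<^sup>2"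
  have "bump_sq TYPE('a) = (\<integral>\<^sup>+y. ennreal ((cmod (cbump (y::'a)))\<^sup>2) \<partial>lebesgue)"
    unfolding bump_sq_def nn_integral_completion by (simp add: ennreal_power bump_nonneg)
  also have "\<dots> = ennreal b" unfolding b_def by (rule nn_l2[OF test_sqint[OF bump_test]]) simp
  finally have "4 * bump_sq TYPE('a) = ennreal (4 * b)" by (simp add: ennreal_mult b_def)
  also have "\<dots> \<le> ennreal ((sqrt (4 * b + 1))\<^sup>2)" by (rule ennreal_leI) (simp add: b_def)
  finally have le: "4 * bump_sq TYPE('a) \<le> ennreal ((sqrt (4 * b + 1))\<^sup>2)" .
  have pos: "0 < sqrt (4 * b + 1)" by (simp add: b_def add_nonneg_pos)
  show thesis by (rule that[OF pos le])
qed

lemma pot_sup_real: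
  fixes H :: "'a::euclidean_space \<Rightarrow> ennreal"
  assumes k: "0 < \<kappa>" "4 * bump_sq TYPE('a) \<le> ennreal (\<kappa>\<^sup>2)" and d: "DIM('a) \<le> 3"
    and H: "H \<in> borel_measurable borel" and n: "0 \<le> n" "(\<integral>\<^sup>+y. (H y)\<^sup>2 \<partial>lborel) \<le> ennreal (n\<^sup>2)"
  shows "pot H x \<le> ennreal (\<kappa> * n)"
proof -
  have "(pot H x)\<^sup>2 \<le> ennreal (\<kappa>\<^sup>2) * ennreal (n\<^sup>2)"
    by (rule order_trans[OF pot_sup[OF H d] mult_mono[OF k(2) n(2)]]) auto
  also have "\<dots> = (ennreal (\<kappa> * n))\<^sup>2" using k n by (simp add: ennreal_power ennreal_mult[symmetric] power_mult_distrib)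
  finally have "(pot H x)\<^sup>2 \<le> (ennreal (\<kappa> * n))\<^sup>2" .
  then show ?thesis
  proof (cases "pot H x")
    case (real p)
    then have "p\<^sup>2 \<le> (\<kappa> * n)\<^sup>2"
      using \<open>(pot H x)\<^sup>2 \<le> (ennreal (\<kappa> * n))\<^sup>2\<close> k n by (simp add: ennreal_power ennreal_le_iff)
    then have "p \<le> \<kappa> * n" by (rule power2_le_imp_le) (use k n in simp)
    then show ?thesis using real by (simp add: ennreal_leI)
  next
    case top
    have "top * top \<le> (ennreal (\<kappa> * n))\<^sup>2" using \<open>(pot H x)\<^sup>2 \<le> (ennreal (\<kappa> * n))\<^sup>2\<close> unfolding top power2_eq_square .
    also have "\<dots> = ennreal ((\<kappa> * n)\<^sup>2)" by (rule ennreal_power) (use k n in auto)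
    finally show ?thesis by (simp add: ennreal_top_mult top_unique)
  qed
qed

lemma pot_L2_real:
  fixes H :: "'a::euclidean_space \<Rightarrow> ennreal"
  assumes k: "0 < \<kappa>" "4 * bump_sq TYPE('a) \<le> ennreal (\<kappa>\<^sup>2)" and d: "DIM('a) \<le> 3"
    and H: "H \<in> borel_measurable borel" and n: "0 \<le> n" "(\<integral>\<^sup>+y. H y \<partial>lborel) \<le> ennreal n"
  shows "(\<integral>\<^sup>+x. (pot H x)\<^sup>2 \<partial>lborel) \<le> ennreal ((\<kappa> * n)\<^sup>2)"
proof -
  have "(\<integral>\<^sup>+x. (pot H x)\<^sup>2 \<partial>lborel) \<le> ennreal (\<kappa>\<^sup>2) * (ennreal n)\<^sup>2"
    by (rule order_trans[OF pot_L2[OF H d] mult_mono[OF k(2) power_mono[OF n(2)]]]) auto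
  also have "\<dots> = ennreal ((\<kappa> * n)\<^sup>2)" using k n by (simp add: ennreal_power ennreal_mult[symmetric] power_mult_distrib)
  finally show ?thesis .
qed

section \<open>Local boundedness of solutions\<close>

lemma conv_diff:
  assumes "integrable lebesgue f" "integrable lebesgue g" "\<phi> \<in> test_functions S"
  shows "conv (\<lambda>x. f x - g x) \<phi> x = conv f \<phi> x - conv g \<phi> x"
  unfolding conv_def left_diff_distrib
  by (rule Bochner_Integration.integral_diff[OF conv_integrable[OF assms(1,3)] conv_integrable[OF assms(2,3)]])

lemma conv_norm_bound:
  fixes h :: "'a::euclidean_space \<Rightarrow> complex"
  assumes [measurable]: "h \<in> borel_measurable borel" and e: "0 < e"
  shows "ennreal (cmod (conv h (cmoll e) x)) \<le> (\<integral>\<^sup>+z. ennreal (moll e z) * ennreal (cmod (h (x - z))) \<partial>lborel)"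
proof -
  have [measurable]: "moll e \<in> borel_measurable (borel :: 'a measure)" by (rule moll_borel[OF e])
  have "ennreal (cmod (conv h (cmoll e) x)) \<le> (\<integral>\<^sup>+y. ennreal (cmod (h y * cmoll e (x - y))) \<partial>lborel)"
    using enn_norm_integral[of lebesgue "\<lambda>y. h y * cmoll e (x - y)"] unfolding conv_def nn_integral_completion .
  also have "\<dots> = (\<integral>\<^sup>+y. ennreal (moll e (x - y)) * ennreal (cmod (h (x - (x - y)))) \<partial>lborel)"
    by (intro nn_integral_cong) (simp add: norm_mult moll_nonneg[OF e] ennreal_mult mult.commute)
  also have "\<dots> = (\<integral>\<^sup>+z. ennreal (moll e z) * ennreal (cmod (h (x - z))) \<partial>lborel)"
    by (rule nn_integral_reflect[of "\<lambda>z. ennreal (moll e z) * ennreal (cmod (h (x - z)))"]) measurable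
  finally show ?thesis .
qed

lemma smear_real:
  fixes U :: "'a::euclidean_space \<Rightarrow> ennreal"
  assumes [measurable]: "U \<in> borel_measurable borel" and fin: "AE x in lebesgue. U x < \<infinity>"
    and i: "integrable lebesgue (\<lambda>x. complex_of_real (enn2real (U x)))" and e: "0 < e"
  shows "(\<integral>\<^sup>+z. ennreal (moll e z) * U (x - z) \<partial>lborel) = ennreal (cmod (conv (\<lambda>x. of_real (enn2real (U x))) (cmoll e) x))"
proof -
  have [measurable]: "moll e \<in> borel_measurable (borel :: 'a measure)" by (rule moll_borel[OF e])
  let ?u = "\<lambda>y. enn2real (U y) * moll e (x - y)"
  have iu: "integrable lebesgue ?u"
    using integrable_Re[OF conv_integrable[OF i moll_test[OF e], of x]] by simp
  have "(\<integral>\<^sup>+z. ennreal (moll e z) * U (x - z) \<partial>lborel) = (\<integral>\<^sup>+y. ennreal (moll e (x - y)) * U (x - (x - y)) \<partial>lborel)"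
    by (rule nn_integral_reflect[symmetric, of "\<lambda>z. ennreal (moll e z) * U (x - z)"]) measurable
  also have "\<dots> = (\<integral>\<^sup>+y. ennreal (moll e (x - y)) * U y \<partial>lebesgue)" by (simp add: nn_integral_completion)
  also have "\<dots> = (\<integral>\<^sup>+y. ennreal (?u y) \<partial>lebesgue)"
    using fin by (intro nn_integral_cong_AE) (auto elim!: eventually_mono simp: ennreal_mult moll_nonneg[OF e] mult.commute ennreal_enn2real)
  also have "\<dots> = ennreal (LINT y|lebesgue. ?u y)"
    by (rule nn_integral_eq_integral[OF iu]) (simp add: moll_nonneg[OF e])
  also have "(LINT y|lebesgue. ?u y) = cmod (of_real (LINT y|lebesgue. ?u y))"
    by (simp add: Bochner_Integration.integral_nonneg moll_nonneg[OF e])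
  also have "complex_of_real (LINT y|lebesgue. ?u y) = conv (\<lambda>x. of_real (enn2real (U x))) (cmoll e) x"
    unfolding conv_def integral_complex_of_real[symmetric] by simp
  finally show ?thesis .
qed

text \<open>
  Split \<open>V\<close> into a bounded part, whose product with \<open>w\<close> is square integrable and joins the source, and a part \<open>V2\<close>
  of small norm. The potential representation then gives \<open>c * cmod (w x) \<le> C + pot (\<lambda>x. cmod (V2 x) * cmod (w x)) x\<close>. Since
  multiplication by \<open>V2\<close> followed by the potential is a contraction on both \<open>L\<^sup>\<infinity>\<close> and \<open>L\<^sup>2\<close>, the excess of \<open>w\<close> over a suitable
  constant \<open>L\<close> is bounded by a contraction of itself, hence zero.
\<close>

theorem schroedinger_bounded:
  fixes w V G :: "'a::euclidean_space \<Rightarrow> complex"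
  assumes d: "DIM('a) \<le> 3"
    and B[measurable]: "w \<in> borel_measurable borel" "V \<in> borel_measurable borel" "G \<in> borel_measurable borel"
    and s: "w \<in> sqint lebesgue" "V \<in> sqint lebesgue" "G \<in> sqint lebesgue"
    and sup: "\<And>x. w x \<noteq> 0 \<Longrightarrow> norm x \<le> r" "\<And>x. G x \<noteq> 0 \<Longrightarrow> norm x \<le> r"
    and wl: "wlap w (\<lambda>x. G x - V x * w x)"
  obtains L where "AE x in lebesgue. cmod (w x) \<le> L"
proof -
  define c where "c = (LINT y|lborel. rim (y::'a))"
  have c: "0 < c" unfolding c_def by (rule rim_integral_pos)
  obtain \<kappa> where k: "0 < \<kappa>" "4 * bump_sq TYPE('a) \<le> ennreal (\<kappa>\<^sup>2)" by (rule bump_sq_real)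
  note psup = pot_sup_real[OF k d] and pL2 = pot_L2_real[OF k d]
  define Vt where "Vt n x = (if cmod (V x) > real n then V x else 0)" for n :: nat and x
  have Vtm[measurable]: "Vt n \<in> borel_measurable borel" for n unfolding Vt_def[abs_def] by measurable
  have "(\<lambda>n. l2 lebesgue (\<lambda>x. Vt n x - (\<lambda>x. 0) x)) \<longlonglongrightarrow> 0"
  proof (rule l2_dominated(1)[OF _ s(2)])
    show "AE x in lebesgue. (\<lambda>n. Vt n x) \<longlonglongrightarrow> 0"
    proof (intro AE_I2 tendsto_eventually)
      fix x
      obtain N where "cmod (V x) \<le> real N" using real_arch_simple by blast
      then show "\<forall>\<^sub>F n in sequentially. Vt n x = 0"
        unfolding eventually_sequentially by (intro exI[of _ N]) (auto simp: Vt_def)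
    qed
    show "AE x in lebesgue. cmod (Vt n x) \<le> cmod (V x)" for n by (simp add: Vt_def)
    show "Vt n \<in> borel_measurable lebesgue" for n by (rule measurable_completion) simp
  qed simp
  from LIMSEQ_D[OF this, of "c / (2 * \<kappa>)"] obtain n where n: "l2 lebesgue (Vt n) < c / (2 * \<kappa>)"
    using c k by auto
  define V2 where "V2 = Vt n"
  have V2m[measurable]: "V2 \<in> borel_measurable borel" unfolding V2_def by simp
  have bl: "f \<in> borel_measurable lebesgue" if "f \<in> borel_measurable borel" for f :: "'a \<Rightarrow> complex"
    by (rule measurable_completion) (use that in simp)
  have V2: "V2 \<in> sqint lebesgue" by (rule sqint_bound(1)[OF s(2) bl, where C=1]) (auto simp: V2_def Vt_def)
  have Vs: "\<kappa> * l2 lebesgue V2 \<le> c / 2" using n k c unfolding V2_def by (simp add: field_simps)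
  define G' where "G' x = G x - (V x - V2 x) * w x" for x
  have G'm[measurable]: "G' \<in> borel_measurable borel" unfolding G'_def[abs_def] by measurable
  have V1: "(\<lambda>x. (V x - V2 x) * w x) \<in> sqint lebesgue"
    by (rule sqint_bound(1)[OF s(1) bl, where C="real n"]) (auto simp: V2_def Vt_def norm_mult intro!: AE_I2 mult_right_mono)
  have G': "G' \<in> sqint lebesgue" unfolding G'_def[abs_def] by (rule L2m.diff[OF s(3) V1])
  have G's: "G' x \<noteq> 0 \<Longrightarrow> norm x \<le> r" for x using sup[of x] by (cases "w x = 0") (auto simp: G'_def)
  have iG: "integrable lebesgue G'" by (rule sqint_integrable[OF G', of "cball 0 r"]) (use G's in auto)
  have iw: "integrable lebesgue w" by (rule sqint_integrable[OF s(1), of "cball 0 r"]) (use sup in auto)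
  define h where "h x = V2 x * w x" for x
  have hm[measurable]: "h \<in> borel_measurable borel" unfolding h_def[abs_def] by measurable
  have ih: "integrable lebesgue h" unfolding h_def[abs_def] by (rule sqint_mult(1)[OF V2 s(1)])
  have wl': "wlap w (\<lambda>x. G' x - h x)" using wl by (simp add: G'_def h_def algebra_simps)
  \<comment> \<open>The product \<open>h\<close> is only integrable, so its potential is controlled in \<open>L\<^sup>2\<close>, not pointwise.\<close>
  define U where "U = pot (\<lambda>x. ennreal (cmod (h x)))"
  have Um[measurable]: "U \<in> borel_measurable borel" unfolding U_def by measurable
  define nh where "nh = (LINT x|lebesgue. cmod (h x))"
  have nh: "0 \<le> nh" "(\<integral>\<^sup>+x. ennreal (cmod (h x)) \<partial>lborel) \<le> ennreal nh"
    using nn_integral_eq_integral[OF integrable_norm[OF ih]] unfolding nh_def nn_integral_completion by (auto intro: Bochner_Integration.integral_nonneg)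
  have U2: "(\<integral>\<^sup>+x. (U x)\<^sup>2 \<partial>lborel) \<le> ennreal ((\<kappa> * nh)\<^sup>2)" unfolding U_def by (rule pL2[OF _ nh]) measurable
  have Uf: "AE x in lebesgue. U x < \<infinity>"
  proof -
    have "(\<integral>\<^sup>+x. (U x)\<^sup>2 \<partial>lborel) \<noteq> \<infinity>" using U2 by (auto simp: top_unique)
    then have "AE x in lborel. (U x)\<^sup>2 \<noteq> \<infinity>" by (intro nn_integral_PInf_AE) auto
    then have "AE x in lborel. U x < \<infinity>" by eventually_elim (auto simp: less_top power2_eq_square ennreal_mult_eq_top_iff)
    then show ?thesis by (rule AE_completion)
  qed
  define Ur where "Ur x = complex_of_real (enn2real (U x))" for x
  have Urm[measurable]: "Ur \<in> borel_measurable borel" unfolding Ur_def[abs_def] by measurable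
  have Urs: "Ur \<in> sqint lebesgue"
  proof (rule sqint_nn(1)[OF bl])
    have "(\<integral>\<^sup>+x. ennreal ((cmod (Ur x))\<^sup>2) \<partial>lebesgue) \<le> (\<integral>\<^sup>+x. (U x)\<^sup>2 \<partial>lborel)"
      unfolding nn_integral_completion
    proof (rule nn_integral_mono)
      fix x show "ennreal ((cmod (Ur x))\<^sup>2) \<le> (U x)\<^sup>2"
        by (cases "U x") (simp_all add: Ur_def ennreal_power[symmetric] top_power_ennreal)
    qed
    then show "(\<integral>\<^sup>+x. ennreal ((cmod (Ur x))\<^sup>2) \<partial>lebesgue) \<le> ennreal ((\<kappa> * nh)\<^sup>2)" using U2 by (rule order_trans)
  qed simp
  have Uz: "Ur x \<noteq> 0 \<Longrightarrow> norm x \<le> r + 1" for x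
    unfolding Ur_def U_def by (rule pot_support[where H="\<lambda>x. ennreal (cmod (h x))"]) (use sup(1) in \<open>auto simp: h_def\<close>)
  have iU: "integrable lebesgue Ur" by (rule sqint_integrable[OF Urs, of "cball 0 (r + 1)"]) (use Uz in auto)
  define C where "C = l2 lebesgue (\<lambda>y::'a. of_real (rim y)) * l2 lebesgue w + \<kappa> * l2 lebesgue G'"
  have C0: "0 \<le> C" unfolding C_def using k by simp
  define F where "F n = conv w (cmoll (meps n))" for n
  have ep: "0 < meps n" for n by simp
  have F: "F n \<in> test_functions UNIV" for n unfolding F_def by (rule conv_moll_test[OF iw ep sup(1)])
  have step: "c * cmod (F n x) \<le> C + cmod (conv Ur (cmoll (meps n)) x)" for n x
  proof -
    let ?m = "cmoll (meps n) :: 'a \<Rightarrow> complex"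
    have [measurable]: "moll (meps n) \<in> borel_measurable (borel :: 'a measure)" by (rule moll_borel[OF ep])
    note mt = moll_test[OF ep]
    define Gn where "Gn = conv G' ?m"
    have cG[measurable]: "Gn \<in> borel_measurable borel" unfolding Gn_def
      by (rule borel_measurable_continuous_onI[OF smoothD(2)[OF smooth_conv[OF iG mt]]])
    have lpe: "lap (F n) x = Gn x - conv h ?m x" for x
      unfolding F_def Gn_def lap_conv_moll[OF wl' iw ep] by (rule conv_diff[OF iG ih mt])
    have lp: "ennreal (cmod (lap (F n) x)) \<le> ennreal (cmod (Gn x)) + (\<integral>\<^sup>+z. ennreal (moll (meps n) z) * ennreal (cmod (h (x - z))) \<partial>lborel)" for x
    proof -
      have "ennreal (cmod (lap (F n) x)) \<le> ennreal (cmod (Gn x) + cmod (conv h ?m x))"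
        unfolding lpe by (intro ennreal_leI norm_triangle_ineq4)
      also have "\<dots> \<le> ennreal (cmod (Gn x)) + (\<integral>\<^sup>+z. ennreal (moll (meps n) z) * ennreal (cmod (h (x - z))) \<partial>lborel)"
        by (subst ennreal_plus) (auto intro!: add_left_mono conv_norm_bound[OF hm ep] simp del: of_nat_Suc)
      finally show ?thesis .
    qed
    have "ennreal (c * cmod (F n x)) \<le> ennreal (l2 lebesgue (\<lambda>y::'a. of_real (rim y)) * l2 lebesgue (F n)) + pot (\<lambda>x. ennreal (cmod (lap (F n) x))) x"
      unfolding c_def by (rule potential_bound[OF F])
    also have "\<dots> \<le> ennreal (l2 lebesgue (\<lambda>y::'a. of_real (rim y)) * l2 lebesgue w) +
      pot (\<lambda>x. ennreal (cmod (Gn x)) + (\<integral>\<^sup>+z. ennreal (moll (meps n) z) * ennreal (cmod (h (x - z))) \<partial>lborel)) x"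
      using conv_young(2)[OF iw s(1) ep] unfolding F_def[symmetric]
      by (intro add_mono ennreal_leI mult_left_mono pot_mono lp) auto
    also have "pot (\<lambda>x. ennreal (cmod (Gn x)) + (\<integral>\<^sup>+z. ennreal (moll (meps n) z) * ennreal (cmod (h (x - z))) \<partial>lborel)) x
      = pot (\<lambda>x. ennreal (cmod (Gn x))) x + (\<integral>\<^sup>+z. ennreal (moll (meps n) z) * U (x - z) \<partial>lborel)"
      unfolding U_def by (subst pot_add; (measurable)?) (subst pot_smear; simp)
    also have "pot (\<lambda>x. ennreal (cmod (Gn x))) x \<le> ennreal (\<kappa> * l2 lebesgue G')"
    proof (rule psup)
      have "(\<integral>\<^sup>+x. (ennreal (cmod (Gn x)))\<^sup>2 \<partial>lborel) = (\<integral>\<^sup>+x. ennreal ((cmod (Gn x))\<^sup>2) \<partial>lebesgue)"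
        unfolding nn_integral_completion by (simp add: ennreal_power)
      also have "\<dots> = ennreal ((l2 lebesgue Gn)\<^sup>2)" unfolding Gn_def by (rule nn_l2[OF conv_young(1)[OF iG G' ep]])
      also have "\<dots> \<le> ennreal ((l2 lebesgue G')\<^sup>2)" unfolding Gn_def by (intro ennreal_leI power_mono conv_young(2)[OF iG G' ep]) simp
      finally show "(\<integral>\<^sup>+x. (ennreal (cmod (Gn x)))\<^sup>2 \<partial>lborel) \<le> ennreal ((l2 lebesgue G')\<^sup>2)" .
      show "(\<lambda>x. ennreal (cmod (Gn x))) \<in> borel_measurable borel" by measurable
    qed simp
    also have "(\<integral>\<^sup>+z. ennreal (moll (meps n) z) * U (x - z) \<partial>lborel) = ennreal (cmod (conv Ur ?m x))"
      unfolding Ur_def[abs_def] by (rule smear_real[OF Um Uf _ ep]) (use iU in \<open>simp add: Ur_def[abs_def]\<close>)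
    finally have "ennreal (c * cmod (F n x)) \<le> ennreal (C + cmod (conv Ur ?m x))"
      unfolding C_def using k by (simp add: ennreal_plus[symmetric] add.assoc del: ennreal_plus)
    then show ?thesis by (rule ennreal_le_iff[THEN iffD1, rotated]) (use C0 in simp)
  qed
  obtain r1 where r1: "strict_mono r1" "AE x in lebesgue. (\<lambda>n. F (r1 n) x) \<longlonglongrightarrow> w x"
    by (rule l2_subseq_AE[OF test_sqint[OF F] s(1) conv_tendsto[OF iw s(1), folded F_def]])
  have cu: "(\<lambda>n. l2 lebesgue (\<lambda>x. conv Ur (cmoll (meps (r1 n))) x - Ur x)) \<longlonglongrightarrow> 0"
    using LIMSEQ_subseq_LIMSEQ[OF conv_tendsto[OF iU Urs] r1(1)] by (simp add: comp_def)
  obtain r2 where r2: "strict_mono r2" "AE x in lebesgue. (\<lambda>n. conv Ur (cmoll (meps (r1 (r2 n)))) x) \<longlonglongrightarrow> Ur x"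
    by (rule l2_subseq_AE[OF conv_young(1)[OF iU Urs ep] Urs cu])
  have ae1: "AE x in lebesgue. c * cmod (w x) \<le> C + cmod (Ur x)"
    using r1(2) r2(2)
  proof eventually_elim
    case (elim x)
    have "(\<lambda>n. F (r1 (r2 n)) x) \<longlonglongrightarrow> w x" using LIMSEQ_subseq_LIMSEQ[OF elim(1) r2(1)] by (simp add: comp_def)
    then show ?case
      by (intro LIMSEQ_le[OF tendsto_mult_left[OF tendsto_norm] tendsto_add[OF tendsto_const tendsto_norm[OF elim(2)]]]) (use step in auto)
  qed
  define L where "L = 2 * C / c"
  have L: "0 \<le> L" "c * L = 2 * C" using C0 c by (auto simp: L_def)
  \<comment> \<open>The constant \<open>L = 2 C / c\<close> is chosen so that the potential of \<open>cmod V2 * L\<close> is at most \<open>C\<close>.\<close>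
  define g where "g x = max 0 (cmod (w x) - L)" for x
  have gm[measurable]: "g \<in> borel_measurable borel" unfolding g_def[abs_def] by measurable
  have g0: "0 \<le> g x" and gw: "g x \<le> cmod (w x)" "cmod (w x) \<le> g x + L" for x using L(1) by (auto simp: g_def)
  have gs: "(\<lambda>x. complex_of_real (g x)) \<in> sqint lebesgue"
    by (rule sqint_bound(1)[OF s(1) bl, where C=1]) (use g0 gw in auto)
  define ng where "ng = l2 lebesgue (\<lambda>x. complex_of_real (g x))"
  define P where "P = pot (\<lambda>x. ennreal (cmod (V2 x) * g x))"
  have Pm[measurable]: "P \<in> borel_measurable borel" unfolding P_def by measurable
  have UP: "U x \<le> P x + ennreal C" for x
  proof -
    have "U x \<le> pot (\<lambda>x. ennreal (cmod (V2 x) * g x) + ennreal (cmod (V2 x) * L)) x"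
      unfolding U_def
    proof (rule pot_mono)
      fix x
      have "cmod (h x) \<le> cmod (V2 x) * (g x + L)" unfolding h_def norm_mult using gw by (intro mult_left_mono) auto
      then have "ennreal (cmod (h x)) \<le> ennreal (cmod (V2 x) * g x + cmod (V2 x) * L)"
        by (intro ennreal_leI) (simp add: distrib_left)
      also have "\<dots> = ennreal (cmod (V2 x) * g x) + ennreal (cmod (V2 x) * L)" by (rule ennreal_plus) (use g0 L(1) in auto)
      finally show "ennreal (cmod (h x)) \<le> ennreal (cmod (V2 x) * g x) + ennreal (cmod (V2 x) * L)" .
    qed
    also have "\<dots> = P x + pot (\<lambda>x. ennreal (cmod (V2 x) * L)) x" unfolding P_def by (rule pot_add) measurable
    also have "pot (\<lambda>x. ennreal (cmod (V2 x) * L)) x \<le> ennreal (\<kappa> * (L * l2 lebesgue V2))"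
    proof (rule psup)
      have "(\<integral>\<^sup>+x. (ennreal (cmod (V2 x) * L))\<^sup>2 \<partial>lborel) = (\<integral>\<^sup>+x. ennreal (L\<^sup>2) * ennreal ((cmod (V2 x))\<^sup>2) \<partial>lborel)"
        using L(1) by (simp add: ennreal_power ennreal_mult[symmetric] power_mult_distrib mult.commute)
      also have "\<dots> = ennreal (L\<^sup>2) * ennreal ((l2 lebesgue V2)\<^sup>2)"
        using nn_l2[OF V2] unfolding nn_integral_completion by (simp add: nn_integral_cmult)
      also have "\<dots> = ennreal ((L * l2 lebesgue V2)\<^sup>2)" by (simp add: ennreal_mult[symmetric] power_mult_distrib)
      finally show "(\<integral>\<^sup>+x. (ennreal (cmod (V2 x) * L))\<^sup>2 \<partial>lborel) \<le> ennreal ((L * l2 lebesgue V2)\<^sup>2)" by simp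
      show "(\<lambda>x. ennreal (cmod (V2 x) * L)) \<in> borel_measurable borel" by measurable
    qed (use L(1) in simp)
    also have "\<kappa> * (L * l2 lebesgue V2) \<le> C"
      using mult_right_mono[OF Vs L(1)] L(2) by (simp add: mult_ac)
    finally show ?thesis by (simp add: ennreal_leI)
  qed
  have ae2: "AE x in lebesgue. ennreal (c * g x) \<le> P x"
    using ae1 Uf
  proof eventually_elim
    case (elim x)
    show ?case
    proof (cases "g x = 0")
      case False
      then have gx: "g x = cmod (w x) - L" by (auto simp: g_def max_def split: if_splits)
      have "c * g x + 2 * C \<le> C + enn2real (U x)" using elim(1) L(2) unfolding gx by (simp add: Ur_def right_diff_distrib)
      then have "ennreal (c * g x + C) \<le> ennreal (enn2real (U x))" by (intro ennreal_leI) linarith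
      also have "\<dots> = U x" using elim(2) by (simp add: ennreal_enn2real)
      also have "\<dots> \<le> P x + ennreal C" by (rule UP)
      finally have "ennreal C + ennreal (c * g x) \<le> ennreal C + P x" using c C0 g0[of x] by (simp add: add.commute)
      then show ?thesis by (rule ennreal_add_left_cancel_le[THEN iffD1, THEN disjE]) auto
    qed simp
  qed
  have "ennreal (c\<^sup>2 * ng\<^sup>2) = ennreal (c\<^sup>2) * (\<integral>\<^sup>+x. ennreal ((cmod (complex_of_real (g x)))\<^sup>2) \<partial>lebesgue)"
    unfolding nn_l2[OF gs] ng_def by (simp add: ennreal_mult)
  also have "\<dots> = (\<integral>\<^sup>+x. (ennreal (c * g x))\<^sup>2 \<partial>lebesgue)"
    unfolding nn_integral_completion using c g0 by (subst nn_integral_cmult[symmetric]) (auto simp: ennreal_power ennreal_mult[symmetric] power_mult_distrib)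
  also have "\<dots> \<le> (\<integral>\<^sup>+x. (P x)\<^sup>2 \<partial>lebesgue)"
    using ae2 by (intro nn_integral_mono_AE) (auto elim!: eventually_mono intro: power_mono)
  also have "\<dots> \<le> ennreal ((\<kappa> * (l2 lebesgue V2 * ng))\<^sup>2)"
    unfolding P_def nn_integral_completion
  proof (rule pL2)
    have "(\<integral>\<^sup>+x. ennreal (cmod (V2 x) * g x) \<partial>lborel) = (\<integral>\<^sup>+x. ennreal (cmod (V2 x) * cmod (complex_of_real (g x))) \<partial>lebesgue)"
      unfolding nn_integral_completion using g0 by simp
    also have "\<dots> = ennreal (LINT x|lebesgue. cmod (V2 x) * cmod (complex_of_real (g x)))"
      by (rule nn_integral_eq_integral[OF sqint_mult_abs[OF V2 gs]]) simp
    also have "\<dots> \<le> ennreal (l2 lebesgue V2 * ng)" unfolding ng_def by (rule ennreal_leI[OF l2_cs_abs[OF V2 gs]])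
    finally show "(\<integral>\<^sup>+x. ennreal (cmod (V2 x) * g x) \<partial>lborel) \<le> ennreal (l2 lebesgue V2 * ng)" .
    show "(\<lambda>x. ennreal (cmod (V2 x) * g x)) \<in> borel_measurable borel" by measurable
  qed (simp add: ng_def)
  also have "\<dots> \<le> ennreal ((c / 2 * ng)\<^sup>2)"
    using mult_right_mono[OF Vs, of ng] k by (intro ennreal_leI power_mono) (auto simp: ng_def mult.assoc)
  finally have "c\<^sup>2 * ng\<^sup>2 \<le> (c / 2 * ng)\<^sup>2" by (simp add: ennreal_le_iff)
  then have "ng = 0" using c by (simp add: power_mult_distrib power_divide)
  then have "AE x in lebesgue. complex_of_real (g x) = 0" unfolding ng_def using l2_zero_iff[OF gs] by simp
  then have "AE x in lebesgue. cmod (w x) \<le> L" by eventually_elim (simp add: g_def max_def split: if_splits)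
  then show thesis by (rule that)
qed

section \<open>Solutions vanish only where the source vanishes\<close>

lemma lap_product:
  assumes c: "smooth c" and \<psi>: "smooth \<psi>"
  shows "c x * lap \<psi> x = lap (\<lambda>x. c x * \<psi> x) x - 2 * (\<Sum>b\<in>Basis. pd b (\<lambda>x. \<psi> x * pd b c x) x) + \<psi> x * lap c x"
proof -
  have 1: "pd b (pd b (\<lambda>x. c x * \<psi> x)) x = pd b (pd b c) x * \<psi> x + 2 * (pd b c x * pd b \<psi> x) + c x * pd b (pd b \<psi>) x"
    and 2: "pd b (\<lambda>x. \<psi> x * pd b c x) x = pd b \<psi> x * pd b c x + \<psi> x * pd b (pd b c) x" if b: "b \<in> Basis" for b
  proof -
    note s = smoothD(3)[OF c b] smoothD(3)[OF \<psi> b]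
    have "pd b (pd b (\<lambda>x. c x * \<psi> x)) = pd b (\<lambda>x. pd b c x * \<psi> x + c x * pd b \<psi> x)" unfolding pd_rules(3)[OF c \<psi>] ..
    also have "\<dots> = (\<lambda>x. (pd b (pd b c) x * \<psi> x + pd b c x * pd b \<psi> x) + (pd b c x * pd b \<psi> x + c x * pd b (pd b \<psi>) x))"
      unfolding pd_rules(1)[OF smooth_closure(4)[OF s(1) \<psi>] smooth_closure(4)[OF c s(2)]] pd_rules(3)[OF s(1) \<psi>] pd_rules(3)[OF c s(2)] ..
    finally show "pd b (pd b (\<lambda>x. c x * \<psi> x)) x = pd b (pd b c) x * \<psi> x + 2 * (pd b c x * pd b \<psi> x) + c x * pd b (pd b \<psi>) x" by simp
    show "pd b (\<lambda>x. \<psi> x * pd b c x) x = pd b \<psi> x * pd b c x + \<psi> x * pd b (pd b c) x" unfolding pd_rules(3)[OF \<psi> s(1)] ..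
  qed
  have e1: "lap (\<lambda>x. c x * \<psi> x) x = (\<Sum>b\<in>Basis. pd b (pd b c) x * \<psi> x + 2 * (pd b c x * pd b \<psi> x) + c x * pd b (pd b \<psi>) x)"
    unfolding lap_def by (rule sum.cong[OF refl 1])
  have e2: "(\<Sum>b\<in>Basis. pd b (\<lambda>x. \<psi> x * pd b c x) x) = (\<Sum>b\<in>Basis. pd b \<psi> x * pd b c x + \<psi> x * pd b (pd b c) x)"
    by (rule sum.cong[OF refl 2])
  show ?thesis unfolding e1 e2 unfolding lap_def by (simp add: sum.distrib sum_distrib_left sum_distrib_right algebra_simps)
qed

text \<open>
  Where a cut-off function attains its maximum 1 its gradient vanishes, even at boundary points of the set where it equals 1.
\<close>

lemma pd_zero_at_max:
  fixes r :: "'a::euclidean_space \<Rightarrow> real"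
  assumes s: "smooth (\<lambda>x. complex_of_real (r x))" and m: "\<And>y. r y \<le> r x"
  shows "pd b (\<lambda>x. complex_of_real (r x)) x = 0"
proof -
  let ?c = "\<lambda>x. complex_of_real (r x)"
  from smoothD(1)[OF s] have d: "(?c has_derivative frechet_derivative ?c (at x)) (at x)" by (simp add: frechet_derivative_works)
  from has_derivative_Re[OF this] have "(r has_derivative (\<lambda>v. Re (frechet_derivative ?c (at x) v))) (at x)" by simp
  then have "(\<lambda>v. Re (frechet_derivative ?c (at x) v)) = (\<lambda>v. 0)"
    by (intro differential_zero_maxmin[of x UNIV r]) (use m in auto)
  then have 1: "Re (pd b ?c x) = 0" unfolding pd_def by meson
  from has_derivative_Im[OF d] have "((\<lambda>x. 0::real) has_derivative (\<lambda>v. Im (frechet_derivative ?c (at x) v))) (at x)" by simp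
  then have "(\<lambda>v. Im (frechet_derivative ?c (at x) v)) = (\<lambda>v. 0)"
    by (rule has_derivative_unique) (rule has_derivative_const)
  then have 2: "Im (pd b ?c x) = 0" unfolding pd_def by meson
  show ?thesis using 1 2 by (simp add: complex_eq_iff)
qed

lemma lebesgue_on_pairing:
  fixes g g0 \<phi> :: "'a::euclidean_space \<Rightarrow> complex"
  assumes G: "G \<in> sets lebesgue" and m: "g \<in> borel_measurable (lebesgue_on G)" and r: "AE x in lebesgue. zero_ext G g x = g0 x"
    and g0: "g0 \<in> borel_measurable borel" and p: "\<phi> \<in> test_functions G"
  shows "(LINT x|lebesgue_on G. g x * \<phi> x) = (LINT x|lebesgue. g0 x * \<phi> x)"
proof -
  note [measurable] = sqint_meas[OF test_sqint[OF p]] lebesgue_on_measurable[OF G, THEN iffD1, OF m]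
  have [measurable]: "g0 \<in> borel_measurable lebesgue" by (rule measurable_completion) (use g0 in simp)
  have "(LINT x|lebesgue_on G. g x * \<phi> x) = (LINT x|lebesgue. zero_ext G g x * \<phi> x)"
    unfolding lebesgue_on_integral[OF G] by (intro Bochner_Integration.integral_cong refl) (simp add: zero_ext_def)
  also have "\<dots> = (LINT x|lebesgue. g0 x * \<phi> x)"
    using r by (intro integral_cong_AE) (auto elim!: eventually_mono)
  finally show ?thesis .
qed

lemma L2_rep:
  fixes g :: "'a::euclidean_space \<Rightarrow> complex"
  assumes G: "G \<in> sets lebesgue" and g: "g \<in> L2 G"
  obtains g0 where "g0 \<in> borel_measurable borel" "g0 \<in> sqint lebesgue" "AE x in lebesgue. zero_ext G g x = g0 x"
proof -
  have s: "zero_ext G g \<in> sqint lebesgue" using g sqint_lebesgue_on(1)[OF G] by (simp add: L2_sqint)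
  obtain g0 where g0: "g0 \<in> borel_measurable borel" "AE x in lebesgue. zero_ext G g x = g0 x"
    by (rule lebesgue_borel_rep[OF sqint_meas[OF s]])
  have "g0 \<in> borel_measurable lebesgue" by (rule measurable_completion) (use g0 in simp)
  then have "g0 \<in> sqint lebesgue" by (rule sqint_cong_AE[OF g0(2) s])
  then show thesis using g0 that by blast
qed

lemma sqint_mult_bounded:
  assumes f: "f \<in> sqint M" and m: "\<phi> \<in> borel_measurable M" and b: "\<And>x. cmod (\<phi> x) \<le> C"
  shows "(\<lambda>x. f x * \<phi> x) \<in> sqint M"
proof (rule sqint_bound(1)[OF f])
  show "(\<lambda>x. f x * \<phi> x) \<in> borel_measurable M" using sqint_meas[OF f] m by measurable
  show "AE x in M. cmod (f x * \<phi> x) \<le> C * cmod (f x)"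
  proof (rule AE_I2)
    fix x show "cmod (f x * \<phi> x) \<le> C * cmod (f x)" using mult_right_mono[OF b[of x] norm_ge_zero[of "f x"]] by (simp add: norm_mult mult.commute)
  qed
qed

lemma sqint_mult_test:
  assumes f: "f \<in> sqint lebesgue" and p: "\<phi> \<in> test_functions S" shows "(\<lambda>x. f x * \<phi> x) \<in> sqint lebesgue"
proof -
  obtain C where "\<And>x. cmod (\<phi> x) \<le> C" using test_bounded[OF p] by metis
  then show ?thesis by (rule sqint_mult_bounded[OF f sqint_meas[OF test_sqint[OF p]]])
qed

text \<open>
  Localise: for a cut-off function \<open>c\<close> the product \<open>w = c p\<close> solves \<open>\<Delta>w = E - V w\<close> on the whole space, with
  \<open>E = - c f + 2 \<nabla>c \<sqdot> \<nabla>p + p \<Delta>c\<close> square integrable. By \<open>schroedinger_bounded\<close> \<open>w\<close> is bounded, so \<open>V w\<close> is square integrable and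
  \<open>laplacian_zero_on_zero_set\<close> applies. At points of \<open>K\<close> where \<open>p = 0\<close> both \<open>\<nabla>c\<close> and \<open>p \<Delta>c\<close> vanish, and \<open>- f\<close> is what remains.
\<close>

theorem source_zero_on_zero_set:
  fixes p V f :: "'a::euclidean_space \<Rightarrow> complex"
  assumes d: "DIM('a) \<le> 3" and G: "open G" and p: "p \<in> L2 G" and V: "V \<in> L2 G" and f: "f \<in> L2 G"
    and P: "\<And>b. b \<in> Basis \<Longrightarrow> is_weak_partial G p b (P b)"
    and eq: "\<And>\<psi>. \<psi> \<in> test_functions G \<Longrightarrow>
      (LINT x|lebesgue_on G. p x * lap \<psi> x) = - (LINT x|lebesgue_on G. (V x * p x + f x) * \<psi> x)"
    and K: "compact K" "K \<subseteq> G"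
  shows "\<exists>L. AE x in lebesgue. x \<in> K \<longrightarrow> cmod (p x) \<le> L"
    and "AE x in lebesgue. x \<in> K \<longrightarrow> p x = 0 \<longrightarrow> f x = 0"
proof -
  have Gm: "G \<in> sets lebesgue" using G by auto
  obtain r :: "'a \<Rightarrow> real" where r: "(\<lambda>x. complex_of_real (r x)) \<in> test_functions G" "\<And>x. r x \<le> 1" "\<And>x. x \<in> K \<Longrightarrow> r x = 1"
    using smooth_cutoff[OF K(1) G K(2)] by metis
  define c where "c = (\<lambda>x. complex_of_real (r x))"
  have ct: "c \<in> test_functions G" unfolding c_def by (rule r(1))
  have cs: "smooth c" by (rule test_smooth[OF ct])
  \<comment> \<open>Borel representatives, as the potential is defined on Borel functions.\<close>
  obtain p0 where p0: "p0 \<in> borel_measurable borel" "p0 \<in> sqint lebesgue" "AE x in lebesgue. zero_ext G p x = p0 x" by (rule L2_rep[OF Gm p])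
  obtain V0 where V0: "V0 \<in> borel_measurable borel" "V0 \<in> sqint lebesgue" "AE x in lebesgue. zero_ext G V x = V0 x" by (rule L2_rep[OF Gm V])
  obtain f0 where f0: "f0 \<in> borel_measurable borel" "f0 \<in> sqint lebesgue" "AE x in lebesgue. zero_ext G f x = f0 x" by (rule L2_rep[OF Gm f])
  have PL: "P b \<in> L2 G" if "b \<in> Basis" for b using P[OF that] by (simp add: is_weak_partial_def)
  have "\<forall>b\<in>Basis. \<exists>g. g \<in> borel_measurable borel \<and> g \<in> sqint lebesgue \<and> (AE x in lebesgue. zero_ext G (P b) x = g x)"
    using L2_rep[OF Gm PL] by metis
  from bchoice[OF this] obtain Q where Q: "\<And>b. b \<in> Basis \<Longrightarrow> Q b \<in> borel_measurable borel"
    "\<And>b. b \<in> Basis \<Longrightarrow> Q b \<in> sqint lebesgue" "\<And>b. b \<in> Basis \<Longrightarrow> AE x in lebesgue. zero_ext G (P b) x = Q b x" by blast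
  have mG: "g \<in> borel_measurable (lebesgue_on G)" if "g \<in> L2 G" for g using that by (simp add: L2_def)
  note [measurable] = p0(1) V0(1) f0(1) Q(1) mG[OF p] mG[OF V] mG[OF f]
  have e1: "(LINT x|lebesgue. p0 x * lap \<phi> x) = - (LINT x|lebesgue. (V0 x * p0 x + f0 x) * \<phi> x)" if \<phi>: "\<phi> \<in> test_functions G" for \<phi>
  proof -
    have ae: "AE x in lebesgue. zero_ext G (\<lambda>x. V x * p x + f x) x = V0 x * p0 x + f0 x"
      using p0(3) V0(3) f0(3) by eventually_elim (auto simp: zero_ext_def split: if_splits)
    have "(LINT x|lebesgue_on G. (V x * p x + f x) * \<phi> x) = (LINT x|lebesgue. (V0 x * p0 x + f0 x) * \<phi> x)"
      by (rule lebesgue_on_pairing[OF Gm _ ae _ \<phi>]) measurable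
    then show ?thesis using eq[OF \<phi>] lebesgue_on_pairing[OF Gm mG[OF p] p0(3,1) test_lap[OF \<phi>]] by simp
  qed
  have e2: "(LINT x|lebesgue. p0 x * pd b \<phi> x) = - (LINT x|lebesgue. Q b x * \<phi> x)" if b: "b \<in> Basis" and \<phi>: "\<phi> \<in> test_functions G" for b \<phi>
    using P[OF b] \<phi> lebesgue_on_pairing[OF Gm mG[OF p] p0(3,1) test_pd[OF \<phi> b]] lebesgue_on_pairing[OF Gm mG[OF PL[OF b]] Q(3)[OF b] Q(1)[OF b] \<phi>]
    unfolding is_weak_partial_def pd_def by auto
  define w where "w x = c x * p0 x" for x
  define E where "E x = p0 x * lap c x + (\<Sum>b\<in>Basis. 2 * (Q b x * pd b c x)) - f0 x * c x" for x
  have cb[measurable]: "c \<in> borel_measurable borel" "lap c \<in> borel_measurable borel" "\<And>b. b \<in> Basis \<Longrightarrow> pd b c \<in> borel_measurable borel"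
    using test_borel[OF ct] test_borel[OF test_lap[OF ct]] test_borel[OF test_pd[OF ct]] by auto
  have wm[measurable]: "w \<in> borel_measurable borel" unfolding w_def[abs_def] by measurable
  have Em: "E \<in> borel_measurable borel" unfolding E_def[abs_def] by measurable
  have ws: "w \<in> sqint lebesgue" using sqint_mult_test[OF p0(2) ct] unfolding w_def[abs_def] by (simp add: mult.commute)
  have ssum: "(\<lambda>x. \<Sum>b\<in>I. h b x) \<in> sqint lebesgue" if "finite I" "\<And>b. b \<in> I \<Longrightarrow> h b \<in> sqint lebesgue" for I and h :: "'a \<Rightarrow> 'a \<Rightarrow> complex"
    using that by (induction I rule: finite_induct) (auto intro: L2m.add)
  have Es: "E \<in> sqint lebesgue" unfolding E_def[abs_def]
    by (intro L2m.diff L2m.add ssum L2m.cmult sqint_mult_test[OF p0(2) test_lap[OF ct]] sqint_mult_test[OF Q(2) test_pd[OF ct]] sqint_mult_test[OF f0(2) ct]) auto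
  obtain k0 where k0: "compact k0" "\<And>x. c x \<noteq> 0 \<Longrightarrow> x \<in> k0" "\<And>x b. pd b c x \<noteq> 0 \<Longrightarrow> x \<in> k0" using test_support[OF ct] by metis
  obtain k1 where k1: "compact k1" "\<And>x. lap c x \<noteq> 0 \<Longrightarrow> x \<in> k1" using test_support[OF test_lap[OF ct]] by metis
  obtain \<rho> where \<rho>: "\<And>x. x \<in> k0 \<union> k1 \<Longrightarrow> norm x \<le> \<rho>"
    using compact_imp_bounded[OF compact_Un[OF k0(1) k1(1)]] unfolding bounded_iff by blast
  have wz: "w x \<noteq> 0 \<Longrightarrow> norm x \<le> \<rho>" for x using k0(2)[of x] \<rho>[of x] by (auto simp: w_def)
  have Ez: "E x \<noteq> 0 \<Longrightarrow> norm x \<le> \<rho>" for x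
  proof (rule ccontr)
    assume nz: "E x \<noteq> 0" and "\<not> norm x \<le> \<rho>"
    then have "x \<notin> k0" "x \<notin> k1" using \<rho>[of x] by auto
    then have "c x = 0" "lap c x = 0" "\<And>b. pd b c x = 0" using k0 k1 by auto
    then show False using nz by (simp add: E_def)
  qed
  have wl: "wlap w (\<lambda>x. E x - V0 x * w x)"
    unfolding wlap_def
  proof
    fix \<psi> :: "'a \<Rightarrow> complex" assume \<psi>: "\<psi> \<in> test_functions UNIV"
    have ps: "smooth \<psi>" by (rule test_smooth[OF \<psi>])
    have t1: "(\<lambda>x. c x * \<psi> x) \<in> test_functions G" by (rule test_mult(1)[OF ct ps])
    have t2: "(\<lambda>x. \<psi> x * pd b c x) \<in> test_functions G" if "b \<in> Basis" for b by (rule test_mult(2)[OF test_pd[OF ct that] ps])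
    have t3: "(\<lambda>x. \<psi> x * lap c x) \<in> test_functions G" by (rule test_mult(2)[OF test_lap[OF ct] ps])
    have i: "integrable lebesgue (\<lambda>x. g x * \<phi> x)" if "g \<in> sqint lebesgue" "\<phi> \<in> test_functions S" for g \<phi> and S :: "'a set"
      by (rule sqint_mult(1)[OF that(1) test_sqint[OF that(2)]])
    have iV: "integrable lebesgue (\<lambda>x. (V0 x * p0 x) * (c x * \<psi> x))"
      using sqint_mult(1)[OF V0(2) sqint_mult_test[OF p0(2) t1]] by (simp add: mult.assoc)
    have "(LINT x|lebesgue. w x * lap \<psi> x) = (LINT x|lebesgue. p0 x * (c x * lap \<psi> x))" by (simp add: w_def mult_ac)
    also have "\<dots> = (LINT x|lebesgue. p0 x * lap (\<lambda>x. c x * \<psi> x) x - (\<Sum>b\<in>Basis. 2 * (p0 x * pd b (\<lambda>x. \<psi> x * pd b c x) x)) + p0 x * (\<psi> x * lap c x))"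
      unfolding lap_product[OF cs ps] by (intro Bochner_Integration.integral_cong refl) (simp add: algebra_simps sum_distrib_left)
    also have "\<dots> = (LINT x|lebesgue. p0 x * lap (\<lambda>x. c x * \<psi> x) x) - (\<Sum>b\<in>Basis. 2 * (LINT x|lebesgue. p0 x * pd b (\<lambda>x. \<psi> x * pd b c x) x)) + (LINT x|lebesgue. p0 x * (\<psi> x * lap c x))"
    proof -
      have j: "integrable lebesgue (\<lambda>x. 2 * (p0 x * pd b (\<lambda>x. \<psi> x * pd b c x) x))" if "b \<in> Basis" for b
        using i[OF p0(2) test_pd[OF t2[OF that] that]] by simp
      show ?thesis
        using i[OF p0(2) test_lap[OF t1]] i[OF p0(2) t3] j Bochner_Integration.integrable_sum[OF j]
        by (simp add: Bochner_Integration.integral_sum)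
    qed
    also have "\<dots> = - (LINT x|lebesgue. (V0 x * p0 x) * (c x * \<psi> x)) - (LINT x|lebesgue. f0 x * (c x * \<psi> x)) + (\<Sum>b\<in>Basis. 2 * (LINT x|lebesgue. Q b x * (\<psi> x * pd b c x))) + (LINT x|lebesgue. p0 x * (\<psi> x * lap c x))"
      using iV i[OF f0(2) t1] by (simp add: e1[OF t1] e2[OF _ t2] distrib_right sum_negf)
    also have "\<dots> = (LINT x|lebesgue. (E x - V0 x * w x) * \<psi> x)"
    proof -
      have j: "integrable lebesgue (\<lambda>x. 2 * (Q b x * (\<psi> x * pd b c x)))" if "b \<in> Basis" for b
        using i[OF Q(2)[OF that] t2[OF that]] by simp
      have "(\<lambda>x. (E x - V0 x * w x) * \<psi> x) = (\<lambda>x. - ((V0 x * p0 x) * (c x * \<psi> x)) - f0 x * (c x * \<psi> x) + (\<Sum>b\<in>Basis. 2 * (Q b x * (\<psi> x * pd b c x))) + p0 x * (\<psi> x * lap c x))"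
        by (simp add: fun_eq_iff E_def w_def algebra_simps sum_distrib_left)
      then show ?thesis
        using iV i[OF f0(2) t1] i[OF p0(2) t3] j Bochner_Integration.integrable_sum[OF j]
        by (simp add: Bochner_Integration.integral_sum)
    qed
    finally show "(LINT x|lebesgue. w x * lap \<psi> x) = (LINT x|lebesgue. (E x - V0 x * w x) * \<psi> x)" .
  qed
  obtain L where L: "AE x in lebesgue. cmod (w x) \<le> L"
    by (rule schroedinger_bounded[OF d wm V0(1) Em ws V0(2) Es wz Ez wl])
  have Vw: "(\<lambda>x. V0 x * w x) \<in> sqint lebesgue"
  proof (rule sqint_bound(1)[OF V0(2)])
    show "(\<lambda>x. V0 x * w x) \<in> borel_measurable lebesgue" using sqint_meas[OF V0(2)] sqint_meas[OF ws] by measurable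
    show "AE x in lebesgue. cmod (V0 x * w x) \<le> L * cmod (V0 x)"
      using L
    proof eventually_elim
      case (elim x)
      then show ?case using mult_right_mono[OF elim norm_ge_zero[of "V0 x"]] by (simp add: norm_mult mult.commute)
    qed
  qed
  have z: "AE x in lebesgue. w x = 0 \<longrightarrow> E x - V0 x * w x = 0"
  proof (rule laplacian_zero_on_zero_set[OF ws wz L2m.diff[OF Es Vw] _ wl])
    show "E x - V0 x * w x \<noteq> 0 \<Longrightarrow> norm x \<le> \<rho>" for x using wz[of x] Ez[of x] by (cases "w x = 0") auto
  qed
  have cK: "c x = 1" "pd b c x = 0" if "x \<in> K" for x b
    using r(3)[OF that] pd_zero_at_max[of r x b] cs r(2) unfolding c_def by auto
  have zK: "zero_ext G g x = g x" if "x \<in> K" for x g using that K(2) by (auto simp: zero_ext_def)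
  show "\<exists>L. AE x in lebesgue. x \<in> K \<longrightarrow> cmod (p x) \<le> L"
  proof (intro exI[of _ L])
    show "AE x in lebesgue. x \<in> K \<longrightarrow> cmod (p x) \<le> L"
      using L p0(3)
    proof eventually_elim
      case (elim x)
      then show ?case using cK(1)[of x] zK[of x p] by (auto simp: w_def)
    qed
  qed
  show "AE x in lebesgue. x \<in> K \<longrightarrow> p x = 0 \<longrightarrow> f x = 0"
    using z p0(3) f0(3)
  proof eventually_elim
    case (elim x)
    show ?case
    proof (intro impI)
      assume x: "x \<in> K" "p x = 0"
      have "p0 x = 0" "f0 x = f x" using elim(2,3) zK[OF x(1)] x(2) by auto
      then show "f x = 0" using elim(1) cK[OF x(1)] by (simp add: w_def E_def)
    qed
  qed
qed

section \<open>Test functions in the Sobolev space\<close>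

lemma zero_ext_support: "(\<And>x. x \<notin> S \<Longrightarrow> f x = 0) \<Longrightarrow> zero_ext S f = f"
  by (auto simp: zero_ext_def)

lemma integral_on_support:
  fixes f :: "'a::euclidean_space \<Rightarrow> complex"
  assumes "S \<in> sets lebesgue" "\<And>x. x \<notin> S \<Longrightarrow> f x = 0"
  shows "(LINT x|lebesgue_on S. f x) = (LINT x|lebesgue. f x)"
proof -
  have "zero_ext S f = f" by (rule zero_ext_support) (rule assms(2))
  then show ?thesis unfolding lebesgue_on_integral[OF assms(1)] by (rule arg_cong)
qed

lemma test_sqint_on:
  assumes "S \<in> sets lebesgue" "\<phi> \<in> test_functions T" shows "\<phi> \<in> sqint (lebesgue_on S)"
proof -
  have [measurable]: "\<phi> \<in> borel_measurable borel" by (rule test_borel[OF assms(2)])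
  have "(\<lambda>x. indicator S x * \<phi> x) \<in> sqint lebesgue"
  proof (rule sqint_bound(1)[OF test_sqint[OF assms(2)], where C=1])
    show "(\<lambda>x. indicator S x * \<phi> x) \<in> borel_measurable lebesgue" using sqint_meas[OF test_sqint[OF assms(2)]] assms(1) by measurable
    show "AE x in lebesgue. cmod (indicator S x * \<phi> x) \<le> 1 * cmod (\<phi> x)" by (intro AE_I2) (simp add: indicator_def)
  qed
  moreover have "(\<lambda>x. indicator S x * \<phi> x) = zero_ext S \<phi>" by (auto simp: zero_ext_def indicator_def)
  ultimately show ?thesis unfolding sqint_lebesgue_on(1)[OF assms(1)] by simp
qed

lemma weak_partial_unique:
  fixes u :: "'a::euclidean_space \<Rightarrow> complex"
  assumes S: "open S" and g: "is_weak_partial S u b g"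
  shows "is_weak_partial S u b (weak_partial S u b)" "AE x in lebesgue_on S. weak_partial S u b x = g x"
proof -
  show w: "is_weak_partial S u b (weak_partial S u b)" unfolding weak_partial_def by (rule someI[of _ g]) (rule g)
  have s: "g \<in> sqint (lebesgue_on S)" "weak_partial S u b \<in> sqint (lebesgue_on S)" using g w by (auto simp: is_weak_partial_def L2_sqint)
  have Sm: "S \<in> sets lebesgue" using S by auto
  have "AE x in lebesgue_on S. weak_partial S u b x - g x = 0"
  proof (rule fundamental_lemma[OF S])
    show "(\<lambda>x. weak_partial S u b x - g x) \<in> L2 S" unfolding L2_sqint by (rule L2m.diff[OF s(2,1)])
    fix \<phi> :: "'a \<Rightarrow> complex" assume p: "\<phi> \<in> test_functions S"
    note ps = test_sqint_on[OF Sm p]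
    have "(LINT x|lebesgue_on S. weak_partial S u b x * \<phi> x) = (LINT x|lebesgue_on S. g x * \<phi> x)"
      using g w p unfolding is_weak_partial_def by (metis neg_equal_iff_equal)
    then show "(LINT x|lebesgue_on S. (weak_partial S u b x - g x) * \<phi> x) = 0"
      unfolding left_diff_distrib using sqint_mult(1)[OF s(1) ps] sqint_mult(1)[OF s(2) ps] by simp
  qed
  then show "AE x in lebesgue_on S. weak_partial S u b x = g x" by eventually_elim simp
qed

lemma test_weak_partial:
  fixes \<phi> :: "'a::euclidean_space \<Rightarrow> complex"
  assumes S: "open S" and p: "\<phi> \<in> test_functions T" and b: "b \<in> Basis"
  shows "is_weak_partial S \<phi> b (pd b \<phi>)"
  unfolding is_weak_partial_def
proof (intro conjI ballI)
  have Sm: "S \<in> sets lebesgue" using S by auto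
  show "pd b \<phi> \<in> L2 S" unfolding L2_sqint by (rule test_sqint_on[OF Sm test_pd[OF p b]])
  fix \<psi> :: "'a \<Rightarrow> complex" assume q: "\<psi> \<in> test_functions S"
  have o: "\<psi> x = 0" "pd b \<psi> x = 0" if "x \<notin> S" for x using test_outside[OF q that, of b] by auto
  have "(LINT x|lebesgue_on S. \<phi> x * pd b \<psi> x) = (LINT x|lebesgue. \<phi> x * pd b \<psi> x)" by (rule integral_on_support[OF Sm]) (simp add: o)
  also have "\<dots> = - (LINT x|lebesgue. pd b \<phi> x * \<psi> x)" using test_parts[OF p q b] by simp
  also have "(LINT x|lebesgue. pd b \<phi> x * \<psi> x) = (LINT x|lebesgue_on S. pd b \<phi> x * \<psi> x)" by (rule integral_on_support[OF Sm, symmetric]) (simp add: o)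
  finally show "(LINT x|lebesgue_on S. \<phi> x * frechet_derivative \<psi> (at x) b) = - (LINT x|lebesgue_on S. pd b \<phi> x * \<psi> x)"
    unfolding pd_def[of b \<psi>] .
qed

lemma test_H1:
  assumes "open S" "\<phi> \<in> test_functions T" shows "\<phi> \<in> H1 S"
  using test_weak_partial[OF assms] test_sqint_on[OF _ assms(2), of S] assms(1) by (auto simp: H1_def L2_sqint)

lemma test_H1_norm:
  fixes \<phi> :: "'a::euclidean_space \<Rightarrow> complex"
  assumes S: "open S" and p: "\<phi> \<in> test_functions T"
  shows "integrable (lebesgue_on S) (\<lambda>x. (cmod (\<phi> x))\<^sup>2 + (\<Sum>b\<in>Basis. (cmod (pd b \<phi> x))\<^sup>2))"
    and "(H1_norm S \<phi>)\<^sup>2 = (LINT x|lebesgue_on S. (cmod (\<phi> x))\<^sup>2 + (\<Sum>b\<in>Basis. (cmod (pd b \<phi> x))\<^sup>2))"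
proof -
  have Sm: "S \<in> sets lebesgue" using S by auto
  note s = sqint_int[OF test_sqint_on[OF Sm p]] sqint_int[OF test_sqint_on[OF Sm test_pd[OF p]]]
  show i: "integrable (lebesgue_on S) (\<lambda>x. (cmod (\<phi> x))\<^sup>2 + (\<Sum>b\<in>Basis. (cmod (pd b \<phi> x))\<^sup>2))"
    using s by (intro Bochner_Integration.integrable_add Bochner_Integration.integrable_sum) auto
  have ae: "AE x in lebesgue_on S. \<forall>b\<in>Basis. weak_partial S \<phi> b x = pd b \<phi> x"
    using weak_partial_unique(2)[OF S test_weak_partial[OF S p]] by (intro AE_finite_allI) auto
  have wm: "weak_partial S \<phi> b \<in> borel_measurable (lebesgue_on S)" if "b \<in> Basis" for b
    using weak_partial_unique(1)[OF S test_weak_partial[OF S p that]] by (simp add: is_weak_partial_def L2_def)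
  note [measurable] = wm sqint_meas[OF test_sqint_on[OF Sm p]] borel_measurable_integrable[OF i]
  have "H1_inner S \<phi> \<phi> = (LINT x|lebesgue_on S. complex_of_real ((cmod (\<phi> x))\<^sup>2 + (\<Sum>b\<in>Basis. (cmod (pd b \<phi> x))\<^sup>2)))"
    unfolding H1_inner_def
  proof (rule integral_cong_AE)
    show "AE x in lebesgue_on S. \<phi> x * cnj (\<phi> x) + (\<Sum>b\<in>Basis. weak_partial S \<phi> b x * cnj (weak_partial S \<phi> b x)) = complex_of_real ((cmod (\<phi> x))\<^sup>2 + (\<Sum>b\<in>Basis. (cmod (pd b \<phi> x))\<^sup>2))"
      using ae by eventually_elim (simp add: complex_norm_square del: of_real_power)
  qed measurable
  then show "(H1_norm S \<phi>)\<^sup>2 = (LINT x|lebesgue_on S. (cmod (\<phi> x))\<^sup>2 + (\<Sum>b\<in>Basis. (cmod (pd b \<phi> x))\<^sup>2))"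
    unfolding H1_norm_def integral_complex_of_real
    by (simp add: Bochner_Integration.integral_nonneg sum_nonneg)
qed

section \<open>Traces of test functions\<close>

lemma open_slab: "open (slab R :: ('n::finite) pt set)"
  unfolding slab_def by (intro open_Times) auto

text \<open>
  The fundamental theorem of calculus for \<open>t * (cmod (\<phi> (y, t)))\<^sup>2\<close> on \<open>[0, R]\<close>: the factor \<open>t\<close> removes the contribution of the other face.
\<close>

lemma trace_inequality:
  fixes \<phi> :: "('n::finite) pt \<Rightarrow> complex"
  assumes p: "\<phi> \<in> test_functions UNIV" and R: "0 < R"
  shows "(\<lambda>y. \<phi> (y, R)) \<in> sqint lebesgue" "R * (l2 lebesgue (\<lambda>y. \<phi> (y, R)))\<^sup>2 \<le> (1 + R) * (H1_norm (slab R) \<phi>)\<^sup>2"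
proof -
  have sm: "smooth \<phi>" by (rule test_smooth[OF p])
  define e :: "'n pt" where "e = (0, 1)"
  have e: "e \<in> Basis" by (simp add: e_def Basis_prod_def)
  define D where "D = pd e \<phi>"
  have [measurable]: "\<phi> \<in> borel_measurable borel" "D \<in> borel_measurable borel"
    unfolding D_def using test_borel[OF p] test_borel[OF test_pd[OF p e]] by auto
  obtain K where K: "compact K" "\<And>x. \<phi> x \<noteq> 0 \<Longrightarrow> x \<in> K" using test_support[OF p] by metis
  obtain B where B: "\<And>x. x \<in> K \<Longrightarrow> norm x \<le> B" using compact_imp_bounded[OF K(1)] by (auto simp: bounded_iff)
  have cs: "continuous_on UNIV (\<lambda>y. \<phi> (y, R))"
    by (rule continuous_on_compose2[OF smoothD(2)[OF sm]]) (auto intro: continuous_intros)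
  show sq: "(\<lambda>y. \<phi> (y, R)) \<in> sqint lebesgue"
  proof (rule compact_support_sqint(1)[OF cs])
    fix y assume "\<phi> (y, R) \<noteq> 0"
    then show "norm y \<le> B" using B[OF K(2)] norm_fst_le[of y R] by (metis order_trans)
  qed
  define N where "N x = (1 + R) * ((cmod (\<phi> x))\<^sup>2 + (cmod (D x))\<^sup>2)" for x
  have [measurable]: "N \<in> borel_measurable borel" unfolding N_def[abs_def] by measurable
  have pt: "ennreal (R * (cmod (\<phi> (y, R)))\<^sup>2) \<le> (\<integral>\<^sup>+t. ennreal (indicator (slab R) (y, t) * N (y, t)) \<partial>lborel)" for y
  proof -
    define q where "q t = t * (cmod (\<phi> (y, t)))\<^sup>2" for t
    define q' where "q' t = (cmod (\<phi> (y, t)))\<^sup>2 + t * (2 * Re (D (y, t) * cnj (\<phi> (y, t))))" for t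
    have d: "(q has_vector_derivative q' t) (at t within {0..R})" for t
    proof -
      have "((\<lambda>t. (y, t)) has_derivative (\<lambda>h. h *\<^sub>R e)) (at t)"
        unfolding e_def by (auto intro!: derivative_eq_intros has_derivative_Pair)
      from has_derivative_compose[OF this smooth_has_derivative[OF sm, of "(y, t)"]]
      have dp: "((\<lambda>t. \<phi> (y, t)) has_derivative (\<lambda>h. \<Sum>b\<in>Basis. ((h *\<^sub>R e) \<bullet> b) *\<^sub>R pd b \<phi> (y, t))) (at t)" .
      have "(\<Sum>b\<in>Basis. ((h *\<^sub>R e) \<bullet> b) *\<^sub>R pd b \<phi> (y, t)) = h *\<^sub>R D (y, t)" for h
      proof -
        have "(\<Sum>b\<in>Basis. ((h *\<^sub>R e) \<bullet> b) *\<^sub>R pd b \<phi> (y, t)) = (\<Sum>b\<in>Basis. if b = e then h *\<^sub>R D (y, t) else 0)"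
          using e by (intro sum.cong refl) (auto simp: D_def inner_Basis)
        then show ?thesis using e by simp
      qed
      with dp have dp': "((\<lambda>t. \<phi> (y, t)) has_derivative (\<lambda>h. h *\<^sub>R D (y, t))) (at t)" by simp
      have "(q has_derivative (\<lambda>h. t * (\<phi> (y, t) \<bullet> (h *\<^sub>R D (y, t)) + (h *\<^sub>R D (y, t)) \<bullet> \<phi> (y, t)) + h * (\<phi> (y, t) \<bullet> \<phi> (y, t)))) (at t)"
        unfolding q_def[abs_def] power2_norm_eq_inner by (rule has_derivative_mult[OF has_derivative_ident has_derivative_inner[OF dp' dp']])
      moreover have "t * (\<phi> (y, t) \<bullet> (h *\<^sub>R D (y, t)) + (h *\<^sub>R D (y, t)) \<bullet> \<phi> (y, t)) + h * (\<phi> (y, t) \<bullet> \<phi> (y, t)) = h *\<^sub>R q' t" for h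
        unfolding q'_def power2_norm_eq_inner by (simp add: inner_complex_def algebra_simps)
      ultimately have "(q has_vector_derivative q' t) (at t)" by (simp add: has_vector_derivative_def)
      then show ?thesis by (rule has_vector_derivative_at_within)
    qed
    have c: "continuous_on {0..R} q'" unfolding q'_def D_def
      by (intro continuous_intros continuous_on_compose2[OF smoothD(2)[OF sm]] continuous_on_compose2[OF smoothD(2)[OF smoothD(3)[OF sm e]]]) auto
    have "(LINT t|lborel. indicator {0..R} t *\<^sub>R q' t) = q R - q 0"
      by (rule integral_FTC_Icc[OF _ d c]) (use R in auto)
    then have "ennreal (R * (cmod (\<phi> (y, R)))\<^sup>2) = ennreal (LINT t|lborel. indicator {0..R} t *\<^sub>R q' t)" by (simp add: q_def)
    also have "\<dots> \<le> (\<integral>\<^sup>+t. ennreal (norm (indicator {0..R} t *\<^sub>R q' t)) \<partial>lborel)"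
      by (rule order_trans[OF ennreal_leI integral_norm_bound_ennreal[OF borel_integrable_compact[OF compact_Icc c]]]) simp
    also have "\<dots> \<le> (\<integral>\<^sup>+t. ennreal (indicator (slab R) (y, t) * N (y, t)) \<partial>lborel)"
    proof (rule nn_integral_mono_AE)
      have "AE t in lborel. t \<noteq> 0 \<and> t \<noteq> R" using AE_lborel_singleton[of 0] AE_lborel_singleton[of R] by eventually_elim simp
      then show "AE t in lborel. ennreal (norm (indicator {0..R} t *\<^sub>R q' t)) \<le> ennreal (indicator (slab R) (y, t) * N (y, t))"
      proof eventually_elim
        case (elim t)
        show ?case
        proof (cases "t \<in> {0..R}")
          case True
          let ?a = "cmod (\<phi> (y, t))" and ?b = "cmod (D (y, t))"
          have "\<bar>Re (D (y, t) * cnj (\<phi> (y, t)))\<bar> \<le> ?b * ?a" using abs_Re_le_cmod[of "D (y, t) * cnj (\<phi> (y, t))"] by (simp add: norm_mult)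
          then have "2 * \<bar>Re (D (y, t) * cnj (\<phi> (y, t)))\<bar> \<le> ?a\<^sup>2 + ?b\<^sup>2" using sum_squares_bound[of ?a ?b] by (simp add: mult.commute)
          then have "\<bar>t\<bar> * (2 * \<bar>Re (D (y, t) * cnj (\<phi> (y, t)))\<bar>) \<le> R * (?a\<^sup>2 + ?b\<^sup>2)" using True by (intro mult_mono) auto
          then have "\<bar>t * (2 * Re (D (y, t) * cnj (\<phi> (y, t))))\<bar> \<le> R * (?a\<^sup>2 + ?b\<^sup>2)" unfolding abs_mult by simp
          then have "\<bar>q' t\<bar> \<le> ?a\<^sup>2 + R * (?a\<^sup>2 + ?b\<^sup>2)" unfolding q'_def using abs_triangle_ineq[of "?a\<^sup>2" "t * (2 * Re (D (y, t) * cnj (\<phi> (y, t))))"] by simp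
          also have "\<dots> \<le> N (y, t)" unfolding N_def by (simp add: algebra_simps)
          finally show ?thesis using True elim by (simp add: slab_def indicator_def ennreal_leI)
        qed simp
      qed
    qed
    finally show ?thesis .
  qed
  have m[measurable]: "slab R \<in> sets (borel :: 'n pt measure)" by (rule borel_open[OF open_slab])
  have iN: "integrable lebesgue (\<lambda>x. indicator (slab R) x * N x)"
  proof -
    have "integrable lebesgue (\<lambda>x. (cmod (\<phi> x))\<^sup>2 + (cmod (D x))\<^sup>2)"
      unfolding D_def using sqint_int[OF test_sqint[OF p]] sqint_int[OF test_sqint[OF test_pd[OF p e]]] by auto
    then have "integrable lebesgue N" unfolding N_def[abs_def] by simp
    from integrable_mult_indicator[OF _ this, of "slab R"] show ?thesis using open_slab[of R, where 'n='n] by auto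
  qed
  have "ennreal (R * (l2 lebesgue (\<lambda>y. \<phi> (y, R)))\<^sup>2) = (\<integral>\<^sup>+y. ennreal (R * (cmod (\<phi> (y, R)))\<^sup>2) \<partial>lborel)"
    using R nn_l2[OF sq] borel_measurable_continuous_onI[OF cs] unfolding nn_integral_completion by (simp add: ennreal_mult nn_integral_cmult)
  also have "\<dots> \<le> (\<integral>\<^sup>+y. \<integral>\<^sup>+t. ennreal (indicator (slab R) (y, t) * N (y, t)) \<partial>lborel \<partial>lborel)" by (intro nn_integral_mono pt)
  also have "\<dots> = (\<integral>\<^sup>+x. ennreal (indicator (slab R) x * N x) \<partial>(lborel \<Otimes>\<^sub>M lborel))"
    by (rule lborel.nn_integral_fst[of "\<lambda>x. ennreal (indicator (slab R) x * N x)"]) (simp add: lborel_prod)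
  also have "\<dots> = (\<integral>\<^sup>+x. ennreal (indicator (slab R) x * N x) \<partial>lebesgue)" unfolding lborel_prod nn_integral_completion ..
  also have "\<dots> = ennreal (LINT x|lebesgue. indicator (slab R) x * N x)"
    by (rule nn_integral_eq_integral[OF iN]) (use R in \<open>simp add: N_def\<close>)
  finally have "R * (l2 lebesgue (\<lambda>y. \<phi> (y, R)))\<^sup>2 \<le> (LINT x|lebesgue. indicator (slab R) x * N x)"
    by (rule ennreal_le_iff[THEN iffD1, rotated]) (use R in \<open>auto intro!: Bochner_Integration.integral_nonneg simp: N_def\<close>)
  also have "\<dots> = (LINT x|lebesgue_on (slab R). N x)"
    using open_slab[of R, where 'n='n] by (subst integral_restrict_space) auto
  also have "\<dots> \<le> (LINT x|lebesgue_on (slab R). (1 + R) * ((cmod (\<phi> x))\<^sup>2 + (\<Sum>b\<in>Basis. (cmod (pd b \<phi> x))\<^sup>2)))"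
  proof (rule integral_mono)
    show "integrable (lebesgue_on (slab R)) N"
      using iN open_slab[of R, where 'n='n] by (subst integrable_restrict_space) auto
    show "integrable (lebesgue_on (slab R)) (\<lambda>x. (1 + R) * ((cmod (\<phi> x))\<^sup>2 + (\<Sum>b\<in>Basis. (cmod (pd b \<phi> x))\<^sup>2)))"
      using test_H1_norm(1)[OF open_slab p] by simp
    fix x
    have "(cmod (D x))\<^sup>2 \<le> (\<Sum>b\<in>Basis. (cmod (pd b \<phi> x))\<^sup>2)"
      unfolding D_def by (rule member_le_sum[OF e]) auto
    then show "N x \<le> (1 + R) * ((cmod (\<phi> x))\<^sup>2 + (\<Sum>b\<in>Basis. (cmod (pd b \<phi> x))\<^sup>2))" unfolding N_def using R by (intro mult_left_mono) auto
  qed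
  also have "\<dots> = (1 + R) * (H1_norm (slab R) \<phi>)\<^sup>2" unfolding test_H1_norm(2)[OF open_slab p] by simp
  finally show "R * (l2 lebesgue (\<lambda>y. \<phi> (y, R)))\<^sup>2 \<le> (1 + R) * (H1_norm (slab R) \<phi>)\<^sup>2" .
qed

lemma L2_norm_UNIV: "L2_norm UNIV f = l2 lebesgue f" "L2 UNIV = sqint lebesgue"
proof -
  have U: "UNIV \<in> sets lebesgue" by simp
  have z: "zero_ext UNIV g = g" for g by (simp add: zero_ext_def)
  show "L2_norm UNIV f = l2 lebesgue f" unfolding L2_norm_l2 sqint_lebesgue_on(2)[OF U] z ..
  show "L2 UNIV = sqint lebesgue" unfolding L2_sqint by (auto simp: sqint_lebesgue_on(1)[OF U] z)
qed

lemma H1_norm_zero: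
  fixes S :: "'a::euclidean_space set"
  assumes S: "open S" shows "H1_norm S (\<lambda>x. 0) = 0"
proof -
  have "(H1_norm S (\<lambda>x. 0))\<^sup>2 = 0" unfolding test_H1_norm(2)[OF S test_zero[of UNIV]] by simp
  then show ?thesis by simp
qed

lemma test_has_trace:
  fixes \<phi> :: "('n::finite) pt \<Rightarrow> complex"
  assumes p: "\<phi> \<in> test_functions (slab R)" and h: "h = 0 \<or> h = R"
  shows "has_trace R h \<phi> (\<lambda>y. 0)"
  unfolding has_trace_def
proof (intro conjI exI[of _ "\<lambda>j. \<phi>"] allI)
  have z: "\<phi> (y, h) = 0" for y using test_outside[OF p, of "(y, h)"] h by (auto simp: slab_def)
  show "(\<lambda>y. 0) \<in> L2 UNIV" by (simp add: L2_norm_UNIV)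
  show "\<phi> \<in> test_functions UNIV" using test_mono[OF p] by auto
  show "(\<lambda>j. H1_norm (slab R) (\<lambda>x. \<phi> x - \<phi> x)) \<longlonglongrightarrow> 0" by (simp add: H1_norm_zero[OF open_slab])
  show "(\<lambda>j. L2_norm UNIV (\<lambda>y. 0 - \<phi> (y, h))) \<longlonglongrightarrow> 0" by (simp add: z L2_norm_UNIV l2_def)
qed

text \<open>
  The trace is fixed only through approximating sequences; the trace inequality shows that every such sequence has the
  same limit, here zero.
\<close>

lemma trace_of_test_null:
  fixes v :: "('n::finite) pt \<Rightarrow> complex"
  assumes v: "v \<in> test_functions (slab R)" and R: "0 < R"
  shows "AE y in lebesgue. trace_at R R v y = 0"
proof -
  define g where "g = trace_at R R v"
  have "has_trace R R v g" unfolding g_def trace_at_def by (rule someI[of _ "\<lambda>y. 0"]) (rule test_has_trace[OF v], simp)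
  then obtain F where g: "g \<in> sqint lebesgue" and F: "\<And>j::nat. F j \<in> test_functions UNIV"
    and n: "(\<lambda>j. H1_norm (slab R) (\<lambda>x. v x - F j x)) \<longlonglongrightarrow> 0" "(\<lambda>j. l2 lebesgue (\<lambda>y. g y - F j (y, R))) \<longlonglongrightarrow> 0"
    unfolding has_trace_def L2_norm_UNIV by blast
  have vF: "(\<lambda>x. v x - F j x) \<in> test_functions UNIV" for j using test_diff[OF test_mono[OF v] F] by auto
  have v0: "v (y, R) = 0" for y using test_outside[OF v, of "(y, R)"] by (auto simp: slab_def)
  define h where "h j = H1_norm (slab R) (\<lambda>x. v x - F j x)" for j
  have b: "l2 lebesgue (\<lambda>y. F j (y, R)) \<le> sqrt ((1 + R) / R * (h j)\<^sup>2)" for j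
  proof -
    have "l2 lebesgue (\<lambda>y. v (y, R) - F j (y, R)) = l2 lebesgue (\<lambda>y. F j (y, R))" unfolding v0 by (simp add: l2_def)
    then have "R * (l2 lebesgue (\<lambda>y. F j (y, R)))\<^sup>2 \<le> (1 + R) * (h j)\<^sup>2" using trace_inequality(2)[OF vF R, of j] unfolding h_def by simp
    then have "(l2 lebesgue (\<lambda>y. F j (y, R)))\<^sup>2 \<le> (1 + R) / R * (h j)\<^sup>2" using R by (simp add: field_simps)
    then show ?thesis by (rule real_le_rsqrt)
  qed
  have lim: "(\<lambda>j. l2 lebesgue (\<lambda>y. g y - F j (y, R)) + sqrt ((1 + R) / R * (h j)\<^sup>2)) \<longlonglongrightarrow> 0 + sqrt ((1 + R) / R * 0\<^sup>2)"
    using n unfolding h_def by (intro tendsto_intros)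
  have "l2 lebesgue g \<le> l2 lebesgue (\<lambda>y. g y - F j (y, R)) + sqrt ((1 + R) / R * (h j)\<^sup>2)" for j
    using L2m.nrm_triangle[OF L2m.diff[OF g trace_inequality(1)[OF F R]] trace_inequality(1)[OF F R], of j j] b[of j] by simp
  then have "l2 lebesgue g \<le> 0" using LIMSEQ_le_const[OF lim] by auto
  then show ?thesis using l2_zero_iff[OF g] l2_nonneg[of lebesgue g] unfolding g_def by simp
qed

lemma fourier_null:
  fixes \<phi> :: "'a::euclidean_space \<Rightarrow> complex"
  assumes z: "AE x in lebesgue. \<phi> x = 0" shows "AE x in lebesgue. fourier \<phi> x = 0"
proof -
  have z2: "fourier_L1 (zero_ext (ball 0 r) \<phi>) \<xi> = 0" for r \<xi>
  proof -
    have "(LINT y|lebesgue. zero_ext (ball 0 r) \<phi> y * exp (- \<i> * of_real (y \<bullet> \<xi>))) = 0"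
      using z by (intro integral_eq_zero_AE) (auto elim!: eventually_mono simp: zero_ext_def)
    then show ?thesis by (simp add: fourier_L1_def)
  qed
  have "has_fourier \<phi> (\<lambda>x. 0)" unfolding has_fourier_def z2 by (simp add: L2_norm_UNIV l2_def)
  then have "has_fourier \<phi> (fourier \<phi>)" unfolding fourier_def by (rule someI[of "has_fourier \<phi>"])
  then have f: "fourier \<phi> \<in> sqint lebesgue" "(\<lambda>j::nat. l2 lebesgue (fourier \<phi>)) \<longlonglongrightarrow> 0"
    unfolding has_fourier_def z2 L2_norm_UNIV by auto
  then have "l2 lebesgue (fourier \<phi>) = 0" using LIMSEQ_unique[OF f(2) tendsto_const] by simp
  then show ?thesis using l2_zero_iff[OF f(1)] by simp
qed

text \<open>
  The boundary operator does not see a factor whose trace is null, so it drops out of every identity with a test function supported inside the slab.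
\<close>

lemma T_op_null:
  assumes "(AE x in lebesgue. \<phi> x = 0) \<or> (AE x in lebesgue. \<psi> x = 0)"
  shows "T_op k \<phi> \<psi> = 0"
proof -
  have "AE \<xi> in lebesgue. fourier \<phi> \<xi> = 0 \<or> fourier \<psi> \<xi> = 0"
    using assms
  proof
    assume "AE x in lebesgue. \<phi> x = 0" from fourier_null[OF this] show ?thesis by eventually_elim simp
  next
    assume "AE x in lebesgue. \<psi> x = 0" from fourier_null[OF this] show ?thesis by eventually_elim simp
  qed
  then show ?thesis unfolding T_op_def inv_fourier_dual_def
    by (intro integral_eq_zero_AE) (auto elim!: eventually_mono)
qed

lemma test_H1_tilde:
  fixes v :: "('n::finite) pt \<Rightarrow> complex"
  assumes v: "v \<in> test_functions (slab R)" shows "v \<in> H1_tilde R"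
  using test_H1[OF open_slab v] test_has_trace[OF v, of 0] by (simp add: H1_tilde_def)

section \<open>The forms on test functions\<close>

lemma open_cell: "open (cell R :: ('n::finite) pt set)"
proof -
  have "(cell R :: 'n pt set) = box (vec (- pi)) (vec pi) \<times> {0<..<R}" by (auto simp: cell_def mem_box_cart)
  then show ?thesis by (simp only:) (intro open_Times open_box open_greaterThanLessThan)
qed

lemma bounded_cell: "bounded (cell R :: ('n::finite) pt set)"
proof -
  have "(cell R :: 'n pt set) = box (vec (- pi)) (vec pi) \<times> {0<..<R}" by (auto simp: cell_def mem_box_cart)
  then show ?thesis by (simp add: bounded_Times)
qed

lemma lebesgue_open: "open S \<Longrightarrow> S \<in> sets (lebesgue :: 'a::euclidean_space measure)"
  by auto

lemma L2_restrict:
  fixes S T :: "'a::euclidean_space set"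
  assumes S: "open S" and T: "open T" and st: "S \<subseteq> T" and f: "f \<in> L2 T" shows "f \<in> L2 S"
proof -
  have m: "S \<in> sets lebesgue" "T \<in> sets lebesgue" using S T by auto
  have z: "zero_ext T f \<in> sqint lebesgue" using f sqint_lebesgue_on(1)[OF m(2)] by (simp add: L2_sqint)
  have e: "zero_ext S f = (\<lambda>x. indicator S x * zero_ext T f x)" using st by (auto simp: zero_ext_def indicator_def fun_eq_iff)
  have "zero_ext S f \<in> sqint lebesgue"
  proof (rule sqint_bound(1)[OF z, where C=1])
    show "zero_ext S f \<in> borel_measurable lebesgue" unfolding e using sqint_meas[OF z] m(1) by measurable
    show "AE x in lebesgue. cmod (zero_ext S f x) \<le> 1 * cmod (zero_ext T f x)" using st by (intro AE_I2) (auto simp: zero_ext_def)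
  qed
  then show ?thesis unfolding L2_sqint sqint_lebesgue_on(1)[OF m(1)] .
qed

lemma weak_partial_restrict:
  fixes S T :: "'a::euclidean_space set"
  assumes S: "open S" and T: "open T" and st: "S \<subseteq> T" and g: "is_weak_partial T u b g" shows "is_weak_partial S u b g"
  unfolding is_weak_partial_def
proof (intro conjI ballI)
  have m: "S \<in> sets lebesgue" "T \<in> sets lebesgue" using S T by auto
  show "g \<in> L2 S" using g L2_restrict[OF S T st] by (simp add: is_weak_partial_def)
  fix \<phi> :: "'a \<Rightarrow> complex" assume p: "\<phi> \<in> test_functions S"
  have o: "\<phi> x = 0" "frechet_derivative \<phi> (at x) b = 0" if "x \<notin> S" for x using test_outside[OF p that, of b] by (auto simp: pd_def)
  have oT: "\<phi> x = 0" "frechet_derivative \<phi> (at x) b = 0" if "x \<notin> T" for x using o st that by auto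
  have "(LINT x|lebesgue_on T. u x * frechet_derivative \<phi> (at x) b) = - (LINT x|lebesgue_on T. g x * \<phi> x)"
    using g test_mono[OF p st] by (auto simp: is_weak_partial_def)
  moreover have "(LINT x|lebesgue_on A. u x * frechet_derivative \<phi> (at x) b) = (LINT x|lebesgue. u x * frechet_derivative \<phi> (at x) b)"
    "(LINT x|lebesgue_on A. g x * \<phi> x) = (LINT x|lebesgue. g x * \<phi> x)" if "A = S \<or> A = T" for A
    using that m o oT by (auto intro!: integral_on_support)
  ultimately show "(LINT x|lebesgue_on S. u x * frechet_derivative \<phi> (at x) b) = - (LINT x|lebesgue_on S. g x * \<phi> x)" by simp
qed

lemma cell_slab: "R0 < R \<Longrightarrow> cell R0 \<subseteq> slab R" "R0 < R \<Longrightarrow> cell R0 \<subseteq> cell R"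
  and slab_half: "slab R \<subseteq> half_space"
  by (auto simp: cell_def slab_def half_space_def)

lemma Linf_restrict:
  fixes S :: "('n::finite) pt set"
  assumes n: "m \<in> Linf half_space" and S: "open S" "S \<subseteq> half_space"
  obtains C where "0 \<le> C" "m \<in> borel_measurable (lebesgue_on S)" "AE x in lebesgue_on S. cmod (m x) \<le> C"
proof -
  have "open (half_space :: 'n pt set)" unfolding half_space_def by (intro open_Collect_less continuous_intros)
  then have h: "half_space \<in> sets (lebesgue :: 'n pt measure)" by auto
  have Sm: "S \<in> sets lebesgue" using S(1) by auto
  obtain C where C: "m \<in> borel_measurable (lebesgue_on half_space)" "AE x in lebesgue_on half_space. cmod (m x) \<le> C"
    using n by (auto simp: Linf_def)
  have e: "zero_ext S m = (\<lambda>x. indicator S x * zero_ext half_space m x)" using S(2) by (auto simp: zero_ext_def indicator_def fun_eq_iff)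
  have "zero_ext half_space m \<in> borel_measurable lebesgue" using C(1) lebesgue_on_measurable[OF h] by blast
  then have "zero_ext S m \<in> borel_measurable lebesgue" unfolding e using Sm by measurable
  then have 1: "m \<in> borel_measurable (lebesgue_on S)" using lebesgue_on_measurable[OF Sm] by blast
  have "AE x in lebesgue. x \<in> half_space \<longrightarrow> cmod (m x) \<le> C" using C(2) unfolding AE_lebesgue_on[OF h] .
  then have "AE x in lebesgue. x \<in> S \<longrightarrow> cmod (m x) \<le> max C 0" by eventually_elim (use S(2) in auto)
  then have 2: "AE x in lebesgue_on S. cmod (m x) \<le> max C 0" using AE_lebesgue_on[OF Sm] by blast
  show thesis by (rule that[OF _ 1 2]) simp
qed

text \<open>
  The potential \<open>q\<close> is only square integrable, so the coefficient is handled through its product with a test function.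
\<close>

lemma coefficient_mult_test:
  fixes np2 q \<psi> :: "('n::finite) pt \<Rightarrow> complex"
  assumes n: "np2 \<in> Linf half_space" and q: "q \<in> L2 (cell R0)" and R: "R0 < R"
  shows "(\<lambda>x. np2 x + zero_ext (cell R0) q x) \<in> borel_measurable (lebesgue_on (slab R))"
    and "\<psi> \<in> test_functions T \<Longrightarrow> (\<lambda>x. (np2 x + zero_ext (cell R0) q x) * \<psi> x) \<in> sqint (lebesgue_on (slab R))"
proof -
  let ?M = "lebesgue_on (slab R :: 'n pt set)"
  have Sm: "slab R \<in> sets (lebesgue :: 'n pt measure)" and Cm: "cell R0 \<in> sets (lebesgue :: 'n pt measure)"
    by (rule lebesgue_open[OF open_slab], rule lebesgue_open[OF open_cell])
  obtain C where C: "0 \<le> C" "np2 \<in> borel_measurable ?M" "AE x in ?M. cmod (np2 x) \<le> C"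
    by (rule Linf_restrict[OF n open_slab slab_half])
  have "zero_ext (slab R) (zero_ext (cell R0) q) = zero_ext (cell R0) q" by (rule zero_ext_support) (use cell_slab(1)[OF R] in \<open>auto simp: zero_ext_def\<close>)
  then have qs: "zero_ext (cell R0) q \<in> sqint ?M"
    unfolding sqint_lebesgue_on(1)[OF Sm] using q sqint_lebesgue_on(1)[OF Cm] by (simp add: L2_sqint)
  show "(\<lambda>x. np2 x + zero_ext (cell R0) q x) \<in> borel_measurable ?M" using C(2) sqint_meas[OF qs] by measurable
  assume p: "\<psi> \<in> test_functions T"
  note ps = test_sqint_on[OF Sm p]
  have "(\<lambda>x. np2 x * \<psi> x) \<in> sqint ?M"
  proof (rule sqint_bound(1)[OF ps])
    show "(\<lambda>x. np2 x * \<psi> x) \<in> borel_measurable ?M" using C(2) sqint_meas[OF ps] by measurable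
    show "AE x in ?M. cmod (np2 x * \<psi> x) \<le> C * cmod (\<psi> x)"
      using C(3) by eventually_elim (simp add: norm_mult mult_right_mono)
  qed
  moreover obtain B where "\<And>x. cmod (\<psi> x) \<le> B" using test_bounded[OF p] by metis
  then have "(\<lambda>x. zero_ext (cell R0) q x * \<psi> x) \<in> sqint ?M" by (rule sqint_mult_bounded[OF qs sqint_meas[OF ps]])
  ultimately show "(\<lambda>x. (np2 x + zero_ext (cell R0) q x) * \<psi> x) \<in> sqint ?M"
    unfolding distrib_right by (rule L2m.add)
qed

lemma H1_tilde_partial:
  assumes "p \<in> H1_tilde R" "b \<in> Basis"
  shows "is_weak_partial (slab R) p b (weak_partial (slab R) p b)" "p \<in> sqint (lebesgue_on (slab R))"
proof -
  obtain g where "is_weak_partial (slab R) p b g" using assms by (auto simp: H1_tilde_def H1_def)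
  then show "is_weak_partial (slab R) p b (weak_partial (slab R) p b)" by (rule weak_partial_unique(1)[OF open_slab])
  show "p \<in> sqint (lebesgue_on (slab R))" using assms by (simp add: H1_tilde_def H1_def L2_sqint)
qed

lemma H1_tilde_L2: "p \<in> H1_tilde R \<Longrightarrow> p \<in> L2 (slab R)"
  by (simp add: H1_tilde_def H1_def)

text \<open>
  On test functions the form is the distributional operator \<open>- \<Delta> - k\<^sup>2 (n\<^sub>p\<^sup>2 + q)\<close>; the conjugate makes the pairing bilinear.
\<close>

lemma a_form_test_right:
  fixes np2 q p \<psi> :: "('n::finite) pt \<Rightarrow> complex"
  assumes n: "np2 \<in> Linf half_space" and q: "q \<in> L2 (cell R0)" and R: "0 < R0" "R0 < R"
    and p: "p \<in> H1_tilde R" and \<psi>: "\<psi> \<in> test_functions (slab R)"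
  shows "a_form k R0 R np2 q p (\<lambda>x. cnj (\<psi> x)) = - (LINT x|lebesgue_on (slab R). p x * lap \<psi> x)
    - of_real (k\<^sup>2) * (LINT x|lebesgue_on (slab R). p x * ((np2 x + zero_ext (cell R0) q x) * \<psi> x))"
proof -
  let ?M = "lebesgue_on (slab R :: 'n pt set)"
  let ?m = "\<lambda>x. np2 x + zero_ext (cell R0) q x"
  let ?v = "\<lambda>x. cnj (\<psi> x)"
  have Sm: "slab R \<in> sets (lebesgue :: 'n pt measure)" by (rule lebesgue_open[OF open_slab])
  have sm: "smooth \<psi>" by (rule test_smooth[OF \<psi>])
  have vt: "?v \<in> test_functions (slab R)" by (rule test_cnj[OF \<psi>])
  have W: "is_weak_partial (slab R) p b (weak_partial (slab R) p b)" if "b \<in> Basis" for b by (rule H1_tilde_partial(1)[OF p that])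
  have Ws: "weak_partial (slab R) p b \<in> sqint ?M" if "b \<in> Basis" for b using W[OF that] by (simp add: is_weak_partial_def L2_sqint)
  have ps: "p \<in> sqint ?M" using H1_tilde_L2[OF p] by (simp add: L2_sqint)
  have vm: "weak_partial (slab R) ?v b \<in> borel_measurable ?M" if "b \<in> Basis" for b
    using weak_partial_unique(1)[OF open_slab test_weak_partial[OF open_slab vt that]] by (simp add: is_weak_partial_def L2_def)
  have ae: "AE x in ?M. \<forall>b\<in>Basis. weak_partial (slab R) ?v b x = cnj (pd b \<psi> x)"
    using weak_partial_unique(2)[OF open_slab test_weak_partial[OF open_slab vt]] unfolding pd_cnj[OF sm] by (intro AE_finite_allI) auto
  have i1: "integrable ?M (\<lambda>x. weak_partial (slab R) p b x * pd b \<psi> x)" if "b \<in> Basis" for b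
    by (rule sqint_mult(1)[OF Ws[OF that] test_sqint_on[OF Sm test_pd[OF \<psi> that]]])
  have i2: "integrable ?M (\<lambda>x. p x * (?m x * \<psi> x))" by (rule sqint_mult(1)[OF ps coefficient_mult_test(2)[OF n q R(2) \<psi>]])
  have pm: "pd b \<psi> \<in> borel_measurable ?M" if "b \<in> Basis" for b using sqint_meas[OF test_sqint_on[OF Sm test_pd[OF \<psi> that]]] .
  note [measurable] = vm pm sqint_meas[OF Ws] sqint_meas[OF ps] coefficient_mult_test(1)[OF n q R(2)] sqint_meas[OF test_sqint_on[OF Sm \<psi>]]
  have t: "T_op k (trace_at R R p) (trace_at R R ?v) = 0"
    by (rule T_op_null) (use trace_of_test_null[OF vt] R in simp)
  have "(LINT x|?M. (\<Sum>b\<in>Basis. weak_partial (slab R) p b x * cnj (weak_partial (slab R) ?v b x)) - of_real (k\<^sup>2) * ?m x * p x * cnj (?v x))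
    = (LINT x|?M. (\<Sum>b\<in>Basis. weak_partial (slab R) p b x * pd b \<psi> x) - of_real (k\<^sup>2) * (p x * (?m x * \<psi> x)))"
  proof (rule integral_cong_AE)
    show "AE x in ?M. (\<Sum>b\<in>Basis. weak_partial (slab R) p b x * cnj (weak_partial (slab R) ?v b x)) - of_real (k\<^sup>2) * ?m x * p x * cnj (?v x)
      = (\<Sum>b\<in>Basis. weak_partial (slab R) p b x * pd b \<psi> x) - of_real (k\<^sup>2) * (p x * (?m x * \<psi> x))"
      using ae by eventually_elim (simp add: mult_ac)
  qed measurable
  also have "\<dots> = (\<Sum>b\<in>Basis. (LINT x|?M. weak_partial (slab R) p b x * pd b \<psi> x)) - of_real (k\<^sup>2) * (LINT x|?M. p x * (?m x * \<psi> x))"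
    using i1 i2 Bochner_Integration.integrable_sum[OF i1] by (simp add: Bochner_Integration.integral_sum)
  also have "(\<Sum>b\<in>Basis. (LINT x|?M. weak_partial (slab R) p b x * pd b \<psi> x)) = (\<Sum>b\<in>Basis. - (LINT x|?M. p x * pd b (pd b \<psi>) x))"
  proof (rule sum.cong[OF refl])
    fix b :: "'n pt" assume b: "b \<in> Basis"
    show "(LINT x|?M. weak_partial (slab R) p b x * pd b \<psi> x) = - (LINT x|?M. p x * pd b (pd b \<psi>) x)"
      using W[OF b] test_pd[OF \<psi> b] unfolding is_weak_partial_def pd_def[of b "pd b \<psi>"] by auto
  qed
  also have "\<dots> = - (LINT x|?M. p x * lap \<psi> x)"
    unfolding lap_def sum_distrib_left sum_negf
    by (subst Bochner_Integration.integral_sum) (auto intro: sqint_mult(1)[OF ps test_sqint_on[OF Sm test_pd[OF test_pd[OF \<psi>]]]])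
  finally show ?thesis unfolding a_form_def t by simp
qed

text \<open>
  The second argument is an arbitrary element of the energy space, so here the derivatives are moved onto the test function.
\<close>

lemma a_form_test_left:
  fixes np2 q u v :: "('n::finite) pt \<Rightarrow> complex"
  assumes n: "np2 \<in> Linf half_space" and q: "q \<in> L2 (cell R0)" and R: "0 < R0" "R0 < R"
    and u: "u \<in> test_functions (slab R)" and v: "v \<in> H1_tilde R"
  shows "a_form k R0 R np2 q u v = (LINT x|lebesgue_on (slab R).
    (- lap u x - of_real (k\<^sup>2) * ((np2 x + zero_ext (cell R0) q x) * u x)) * cnj (v x))"
proof -
  let ?M = "lebesgue_on (slab R :: 'n pt set)"
  let ?m = "\<lambda>x. np2 x + zero_ext (cell R0) q x"
  have Sm: "slab R \<in> sets (lebesgue :: 'n pt measure)" by (rule lebesgue_open[OF open_slab])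
  have sm: "smooth u" by (rule test_smooth[OF u])
  have W: "is_weak_partial (slab R) v b (weak_partial (slab R) v b)" if "b \<in> Basis" for b by (rule H1_tilde_partial(1)[OF v that])
  have Ws: "weak_partial (slab R) v b \<in> sqint ?M" if "b \<in> Basis" for b using W[OF that] by (simp add: is_weak_partial_def L2_sqint)
  have vs: "v \<in> sqint ?M" using H1_tilde_L2[OF v] by (simp add: L2_sqint)
  have um: "weak_partial (slab R) u b \<in> borel_measurable ?M" if "b \<in> Basis" for b
    using weak_partial_unique(1)[OF open_slab test_weak_partial[OF open_slab u that]] by (simp add: is_weak_partial_def L2_def)
  have ae: "AE x in ?M. \<forall>b\<in>Basis. weak_partial (slab R) u b x = pd b u x"
    using weak_partial_unique(2)[OF open_slab test_weak_partial[OF open_slab u]] by (intro AE_finite_allI) auto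
  have i1: "integrable ?M (\<lambda>x. pd b u x * cnj (weak_partial (slab R) v b x))" if "b \<in> Basis" for b
    by (rule sqint_mult(2)[OF test_sqint_on[OF Sm test_pd[OF u that]] Ws[OF that]])
  have i2: "integrable ?M (\<lambda>x. (?m x * u x) * cnj (v x))" by (rule sqint_mult(2)[OF coefficient_mult_test(2)[OF n q R(2) u] vs])
  have i3: "integrable ?M (\<lambda>x. pd b (pd b u) x * cnj (v x))" if "b \<in> Basis" for b
    by (rule sqint_mult(2)[OF test_sqint_on[OF Sm test_pd[OF test_pd[OF u that] that]] vs])
  have i4: "integrable ?M (\<lambda>x. lap u x * cnj (v x))" by (rule sqint_mult(2)[OF test_sqint_on[OF Sm test_lap[OF u]] vs])
  have pm: "pd b u \<in> borel_measurable ?M" if "b \<in> Basis" for b using sqint_meas[OF test_sqint_on[OF Sm test_pd[OF u that]]] .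
  note [measurable] = um pm sqint_meas[OF Ws] sqint_meas[OF vs] coefficient_mult_test(1)[OF n q R(2)] sqint_meas[OF test_sqint_on[OF Sm u]]
  have t: "T_op k (trace_at R R u) (trace_at R R v) = 0"
    by (rule T_op_null) (use trace_of_test_null[OF u] R in simp)
  have "(LINT x|?M. (\<Sum>b\<in>Basis. weak_partial (slab R) u b x * cnj (weak_partial (slab R) v b x)) - of_real (k\<^sup>2) * ?m x * u x * cnj (v x))
    = (LINT x|?M. (\<Sum>b\<in>Basis. pd b u x * cnj (weak_partial (slab R) v b x)) - of_real (k\<^sup>2) * ((?m x * u x) * cnj (v x)))"
  proof (rule integral_cong_AE)
    show "AE x in ?M. (\<Sum>b\<in>Basis. weak_partial (slab R) u b x * cnj (weak_partial (slab R) v b x)) - of_real (k\<^sup>2) * ?m x * u x * cnj (v x)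
      = (\<Sum>b\<in>Basis. pd b u x * cnj (weak_partial (slab R) v b x)) - of_real (k\<^sup>2) * ((?m x * u x) * cnj (v x))"
      using ae by eventually_elim (simp add: mult_ac)
  qed measurable
  also have "\<dots> = (\<Sum>b\<in>Basis. (LINT x|?M. pd b u x * cnj (weak_partial (slab R) v b x))) - of_real (k\<^sup>2) * (LINT x|?M. (?m x * u x) * cnj (v x))"
    using i1 i2 Bochner_Integration.integrable_sum[OF i1] by (simp add: Bochner_Integration.integral_sum)
  also have "(\<Sum>b\<in>Basis. (LINT x|?M. pd b u x * cnj (weak_partial (slab R) v b x))) = (\<Sum>b\<in>Basis. - (LINT x|?M. pd b (pd b u) x * cnj (v x)))"
  proof (rule sum.cong[OF refl])
    fix b :: "'n pt" assume b: "b \<in> Basis"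
    let ?c = "\<lambda>x. cnj (pd b u x)"
    have c: "?c \<in> test_functions (slab R)" by (rule test_cnj[OF test_pd[OF u b]])
    have "(LINT x|?M. v x * pd b ?c x) = - (LINT x|?M. weak_partial (slab R) v b x * ?c x)"
      using W[OF b] c unfolding is_weak_partial_def pd_def[of b ?c] by auto
    then have "(LINT x|?M. cnj (v x * pd b ?c x)) = - (LINT x|?M. cnj (weak_partial (slab R) v b x * ?c x))"
      unfolding Bochner_Integration.integral_cnj by simp
    then show "(LINT x|?M. pd b u x * cnj (weak_partial (slab R) v b x)) = - (LINT x|?M. pd b (pd b u) x * cnj (v x))"
      unfolding pd_cnj[OF smoothD(3)[OF sm b]] by (simp add: mult.commute)
  qed
  also have "\<dots> = - (LINT x|?M. lap u x * cnj (v x))"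
    unfolding lap_def sum_distrib_right sum_negf
    by (subst Bochner_Integration.integral_sum) (auto intro: i3)
  also have "- (LINT x|?M. lap u x * cnj (v x)) - of_real (k\<^sup>2) * (LINT x|?M. (?m x * u x) * cnj (v x))
    = (LINT x|?M. (- lap u x - of_real (k\<^sup>2) * (?m x * u x)) * cnj (v x))"
  proof -
    have "(\<lambda>x. (- lap u x - of_real (k\<^sup>2) * (?m x * u x)) * cnj (v x)) = (\<lambda>x. - (lap u x * cnj (v x)) - of_real (k\<^sup>2) * ((?m x * u x) * cnj (v x)))"
      by (simp add: fun_eq_iff algebra_simps)
    then show ?thesis using i4 i2 by simp
  qed
  finally show ?thesis unfolding a_form_def t by simp
qed

text \<open>
  The source for which \<open>u\<close> solves the problem with potential \<open>q\<close>.
\<close>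

definition source_of :: "real \<Rightarrow> (('n::finite) pt \<Rightarrow> complex) \<Rightarrow> ('n pt \<Rightarrow> complex) \<Rightarrow> ('n pt \<Rightarrow> complex) \<Rightarrow> 'n pt \<Rightarrow> complex" where
  "source_of k np2 q u x = - lap u x - of_real (k\<^sup>2) * ((np2 x + q x) * u x)"

lemma test_is_solution:
  fixes np2 q u :: "('n::finite) pt \<Rightarrow> complex"
  assumes n: "np2 \<in> Linf half_space" and q: "q \<in> L2 (cell R0)" and R: "0 < R0" "R0 < R"
    and u: "u \<in> test_functions (cell R0)"
  shows "is_solution k R0 R np2 q (source_of k np2 q u) u"
  unfolding is_solution_def
proof (intro conjI ballI)
  have us: "u \<in> test_functions (slab R)" by (rule test_mono[OF u cell_slab(1)[OF R(2)]])
  show "u \<in> H1_tilde R" by (rule test_H1_tilde[OF us])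
  fix v :: "'n pt \<Rightarrow> complex" assume v: "v \<in> H1_tilde R"
  have e: "- lap u x - of_real (k\<^sup>2) * ((np2 x + zero_ext (cell R0) q x) * u x) = zero_ext (cell R0) (source_of k np2 q u) x" for x
    using test_outside[OF u, of x] test_outside[OF test_lap[OF u], of x] by (auto simp: zero_ext_def source_of_def)
  show "a_form k R0 R np2 q u v = (LINT x|lebesgue_on (slab R). zero_ext (cell R0) (source_of k np2 q u) x * cnj (v x))"
    unfolding a_form_test_left[OF n q R us v] e ..
qed

lemma coefficient_cell:
  fixes np2 q :: "('n::finite) pt \<Rightarrow> complex"
  assumes n: "np2 \<in> Linf half_space" and q: "q \<in> L2 (cell R0)"
  shows "(\<lambda>x. of_real (k\<^sup>2) * (np2 x + q x)) \<in> L2 (cell R0)"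
proof -
  let ?M = "lebesgue_on (cell R0 :: 'n pt set)"
  have Cm: "cell R0 \<in> sets (lebesgue :: 'n pt measure)" by (rule lebesgue_open[OF open_cell])
  have ch: "cell R0 \<subseteq> (half_space :: 'n pt set)" by (auto simp: cell_def half_space_def)
  obtain C where C: "0 \<le> C" "np2 \<in> borel_measurable ?M" "AE x in ?M. cmod (np2 x) \<le> C"
    by (rule Linf_restrict[OF n open_cell ch])
  have "(cell R0 :: 'n pt set) \<in> lmeasurable" by (rule bounded_set_imp_lmeasurable[OF bounded_cell Cm])
  then have fin: "finite_measure ?M" by (rule finite_measure_lebesgue_on)
  have one: "(\<lambda>x. 1) \<in> sqint ?M" unfolding sqint_def using finite_measure.integrable_const[OF fin, of "1::real"] by simp
  have "np2 \<in> sqint ?M" by (rule sqint_bound(1)[OF one C(2)]) (use C(3) in simp)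
  then have "(\<lambda>x. np2 x + q x) \<in> sqint ?M" using q by (intro L2m.add) (simp_all add: L2_sqint)
  then show ?thesis unfolding L2_sqint by (rule L2m.cmult)
qed

lemma source_of_L2:
  fixes np2 q u :: "('n::finite) pt \<Rightarrow> complex"
  assumes n: "np2 \<in> Linf half_space" and q: "q \<in> L2 (cell R0)" and u: "u \<in> test_functions (cell R0)"
  shows "source_of k np2 q u \<in> L2 (cell R0)"
proof -
  let ?M = "lebesgue_on (cell R0 :: 'n pt set)"
  have Cm: "cell R0 \<in> sets (lebesgue :: 'n pt measure)" by (rule lebesgue_open[OF open_cell])
  obtain B where B: "\<And>x. cmod (u x) \<le> B" using test_bounded[OF u] by metis
  have 1: "(\<lambda>x. (of_real (k\<^sup>2) * (np2 x + q x)) * u x) \<in> sqint ?M"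
    using coefficient_cell[OF n q, of k] unfolding L2_sqint by (rule sqint_mult_bounded[OF _ sqint_meas[OF test_sqint_on[OF Cm u]] B])
  have 2: "(\<lambda>x. (-1) * lap u x) \<in> sqint ?M" by (rule L2m.cmult[OF test_sqint_on[OF Cm test_lap[OF u]]])
  have "source_of k np2 q u = (\<lambda>x. (-1) * lap u x - (of_real (k\<^sup>2) * (np2 x + q x)) * u x)" by (simp add: fun_eq_iff source_of_def)
  then show ?thesis using L2m.diff[OF 2 1] by (simp add: L2_sqint)
qed

text \<open>
  Testing inside the cell reduces the variational problem on the slab to an equation on the cell, without boundary operator.
\<close>

lemma solution_equation:
  fixes np2 q f p \<psi> :: "('n::finite) pt \<Rightarrow> complex"
  assumes n: "np2 \<in> Linf half_space" and q: "q \<in> L2 (cell R0)" and R: "0 < R0" "R0 < R" and f: "f \<in> L2 (cell R0)"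
    and p: "is_solution k R0 R np2 q f p" and \<psi>: "\<psi> \<in> test_functions (cell R0)"
  shows "(LINT x|lebesgue_on (cell R0). p x * lap \<psi> x) = - (LINT x|lebesgue_on (cell R0). (of_real (k\<^sup>2) * (np2 x + q x) * p x + f x) * \<psi> x)"
proof -
  let ?M = "lebesgue_on (slab R :: 'n pt set)"
  let ?m = "\<lambda>x. np2 x + zero_ext (cell R0) q x"
  have Sm: "slab R \<in> sets (lebesgue :: 'n pt measure)" and Cm: "cell R0 \<in> sets (lebesgue :: 'n pt measure)"
    by (rule lebesgue_open[OF open_slab], rule lebesgue_open[OF open_cell])
  have ps: "\<psi> \<in> test_functions (slab R)" by (rule test_mono[OF \<psi> cell_slab(1)[OF R(2)]])
  have pH: "p \<in> H1_tilde R" and pe: "\<And>v. v \<in> H1_tilde R \<Longrightarrow> a_form k R0 R np2 q p v = (LINT x|?M. zero_ext (cell R0) f x * cnj (v x))"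
    using p by (auto simp: is_solution_def)
  have "zero_ext (slab R) (zero_ext (cell R0) f) = zero_ext (cell R0) f" by (rule zero_ext_support) (use cell_slab(1)[OF R(2)] in \<open>auto simp: zero_ext_def\<close>)
  then have fs: "zero_ext (cell R0) f \<in> sqint ?M"
    unfolding sqint_lebesgue_on(1)[OF Sm] using f sqint_lebesgue_on(1)[OF Cm] by (simp add: L2_sqint)
  have pss: "p \<in> sqint ?M" using H1_tilde_L2[OF pH] by (simp add: L2_sqint)
  have i: "integrable ?M (\<lambda>x. p x * (?m x * \<psi> x))" "integrable ?M (\<lambda>x. zero_ext (cell R0) f x * \<psi> x)"
    by (rule sqint_mult(1)[OF pss coefficient_mult_test(2)[OF n q R(2) ps]], rule sqint_mult(1)[OF fs test_sqint_on[OF Sm ps]])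
  have solve: "a = - (b + c)" if "- a - b = c" for a b c :: complex using that by auto
  have "a_form k R0 R np2 q p (\<lambda>x. cnj (\<psi> x)) = (LINT x|?M. zero_ext (cell R0) f x * \<psi> x)"
    using pe[OF test_H1_tilde[OF test_cnj[OF ps]]] by simp
  then have "(LINT x|?M. p x * lap \<psi> x) = - (of_real (k\<^sup>2) * (LINT x|?M. p x * (?m x * \<psi> x)) + (LINT x|?M. zero_ext (cell R0) f x * \<psi> x))"
    unfolding a_form_test_right[OF n q R pH ps] by (rule solve)
  also have "of_real (k\<^sup>2) * (LINT x|?M. p x * (?m x * \<psi> x)) + (LINT x|?M. zero_ext (cell R0) f x * \<psi> x)
    = (LINT x|?M. of_real (k\<^sup>2) * (p x * (?m x * \<psi> x)) + zero_ext (cell R0) f x * \<psi> x)" using i by simp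
  finally have e: "(LINT x|?M. p x * lap \<psi> x) = - (LINT x|?M. of_real (k\<^sup>2) * (p x * (?m x * \<psi> x)) + zero_ext (cell R0) f x * \<psi> x)" .
  have z: "\<psi> x = 0" "lap \<psi> x = 0" if "x \<notin> cell R0" for x using test_outside[OF \<psi> that] test_outside[OF test_lap[OF \<psi>] that] by auto
  have zs: "\<psi> x = 0" "lap \<psi> x = 0" if "x \<notin> slab R" for x using z[of x] that cell_slab(1)[OF R(2)] by auto
  have "(LINT x|lebesgue_on (cell R0). p x * lap \<psi> x) = (LINT x|?M. p x * lap \<psi> x)"
    by (subst integral_on_support[OF Cm], simp add: z, subst integral_on_support[OF Sm], simp_all add: zs)
  also have "\<dots> = - (LINT x|lebesgue_on (cell R0). of_real (k\<^sup>2) * (p x * (?m x * \<psi> x)) + zero_ext (cell R0) f x * \<psi> x)"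
    unfolding e by (rule arg_cong[where f=uminus], subst integral_on_support[OF Sm], simp add: zs, subst integral_on_support[OF Cm], simp_all add: z)
  also have "(LINT x|lebesgue_on (cell R0). of_real (k\<^sup>2) * (p x * (?m x * \<psi> x)) + zero_ext (cell R0) f x * \<psi> x)
    = (LINT x|lebesgue_on (cell R0). (of_real (k\<^sup>2) * (np2 x + q x) * p x + f x) * \<psi> x)"
    by (intro Bochner_Integration.integral_cong refl) (simp add: space_restrict_space zero_ext_def algebra_simps)
  finally show ?thesis .
qed

section \<open>Uniqueness\<close>

lemma lap_mult_flat:
  assumes c: "smooth c" and \<psi>: "smooth \<psi>" and z: "\<And>b. b \<in> Basis \<Longrightarrow> pd b c x = 0"
  shows "lap (\<lambda>x. c x * \<psi> x) x = c x * lap \<psi> x + \<psi> x * lap c x"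
proof -
  have "(\<Sum>b\<in>Basis. pd b (\<lambda>x. \<psi> x * pd b c x) x) = (\<Sum>b\<in>Basis. \<psi> x * pd b (pd b c) x)"
    using z by (intro sum.cong refl) (simp add: pd_rules(3)[OF \<psi> smoothD(3)[OF c]])
  also have "\<dots> = \<psi> x * lap c x" by (simp add: lap_def sum_distrib_left)
  finally show ?thesis using lap_product[OF c \<psi>, of x] by simp
qed

lemma lap_square:
  assumes b: "b \<in> Basis"
  shows "smooth (\<lambda>x. complex_of_real (x \<bullet> b) * of_real (x \<bullet> b))" "lap (\<lambda>x. complex_of_real (x \<bullet> b) * of_real (x \<bullet> b)) x = 2"
proof -
  have l: "smooth (\<lambda>x. complex_of_real (x \<bullet> b))" by (rule smooth_closure(2))
  show "smooth (\<lambda>x. complex_of_real (x \<bullet> b) * of_real (x \<bullet> b))" by (rule smooth_closure(4)[OF l l])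
  have 1: "pd i (\<lambda>x. complex_of_real (x \<bullet> b) * of_real (x \<bullet> b)) = (\<lambda>x. (2 * of_real (i \<bullet> b)) * of_real (x \<bullet> b))" for i
    unfolding pd_rules(3)[OF l l] pd_inner by (simp add: fun_eq_iff)
  have 2: "pd i (pd i (\<lambda>x. complex_of_real (x \<bullet> b) * of_real (x \<bullet> b))) x = (if i = b then 2 else 0)" if "i \<in> Basis" for i
    unfolding 1 pd_unary(5)[OF l] pd_inner using b that by (simp add: inner_Basis)
  have "lap (\<lambda>x. complex_of_real (x \<bullet> b) * of_real (x \<bullet> b)) x = (\<Sum>i\<in>Basis. if i = b then 2 else 0)"
    unfolding lap_def by (rule sum.cong[OF refl 2])
  then show "lap (\<lambda>x. complex_of_real (x \<bullet> b) * of_real (x \<bullet> b)) x = 2" using b by simp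
qed

lemma integral_cong_on_test:
  fixes p p' \<phi> :: "'a::euclidean_space \<Rightarrow> complex"
  assumes G: "open G" and p: "p \<in> L2 G" "p' \<in> L2 G" and ae: "AE x in lebesgue_on G. p x = p' x" and \<phi>: "\<phi> \<in> test_functions T"
  shows "(LINT x|lebesgue_on G. p x * \<phi> x) = (LINT x|lebesgue_on G. p' x * \<phi> x)"
proof (rule integral_cong_AE)
  note [measurable] = sqint_meas[OF test_sqint_on[OF lebesgue_open[OF G] \<phi>]]
  have [measurable]: "p \<in> borel_measurable (lebesgue_on G)" "p' \<in> borel_measurable (lebesgue_on G)" using p by (auto simp: L2_def)
  show "(\<lambda>x. p x * \<phi> x) \<in> borel_measurable (lebesgue_on G)" "(\<lambda>x. p' x * \<phi> x) \<in> borel_measurable (lebesgue_on G)" by measurable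
  show "AE x in lebesgue_on G. p x * \<phi> x = p' x * \<phi> x" using ae by eventually_elim simp
qed

text \<open>
  The difference of the equations gives \<open>(V1 - V2) p = 0\<close>, hence \<open>p = 0\<close> where the potentials differ, and there
  \<open>source_zero_on_zero_set\<close> applies. The local bound for \<open>p\<close> from the same theorem makes \<open>(V1 - V2) p\<close> square integrable, as
  the fundamental lemma requires.
\<close>

lemma source_zero_where_potentials_differ:
  fixes p V1 V2 f :: "'a::euclidean_space \<Rightarrow> complex"
  assumes d: "DIM('a) \<le> 3" and G: "open G" and p: "p \<in> L2 G" and V: "V1 \<in> L2 G" "V2 \<in> L2 G" and f: "f \<in> L2 G"
    and P: "\<And>b. b \<in> Basis \<Longrightarrow> is_weak_partial G p b (P b)"
    and e1: "\<And>\<psi>. \<psi> \<in> test_functions G \<Longrightarrow> (LINT x|lebesgue_on G. p x * lap \<psi> x) = - (LINT x|lebesgue_on G. (V1 x * p x + f x) * \<psi> x)"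
    and e2: "\<And>\<psi>. \<psi> \<in> test_functions G \<Longrightarrow> (LINT x|lebesgue_on G. p x * lap \<psi> x) = - (LINT x|lebesgue_on G. (V2 x * p x + f x) * \<psi> x)"
    and K: "compact K" "K \<subseteq> G"
  shows "AE x in lebesgue. x \<in> K \<longrightarrow> V1 x \<noteq> V2 x \<longrightarrow> f x = 0"
proof -
  let ?M = "lebesgue_on G"
  have Gm: "G \<in> sets lebesgue" by (rule lebesgue_open[OF G])
  obtain r :: "'a \<Rightarrow> real" where r: "(\<lambda>x. complex_of_real (r x)) \<in> test_functions G" "\<And>x. x \<in> K \<Longrightarrow> r x = 1"
    using smooth_cutoff[OF K(1) G K(2)] by metis
  define c where "c = (\<lambda>x. complex_of_real (r x))"
  have ct: "c \<in> test_functions G" unfolding c_def by (rule r(1))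
  obtain A where A: "compact A" "A \<subseteq> G" "\<And>x. c x \<noteq> 0 \<Longrightarrow> x \<in> A" using test_support[OF ct] by metis
  obtain L where L: "AE x in lebesgue. x \<in> A \<longrightarrow> cmod (p x) \<le> L"
    using source_zero_on_zero_set(1)[OF d G p V(1) f P e1 A(1,2)] by blast
  obtain B where B: "0 < B" "\<And>x. cmod (c x) \<le> B" using test_bounded[OF ct] by metis
  have s: "p \<in> sqint ?M" "V1 \<in> sqint ?M" "V2 \<in> sqint ?M" "f \<in> sqint ?M" using p V f by (auto simp: L2_sqint)
  note ds = L2m.diff[OF s(2,3)]
  note cm = sqint_meas[OF test_sqint_on[OF Gm ct]]
  note [measurable] = sqint_meas[OF s(1)] sqint_meas[OF s(2)] sqint_meas[OF s(3)] cm
  define g where "g x = (V1 x - V2 x) * (p x * c x)" for x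
  have gs: "g \<in> L2 G"
    unfolding L2_sqint
  proof (rule sqint_bound(1)[OF ds])
    show "g \<in> borel_measurable ?M" unfolding g_def[abs_def] by measurable
    have "AE x in ?M. x \<in> A \<longrightarrow> cmod (p x) \<le> L" using L unfolding AE_lebesgue_on[OF Gm] by eventually_elim simp
    then show "AE x in ?M. cmod (g x) \<le> (\<bar>L\<bar> * B) * cmod (V1 x - V2 x)"
    proof eventually_elim
      case (elim x)
      have "cmod (p x * c x) \<le> \<bar>L\<bar> * B"
      proof (cases "c x = 0")
        case False
        then have "cmod (p x) \<le> \<bar>L\<bar>" using elim A(3)[of x] by simp
        then show ?thesis unfolding norm_mult using B by (intro mult_mono) auto
      qed (use B in simp)
      from mult_right_mono[OF this norm_ge_zero[of "V1 x - V2 x"]] show ?case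
        unfolding g_def norm_mult[of "V1 x - V2 x"] by (simp add: mult.commute)
    qed
  qed
  have "AE x in ?M. g x = 0"
  proof (rule fundamental_lemma[OF G gs])
    fix \<psi> :: "'a \<Rightarrow> complex" assume \<psi>: "\<psi> \<in> test_functions G"
    have t: "(\<lambda>x. c x * \<psi> x) \<in> test_functions G" by (rule test_mult(1)[OF ct test_smooth[OF \<psi>]])
    obtain D where D: "\<And>x. cmod (c x * \<psi> x) \<le> D" using test_bounded[OF t] by metis
    note pt = sqint_mult_bounded[OF s(1) sqint_meas[OF test_sqint_on[OF Gm t]] D]
    have i: "integrable ?M (\<lambda>x. V1 x * (p x * (c x * \<psi> x)))" "integrable ?M (\<lambda>x. V2 x * (p x * (c x * \<psi> x)))" "integrable ?M (\<lambda>x. f x * (c x * \<psi> x))"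
      by (rule sqint_mult(1)[OF s(2) pt], rule sqint_mult(1)[OF s(3) pt], rule sqint_mult(1)[OF s(4) test_sqint_on[OF Gm t]])
    have x: "(LINT x|?M. (W x * p x + f x) * (c x * \<psi> x)) = (LINT x|?M. W x * (p x * (c x * \<psi> x))) + (LINT x|?M. f x * (c x * \<psi> x))"
      if "integrable ?M (\<lambda>x. W x * (p x * (c x * \<psi> x)))" for W
      unfolding distrib_right mult.assoc using that i(3) by simp
    have "(LINT x|?M. V1 x * (p x * (c x * \<psi> x))) = (LINT x|?M. V2 x * (p x * (c x * \<psi> x)))"
      using e1[OF t] e2[OF t] unfolding x[OF i(1)] x[OF i(2)] by simp
    moreover have "(LINT x|?M. g x * \<psi> x) = (LINT x|?M. V1 x * (p x * (c x * \<psi> x)) - V2 x * (p x * (c x * \<psi> x)))"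
      unfolding g_def by (intro Bochner_Integration.integral_cong refl) (simp add: algebra_simps)
    ultimately show "(LINT x|?M. g x * \<psi> x) = 0" using i by simp
  qed
  then have "AE x in lebesgue. x \<in> G \<longrightarrow> g x = 0" unfolding AE_lebesgue_on[OF Gm] .
  moreover have "AE x in lebesgue. x \<in> K \<longrightarrow> p x = 0 \<longrightarrow> f x = 0"
    by (rule source_zero_on_zero_set(2)[OF d G p V(1) f P e1 K])
  ultimately show ?thesis
  proof eventually_elim
    case (elim x)
    show ?case
    proof (intro impI)
      assume x: "x \<in> K" "V1 x \<noteq> V2 x"
      then have "p x = 0" using elim(1) K(2) r(2)[of x] by (auto simp: g_def c_def)
      then show "f x = 0" using elim(2) x by simp
    qed
  qed
qed

lemma source_zero_if_two_sources:
  fixes p V f :: "'a::euclidean_space \<Rightarrow> complex"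
  assumes G: "open G" and p: "p \<in> L2 G" and V: "V \<in> L2 G" and f: "f \<in> L2 G"
    and e1: "\<And>\<psi>. \<psi> \<in> test_functions G \<Longrightarrow> (LINT x|lebesgue_on G. p x * lap \<psi> x) = - (LINT x|lebesgue_on G. (V x * p x + f x) * \<psi> x)"
    and e2: "\<And>\<psi>. \<psi> \<in> test_functions G \<Longrightarrow> (LINT x|lebesgue_on G. p x * lap \<psi> x) = - (LINT x|lebesgue_on G. (V x * p x + 2 * f x) * \<psi> x)"
  shows "AE x in lebesgue_on G. f x = 0"
proof (rule fundamental_lemma[OF G f])
  let ?M = "lebesgue_on G"
  fix \<psi> :: "'a \<Rightarrow> complex" assume \<psi>: "\<psi> \<in> test_functions G"
  have Gm: "G \<in> sets lebesgue" by (rule lebesgue_open[OF G])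
  note t = test_sqint_on[OF Gm \<psi>]
  have s: "p \<in> sqint ?M" "V \<in> sqint ?M" "f \<in> sqint ?M" using p V f by (auto simp: L2_sqint)
  obtain D where D: "\<And>x. cmod (\<psi> x) \<le> D" using test_bounded[OF \<psi>] by metis
  have i: "integrable ?M (\<lambda>x. V x * (p x * \<psi> x))" "integrable ?M (\<lambda>x. f x * \<psi> x)"
    by (rule sqint_mult(1)[OF s(2) sqint_mult_bounded[OF s(1) sqint_meas[OF t] D]], rule sqint_mult(1)[OF s(3) t])
  have "(LINT x|?M. (V x * p x + f x) * \<psi> x) = (LINT x|?M. V x * (p x * \<psi> x)) + (LINT x|?M. f x * \<psi> x)"
    "(LINT x|?M. (V x * p x + 2 * f x) * \<psi> x) = (LINT x|?M. V x * (p x * \<psi> x)) + 2 * (LINT x|?M. f x * \<psi> x)"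
    unfolding distrib_right mult.assoc using i by simp_all
  then show "(LINT x|?M. f x * \<psi> x) = 0" using e1[OF \<psi>] e2[OF \<psi>] by simp
qed

text \<open>
  Either some nonzero multiple of the source has a solution for \<open>q2\<close>, and then the two chosen solutions agree and satisfy
  both equations; or the choice for \<open>q2\<close> is the same for the source and its double, and then one function satisfies the
  equation for \<open>q1\<close> with two different sources.
\<close>

lemma equal_data_source_zero:
  fixes np2 q1 q2 u :: "('n::finite) pt \<Rightarrow> complex"
  assumes dim: "CARD('n) + 1 \<le> 3" and n: "np2 \<in> Linf half_space" and R: "0 < R0" "R0 < R" and k: "0 < k"
    and q: "q1 \<in> L2 (cell R0)" "q2 \<in> L2 (cell R0)"
    and eq: "\<And>f. f \<in> L2 (cell R0) \<Longrightarrow>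
          AE x in lebesgue_on (cell R). \<Lambda>_op k R0 R np2 q1 f x = \<Lambda>_op k R0 R np2 q2 f x"
    and u: "u \<in> test_functions (cell R0)" and K: "compact K" "K \<subseteq> cell R0"
  shows "AE x in lebesgue. x \<in> K \<longrightarrow> q1 x \<noteq> q2 x \<longrightarrow> source_of k np2 q1 u x = 0"
proof -
  let ?C = "cell R0 :: 'n pt set"
  have d: "DIM('n pt) \<le> 3" using dim by simp
  \<comment> \<open>All multiples of the source at once: the case distinction compares the factors 1 and 2.\<close>
  define f where "f c = source_of k np2 q1 (\<lambda>x. c * u x)" for c
  have ut: "(\<lambda>x. c * u x) \<in> test_functions ?C" for c by (rule test_cmult[OF u])
  have fL: "f c \<in> L2 ?C" for c unfolding f_def by (rule source_of_L2[OF n q(1) ut])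
  have fc: "f c x = c * source_of k np2 q1 u x" for c x
  proof -
    have "lap (\<lambda>x. c * u x) x = c * lap u x"
      using test_smooth[OF u] by (simp add: lap_def pd_unary(5) smoothD(3) sum_distrib_left cong: sum.cong)
    then show ?thesis by (simp add: f_def source_of_def algebra_simps)
  qed
  define V where "V q x = of_real (k\<^sup>2) * (np2 x + q x)" for q x
  have VL: "V q \<in> L2 ?C" if "q \<in> L2 ?C" for q unfolding V_def[abs_def] by (rule coefficient_cell[OF n that])
  have Vd: "V q1 x \<noteq> V q2 x \<longleftrightarrow> q1 x \<noteq> q2 x" for x using k by (simp add: V_def)
  define p where "p c = (SOME v. is_solution k R0 R np2 q1 (f c) v)" for c
  have ps: "is_solution k R0 R np2 q1 (f c) (p c)" for c
    unfolding p_def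
  proof (rule someI[of "is_solution k R0 R np2 q1 (f c)"])
    show "is_solution k R0 R np2 q1 (f c) (\<lambda>x. c * u x)" unfolding f_def by (rule test_is_solution[OF n q(1) R ut])
  qed
  have sol: "v \<in> L2 ?C" "\<And>b. b \<in> Basis \<Longrightarrow> is_weak_partial ?C v b (weak_partial (slab R) v b)"
    "\<And>\<psi>. \<psi> \<in> test_functions ?C \<Longrightarrow> (LINT x|lebesgue_on ?C. v x * lap \<psi> x) = - (LINT x|lebesgue_on ?C. (V q' x * v x + f c x) * \<psi> x)"
    if "is_solution k R0 R np2 q' (f c) v" "q' \<in> L2 ?C" for v c q'
  proof -
    have v: "v \<in> H1_tilde R" using that(1) by (simp add: is_solution_def)
    show "v \<in> L2 ?C" by (rule L2_restrict[OF open_cell open_slab cell_slab(1)[OF R(2)] H1_tilde_L2[OF v]])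
    show "is_weak_partial ?C v b (weak_partial (slab R) v b)" if "b \<in> Basis" for b
      by (rule weak_partial_restrict[OF open_cell open_slab cell_slab(1)[OF R(2)] H1_tilde_partial(1)[OF v that]])
    show "(LINT x|lebesgue_on ?C. v x * lap \<psi> x) = - (LINT x|lebesgue_on ?C. (V q' x * v x + f c x) * \<psi> x)" if "\<psi> \<in> test_functions ?C" for \<psi>
      unfolding V_def by (rule solution_equation[OF n \<open>q' \<in> L2 ?C\<close> R fL \<open>is_solution k R0 R np2 q' (f c) v\<close> that])
  qed
  have Cm: "?C \<in> sets lebesgue" by (rule lebesgue_open[OF open_cell])
  have Rm: "cell R \<in> sets (lebesgue :: 'n pt measure)" by (rule lebesgue_open[OF open_cell])
  have transfer: "AE x in lebesgue_on ?C. v x = v' x"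
    if "AE x in lebesgue_on (cell R). zero_ext (cell R) v x = zero_ext (cell R) v' x" for v v'
  proof -
    have "AE x in lebesgue. x \<in> cell R \<longrightarrow> zero_ext (cell R) v x = zero_ext (cell R) v' x" using that unfolding AE_lebesgue_on[OF Rm] .
    then show ?thesis unfolding AE_lebesgue_on[OF Cm]
      by eventually_elim (use cell_slab(2)[OF R(2)] in \<open>auto simp: zero_ext_def\<close>)
  qed
  have change: "(LINT x|lebesgue_on ?C. v x * lap \<psi> x) = (LINT x|lebesgue_on ?C. v' x * lap \<psi> x)"
    "(LINT x|lebesgue_on ?C. (W x * v x + g x) * \<psi> x) = (LINT x|lebesgue_on ?C. (W x * v' x + g x) * \<psi> x)"
    if v: "v \<in> L2 ?C" "v' \<in> L2 ?C" "AE x in lebesgue_on ?C. v x = v' x" and W: "W \<in> L2 ?C" "g \<in> L2 ?C" and \<psi>: "\<psi> \<in> test_functions ?C" for v v' W g \<psi>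
  proof -
    show "(LINT x|lebesgue_on ?C. v x * lap \<psi> x) = (LINT x|lebesgue_on ?C. v' x * lap \<psi> x)"
      by (rule integral_cong_on_test[OF open_cell v test_lap[OF \<psi>]])
    have [measurable]: "v \<in> borel_measurable (lebesgue_on ?C)" "v' \<in> borel_measurable (lebesgue_on ?C)"
      "W \<in> borel_measurable (lebesgue_on ?C)" "g \<in> borel_measurable (lebesgue_on ?C)" using v W by (auto simp: L2_def)
    note [measurable] = sqint_meas[OF test_sqint_on[OF Cm \<psi>]]
    show "(LINT x|lebesgue_on ?C. (W x * v x + g x) * \<psi> x) = (LINT x|lebesgue_on ?C. (W x * v' x + g x) * \<psi> x)"
      by (rule integral_cong_AE, measurable) (use v(3) in eventually_elim, simp)
  qed
  show ?thesis
  proof (cases "\<exists>c v. c \<noteq> 0 \<and> is_solution k R0 R np2 q2 (f c) v")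
    case True
    then obtain c where c: "c \<noteq> 0" "\<exists>v. is_solution k R0 R np2 q2 (f c) v" by blast
    define v where "v = (SOME v. is_solution k R0 R np2 q2 (f c) v)"
    have vs: "is_solution k R0 R np2 q2 (f c) v" unfolding v_def using c(2) by (rule someI_ex)
    have ae: "AE x in lebesgue_on ?C. v x = p c x"
      using transfer[of "p c" v] eq[OF fL, of c] unfolding \<Lambda>_op_def p_def[symmetric] v_def[symmetric] by (auto elim!: eventually_mono)
    have e2: "(LINT x|lebesgue_on ?C. p c x * lap \<psi> x) = - (LINT x|lebesgue_on ?C. (V q2 x * p c x + f c x) * \<psi> x)"
      if "\<psi> \<in> test_functions ?C" for \<psi>
      using sol(3)[OF vs q(2) that] unfolding change[OF sol(1)[OF vs q(2)] sol(1)[OF ps q(1)] ae VL[OF q(2)] fL that] .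
    have "AE x in lebesgue. x \<in> K \<longrightarrow> V q1 x \<noteq> V q2 x \<longrightarrow> f c x = 0"
      by (rule source_zero_where_potentials_differ[OF d open_cell sol(1)[OF ps q(1)] VL[OF q(1)] VL[OF q(2)] fL sol(2)[OF ps q(1)] sol(3)[OF ps q(1)] e2 K])
    then show ?thesis by eventually_elim (use c(1) in \<open>simp add: Vd fc\<close>)
  next
    case False
    then have F: "\<not> is_solution k R0 R np2 q2 (f c) v" if "c \<noteq> 0" for c v using that by blast
    have "\<not> is_solution k R0 R np2 q2 (f 1) v" "\<not> is_solution k R0 R np2 q2 (f 2) v" for v
      by (rule F, simp)+
    then have "is_solution k R0 R np2 q2 (f 1) = is_solution k R0 R np2 q2 (f 2)" by (intro ext) simp
    \<comment> \<open>Without solutions both values are \<open>SOME v. False\<close>.\<close>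
    then have same: "\<Lambda>_op k R0 R np2 q2 (f 1) = \<Lambda>_op k R0 R np2 q2 (f 2)" unfolding \<Lambda>_op_def by simp
    have "AE x in lebesgue_on (cell R). zero_ext (cell R) (p 2) x = zero_ext (cell R) (p 1) x"
      using eq[OF fL, of 1] eq[OF fL, of 2] unfolding same unfolding \<Lambda>_op_def p_def[symmetric] by eventually_elim simp
    then have ae: "AE x in lebesgue_on ?C. p 2 x = p 1 x" by (rule transfer)
    have f2: "f 2 = (\<lambda>x. 2 * f 1 x)" by (simp add: fun_eq_iff fc)
    have e2: "(LINT x|lebesgue_on ?C. p 1 x * lap \<psi> x) = - (LINT x|lebesgue_on ?C. (V q1 x * p 1 x + 2 * f 1 x) * \<psi> x)"
      if "\<psi> \<in> test_functions ?C" for \<psi>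
      using sol(3)[OF ps q(1) that, of 2] unfolding change[OF sol(1)[OF ps q(1)] sol(1)[OF ps q(1)] ae VL[OF q(1)] fL that] unfolding f2 .
    have "AE x in lebesgue_on ?C. f 1 x = 0"
      by (rule source_zero_if_two_sources[OF open_cell sol(1)[OF ps q(1)] VL[OF q(1)] fL sol(3)[OF ps q(1)] e2])
    then have "AE x in lebesgue. x \<in> ?C \<longrightarrow> f 1 x = 0" unfolding AE_lebesgue_on[OF Cm] .
    then show ?thesis by eventually_elim (use K(2) in \<open>auto simp: fc\<close>)
  qed
qed

theorem theorem12:
  fixes k R0 R :: real
    and np2 :: "('n::finite) pt \<Rightarrow> complex"
    and \<delta> :: "('n pt \<Rightarrow> complex) \<Rightarrow> real"
    and q1 q2 :: "'n pt \<Rightarrow> complex"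
  assumes dim: "CARD('n) + 1 \<in> {2, 3}"
    and k: "0 < k"
    and R0: "0 < R0" "R0 < R"
    and np2_bounded: "np2 \<in> Linf half_space"
    and np2_periodic: "\<And>i. AE x in lebesgue_on half_space.
          np2 (fst x + axis i (2 * pi), snd x) = np2 x"
    and np2_one: "AE x in lebesgue_on half_space. R0 < snd x \<longrightarrow> np2 x = 1"
    and np2_Im: "AE x in lebesgue_on half_space. 0 \<le> Im (np2 x)"
    and np2_absorbing: "\<exists>U. open U \<and> U \<noteq> {} \<and> U \<subseteq> half_space \<and>
          (AE x in lebesgue_on U. 0 < Im (np2 x))"
    and \<delta>: "admissible_radius k R0 R np2 \<delta>"
    and q1: "q1 \<in> Q_set R0 \<delta>"
    and q2: "q2 \<in> Q_set R0 \<delta>"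
    and eq: "\<And>f. f \<in> L2 (cell R0) \<Longrightarrow>
          AE x in lebesgue_on (cell R). \<Lambda>_op k R0 R np2 q1 f x = \<Lambda>_op k R0 R np2 q2 f x"
  shows "AE x in lebesgue_on (cell R0). q1 x = q2 x"
proof -
  let ?C = "cell R0 :: 'n pt set"
  have q: "q1 \<in> L2 ?C" "q2 \<in> L2 ?C" using q1 q2 by (auto simp: Q_set_def)
  have d: "CARD('n) + 1 \<le> 3" using dim by auto
  have Cm: "?C \<in> sets lebesgue" by (rule lebesgue_open[OF open_cell])
  have zero: "AE x in lebesgue. x \<in> K \<longrightarrow> q1 x \<noteq> q2 x \<longrightarrow> source_of k np2 q1 u x = 0"
    if "u \<in> test_functions ?C" "compact K" "K \<subseteq> ?C" for u K
    by (rule equal_data_source_zero[OF d np2_bounded R0 k q eq that])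
  obtain b :: "'n pt" where b: "b \<in> Basis" using nonempty_Basis by blast
  define s where "s x = complex_of_real (x \<bullet> b) * of_real (x \<bullet> b)" for x
  have s: "smooth s" "lap s x = 2" for x unfolding s_def[abs_def] using lap_square[OF b] by auto
  have on_compact: "AE x in lebesgue. x \<in> K \<longrightarrow> q1 x = q2 x" if K: "compact K" "K \<subseteq> ?C" for K
  proof -
    obtain r :: "'n pt \<Rightarrow> real" where r: "(\<lambda>x. complex_of_real (r x)) \<in> test_functions ?C" "\<And>x. r x \<le> 1" "\<And>x. x \<in> K \<Longrightarrow> r x = 1"
      using smooth_cutoff[OF K(1) open_cell K(2)] by metis
    define c where "c = (\<lambda>x. complex_of_real (r x))"
    have ct: "c \<in> test_functions ?C" unfolding c_def by (rule r(1))
    have cs: "smooth c" by (rule test_smooth[OF ct])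
    have cK: "c x = 1" "pd i c x = 0" if "x \<in> K" for x i
      using r(3)[OF that] pd_zero_at_max[of r x i] cs r(2) unfolding c_def by auto
    show ?thesis
      using zero[OF ct K] zero[OF test_mult(1)[OF ct s(1)] K]
    proof eventually_elim
      case (elim x)
      show ?case
      proof (intro impI, rule ccontr)
        assume x: "x \<in> K" and ne: "q1 x \<noteq> q2 x"
        \<comment> \<open>The test functions \<open>c\<close> and \<open>c s\<close> give \<open>\<Delta>c + W = 0\<close> and \<open>2 + s (\<Delta>c + W) = 0\<close>.\<close>
        let ?W = "of_real (k\<^sup>2) * (np2 x + q1 x)"
        have "source_of k np2 q1 c x = 0" using elim(1) x ne by blast
        then have "- lap c x - ?W = 0" unfolding source_of_def cK(1)[OF x] mult_1_right .
        then have "- (lap c x + ?W) = 0" by (simp only: minus_add_distrib diff_conv_add_uminus)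
        then have "lap c x + ?W = 0" by (simp only: neg_equal_0_iff_equal)
        moreover have "lap (\<lambda>x. c x * s x) x = 2 + s x * lap c x"
          using lap_mult_flat[OF cs s(1) cK(2)[OF x]] cK(1)[OF x] s(2) by simp
        then have "2 + s x * (lap c x + ?W) = 0" using elim(2) x ne cK[OF x] by (simp add: source_of_def algebra_simps)
        ultimately show False by simp
      qed
    qed
  qed
  obtain F :: "nat \<Rightarrow> 'n pt set" where F: "\<And>j. compact (F j)" "\<And>j. F j \<subseteq> ?C" "(\<Union>j. F j) = ?C"
    using open_Union_compact_subsets[OF open_cell] by metis
  have "AE x in lebesgue. \<forall>j. x \<in> F j \<longrightarrow> q1 x = q2 x" unfolding AE_all_countable using on_compact[OF F(1,2)] by blast
  then have "AE x in lebesgue. x \<in> ?C \<longrightarrow> q1 x = q2 x" by eventually_elim (use F(3) in blast)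
  then show ?thesis unfolding AE_lebesgue_on[OF Cm] .
qed

end
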